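(* Let $V^1,\dots,V^n$ be finite-dimensional $F_0(R)$-comodules, let $K\in k[[h]]$ and $\kappa=K+N$. For $\mathbf z\in\Sigma_n$ let $B_K(\mathbf z)=\mathrm{Hom}_{F_0(R)_{\mathbf z}}(M_K(\mathbf z),k[[h]])$ be the space of quantum conformal blocks, trivialized by the restriction isomorphism $\xi:B_K(\mathbf z)\to (V^1\otimes\dots\otimes V^n)^*$, and let $\{\tilde A_i\}$, $\tilde A_i(\mathbf z):B_K(\mathbf z)\to B_K(\mathbf z-\kappa h\mathbf e_i)$, be the quantum Knizhnik–Zamolodchikov $\kappa$-connection on $B_K(\mathbf z)$, $(\tilde A_i(\mathbf z)f)(x_1\otimes\dots\otimes x_n)=f(x_1\otimes\dots\otimes Q_ix_i\otimes\dots\otimes x_n)$. Let $\nabla_i(\mathbf z)=(\tilde A_i(\mathbf z)^* )^{-1}$ be the induced $\kappa$-connection in the trivial bundle over $\Sigma_n$ with fiber $V^1\otimes\dots\otimes V^n$ ($\nabla_i(\mathbf z)$ acts from the fiber over $\mathbf z$ to the fiber over $\mathbf z-\kappa h\mathbf e_i$); equivalently, $f(v_1\otimes\dots\otimes Q_i^{-1}v_i\otimes\dots\otimes v_n)=\xi(f)(\nabla_i(\mathbf z)(v_1\otimes\dots\otimes v_n))$ for all $f\in B_K(\mathbf z-\kappa h\mathbf e_i)$, $v_j\in V^j$. Then for $i=1,\dots,n$ $$\nabla_i(\mathbf z)=R^{i-1,i}_{V^{i-1}V^i}(z_{i-1}-z_i+\kappa h)\cdots R^{1,i}_{V^1V^i}(z_1-z_i+\kappa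 h)\; R^{n,i}_{V^nV^i}(z_n-z_i)\cdots R^{i+1,i}_{V^{i+1}V^i}(z_{i+1}-z_i).$$
   Context: Conventions. $k$ is an algebraically closed field of characteristic $0$, $N$ a positive integer, $h$ a formal parameter; algebras over $k[[h]]$ are $h$-adically complete and tensor products are completed; vector spaces over $k$ are extended to $k[[h]]$ when needed. Superscripts show the tensor factors in which an element acts; $\sigma$ is the permutation of two factors, $X^{21}=\sigma X\sigma$; $\mathbf e_i$ is the $i$-th standard basis vector of $k^n$. R-matrix. $\Sigma$ is a connected one-dimensional algebraic group over $k$ ($\mathbb G_a$, $\mathbb G_m$ or an elliptic curve), written additively, with canonical (translation-invariant) formal parameter $u$ at the origin; $k(\Sigma)\subset k((u))$ by expansion at the origin. $R(u)\in\mathrm{End}(k^N\otimes k^N)\otimes k(\Sigma)[[h]]$ is, respectively, the rational R-matrix $R(u)=1-\frac{h(\sigma-1/N)}{u-h/N}$, the trigonometric, or the elliptic (Belavin) R-matrix of type $\mathfrak{sl}_N$, with $u$ rescaled to $u/N$ and $\Sigma$ chosen so that $R$ has trivial stabilizer in $\Sigma$. They satisfy: $R=1+O(h)$; $R^{12}(u_1-u_2)R^{13}(u_1-u_3)R^{23}(u_2-u_3)=R^{23}(u_2-u_3)R^{13}(u_1-u_3)R^{12}(u_1-u_2)$; $\lim_{s\to0}R(su,sh)=1-\frac{h(\sigma-1/N)}{u-h/N}$; $(((R(u)^{-1})^{t_1})^{-1})^{t_1}=(((R(u)^{-1})^{t_2})^{-1})^{t_2}=g(u)R(u+Nh)$ with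 $g\in 1+hk((u))[[h]]$ scalar ($t_i$ = transposition in the $i$-th factor); $R(u)R^{21}(-u)$ is scalar. $f=\sum f_nh^n\in k(\Sigma)[[h]]$ is regular at $z\in\Sigma(k[[h]])$ if all $f_n$ are regular at $z$ mod $h$. Quantum determinant. $F(R)$ is the $h$-adically complete $k[[h]]$-algebra generated by the entries of the coefficients of $T(u)^{\pm1}\in\mathrm{End}(k^N)\otimes F(R)[[u]]$ with relations $TT^{-1}=T^{-1}T=1$, $R^{12}(u-v)T^{13}(u)T^{23}(v)=T^{23}(v)T^{13}(u)R^{12}(u-v)$; it is a Hopf algebra with $\Delta(T(u))=T^{12}(u)T^{13}(u)$, $\varepsilon(T(u))=1$, $S(T(u))=T(u)^{-1}$. Put $u_m=u+h(m-\frac{N+1}2)$. There is a unique line spanned by $v_0=\sum C_{i_1\dots i_N}e_{i_1}\otimes\dots\otimes e_{i_N}$, normalized by $C_{1\dots N}=1$, with $T^{1,N+1}(u_1)\cdots T^{N,N+1}(u_N)(v_0\otimes1)=v_0\otimes q(u)$. For a matrix series $X(u)\in\mathrm{End}(k^N)\otimes A((u))[[h]]$ over an algebra $A$, $\mathrm{qdet}_R(X(u))=\sum C_{i_1\dots i_N}X_{1i_1}(u_1)\cdots X_{Ni_N}(u_N)$ (so $q=\mathrm{qdet}_R(T)$, which is central and grouplike). $\bar R$, $F_0(R)$, $B$. $\bar R=f_0R$, where $f_0\in1+hk(\Sigma)[[h]]$ is the unique scalar function with $\mathrm{qdet}_R(\bar R(u))=1$ ($\bar R$ viewed as an $N\times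 N$ matrix in the first factor over $A=\mathrm{End}(k^N)$). $F_0(R)=F(R)/(\mathrm{qdet}_R(T(u))=1)$, a Hopf algebra; $\tau_a$ is its automorphism $T(u)\mapsto T(u-a)$, $a\in hk[[h]]$. $B:F_0(R)\otimes F_0(R)\to k(\Sigma)[[h]]$ is the bilinear form $B(X,Y)(y)$ with $B(1,X)=B(X,1)=\varepsilon(X)$, $B(XY,Z)=\sum B(X,Z_{(1)})B(Y,Z_{(2)})$, $B(X,YZ)=\sum B(X_{(1)},Z)B(X_{(2)},Y)$, $B(T^{13}(u),T^{23}(v))(y)=\bar R^{12}(u-v+y)$. Comodules. A right comodule over a coalgebra $A$ is a space $V$ with a coaction $\pi^*:V\to A\otimes V$, $\pi^*(v)=\sum v_{(-1)}\otimes v_{(0)}$, satisfying $(1\otimes\pi^* )\pi^*=(\Delta^{op}\otimes1)\pi^*$. For finite-dimensional $F_0(R)$-comodules $V,W$: $R_{VW}(u)(v\otimes w)=\sum B(v_{(-1)},w_{(-1)})(u)\,v_{(0)}\otimes w_{(0)}$. $R^{ij}_{V^iV^j}$ acts in the factors $V^i$, $V^j$. Multi-point algebras. $\Sigma_n$ is the set of $\mathbf z=(z_1,\dots,z_n)\in\Sigma(k[[h]])^n$ with $R^{\pm1}$ regular at $z_i-z_j$ for $i\ne j$. $\hat F_0(R)_{\mathbf z}$ is the $h$-adically complete algebra generated by the entries of $T_i(u)^{\pm1}$ ($T_i(u)$ a power series in $u$) and central $c_i$, $1\le i\le n$, with relations $T_iT_i^{-1}=T_i^{-1}T_i=1$,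 $\mathrm{qdet}_R(T_i)=1$, $\bar R^{12}(u-v+z_i-z_j-\frac h2(c_i^3-c_j^3))T_i^{13}(u)T_j^{23}(v)=T_j^{23}(v)T_i^{13}(u)\bar R^{12}(u-v+z_i-z_j+\frac h2(c_i^3-c_j^3))$. It is a Hopf algebra: $c_i$ primitive, $\Delta(T_i(u))=T_i^{12}(u-hc_i^3/2)T_i^{13}(u+hc_i^2/2)$, $\varepsilon(T_i)=1$, $S(T_i)=T_i^{-1}$. $C$ is the ideal generated by all $c_i$, and $F_0(R)_{\mathbf z}=\hat F_0(R)_{\mathbf z}/C$. $\hat F_0(R)_{\hat{\mathbf z}_i}$ is the subalgebra generated by $T_j,c_j$, $j\neq i$. Dimodules. For a Hopf algebra $A$, Hopf subalgebra $D\subset A$ and Hopf ideal $I$, a $(D,A,I)$-dimodule is a space $X$ with a left $D$-action and a right $A/I$-coaction $X\to A/I\otimes X$ such that $\pi^*(ax)=\sum a_{(3)}x_{(-1)}S^{-1}(a_{(1)})\otimes a_{(2)}x_{(0)}$, $a\in D$. Tensor products: action through $\Delta$, coaction $\pi^*(v\otimes w)=\sum w_{(-1)}v_{(-1)}\otimes v_{(0)}\otimes w_{(0)}$. The induced $(A,A,I)$-dimodule $\mathrm{Ind}\,X=A\otimes_DX$ has the left multiplication action and the unique compatible coaction with $\pi^*(1\otimes x)=\sum x_{(-1)}\otimes(1\otimes x_{(0)})$. Modules. For a finite-dimensional $F_0(R)$-comodule $V$, $V_K(z_i)$ is the $(\hat F_0(R)_{\hat{\mathbf z}_i}\otimes k[c_i],\hat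 F_0(R)_{\mathbf z},C)$-dimodule equal to $V$ with coaction induced by $F_0(R)\to F_0(R)_{\mathbf z}$, $T(u)\mapsto T_i(u)$; with $T_j(u)$, $j\ne i$, acting by $v\mapsto\sum B(T(u),v_{(-1)})(z_j-z_i)v_{(0)}$ (entrywise in $T$); $c_i=K$, $c_j=0$ for $j\neq i$. $\hat V_K(z_i)$ is the induced $(\hat F_0(R)_{\mathbf z},\hat F_0(R)_{\mathbf z},C)$-dimodule; as a space it is $F_0(R)\otimes V$ (with $F_0(R)$ generated by $T_i$), independent of $\mathbf z$. For $n=1$ this gives $\hat V_K$ over $\hat F_0(R)$ (generators $T(u),c$), on which $F_0(R)$ acts (through $T(u)$) and coacts. The Sugawara operator is $Q:\hat V_K\to\hat V_K$, $Qx=\sum\tau_{Kh/2}(S^{-1}(x_{(-1)}))x_{(0)}$; it is invertible. $M_K(\mathbf z)=\hat V^1_K(z_1)\otimes\dots\otimes\hat V^n_K(z_n)$; all $c_i$ act on it by $K$, so the $T_i(u)$ define an action of $F_0(R)_{\mathbf z}$ on it ($k[[h]]$ is the trivial module). $Q_i$ is $Q$ acting in the $i$-th factor. Precomposition with $Q_i$ maps $B_K(\mathbf z)$ to $B_K(\mathbf z-\kappa h\mathbf e_i)$ (all $M_K(\mathbf z)$ being identified as vector spaces). $\xi(f)$ is the restriction of $f$ to $V^1\otimes\dots\otimes V^n\subset M_K(\mathbf z)$. By a $\kappa$-connection on a bundle $\mathcal E$ over $\Sigma_n$ one means a collection of maps $\mathcal E_{\mathbf z}\to\mathcal E_{\mathbf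 z-\kappa h\mathbf e_i}$, $i=1,\dots,n$. *)

theory Defs
  imports
    "HOL-Computational_Algebra.Computational_Algebra"
    "HOL-Library.Poly_Mapping"
    "HOL-Library.Product_Plus"
begin

section \<open>Topologically free k[[h]]-modules and completed free algebras\<close>

text \<open>
  The ring k[[h]] is \<open>'k fps\<close>.  The h-adically complete k[[h]]-module with topological basis \<open>'s\<close>
  is k[\<open>'s\<close>][[h]], rendered as power series in h over finitely supported functions; for a monoid
  \<open>'s\<close> the library multiplication on this type is that of the completed monoid algebra.  With
  \<open>'s\<close> = words this is the h-adically complete free algebra, with \<open>'s\<close> = pairs (lists) of words
  the completed tensor square (powers) of it.
\<close>

type_synonym ('s, 'k) cmod = "('s \<Rightarrow>\<^sub>0 'k) fps"

datatype 'g word = Word (letters: "'g list")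

instantiation word :: (type) monoid_add
begin
definition zero_word :: "'a word" where "zero_word = Word []"
definition plus_word :: "'a word \<Rightarrow> 'a word \<Rightarrow> 'a word"
  where "plus_word u v = Word (letters u @ letters v)"
instance by standard (simp_all add: zero_word_def plus_word_def)
end

definition basis :: "'s \<Rightarrow> ('s, 'k::zero_neq_one) cmod"
  where "basis s = fps_const (Poly_Mapping.single s 1)"

definition letter :: "'g \<Rightarrow> 'g word \<Rightarrow>\<^sub>0 'k::zero_neq_one"
  where "letter g = Poly_Mapping.single (Word [g]) 1"

definition scal :: "'k::zero fps \<Rightarrow> ('s::monoid_add, 'k) cmod"
  where "scal a = Abs_fps (\<lambda>n. Poly_Mapping.single 0 (fps_nth a n))"

definition hscale :: "'k::comm_ring_1 fps \<Rightarrow> ('s, 'k) cmod \<Rightarrow> ('s, 'k) cmod"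
  where "hscale a x = Abs_fps (\<lambda>n. \<Sum>i\<le>n. Poly_Mapping.map ((*) (fps_nth a i)) (fps_nth x (n - i)))"

text \<open>
  The k[[h]]-linear extension of an arbitrary map on the basis.  A k[[h]]-linear map out of a
  topologically free module is automatically h-adically continuous, so it is the same thing as
  an arbitrary map on the basis; linear functionals and maps are represented in this way.
\<close>

definition linext :: "('k \<Rightarrow> 'b \<Rightarrow> 'b) \<Rightarrow> ('s \<Rightarrow> 'b fps) \<Rightarrow> ('s, 'k::zero) cmod \<Rightarrow> 'b::comm_monoid_add fps"
  where "linext sc \<phi> x = Abs_fps (\<lambda>n. \<Sum>i\<le>n. \<Sum>s\<in>Poly_Mapping.keys (fps_nth x i).
           sc (Poly_Mapping.lookup (fps_nth x i) s) (fps_nth (\<phi> s) (n - i)))"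

definition lin :: "('s \<Rightarrow> ('t, 'k) cmod) \<Rightarrow> ('s, 'k::comm_ring_1) cmod \<Rightarrow> ('t, 'k) cmod"
  where "lin = linext (\<lambda>c. Poly_Mapping.map ((*) c))"

definition appl :: "('s \<Rightarrow> 'k fps) \<Rightarrow> ('s, 'k::comm_ring_1) cmod \<Rightarrow> 'k fps"
  where "appl = linext (*)"

definition appl_fls :: "('s \<Rightarrow> 'k fls fps) \<Rightarrow> ('s, 'k::comm_ring_1) cmod \<Rightarrow> 'k fls fps"
  where "appl_fls = linext (\<lambda>c g. fls_const c * g)"

definition tens :: "('s, 'k::comm_ring_1) cmod \<Rightarrow> ('t, 'k) cmod \<Rightarrow> ('s \<times> 't, 'k) cmod"
  where "tens x y = lin (\<lambda>s. lin (\<lambda>t. basis (s, t)) y) x"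

inductive_set hspan :: "('s, 'k::comm_ring_1) cmod set \<Rightarrow> ('s, 'k) cmod set" for X where
  "0 \<in> hspan X"
| "x \<in> X \<Longrightarrow> hscale a x \<in> hspan X"
| "x \<in> hspan X \<Longrightarrow> y \<in> hspan X \<Longrightarrow> x + y \<in> hspan X"

definition closed_span :: "('s, 'k::comm_ring_1) cmod set \<Rightarrow> ('s, 'k) cmod set"
  where "closed_span X = {x. \<forall>m. \<exists>y\<in>hspan X. \<forall>l<m. fps_nth x l = fps_nth y l}"

definition closed_ideal :: "('s::monoid_add, 'k::comm_ring_1) cmod set \<Rightarrow> ('s, 'k) cmod set"
  where "closed_ideal X = closed_span {a * x * b |a x b. x \<in> X}"

text \<open>
  An algebra given by generators and relations is handled as the completed free algebra modulo the
  closed two-sided ideal of its relations; a relation holds in it iff the difference of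
  the two sides lies in that ideal.  The next set is the kernel of the map from the tensor
  square of the free algebra to the completed tensor square of the quotient by \<open>J\<close>.
\<close>

definition tens_ideal :: "('s, 'k::comm_ring_1) cmod set \<Rightarrow> ('s \<times> 's, 'k) cmod set"
  where "tens_ideal J = closed_span ({tens x y |x y. x \<in> J} \<union> {tens x y |x y. y \<in> J})"

text \<open>The h-adically convergent sum of a family whose \<open>k\<close>-th member is divisible by \<open>h^k\<close>.\<close>

definition hsum :: "(nat \<Rightarrow> 'a fps) \<Rightarrow> 'a::comm_monoid_add fps"
  where "hsum g = Abs_fps (\<lambda>n. \<Sum>k\<le>n. fps_nth (g k) n)"

text \<open>For \<open>L(u) = \<Sum>k. L k u^k\<close> and central \<open>a\<close> divisible by h: the coefficient of \<open>u^m\<close> in \<open>L(u + a)\<close>.\<close>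

definition translate :: "(nat \<Rightarrow> 'a fps) \<Rightarrow> 'a fps \<Rightarrow> nat \<Rightarrow> 'a::ring_1 fps"
  where "translate L a m = hsum (\<lambda>k. of_nat ((m + k) choose k) * L (m + k) * a ^ k)"


section \<open>The group \<open>\<Sigma>\<close> and its functions\<close>

text \<open>
  Up to isomorphism a connected one-dimensional algebraic group over k is the additive group, the
  multiplicative group, or an elliptic curve, here in the Weierstrass form
  \<open>y\<^sup>2 = 4x\<^sup>3 - g2 x - g3\<close>.  Points and group law are polymorphic in the field because they are
  needed both over k and over k((u)).
\<close>

datatype 'a curve = Additive | Multiplicative | Elliptic 'a 'a

datatype 'a pt = Ga 'a | Gm 'a | EO | EP 'a 'a

fun smooth :: "'a::field curve \<Rightarrow> bool" where
  "smooth (Elliptic g2 g3) \<longleftrightarrow> g2 ^ 3 \<noteq> 27 * g3 ^ 2"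
| "smooth _ \<longleftrightarrow> True"

fun points :: "'a::field curve \<Rightarrow> 'a pt set" where
  "points Additive = range Ga"
| "points Multiplicative = Gm ` {x. x \<noteq> 0}"
| "points (Elliptic g2 g3) = insert EO {EP x y |x y. y ^ 2 = 4 * x ^ 3 - g2 * x - g3}"

fun origin :: "'a::field curve \<Rightarrow> 'a pt" where
  "origin Additive = Ga 0"
| "origin Multiplicative = Gm 1"
| "origin (Elliptic g2 g3) = EO"

fun neg :: "'a::field pt \<Rightarrow> 'a pt" where
  "neg (Ga x) = Ga (- x)"
| "neg (Gm x) = Gm (inverse x)"
| "neg EO = EO"
| "neg (EP x y) = EP x (- y)"

text \<open>In the last but one equation \<open>m\<close> is the slope of the chord or tangent.\<close>

fun add :: "'a::field curve \<Rightarrow> 'a pt \<Rightarrow> 'a pt \<Rightarrow> 'a pt" where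
  "add _ (Ga x) (Ga y) = Ga (x + y)"
| "add _ (Gm x) (Gm y) = Gm (x * y)"
| "add _ EO Q = Q"
| "add _ P EO = P"
| "add (Elliptic g2 g3) (EP x1 y1) (EP x2 y2) =
     (if x1 = x2 \<and> y1 = - y2 then EO
      else let m = (if x1 = x2 then (12 * x1 ^ 2 - g2) / (2 * y1) else (y2 - y1) / (x2 - x1));
               x3 = m ^ 2 / 4 - x1 - x2
           in EP x3 (- (y1 + m * (x3 - x1))))"
| "add _ P _ = P"

text \<open>The Weierstrass function as the formal Laurent series \<open>u\<^sup>-\<^sup>2 + \<dots>\<close> solving its differential equation.\<close>

definition wp :: "'k::field_char_0 \<Rightarrow> 'k \<Rightarrow> 'k fls"
  where "wp g2 g3 = (THE p. fls_nth p (-2) = 1 \<and>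
           fls_deriv p ^ 2 = 4 * p ^ 3 - fls_const g2 * p - fls_const g3)"

text \<open>
  The k((u))-point of \<open>\<Sigma>\<close> given by the translation-invariant formal parameter u at the origin,
  and its translate \<open>z + u\<close> by a k-point \<open>z\<close>.
\<close>

fun formal_point :: "'k::field_char_0 curve \<Rightarrow> 'k fls pt" where
  "formal_point Additive = Ga fls_X"
| "formal_point Multiplicative = Gm (fps_to_fls (fps_exp 1))"
| "formal_point (Elliptic g2 g3) = EP (wp g2 g3) (fls_deriv (wp g2 g3))"

definition near :: "'k::field_char_0 curve \<Rightarrow> 'k pt \<Rightarrow> 'k fls pt"
  where "near \<Sigma> z = add (map_curve fls_const \<Sigma>) (map_pt fls_const z) (formal_point \<Sigma>)"

fun xcoord :: "'a::zero pt \<Rightarrow> 'a" where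
  "xcoord (Ga x) = x" | "xcoord (Gm x) = x" | "xcoord (EP x y) = x" | "xcoord EO = 0"

fun ycoord :: "'a::zero pt \<Rightarrow> 'a" where
  "ycoord (EP x y) = y" | "ycoord _ = 0"

text \<open>
  A rational function f on \<open>\<Sigma>\<close> is represented by all its expansions
  \<open>z \<mapsto> f(z + u) \<in> k((u))\<close>, \<open>z \<in> \<Sigma>(k)\<close>.  An element of \<open>k(\<Sigma>)[[h]]\<close> is correspondingly a map
  from points to k((u))[[h]] (\<open>hfun\<close>), each of whose h-coefficients is a rational function.
\<close>

definition eval2 :: "'k::field_char_0 poly poly \<Rightarrow> 'k fls pt \<Rightarrow> 'k fls"
  where "eval2 p P = poly (map_poly (\<lambda>q. poly (map_poly fls_const q) (xcoord P)) p) (ycoord P)"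

definition function_field :: "'k::field_char_0 curve \<Rightarrow> ('k pt \<Rightarrow> 'k fls) set"
  where "function_field \<Sigma> = {f. \<exists>p q. \<forall>z\<in>points \<Sigma>.
           eval2 q (near \<Sigma> z) \<noteq> 0 \<and> f z = eval2 p (near \<Sigma> z) / eval2 q (near \<Sigma> z)}"

type_synonym 'k hfun = "'k pt \<Rightarrow> 'k fls fps"

definition rational_hfun :: "'k::field_char_0 curve \<Rightarrow> 'k hfun \<Rightarrow> bool"
  where "rational_hfun \<Sigma> f \<longleftrightarrow> (\<forall>n. (\<lambda>z. fps_nth (f z) n) \<in> function_field \<Sigma>)"

definition hconst :: "'k::zero fps \<Rightarrow> 'k fls fps"
  where "hconst a = Abs_fps (\<lambda>n. fls_const (fps_nth a n))"

text \<open>\<open>F(u + a)\<close> for \<open>F \<in> k((u))[[h]]\<close> and \<open>a\<close> divisible by h, central in an algebra containing k via \<open>e\<close>.\<close>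

definition taylor :: "('k \<Rightarrow> 'r) \<Rightarrow> 'k::field_char_0 fls fps \<Rightarrow> 'r fls fps \<Rightarrow> 'r::ring_1 fls fps"
  where "taylor e F a = hsum (\<lambda>m.
           Abs_fps (\<lambda>n. Abs_fls (\<lambda>i. e (fls_nth ((fls_deriv ^^ m) (fps_nth F n)) i / fact m))) * a ^ m)"

definition shift :: "'k::field_char_0 fps \<Rightarrow> 'k fls fps \<Rightarrow> 'k fls fps"
  where "shift a F = taylor (\<lambda>c. c) F (hconst a)"

text \<open>
  Points of \<open>\<Sigma>(k[[h]])\<close>: reduction mod h is split by the constant points, and its kernel
  is h k[[h]] through the additive parameter u, so \<open>(z, \<zeta>)\<close> stands for the point \<open>z + \<zeta>\<close>.
\<close>

type_synonym 'k hpt = "'k pt \<times> 'k fps"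

definition hpoints :: "'k::field curve \<Rightarrow> 'k hpt set"
  where "hpoints \<Sigma> = {(z, \<zeta>). z \<in> points \<Sigma> \<and> fps_nth \<zeta> 0 = 0}"

definition hsub :: "'k::field curve \<Rightarrow> 'k hpt \<Rightarrow> 'k hpt \<Rightarrow> 'k hpt"
  where "hsub \<Sigma> x y = (add \<Sigma> (fst x) (neg (fst y)), snd x - snd y)"

definition hmove :: "'k::field hpt \<Rightarrow> 'k fps \<Rightarrow> 'k hpt"
  where "hmove x a = (fst x, snd x + a)"

definition expand :: "'k::field_char_0 hfun \<Rightarrow> 'k hpt \<Rightarrow> 'k fls fps"
  where "expand f x = shift (snd x) (f (fst x))"

definition regular :: "'k::field hfun \<Rightarrow> 'k hpt \<Rightarrow> bool"
  where "regular f x \<longleftrightarrow> (\<forall>n. fls_subdegree (fps_nth (f (fst x)) n) \<ge> 0)"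

definition val :: "'k::field_char_0 hfun \<Rightarrow> 'k hpt \<Rightarrow> 'k fps"
  where "val f x = Abs_fps (\<lambda>n. fls_nth (fps_nth (expand f x) n) 0)"


section \<open>R-matrices\<close>

text \<open>
  Indices of the basis of \<open>k^N\<close> run over \<open>0, \<dots>, N - 1\<close>.  An operator \<open>X\<close> on \<open>k^N \<otimes> k^N\<close>
  has the entries \<open>X a b c d\<close> with \<open>X (e_c \<otimes> e_d) = (\<Sum>a b. X a b c d e_a \<otimes> e_b)\<close>.
\<close>

type_synonym 'r tmat = "nat \<Rightarrow> nat \<Rightarrow> nat \<Rightarrow> nat \<Rightarrow> 'r"

definition tid :: "'r::zero_neq_one tmat"
  where "tid a b c d = (if a = c \<and> b = d then 1 else 0)"

definition tflip :: "'r::zero_neq_one tmat"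
  where "tflip a b c d = (if a = d \<and> b = c then 1 else 0)"

definition tmul :: "nat \<Rightarrow> 'r tmat \<Rightarrow> 'r tmat \<Rightarrow> 'r::semiring_0 tmat"
  where "tmul N X Y a b c d = (\<Sum>p<N. \<Sum>q<N. X a b p q * Y p q c d)"

definition teq :: "nat \<Rightarrow> 'r tmat \<Rightarrow> 'r tmat \<Rightarrow> bool"
  where "teq N X Y \<longleftrightarrow> (\<forall>a<N. \<forall>b<N. \<forall>c<N. \<forall>d<N. X a b c d = Y a b c d)"

definition tinv :: "nat \<Rightarrow> 'r::ring_1 tmat \<Rightarrow> 'r tmat \<Rightarrow> bool"
  where "tinv N X Y \<longleftrightarrow> teq N (tmul N X Y) tid \<and> teq N (tmul N Y X) tid"

definition transp1 :: "'r tmat \<Rightarrow> 'r tmat" where "transp1 X a b c d = X c b a d"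
definition transp2 :: "'r tmat \<Rightarrow> 'r tmat" where "transp2 X a b c d = X a d c b"

definition tat :: "'k hfun tmat \<Rightarrow> 'k pt \<Rightarrow> 'k fls fps tmat"
  where "tat R z a b c d = R a b c d z"

text \<open>\<open>1 - h(\<sigma> - 1/N) / (u - h/N)\<close>; in the type \<open>'k fls fps\<close> the variable \<open>fps_X\<close> is h.\<close>

definition rational_R :: "nat \<Rightarrow> 'k::field_char_0 hfun tmat"
  where "rational_R N a b c d z =
    tid a b c d - fps_X * (tflip a b c d - hconst (fps_const (1 / of_nat N)) * tid a b c d)
      * inverse (fps_const (xcoord (near Additive z)) - hconst (fps_const (1 / of_nat N)) * fps_X)"

text \<open>
  The R-matrix of the vector representation of the quantum affine algebra of type \<open>sl_N\<close> in the
  principal gradation, which is the one with the crossing symmetry below (the homogeneous gradation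
  has it only up to conjugation) and with trivial stabilizer.  It is a function of \<open>x = e^u\<close> on the
  multiplicative group; \<open>qq c = e^(c h)\<close> and the usual q is \<open>e^(- N h / 2)\<close>.
\<close>

definition trigonometric_R :: "nat \<Rightarrow> 'k::field_char_0 hfun tmat"
  where "trigonometric_R N a b c d z =
    (let qq = (\<lambda>r. hconst (fps_exp r)); x = xcoord (near Multiplicative z);
         X = fps_const (x ^ N); q = qq (- of_nat N / 2); q' = qq (of_nat N / 2)
     in (if a = b \<and> c = a \<and> d = a then q * X - q'
         else if a = c \<and> b = d then X - 1
         else if a = d \<and> b = c then (q - q') * fps_const (x ^ nat ((int a - int b) mod int N))
         else 0) * inverse (qq (- 1 / 2) * X - qq (1 / 2)))"

text \<open>
  Belavin's R-matrix.  \<open>E r s\<close> enumerates the N-torsion points, \<open>\<omega>\<close> is a primitive N-th root of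
  unity, and \<open>I r s = X^r Z^s\<close> with \<open>X e_j = e_(j+1)\<close>, \<open>Z e_j = \<omega>^j e_j\<close> (indices mod N).
  For \<open>(r, s) \<noteq> (0, 0)\<close> the function \<open>\<phi> r s\<close>, a ratio of theta functions with characteristics,
  is determined by its behaviour under torsion translations, its poles and its residue 1 at
  the origin.  Then
  \<open>R(u) = (\<Sum>r s. w r s (u) I r s \<otimes> (I r s)^-1)\<close> with \<open>w r s (u) = \<phi> r s (u - h/N) / \<phi> r s (- h/N)\<close>,
  \<open>w 0 0 = 1\<close>.  The value \<open>\<phi> r s (- h/N)\<close> is a Laurent series in h whose inverse is divisible by h.
  Since \<open>R(u + E r s)\<close> is \<open>R(u)\<close> conjugated by \<open>I r s \<otimes> 1\<close>, the stabilizer is trivial.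
\<close>

definition heis :: "nat \<Rightarrow> 'k \<Rightarrow> nat \<Rightarrow> nat \<Rightarrow> nat \<Rightarrow> nat \<Rightarrow> 'k::field"
  where "heis N \<omega> r s a c = (if a = (c + r) mod N then \<omega> ^ (s * c) else 0)"

definition heis_inv :: "nat \<Rightarrow> 'k \<Rightarrow> nat \<Rightarrow> nat \<Rightarrow> nat \<Rightarrow> nat \<Rightarrow> 'k::field"
  where "heis_inv N \<omega> r s a c = (if c = (a + r) mod N then inverse (\<omega> ^ (s * a)) else 0)"

definition belavin_coeff :: "nat \<Rightarrow> 'k::field_char_0 curve \<Rightarrow> ('k pt \<Rightarrow> 'k fls) \<Rightarrow> 'k hfun"
  where "belavin_coeff N \<Sigma> \<phi> z =
    hconst (fls_regpart (inverse (fls_compose_fps (\<phi> (origin \<Sigma>)) (fps_const (- 1 / of_nat N) * fps_X))))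
    * shift (fps_const (- 1 / of_nat N) * fps_X) (fps_const (\<phi> z))"

definition belavin_R :: "'k::field_char_0 curve \<Rightarrow> nat \<Rightarrow> 'k hfun tmat \<Rightarrow> bool"
  where "belavin_R \<Sigma> N R \<longleftrightarrow> (\<exists>\<omega> E \<phi>.
     \<omega> ^ N = 1 \<and> (\<forall>m. 0 < m \<and> m < N \<longrightarrow> \<omega> ^ m \<noteq> 1) \<and>
     bij_betw (\<lambda>(r, s). E r s) ({..<N} \<times> {..<N}) {P \<in> points \<Sigma>. (add \<Sigma> P ^^ N) (origin \<Sigma>) = origin \<Sigma>} \<and>
     (\<forall>r<N. \<forall>s<N. \<forall>r'<N. \<forall>s'<N.
        add \<Sigma> (E r s) (E r' s') = E ((r + r') mod N) ((s + s') mod N)) \<and>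
     (\<forall>r<N. \<forall>s<N. (r, s) \<noteq> (0, 0) \<longrightarrow>
        \<phi> r s \<in> function_field \<Sigma> \<and>
        (\<forall>z\<in>points \<Sigma>. \<forall>r'<N. \<forall>s'<N.
           \<phi> r s (add \<Sigma> z (E r' s')) = fls_const (\<omega> ^ (r * s') / \<omega> ^ (s * r')) * \<phi> r s z) \<and>
        (\<forall>z\<in>points \<Sigma>. z \<notin> (\<lambda>(r, s). E r s) ` ({..<N} \<times> {..<N}) \<longrightarrow> fls_subdegree (\<phi> r s z) \<ge> 0) \<and>
        fls_subdegree (\<phi> r s (origin \<Sigma>)) = -1 \<and> fls_nth (\<phi> r s (origin \<Sigma>)) (-1) = 1) \<and>
     (\<forall>z\<in>points \<Sigma>. \<forall>a<N. \<forall>b<N. \<forall>c<N. \<forall>d<N.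
        R a b c d z = (\<Sum>r<N. \<Sum>s<N.
          (if (r, s) = (0, 0) then 1 else belavin_coeff N \<Sigma> (\<phi> r s) z)
          * hconst (fps_const (heis N \<omega> r s a c * heis_inv N \<omega> r s b d)))))"

definition standard_R :: "'k::field_char_0 curve \<Rightarrow> nat \<Rightarrow> 'k hfun tmat \<Rightarrow> bool"
  where "standard_R \<Sigma> N R = (case \<Sigma> of
      Additive \<Rightarrow> \<forall>z\<in>points \<Sigma>. teq N (tat R z) (tat (rational_R N) z)
    | Multiplicative \<Rightarrow> \<forall>z\<in>points \<Sigma>. teq N (tat R z) (tat (trigonometric_R N) z)
    | Elliptic g2 g3 \<Rightarrow> belavin_R \<Sigma> N R)"

text \<open>The entries of \<open>R^21(-u)\<close>, expanded at \<open>z\<close>.\<close>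

definition opposite_R :: "'k::field_char_0 hfun tmat \<Rightarrow> 'k pt \<Rightarrow> 'k fls fps tmat"
  where "opposite_R R z a b c d =
           Abs_fps (\<lambda>n. fls_compose_fps (fps_nth (R b a d c (neg z)) n) (- fps_X))"

definition tregular :: "nat \<Rightarrow> 'k::field hfun tmat \<Rightarrow> 'k hpt \<Rightarrow> bool"
  where "tregular N R x \<longleftrightarrow> (\<forall>a<N. \<forall>b<N. \<forall>c<N. \<forall>d<N. regular (R a b c d) x)"

text \<open>
  The recorded identities of the three R-matrices: \<open>R = 1 + O(h)\<close>; the Yang-Baxter equation (as an
  identity of values at all points where it is defined); the limit of \<open>R(su, sh)\<close>, which exists iff the
  \<open>h^n\<close>-coefficient has a pole of order at most n and is then read off from the \<open>h^n u^-n\<close>-terms;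
  crossing; unitarity.
\<close>

definition R_identities :: "'k::field_char_0 curve \<Rightarrow> nat \<Rightarrow> 'k hfun tmat \<Rightarrow> bool"
  where "R_identities \<Sigma> N R \<longleftrightarrow>
    (\<forall>z\<in>points \<Sigma>. \<forall>a<N. \<forall>b<N. \<forall>c<N. \<forall>d<N. fps_nth (R a b c d z) 0 = tid a b c d) \<and>
    (\<forall>x\<in>hpoints \<Sigma>. \<forall>y\<in>hpoints \<Sigma>. \<forall>z\<in>hpoints \<Sigma>.
       tregular N R (hsub \<Sigma> x y) \<and> tregular N R (hsub \<Sigma> x z) \<and> tregular N R (hsub \<Sigma> y z) \<longrightarrow>
       (\<forall>a<N. \<forall>b<N. \<forall>c<N. \<forall>d<N. \<forall>e<N. \<forall>f<N.
          (\<Sum>p<N. \<Sum>q<N. \<Sum>r<N. val (R a b p q) (hsub \<Sigma> x y) * val (R p c d r) (hsub \<Sigma> x z)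
             * val (R q r e f) (hsub \<Sigma> y z)) =
          (\<Sum>p<N. \<Sum>q<N. \<Sum>r<N. val (R b c q r) (hsub \<Sigma> y z) * val (R a r p f) (hsub \<Sigma> x z)
             * val (R p q d e) (hsub \<Sigma> x y)))) \<and>
    (\<forall>a<N. \<forall>b<N. \<forall>c<N. \<forall>d<N. \<forall>n.
       fls_subdegree (fps_nth (R a b c d (origin \<Sigma>)) n) \<ge> - int n \<and>
       fls_nth (fps_nth (R a b c d (origin \<Sigma>)) n) (- int n) =
       fls_nth (fps_nth (rational_R N a b c d (Ga 0)) n) (- int n)) \<and>
    (\<forall>z\<in>points \<Sigma>. \<exists>Y Z1 Z2 g. tinv N (tat R z) Y \<and> tinv N (transp1 Y) Z1 \<and> tinv N (transp2 Y) Z2 \<and>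
       fps_nth g 0 = 1 \<and>
       (let R' = (\<lambda>a b c d. g * shift (of_nat N * fps_X) (R a b c d z))
        in teq N (transp1 Z1) R' \<and> teq N (transp2 Z2) R')) \<and>
    (\<forall>z\<in>points \<Sigma>. \<exists>g. teq N (tmul N (tat R z) (opposite_R R z)) (\<lambda>a b c d. g * tid a b c d))"


section \<open>The Hopf algebra \<open>F_0(R)\<close>\<close>

text \<open>\<open>Tc a b m\<close> and \<open>Tic a b m\<close> are the coefficients of \<open>u^m\<close> in the entries (a, b) of \<open>T(u)\<close> and \<open>T(u)^-1\<close>.\<close>

datatype gen0 = Tc nat nat nat | Tic nat nat nat

text \<open>
  Relations common to \<open>F(R)\<close> and the multi-point algebras, for matrix series with coefficients \<open>s a b m\<close>,
  \<open>t a b m\<close>, etc. in the free algebra over k.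
\<close>

type_synonym ('g, 'k) mser = "nat \<Rightarrow> nat \<Rightarrow> nat \<Rightarrow> 'g word \<Rightarrow>\<^sub>0 'k"

definition range_rels :: "nat \<Rightarrow> ('g, 'k::field_char_0) mser \<Rightarrow> ('g word, 'k) cmod set"
  where "range_rels N t = {fps_const (t a b m) |a b m. a \<ge> N \<or> b \<ge> N}"

definition inverse_rels :: "nat \<Rightarrow> ('g, 'k::field_char_0) mser \<Rightarrow> ('g, 'k) mser \<Rightarrow> ('g word, 'k) cmod set"
  where "inverse_rels N s t = {fps_const ((\<Sum>b<N. \<Sum>l\<le>m. s a b l * t b c (m - l))
           - (if a = c \<and> m = 0 then 1 else 0)) |a c m. a < N \<and> c < N}"

text \<open>
  The relation \<open>X^12 s^13(u) t^23(v) = t^23(v) s^13(u) Y^12\<close> with \<open>X\<close>, \<open>Y\<close> Laurent series in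
  \<open>w = u - v\<close>.  Both sides are expanded in \<open>v\<close> and \<open>w\<close>, using
  \<open>s(v + w) = (\<Sum>k l. ((k + l) choose l) s_(k+l) v^l w^k)\<close>; \<open>mser_prod\<close> is the coefficient of \<open>v^m\<close> in
  \<open>s(v + w) t(v)\<close> (or in \<open>t(v) s(v + w)\<close>), as a series in \<open>w\<close>.
\<close>

definition mser_prod :: "bool \<Rightarrow> (nat \<Rightarrow> 'r) \<Rightarrow> (nat \<Rightarrow> 'r) \<Rightarrow> nat \<Rightarrow> 'r::ring_1 fls fps"
  where "mser_prod st s t m = fps_const (Abs_fls (\<lambda>k. if k < 0 then 0 else
           (\<Sum>l\<le>m. of_nat ((nat k + l) choose l) *
             (if st then s (nat k + l) * t (m - l) else t (m - l) * s (nat k + l)))))"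

definition RTT_rels :: "nat \<Rightarrow> ('g word \<Rightarrow>\<^sub>0 'k) fls fps tmat \<Rightarrow> ('g word \<Rightarrow>\<^sub>0 'k) fls fps tmat \<Rightarrow>
    ('g, 'k::field_char_0) mser \<Rightarrow> ('g, 'k) mser \<Rightarrow> ('g word, 'k) cmod set"
  where "RTT_rels N X Y s t = {Abs_fps (\<lambda>n. fls_nth (fps_nth
      ((\<Sum>p<N. \<Sum>q<N. X a b p q * mser_prod True (s p c) (t q d) m)
       - (\<Sum>p<N. \<Sum>q<N. mser_prod False (s a p) (t b q) m * Y p q c d)) n) i)
     |a b c d m i. a < N \<and> b < N \<and> c < N \<and> d < N}"

definition const_coeff :: "'k::field_char_0 fls fps \<Rightarrow> ('g word \<Rightarrow>\<^sub>0 'k) fls fps"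
  where "const_coeff F = taylor (Poly_Mapping.single 0) F 0"

definition T0 :: "(gen0, 'k::field_char_0) mser" where "T0 a b m = letter (Tc a b m)"
definition T0' :: "(gen0, 'k::field_char_0) mser" where "T0' a b m = letter (Tic a b m)"

definition F_rels :: "'k::field_char_0 curve \<Rightarrow> nat \<Rightarrow> 'k hfun tmat \<Rightarrow> (gen0 word, 'k) cmod set"
  where "F_rels \<Sigma> N R = range_rels N T0 \<union> range_rels N T0' \<union> inverse_rels N T0 T0' \<union> inverse_rels N T0' T0 \<union>
     (let X = (\<lambda>a b c d. const_coeff (R a b c d (origin \<Sigma>))) in RTT_rels N X X T0 T0)"

definition F_ideal :: "'k::field_char_0 curve \<Rightarrow> nat \<Rightarrow> 'k hfun tmat \<Rightarrow> (gen0 word, 'k) cmod set"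
  where "F_ideal \<Sigma> N R = closed_ideal (F_rels \<Sigma> N R)"

subsection \<open>Quantum determinant\<close>

text \<open>
  \<open>u_shift N m\<close> is the shift \<open>u_(m+1) - u = h (m + 1 - (N + 1)/2)\<close>, the index m starting at 0.
  Power series in u over the algebra are the outer \<open>fps\<close>.
\<close>

definition u_shift :: "nat \<Rightarrow> nat \<Rightarrow> 'k::field_char_0 fps"
  where "u_shift N m = fps_const (of_nat m - (of_nat N - 1) / 2) * fps_X"

definition midx :: "nat \<Rightarrow> nat list set"
  where "midx N = {I. length I = N \<and> set I \<subseteq> {..<N}}"

definition qmonomial :: "nat \<Rightarrow> ('g, 'k::field_char_0) mser \<Rightarrow> nat list \<Rightarrow> nat list \<Rightarrow> ('g word, 'k) cmod fps"
  where "qmonomial N t I J = prod_list (map (\<lambda>r. Abs_fps (\<lambda>m.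
           translate (\<lambda>k. fps_const (t (I ! r) (J ! r) k)) (scal (u_shift N r)) m)) [0..<N])"

definition qdet :: "nat \<Rightarrow> (nat list \<Rightarrow> 'k fps) \<Rightarrow> ('g, 'k::field_char_0) mser \<Rightarrow> ('g word, 'k) cmod fps"
  where "qdet N C t = (\<Sum>J\<in>midx N. fps_const (scal (C J)) * qmonomial N t [0..<N] J)"

text \<open>\<open>T^(1,N+1)(u_1) \<cdots> T^(N,N+1)(u_N) (v_0 \<otimes> 1) = v_0 \<otimes> q(u)\<close> in \<open>F(R)\<close>; the component \<open>1\<dots>N\<close> gives \<open>q = qdet(T)\<close>.\<close>

definition qdet_vector :: "'k::field_char_0 curve \<Rightarrow> nat \<Rightarrow> 'k hfun tmat \<Rightarrow> (nat list \<Rightarrow> 'k fps) \<Rightarrow> bool"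
  where "qdet_vector \<Sigma> N R C \<longleftrightarrow> C [0..<N] = 1 \<and>
    (\<forall>I\<in>midx N. \<forall>m. fps_nth ((\<Sum>J\<in>midx N. fps_const (scal (C J)) * qmonomial N T0 I J)
        - fps_const (scal (C I)) * qdet N C T0) m \<in> F_ideal \<Sigma> N R)"

definition qdet_rels :: "nat \<Rightarrow> (nat list \<Rightarrow> 'k fps) \<Rightarrow> ('g, 'k::field_char_0) mser \<Rightarrow> ('g word, 'k) cmod set"
  where "qdet_rels N C t = {fps_nth (qdet N C t) m - (if m = 0 then 1 else 0) |m. True}"

definition F0_ideal :: "'k::field_char_0 curve \<Rightarrow> nat \<Rightarrow> 'k hfun tmat \<Rightarrow> (nat list \<Rightarrow> 'k fps) \<Rightarrow> (gen0 word, 'k) cmod set"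
  where "F0_ideal \<Sigma> N R C = closed_ideal (F_rels \<Sigma> N R \<union> qdet_rels N C T0)"

definition matprod :: "nat \<Rightarrow> (nat \<Rightarrow> nat \<Rightarrow> 'r) list \<Rightarrow> nat \<Rightarrow> nat \<Rightarrow> 'r::semiring_1"
  where "matprod N Ms = foldr (\<lambda>M P a c. \<Sum>b<N. M a b * P b c) Ms (\<lambda>a c. if a = c then 1 else 0)"

text \<open>The scalar \<open>f_0\<close> with \<open>qdet_R(f_0 R) = 1\<close>, where \<open>f_0 R\<close> is a matrix in the first tensor factor with entries in the second.\<close>

definition Rbar :: "'k::field hfun \<Rightarrow> 'k hfun tmat \<Rightarrow> 'k hfun tmat"
  where "Rbar f0 R a b c d z = f0 z * R a b c d z"

definition normalizing :: "'k::field_char_0 curve \<Rightarrow> nat \<Rightarrow> 'k hfun tmat \<Rightarrow> (nat list \<Rightarrow> 'k fps) \<Rightarrow> 'k hfun \<Rightarrow> bool"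
  where "normalizing \<Sigma> N R C f0 \<longleftrightarrow> rational_hfun \<Sigma> f0 \<and> (\<forall>z\<in>points \<Sigma>. fps_nth (f0 z) 0 = 1) \<and>
    (\<forall>z\<in>points \<Sigma>. \<forall>a<N. \<forall>b<N.
       (\<Sum>J\<in>midx N. hconst (C J) * matprod N (map (\<lambda>r a b.
          shift (u_shift N r) (Rbar f0 R r a (J ! r) b z)) [0..<N]) a b) = (if a = b then 1 else 0))"

subsection \<open>Hopf structure, the form B and comodules\<close>

fun cop0_gen :: "nat \<Rightarrow> gen0 \<Rightarrow> (gen0 word \<times> gen0 word, 'k::field_char_0) cmod" where
  "cop0_gen N (Tc a c m) = (\<Sum>b<N. \<Sum>l\<le>m. basis (Word [Tc a b l], Word [Tc b c (m - l)]))"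
| "cop0_gen N (Tic a c m) = (\<Sum>b<N. \<Sum>l\<le>m. basis (Word [Tic b c l], Word [Tic a b (m - l)]))"

definition cop0 :: "nat \<Rightarrow> gen0 word \<Rightarrow> (gen0 word \<times> gen0 word, 'k::field_char_0) cmod"
  where "cop0 N w = prod_list (map (cop0_gen N) (letters w))"

fun eps0_gen :: "nat \<Rightarrow> gen0 \<Rightarrow> 'k::field_char_0" where
  "eps0_gen N (Tc a b m) = (if a = b \<and> a < N \<and> m = 0 then 1 else 0)"
| "eps0_gen N (Tic a b m) = (if a = b \<and> a < N \<and> m = 0 then 1 else 0)"

definition eps0 :: "nat \<Rightarrow> gen0 word \<Rightarrow> 'k::field_char_0 fps"
  where "eps0 N w = fps_const (prod_list (map (eps0_gen N) (letters w)))"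

definition tau0_gen :: "'k::field_char_0 fps \<Rightarrow> gen0 \<Rightarrow> (gen0 word, 'k) cmod"
  where "tau0_gen a g = (case g of
      Tc i j m \<Rightarrow> translate (\<lambda>k. basis (Word [Tc i j k])) (scal (- a)) m
    | Tic i j m \<Rightarrow> translate (\<lambda>k. basis (Word [Tic i j k])) (scal (- a)) m)"

definition tau0 :: "'k::field_char_0 fps \<Rightarrow> (gen0 word, 'k) cmod \<Rightarrow> (gen0 word, 'k) cmod"
  where "tau0 a = lin (\<lambda>w. prod_list (map (tau0_gen a) (letters w)))"

text \<open>\<open>S\<close> and \<open>S'\<close>, given on words, induce the antipode of \<open>F_0(R)\<close> and its inverse.\<close>

definition antipode_pair :: "(gen0 word, 'k) cmod set \<Rightarrow> (gen0 word \<Rightarrow> (gen0 word, 'k::field_char_0) cmod) \<Rightarrow>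
    (gen0 word \<Rightarrow> (gen0 word, 'k) cmod) \<Rightarrow> bool"
  where "antipode_pair J S S' \<longleftrightarrow>
    S 0 - 1 \<in> J \<and> (\<forall>u v. S (u + v) - S v * S u \<in> J) \<and>
    (\<forall>a b m. S (Word [Tc a b m]) - basis (Word [Tic a b m]) \<in> J) \<and>
    (\<forall>x\<in>J. lin S x \<in> J) \<and> (\<forall>x\<in>J. lin S' x \<in> J) \<and>
    (\<forall>w. lin S (S' w) - basis w \<in> J \<and> lin S' (S w) - basis w \<in> J)"

definition Bext :: "(gen0 word \<Rightarrow> gen0 word \<Rightarrow> 'k hfun) \<Rightarrow> (gen0 word, 'k) cmod \<Rightarrow> (gen0 word, 'k) cmod \<Rightarrow> 'k::field_char_0 hfun"
  where "Bext B x y z = appl_fls (\<lambda>v. appl_fls (\<lambda>w. B v w z) y) x"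

text \<open>
  \<open>B\<close> is given on words and extended bilinearly by \<open>Bext\<close>.  In the last clause, the coefficient of \<open>u^l v^m\<close>
  in the Taylor expansion of \<open>f(u - v + y)\<close> is \<open>(-1)^m f^(l+m)(y) / (l! m!)\<close>.
\<close>

definition B_form :: "'k::field_char_0 curve \<Rightarrow> nat \<Rightarrow> 'k hfun tmat \<Rightarrow> (nat list \<Rightarrow> 'k fps) \<Rightarrow> 'k hfun \<Rightarrow>
    (gen0 word \<Rightarrow> gen0 word \<Rightarrow> 'k hfun) \<Rightarrow> bool"
  where "B_form \<Sigma> N R C f0 B \<longleftrightarrow>
    (\<forall>v w. rational_hfun \<Sigma> (B v w)) \<and>
    (\<forall>z\<in>points \<Sigma>.
      (\<forall>x\<in>F0_ideal \<Sigma> N R C. \<forall>y. Bext B x y z = 0 \<and> Bext B y x z = 0) \<and>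
      (\<forall>w. B 0 w z = hconst (eps0 N w) \<and> B w 0 z = hconst (eps0 N w)) \<and>
      (\<forall>u v w. B (u + v) w z = appl_fls (\<lambda>(w1, w2). B u w1 z * B v w2 z) (cop0 N w)) \<and>
      (\<forall>u v w. B u (v + w) z = appl_fls (\<lambda>(u1, u2). B u1 w z * B u2 v z) (cop0 N u)) \<and>
      (\<forall>a<N. \<forall>b<N. \<forall>c<N. \<forall>d<N. \<forall>l m.
         B (Word [Tc a c l]) (Word [Tc b d m]) z =
         Abs_fps (\<lambda>n. fls_const ((-1) ^ m / (fact l * fact m)) *
           (fls_deriv ^^ (l + m)) (fps_nth (Rbar f0 R a b c d z) n))))"

text \<open>
  A finite-dimensional comodule is \<open>V = k^d\<close> (over k[[h]]) with the coaction
  \<open>\<pi>^*(e_b) = (\<Sum>a<d. t a b \<otimes> e_a)\<close>.  Then \<open>(1 \<otimes> \<pi>^* ) \<pi>^* = (\<Delta>^op \<otimes> 1) \<pi>^*\<close> says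
  \<open>\<Delta>(t a b) = (\<Sum>c. t a c \<otimes> t c b)\<close>, and the counit axiom says \<open>\<epsilon>(t a b) = \<delta>_ab\<close>.
\<close>

definition comodule :: "nat \<Rightarrow> (gen0 word, 'k) cmod set \<Rightarrow> nat \<Rightarrow> (nat \<Rightarrow> nat \<Rightarrow> (gen0 word, 'k::field_char_0) cmod) \<Rightarrow> bool"
  where "comodule N J d t \<longleftrightarrow> (\<forall>a<d. \<forall>b<d.
     lin (cop0 N) (t a b) - (\<Sum>c<d. tens (t a c) (t c b)) \<in> tens_ideal J \<and>
     appl (eps0 N) (t a b) = (if a = b then 1 else 0))"

text \<open>The entries of \<open>R_VW(u) (e_b \<otimes> e_d) = (\<Sum>a c. R_VW a c b d e_a \<otimes> e_c)\<close>.\<close>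

definition R_comod :: "(gen0 word \<Rightarrow> gen0 word \<Rightarrow> 'k hfun) \<Rightarrow> (nat \<Rightarrow> nat \<Rightarrow> (gen0 word, 'k) cmod) \<Rightarrow>
    (nat \<Rightarrow> nat \<Rightarrow> (gen0 word, 'k) cmod) \<Rightarrow> 'k::field_char_0 hfun tmat"
  where "R_comod B t s a c b d = Bext B (t a b) (s c d)"


section \<open>Multi-point algebras\<close>

text \<open>Generators of the multi-point algebra: \<open>G i g\<close> are the generators of the series \<open>T_i\<close>, \<open>Cc i\<close> is \<open>c_i\<close>; the points are numbered from 0.\<close>

datatype gen = G nat gen0 | Cc nat

definition TG :: "nat \<Rightarrow> (gen, 'k::field_char_0) mser" where "TG i a b m = letter (G i (Tc a b m))"
definition TG' :: "nat \<Rightarrow> (gen, 'k::field_char_0) mser" where "TG' i a b m = letter (G i (Tic a b m))"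

definition config_space :: "'k::field_char_0 curve \<Rightarrow> nat \<Rightarrow> 'k hfun tmat \<Rightarrow> nat \<Rightarrow> (nat \<Rightarrow> 'k hpt) set"
  where "config_space \<Sigma> N R n = {z. (\<forall>i<n. z i \<in> hpoints \<Sigma>) \<and>
     (\<forall>i<n. \<forall>j<n. i \<noteq> j \<longrightarrow> tregular N R (hsub \<Sigma> (z i) (z j)) \<and>
        (\<exists>Y. (\<forall>x\<in>points \<Sigma>. tinv N (tat R x) (tat Y x)) \<and> tregular N Y (hsub \<Sigma> (z i) (z j))))}"

text \<open>The entries of \<open>Rbar(w + z_i - z_j + r h (c_i - c_j))\<close>, a series in w over the free algebra.\<close>

definition R_central :: "'k::field_char_0 curve \<Rightarrow> 'k hfun tmat \<Rightarrow> (nat \<Rightarrow> 'k hpt) \<Rightarrow> nat \<Rightarrow> nat \<Rightarrow> 'k \<Rightarrow>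
    (gen word \<Rightarrow>\<^sub>0 'k) fls fps tmat"
  where "R_central \<Sigma> Rb z i j r a b c d = taylor (Poly_Mapping.single 0) (expand (Rb a b c d) (hsub \<Sigma> (z i) (z j)))
     (fps_X * fps_const (fls_const (Poly_Mapping.single 0 r * (letter (Cc i) - letter (Cc j)))))"

definition multi_ideal :: "'k::field_char_0 curve \<Rightarrow> nat \<Rightarrow> 'k hfun tmat \<Rightarrow> (nat list \<Rightarrow> 'k fps) \<Rightarrow> 'k hfun \<Rightarrow>
    nat \<Rightarrow> (nat \<Rightarrow> 'k hpt) \<Rightarrow> (gen word, 'k) cmod set"
  where "multi_ideal \<Sigma> N R C f0 n z = closed_ideal (
     {basis (Word [G i g]) |i g. i \<ge> n} \<union> {basis (Word [Cc i]) |i. i \<ge> n} \<union>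
     {basis (Word [Cc i, g]) - basis (Word [g, Cc i]) |i g. True} \<union>
     (\<Union>i<n. range_rels N (TG i) \<union> range_rels N (TG' i) \<union> inverse_rels N (TG i) (TG' i) \<union>
        inverse_rels N (TG' i) (TG i) \<union> qdet_rels N C (TG i)) \<union>
     (\<Union>i<n. \<Union>j<n. RTT_rels N (R_central \<Sigma> (Rbar f0 R) z i j (- 1 / 2))
        (R_central \<Sigma> (Rbar f0 R) z i j (1 / 2)) (TG i) (TG j)))"

fun cop_gen :: "nat \<Rightarrow> gen \<Rightarrow> (gen word \<times> gen word, 'k::field_char_0) cmod" where
  "cop_gen N (Cc i) = basis (Word [Cc i], 0) + basis (0, Word [Cc i])"
| "cop_gen N (G i (Tc a b m)) = (\<Sum>p<N. \<Sum>l\<le>m.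
     translate (\<lambda>k. basis (Word [G i (Tc a p k)], 0)) (scal (fps_const (- 1 / 2) * fps_X) * basis (0, Word [Cc i])) l *
     translate (\<lambda>k. basis (0, Word [G i (Tc p b k)])) (scal (fps_const (1 / 2) * fps_X) * basis (Word [Cc i], 0)) (m - l))"
| "cop_gen N (G i (Tic a b m)) = (\<Sum>p<N. \<Sum>l\<le>m.
     translate (\<lambda>k. basis (0, Word [G i (Tic a p k)])) (scal (fps_const (1 / 2) * fps_X) * basis (Word [Cc i], 0)) l *
     translate (\<lambda>k. basis (Word [G i (Tic p b k)], 0)) (scal (fps_const (- 1 / 2) * fps_X) * basis (0, Word [Cc i])) (m - l))"

definition cop :: "nat \<Rightarrow> gen word \<Rightarrow> (gen word \<times> gen word, 'k::field_char_0) cmod"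
  where "cop N w = prod_list (map (cop_gen N) (letters w))"

fun eps_gen :: "nat \<Rightarrow> gen \<Rightarrow> 'k::field_char_0" where
  "eps_gen N (G i g) = eps0_gen N g"
| "eps_gen N (Cc i) = 0"

definition eps :: "nat \<Rightarrow> gen word \<Rightarrow> 'k::field_char_0 fps"
  where "eps N w = fps_const (prod_list (map (eps_gen N) (letters w)))"

text \<open>The n-fold coproduct, with the tensor factors listed from left to right.\<close>

fun iter_cop :: "nat \<Rightarrow> nat \<Rightarrow> gen word \<Rightarrow> (gen word list, 'k::field_char_0) cmod" where
  "iter_cop N 0 w = hscale (eps N w) (basis [])"
| "iter_cop N (Suc n) w = lin (\<lambda>(w1, w2). lin (\<lambda>l. basis (w1 # l)) (iter_cop N n w2)) (cop N w)"


section \<open>Induced modules and conformal blocks\<close>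

text \<open>
  \<open>t\<close> and \<open>d\<close> describe the comodule V.  The induced module \<open>A \<otimes>_D V\<close> is the free module with basis
  (word, index of a basis vector of V) modulo the closed submodule expressing the relations
  of A and \<open>a g \<otimes> v = a \<otimes> g v\<close> for the generators g of D, that is \<open>T_j\<close> (\<open>j \<noteq> i\<close>) and all \<open>c_j\<close>.
\<close>

definition ind_kernel :: "'k::field_char_0 curve \<Rightarrow> nat \<Rightarrow> 'k hfun tmat \<Rightarrow> (nat list \<Rightarrow> 'k fps) \<Rightarrow> 'k hfun \<Rightarrow>
    (gen0 word \<Rightarrow> gen0 word \<Rightarrow> 'k hfun) \<Rightarrow> 'k fps \<Rightarrow> nat \<Rightarrow> (nat \<Rightarrow> 'k hpt) \<Rightarrow>
    nat \<Rightarrow> nat \<Rightarrow> (nat \<Rightarrow> nat \<Rightarrow> (gen0 word, 'k) cmod) \<Rightarrow> (gen word \<times> nat, 'k) cmod set"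
  where "ind_kernel \<Sigma> N R C f0 B K n z i d t = closed_span (
     {basis (w, e) |w e. e \<ge> d} \<union>
     {lin (\<lambda>w. basis (w, e)) y |y e. y \<in> multi_ideal \<Sigma> N R C f0 n z} \<union>
     {basis (w + Word [G j g], e) -
        (\<Sum>a<d. hscale (val (Bext B (basis (Word [g])) (t a e)) (hsub \<Sigma> (z j) (z i))) (basis (w, a)))
       |w j g e. j < n \<and> j \<noteq> i \<and> e < d} \<union>
     {basis (w + Word [Cc j], e) - hscale (if j = i then K else 0) (basis (w, e)) |w j e. j < n})"

text \<open>
  \<open>M_K(z)\<close> is presented on lists of length n of such pairs; \<open>d j\<close>, \<open>t j\<close> describe \<open>V^(j+1)\<close>.  Words act
  from the left through the n-fold coproduct.
\<close>

definition M_kernel :: "'k::field_char_0 curve \<Rightarrow> nat \<Rightarrow> 'k hfun tmat \<Rightarrow> (nat list \<Rightarrow> 'k fps) \<Rightarrow> 'k hfun \<Rightarrow>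
    (gen0 word \<Rightarrow> gen0 word \<Rightarrow> 'k hfun) \<Rightarrow> 'k fps \<Rightarrow> nat \<Rightarrow> (nat \<Rightarrow> nat) \<Rightarrow>
    (nat \<Rightarrow> nat \<Rightarrow> nat \<Rightarrow> (gen0 word, 'k) cmod) \<Rightarrow> (nat \<Rightarrow> 'k hpt) \<Rightarrow> ((gen word \<times> nat) list, 'k) cmod set"
  where "M_kernel \<Sigma> N R C f0 B K n d t z = closed_span (
     {basis s |s. length s \<noteq> n} \<union>
     {lin (\<lambda>b. basis (s[j := b])) y |s j y. length s = n \<and> j < n \<and>
        y \<in> ind_kernel \<Sigma> N R C f0 B K n z j (d j) (t j)})"

definition M_action :: "nat \<Rightarrow> gen word \<Rightarrow> (gen word \<times> nat) list \<Rightarrow> ((gen word \<times> nat) list, 'k::field_char_0) cmod"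
  where "M_action N w s = lin (\<lambda>l. basis (map2 (\<lambda>u (v, e). (u + v, e)) l s)) (iter_cop N (length s) w)"

definition invariant_functionals :: "'k::field_char_0 curve \<Rightarrow> nat \<Rightarrow> 'k hfun tmat \<Rightarrow> (nat list \<Rightarrow> 'k fps) \<Rightarrow> 'k hfun \<Rightarrow>
    (gen0 word \<Rightarrow> gen0 word \<Rightarrow> 'k hfun) \<Rightarrow> 'k fps \<Rightarrow> nat \<Rightarrow> (nat \<Rightarrow> nat) \<Rightarrow>
    (nat \<Rightarrow> nat \<Rightarrow> nat \<Rightarrow> (gen0 word, 'k) cmod) \<Rightarrow> (nat \<Rightarrow> 'k hpt) \<Rightarrow> ((gen word \<times> nat) list \<Rightarrow> 'k fps) set"
  where "invariant_functionals \<Sigma> N R C f0 B K n d t z = {F.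
     (\<forall>x\<in>M_kernel \<Sigma> N R C f0 B K n d t z. appl F x = 0) \<and>
     (\<forall>w s. set (letters w) \<subseteq> {G i g |i g. i < n} \<and> length s = n \<longrightarrow>
        appl F (M_action N w s) = eps N w * F s)}"

text \<open>
  The identification of all \<open>M_K(z)\<close> with the tensor product of the spaces \<open>F_0(R) \<otimes> V^j\<close>: in the j-th factor
  \<open>T(u)\<close> goes to \<open>T_j(u)\<close>.  Under it \<open>B_K(z)\<close> becomes a space of functionals independent of z.
\<close>

definition identify :: "(gen0 word \<times> nat) list \<Rightarrow> (gen word \<times> nat) list"
  where "identify s = map (\<lambda>(j, (w, e)). (Word (map (G j) (letters w)), e)) (List.enumerate 0 s)"

definition conformal_blocks :: "'k::field_char_0 curve \<Rightarrow> nat \<Rightarrow> 'k hfun tmat \<Rightarrow> (nat list \<Rightarrow> 'k fps) \<Rightarrow> 'k hfun \<Rightarrow>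
    (gen0 word \<Rightarrow> gen0 word \<Rightarrow> 'k hfun) \<Rightarrow> 'k fps \<Rightarrow> nat \<Rightarrow> (nat \<Rightarrow> nat) \<Rightarrow>
    (nat \<Rightarrow> nat \<Rightarrow> nat \<Rightarrow> (gen0 word, 'k) cmod) \<Rightarrow> (nat \<Rightarrow> 'k hpt) \<Rightarrow> ((gen0 word \<times> nat) list \<Rightarrow> 'k fps) set"
  where "conformal_blocks \<Sigma> N R C f0 B K n d t z =
     (\<lambda>F. F \<circ> identify) ` invariant_functionals \<Sigma> N R C f0 B K n d t z"

text \<open>
  Vectors of \<open>V^1 \<otimes> \<dots> \<otimes> V^n\<close>, and likewise of its dual, in coordinates indexed by lists.
\<close>

definition tidx :: "nat \<Rightarrow> (nat \<Rightarrow> nat) \<Rightarrow> nat list set"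
  where "tidx n d = {I. length I = n \<and> (\<forall>j<n. I ! j < d j)}"

definition tspace :: "nat \<Rightarrow> (nat \<Rightarrow> nat) \<Rightarrow> (nat list \<Rightarrow> 'k::zero fps) set"
  where "tspace n d = {x. \<forall>I. I \<notin> tidx n d \<longrightarrow> x I = 0}"

definition xi :: "((gen0 word \<times> nat) list \<Rightarrow> 'k fps) \<Rightarrow> nat list \<Rightarrow> 'k fps"
  where "xi f I = f (map (\<lambda>e. (0, e)) I)"


section \<open>The Sugawara operator and the connection\<close>

text \<open>\<open>proj c\<close> sends \<open>T_i\<close> to \<open>T\<close> and each \<open>c_i\<close> to the scalar \<open>c\<close>.\<close>

fun proj_gen :: "'k::field_char_0 fps \<Rightarrow> gen \<Rightarrow> (gen0 word, 'k) cmod" where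
  "proj_gen c (G i g) = basis (Word [g])"
| "proj_gen c (Cc i) = scal c"

definition proj :: "'k::field_char_0 fps \<Rightarrow> gen word \<Rightarrow> (gen0 word, 'k) cmod"
  where "proj c w = prod_list (map (proj_gen c) (letters w))"

text \<open>
  The coaction on the induced module \<open>F_0(R) \<otimes> V\<close> (case of one point, which gets the number 0):
  \<open>\<pi>^*(a \<otimes> e_b) = (\<Sum>a_(3) x_(-1) S^-1(a_(1)) \<otimes> a_(2) \<otimes> x_(0))\<close> with \<open>x = e_b\<close>, the coproduct being that of the algebra with c,
  in which c is 0 in the first and third factors (taken mod C) and acts by K in the second.
\<close>

definition ind_coaction :: "nat \<Rightarrow> 'k::field_char_0 fps \<Rightarrow> (gen0 word \<Rightarrow> (gen0 word, 'k) cmod) \<Rightarrow>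
    nat \<Rightarrow> (nat \<Rightarrow> nat \<Rightarrow> (gen0 word, 'k) cmod) \<Rightarrow> gen0 word \<times> nat \<Rightarrow> (gen0 word \<times> gen0 word \<times> nat, 'k) cmod"
  where "ind_coaction N K S' d t = (\<lambda>(w, b). if b < d then
      lin (\<lambda>l. \<Sum>a<d. tens (proj 0 (l ! 2) * t a b * lin S' (proj 0 (l ! 0)))
                         (lin (\<lambda>v. basis (v, a)) (proj K (l ! 1))))
        (iter_cop N 3 (Word (map (G 0) (letters w))))
    else 0)"

definition sugawara :: "nat \<Rightarrow> 'k::field_char_0 fps \<Rightarrow> (gen0 word \<Rightarrow> (gen0 word, 'k) cmod) \<Rightarrow>
    nat \<Rightarrow> (nat \<Rightarrow> nat \<Rightarrow> (gen0 word, 'k) cmod) \<Rightarrow> gen0 word \<times> nat \<Rightarrow> (gen0 word \<times> nat, 'k) cmod"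
  where "sugawara N K S' d t x =
     lin (\<lambda>(w, v, a). lin (\<lambda>v'. basis (v', a)) (tau0 (fps_const (1 / 2) * K * fps_X) (S' w) * basis v))
       (ind_coaction N K S' d t x)"

definition A_tilde :: "nat \<Rightarrow> 'k::field_char_0 fps \<Rightarrow> (gen0 word \<Rightarrow> (gen0 word, 'k) cmod) \<Rightarrow> (nat \<Rightarrow> nat) \<Rightarrow>
    (nat \<Rightarrow> nat \<Rightarrow> nat \<Rightarrow> (gen0 word, 'k) cmod) \<Rightarrow> nat \<Rightarrow>
    ((gen0 word \<times> nat) list \<Rightarrow> 'k fps) \<Rightarrow> (gen0 word \<times> nat) list \<Rightarrow> 'k fps"
  where "A_tilde N K S' d t i f s = appl f (lin (\<lambda>b. basis (s[i := b])) (sugawara N K S' (d i) (t i) (s ! i)))"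

text \<open>
  \<open>A_triv\<close> is the operator on the dual of \<open>V^1 \<otimes> \<dots> \<otimes> V^n\<close> corresponding to \<open>A_tilde\<close> under \<open>\<xi>\<close>; \<open>A_dual\<close> is the
  dual operator on \<open>V^1 \<otimes> \<dots> \<otimes> V^n\<close>, from the fiber over \<open>z - \<kappa> h e_i\<close> to that over \<open>z\<close>.
\<close>

definition A_triv :: "((gen0 word \<times> nat) list \<Rightarrow> 'k::field_char_0 fps) set \<Rightarrow> nat \<Rightarrow> 'k fps \<Rightarrow>
    (gen0 word \<Rightarrow> (gen0 word, 'k) cmod) \<Rightarrow> (nat \<Rightarrow> nat) \<Rightarrow>
    (nat \<Rightarrow> nat \<Rightarrow> nat \<Rightarrow> (gen0 word, 'k) cmod) \<Rightarrow> nat \<Rightarrow> (nat list \<Rightarrow> 'k fps) \<Rightarrow> nat list \<Rightarrow> 'k fps"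
  where "A_triv BK N K S' d t i \<phi> = xi (A_tilde N K S' d t i (inv_into BK xi \<phi>))"

definition A_dual :: "((gen0 word \<times> nat) list \<Rightarrow> 'k::field_char_0 fps) set \<Rightarrow> nat \<Rightarrow> 'k fps \<Rightarrow>
    (gen0 word \<Rightarrow> (gen0 word, 'k) cmod) \<Rightarrow> nat \<Rightarrow> (nat \<Rightarrow> nat) \<Rightarrow>
    (nat \<Rightarrow> nat \<Rightarrow> nat \<Rightarrow> (gen0 word, 'k) cmod) \<Rightarrow> nat \<Rightarrow> (nat list \<Rightarrow> 'k fps) \<Rightarrow> nat list \<Rightarrow> 'k fps"
  where "A_dual BK N K S' n d t i x I = (if I \<in> tidx n d then
     \<Sum>J\<in>tidx n d. A_triv BK N K S' d t i (\<lambda>I'. if I' = I then 1 else 0) J * x J else 0)"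

definition nabla :: "((gen0 word \<times> nat) list \<Rightarrow> 'k::field_char_0 fps) set \<Rightarrow> nat \<Rightarrow> 'k fps \<Rightarrow>
    (gen0 word \<Rightarrow> (gen0 word, 'k) cmod) \<Rightarrow> nat \<Rightarrow> (nat \<Rightarrow> nat) \<Rightarrow>
    (nat \<Rightarrow> nat \<Rightarrow> nat \<Rightarrow> (gen0 word, 'k) cmod) \<Rightarrow> nat \<Rightarrow> (nat list \<Rightarrow> 'k fps) \<Rightarrow> nat list \<Rightarrow> 'k fps"
  where "nabla BK N K S' n d t i = inv_into (tspace n d) (A_dual BK N K S' n d t i)"

text \<open>\<open>R^(j,i)\<close> of the comodules \<open>V^j\<close>, \<open>V^i\<close> at the point \<open>x\<close>, acting on \<open>V^1 \<otimes> \<dots> \<otimes> V^n\<close>.\<close>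

definition R_op :: "(gen0 word \<Rightarrow> gen0 word \<Rightarrow> 'k hfun) \<Rightarrow> nat \<Rightarrow> (nat \<Rightarrow> nat) \<Rightarrow>
    (nat \<Rightarrow> nat \<Rightarrow> nat \<Rightarrow> (gen0 word, 'k) cmod) \<Rightarrow> nat \<Rightarrow> nat \<Rightarrow> 'k::field_char_0 hpt \<Rightarrow>
    (nat list \<Rightarrow> 'k fps) \<Rightarrow> nat list \<Rightarrow> 'k fps"
  where "R_op B n d t j i x v I = (if I \<in> tidx n d then
     \<Sum>a<d j. \<Sum>b<d i. val (R_comod B (t j) (t i) (I ! j) (I ! i) a b) x * v (I[j := a, i := b]) else 0)"

end

theory Submission
  imports Defs
begin

text \<open>
  An invariant functional f restricted to vectors with an arbitrary element g of \<open>F_0(R)\<close> in the i-th factor and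
  vectors of \<open>V^j\<close> elsewhere is determined by its restriction to \<open>V^1 \<otimes> \<dots> \<otimes> V^n\<close>: invariance under \<open>T_i\<close> is a
  convolution equation in g, in which the factor j acts through the form B at \<open>z_i - z_j \<mp> hK/2\<close> (the shift comes from
  the central elements in the coproduct, which act by K in the factor i only and reach the factors before and after it
  with opposite signs).  The factors \<open>j < i\<close> stand to the left of g and are inverted by the crossing symmetry
  of B, which contributes the shift by Nh; the factors \<open>j > i\<close> stand to the right and are inverted by unitarity.
  Applying the translation by hK/2 of the Sugawara operator turns the result into a convolution product of matrix
  coefficients of \<open>B(V^j, g)\<close> at \<open>z_j - z_i + \<kappa>h\<close> for \<open>j < i\<close> and at \<open>z_j - z_i\<close> for \<open>j > i\<close>.  As a function of g this product is
  multiplicative and, \<open>F_0(R)\<close> being a coalgebra, kills its relations.  Evaluated on the coaction of \<open>V^i\<close> it is the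
  product of R-matrices of the theorem, and on the inverse antipode of the coaction it is the operator of \<open>f \<mapsto> f \<circ> Q_i\<close>; the
  antipode axioms say that the two are inverse to each other.

  That the normalization by the quantum determinant makes unitarity and crossing hold for B without scalar factors is
  part of the proof: \<open>qdet = 1\<close> for \<open>R\<close> and for its inverse forces the product of the scalar over the shifts
  \<open>u_1, \<dots>, u_N\<close> to be 1, and a series \<open>1 + O(h)\<close> with this property is 1.
\<close>

section \<open>Linear maps on h-adic modules\<close>

text \<open>Quotient algebras and completed tensor products are never formed. Everything is computed
  on words, where the coproduct of \<open>F_0(R)\<close> is a finite sum of pairs of words, and a
  relation enters only through functionals vanishing on the closed ideal. Such functionals are
  closed under convolution, which is how the coalgebra structure of the quotient is used. Evaluation
  of a Laurent series at a point is multiplicative only on regular series. So B must be regular on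
  all words, including those with letters of \<open>T^-1\<close>, while the configuration space
  controls \<open>R\<close> and its inverse but not the scalar \<open>f0\<close>. Regularity of
  \<open>f0\<close> is extracted from \<open>qdet = 1\<close>, and the values of B on
  \<open>T^-1\<close> are recognized as entries of \<open>R^21(-u)\<close>, of its shift by Nh, or
  of R itself, all normalized. The shift in the result adds up as follows. For j < i the equation
  contains B at \<open>z_i - z_j - hK/2\<close>; inversion by crossing gives
  \<open>z_j - z_i + hK/2 + Nh\<close>, and the Sugawara translation adds another hK/2, so the total
  is \<open>\<kappa>h\<close>. For j > i inversion by unitarity gives
  \<open>z_j - z_i - hK/2\<close>, and the translation cancels the half.\<close>

definition hX :: "'a::zero fps \<Rightarrow> 'a fps"
  where "hX x = Abs_fps (\<lambda>n. case n of 0 \<Rightarrow> 0 | Suc m \<Rightarrow> fps_nth x m)"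

lemma hX_nth [simp]: "fps_nth (hX x) 0 = 0" "fps_nth (hX x) (Suc n) = fps_nth x n"
  by (simp_all add: hX_def)

lemma fps_split: "x = fps_const (fps_nth x 0) + hX (fps_shift 1 (x::'a::monoid_add fps))"
proof (rule fps_ext)
  fix n show "fps_nth x n = fps_nth (fps_const (fps_nth x 0) + hX (fps_shift 1 x)) n"
    by (cases n) auto
qed

lemma hX_add: "hX (x + y) = hX x + hX (y::'a::monoid_add fps)"
proof (rule fps_ext)
  fix n show "fps_nth (hX (x + y)) n = fps_nth (hX x + hX y) n"
    by (cases n) auto
qed

lemma hX_conv_mult: "hX x = fps_X * (x::'a::semiring_1 fps)"
proof (rule fps_ext)
  fix n show "fps_nth (hX x) n = fps_nth (fps_X * x) n"
    by (cases n) auto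
qed

text \<open>Only additivity and compatibility with h are asked, not linearity over k. Thus one
  notion covers linear extensions, ring homomorphisms, derivations and extraction of coefficients,
  and it already forces h-adic continuity.\<close>

definition hadd :: "('a::ab_group_add fps \<Rightarrow> 'b::ab_group_add fps) \<Rightarrow> bool"
  where "hadd f \<longleftrightarrow> (\<forall>x y. f (x + y) = f x + f y) \<and> (\<forall>x. f (hX x) = hX (f x))"

lemma haddI: "(\<And>x y. f (x + y) = f x + f y) \<Longrightarrow> (\<And>x. f (hX x) = hX (f x)) \<Longrightarrow> hadd f"
  by (simp add: hadd_def)

lemma hadd_add: "hadd f \<Longrightarrow> f (x + y) = f x + f y"
  and hadd_hX: "hadd f \<Longrightarrow> f (hX x) = hX (f x)"
  by (simp_all add: hadd_def)

lemma hadd_0: assumes "hadd f" shows "f 0 = 0"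
proof -
  have "f (0 + 0) = f 0 + f 0" using assms by (rule hadd_add)
  thus ?thesis by simp
qed

lemma hadd_minus: assumes "hadd f" shows "f (- x) = - f x"
proof -
  have "f (- x) + f x = f (- x + x)" using assms by (simp only: hadd_add)
  thus ?thesis using hadd_0[OF assms] by (simp add: eq_neg_iff_add_eq_0)
qed

lemma hadd_diff: assumes "hadd f" shows "f (x - y) = f x - f y"
  using hadd_add[OF assms, of x "- y"] hadd_minus[OF assms] by simp

lemma hadd_sum: assumes "hadd f" shows "f (\<Sum>i\<in>A. g i) = (\<Sum>i\<in>A. f (g i))"
  by (induction A rule: infinite_finite_induct) (simp_all add: hadd_0[OF assms] hadd_add[OF assms])

text \<open>A series with no terms below \<open>h^m\<close> is an m-fold \<open>hX\<close>, and each
  \<open>hX\<close> passes through f. This is the automatic continuity on which every reduction to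
  constants rests.\<close>

lemma hadd_vanish:
  assumes "hadd f" "\<And>l. l < m \<Longrightarrow> fps_nth x l = 0" "l < m"
  shows "fps_nth (f x) l = 0"
  using assms(2,3)
proof (induction m arbitrary: x l)
  case (Suc m)
  have "x = fps_const (fps_nth x 0) + hX (fps_shift 1 x)" by (rule fps_split)
  also have "fps_nth x 0 = 0" using Suc.prems(1)[of 0] by simp
  finally have "x = hX (fps_shift 1 x)" by simp
  hence eq: "f x = hX (f (fps_shift 1 x))" using hadd_hX[OF assms(1)] by metis
  show ?case
  proof (cases l)
    case 0 thus ?thesis by (subst eq) simp
  next
    case (Suc k)
    have "fps_nth (f (fps_shift 1 x)) k = 0"
      by (rule Suc.IH) (use Suc.prems Suc in auto)
    thus ?thesis by (subst eq) (simp add: Suc)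
  qed
qed simp

lemma hadd_cong_below:
  assumes "hadd f" "\<And>l. l < m \<Longrightarrow> fps_nth x l = fps_nth y l" "l < m"
  shows "fps_nth (f x) l = fps_nth (f y) l"
proof -
  have "fps_nth (f (x - y)) l = 0"
    by (rule hadd_vanish[OF assms(1) _ assms(3)]) (simp add: assms(2))
  thus ?thesis by (simp add: hadd_diff[OF assms(1)])
qed

lemma hadd_eqI:
  assumes "hadd f" "hadd g" "\<And>c. f (fps_const c) = g (fps_const c)"
  shows "f x = g x"
proof (rule fps_ext)
  fix n
  show "fps_nth (f x) n = fps_nth (g x) n"
  proof (induction n arbitrary: x)
    case 0
    have "fps_nth (f x) 0 = fps_nth (f (fps_const (fps_nth x 0))) 0"
      "fps_nth (g x) 0 = fps_nth (g (fps_const (fps_nth x 0))) 0"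
      by (rule hadd_cong_below[where m = 1]; use assms in simp)+
    thus ?case by (simp add: assms(3))
  next
    case (Suc n)
    have "f x = f (fps_const (fps_nth x 0)) + hX (f (fps_shift 1 x))"
      by (metis fps_split hadd_add[OF assms(1)] hadd_hX[OF assms(1)])
    moreover have "g x = g (fps_const (fps_nth x 0)) + hX (g (fps_shift 1 x))"
      by (metis fps_split hadd_add[OF assms(2)] hadd_hX[OF assms(2)])
    ultimately show ?case using Suc[of "fps_shift 1 x"] by (simp add: assms(3))
  qed
qed

lemma poly_mapping_additive_induct [case_names single add]:
  fixes p :: "'s \<Rightarrow>\<^sub>0 'k::comm_monoid_add"
  assumes "\<And>s c. P (Poly_Mapping.single s c)" "\<And>p q. P p \<Longrightarrow> P q \<Longrightarrow> P (p + q)"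
  shows "P p"
proof (induction p rule: Poly_Mapping.update_induct)
  case const
  show ?case using assms(1)[of undefined 0] by simp
next
  case (update f a b)
  have "Poly_Mapping.update a b f = Poly_Mapping.single a b + f"
  proof (rule poly_mapping_eqI)
    fix k show "Poly_Mapping.lookup (Poly_Mapping.update a b f) k = Poly_Mapping.lookup (Poly_Mapping.single a b + f) k"
      using update by (cases "k = a") (auto simp: lookup_update lookup_add lookup_single in_keys_iff)
  qed
  thus ?case using assms update by metis
qed

lemma fps_const_add': "fps_const (a + b) = fps_const a + fps_const (b::'a::monoid_add)"
  by (rule fps_ext) auto

lemma cmod_eqI:
  fixes f g :: "('s, 'k::comm_ring_1) cmod \<Rightarrow> 'b::ab_group_add fps"
  assumes "hadd f" "hadd g"
    "\<And>s c. f (fps_const (Poly_Mapping.single s c)) = g (fps_const (Poly_Mapping.single s c))"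
  shows "f x = g x"
proof (rule hadd_eqI[OF assms(1,2)])
  fix p :: "'s \<Rightarrow>\<^sub>0 'k"
  show "f (fps_const p) = g (fps_const p)"
    by (induction p rule: poly_mapping_additive_induct)
       (simp_all add: assms(3) fps_const_add' hadd_add[OF assms(1)] hadd_add[OF assms(2)] del: fps_const_add)
qed

lemma hadd_compose: "hadd f \<Longrightarrow> hadd g \<Longrightarrow> hadd (\<lambda>x. f (g x))"
  by (auto simp: hadd_def)

lemma hadd_plus: "hadd f \<Longrightarrow> hadd g \<Longrightarrow> hadd (\<lambda>x. f x + g x)"
  by (auto simp: hadd_def hX_add algebra_simps)

lemma hX_minus: "hX (- x) = - hX (x::'a::ab_group_add fps)"
proof (rule fps_ext)
  fix n show "fps_nth (hX (- x)) n = fps_nth (- hX x) n" by (cases n) auto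
qed

lemma hadd_neg: "hadd f \<Longrightarrow> hadd (\<lambda>x. - f x)"
  by (auto simp: hadd_def hX_minus algebra_simps)

lemma hadd_subtract: "hadd f \<Longrightarrow> hadd g \<Longrightarrow> hadd (\<lambda>x. f x - g x)"
  using hadd_plus[OF _ hadd_neg, of f g] by simp

lemma hX_0 [simp]: "hX 0 = (0::'a::zero fps)"
  by (rule fps_ext) (simp add: hX_def split: nat.split)

lemma hadd_zero_fun: "hadd (\<lambda>x. 0)"
  by (auto simp: hadd_def)

lemma hadd_id: "hadd (\<lambda>x. x)"
  by (auto simp: hadd_def)

lemma hadd_mult_left: "hadd (\<lambda>x. a * (x::'a::ring_1 fps))"
proof (rule haddI)
  fix x show "a * hX x = hX (a * x)"
    unfolding hX_conv_mult by (metis mult.assoc fps_mult_fps_X_commute)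
qed (simp add: algebra_simps)

lemma hadd_mult_right: "hadd (\<lambda>x. (x::'a::ring_1 fps) * a)"
  by (rule haddI) (simp_all add: algebra_simps hX_conv_mult)

text \<open>Common interface for the three linear extensions: the coefficients of the target may be
  k, k((u)) or finitely supported functions, and \<open>sc\<close> is the action of k on
  them.\<close>

locale hmod =
  fixes sc :: "'k::comm_ring_1 \<Rightarrow> 'b::ab_group_add \<Rightarrow> 'b"
  assumes sc_left: "sc (c + c') b = sc c b + sc c' b"
    and sc_right: "sc c (b + b') = sc c b + sc c b'"
    and sc_sc: "sc c (sc c' b) = sc (c * c') b"
    and sc_1: "sc 1 b = b"
begin

lemma sc_0_left [simp]: "sc 0 b = 0"
  using sc_left[of 0 0 b] by simp

lemma sc_0_right [simp]: "sc c 0 = 0"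
  using sc_right[of c 0 0] by simp

definition hsc :: "'k \<Rightarrow> 'b fps \<Rightarrow> 'b fps" where "hsc c y = Abs_fps (\<lambda>n. sc c (fps_nth y n))"

lemma hsc_nth [simp]: "fps_nth (hsc c y) n = sc c (fps_nth y n)"
  by (simp add: hsc_def)

lemma hadd_hsc: "hadd (hsc c)"
proof (rule haddI)
  fix x show "hsc c (hX x) = hX (hsc c x)"
  proof (rule fps_ext)
    fix n show "fps_nth (hsc c (hX x)) n = fps_nth (hX (hsc c x)) n" by (cases n) auto
  qed
qed (rule fps_ext, simp add: sc_right)

lemma hsc_hsc: "hsc c (hsc c' y) = hsc (c * c') y"
  by (rule fps_ext) (simp add: sc_sc)

lemma hsc_1: "hsc 1 y = y"
  by (rule fps_ext) (simp add: sc_1)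

lemma linext_nth: "fps_nth (linext sc \<phi> x) n =
    (\<Sum>i\<le>n. \<Sum>s\<in>Poly_Mapping.keys (fps_nth x i). sc (Poly_Mapping.lookup (fps_nth x i) s) (fps_nth (\<phi> s) (n - i)))"
  by (simp add: linext_def)

lemma hadd_linext:
  fixes \<phi> :: "'s \<Rightarrow> 'b fps"
  shows "hadd (linext sc \<phi>)"
proof (rule haddI)
  fix x y :: "('s, 'k) cmod"
  show "linext sc \<phi> (x + y) = linext sc \<phi> x + linext sc \<phi> y"
    by (rule fps_ext, simp only: linext_nth fps_add_nth sum.distrib[symmetric], rule sum.cong[OF refl],
        rule setsum_keys_plus_distrib) (simp_all add: sc_left)
next
  fix x :: "('s, 'k) cmod"
  show "linext sc \<phi> (hX x) = hX (linext sc \<phi> x)"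
  proof (rule fps_ext)
    fix n show "fps_nth (linext sc \<phi> (hX x)) n = fps_nth (hX (linext sc \<phi> x)) n"
    proof (cases n)
      case (Suc m)
      show ?thesis unfolding Suc linext_nth by (subst sum.atMost_Suc_shift) (simp add: linext_nth)
    qed (simp add: linext_nth)
  qed
qed

lemma linext_single: "linext sc \<phi> (fps_const (Poly_Mapping.single s c)) = hsc c (\<phi> s)"
proof (rule fps_ext)
  fix n
  have "fps_nth (linext sc \<phi> (fps_const (Poly_Mapping.single s c))) n =
    (\<Sum>i\<le>n. if i = 0 then sc c (fps_nth (\<phi> s) n) else 0)"
    unfolding linext_nth by (rule sum.cong) auto
  thus "fps_nth (linext sc \<phi> (fps_const (Poly_Mapping.single s c))) n = fps_nth (hsc c (\<phi> s)) n"
    by simp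
qed

lemma linext_basis: "linext sc \<phi> (basis s) = \<phi> s"
  by (simp add: basis_def linext_single hsc_1)

lemma linext_add_fun: "linext sc (\<lambda>s. \<phi> s + \<psi> s) x = linext sc \<phi> x + linext sc \<psi> x"
  by (rule cmod_eqI[OF hadd_linext hadd_plus[OF hadd_linext hadd_linext]])
     (simp add: linext_single hadd_add[OF hadd_hsc])

lemma linext_hadd_fun:
  assumes "hadd f" "\<And>c y. f (hsc c y) = hsc c (f y)"
  shows "linext sc (\<lambda>s. f (\<phi> s)) x = f (linext sc \<phi> x)"
  by (rule cmod_eqI[OF hadd_linext hadd_compose[OF assms(1) hadd_linext]]) (simp add: linext_single assms(2))

lemma hadd_hX': "hadd (hX :: 'c::ab_group_add fps \<Rightarrow> _)"
  by (rule haddI) (simp_all add: hX_add)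

lemma linext_hX_fun: "linext sc (\<lambda>s. hX (\<phi> s)) x = hX (linext sc \<phi> x)"
  by (rule linext_hadd_fun[OF hadd_hX']) (simp add: hadd_hX[OF hadd_hsc])

lemma linext_hsc_fun: "linext sc (\<lambda>s. hsc c (\<phi> s)) x = hsc c (linext sc \<phi> x)"
  by (rule linext_hadd_fun[OF hadd_hsc]) (simp add: hsc_hsc mult.commute)

lemma linext_zero_fun: "linext sc (\<lambda>s. 0) x = 0"
  by (rule linext_hadd_fun[OF hadd_zero_fun]) (simp add: hadd_0[OF hadd_hsc])

lemma linext_sum_fun: "linext sc (\<lambda>s. \<Sum>i\<in>A. \<phi> i s) x = (\<Sum>i\<in>A. linext sc (\<phi> i) x)"
  by (induction A rule: infinite_finite_induct) (simp_all add: linext_zero_fun linext_add_fun)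

lemma hadd_linext_arg:
  assumes "\<And>s. hadd (\<lambda>x. \<phi> x s)"
  shows "hadd (\<lambda>x. linext sc (\<phi> x) y)"
proof -
  have "\<phi> (x + x') = (\<lambda>s. \<phi> x s + \<phi> x' s)" "\<phi> (hX x) = (\<lambda>s. hX (\<phi> x s))" for x x'
    using hadd_add[OF assms] hadd_hX[OF assms] by auto
  thus ?thesis by (intro haddI) (simp_all add: linext_add_fun linext_hX_fun)
qed

text \<open>Both orders of summation are continuous in x, so x may be taken to be a single basis
  vector, where the inner sum stands alone. No convergence argument for the infinite double sum is
  required.\<close>

lemma linext_Fubini:
  "linext sc (\<lambda>s. linext sc (\<Psi> s) y) x = linext sc (\<lambda>t. linext sc (\<lambda>s. \<Psi> s t) x) y"
  by (rule cmod_eqI[OF hadd_linext hadd_linext_arg[OF hadd_linext]]) (simp add: linext_single linext_hsc_fun)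

end

section \<open>Instances: functionals with values in k[[h]] and in k((u))[[h]], and linear
  maps\<close>

interpretation hmod_appl: hmod "(*) :: 'k::comm_ring_1 \<Rightarrow> 'k \<Rightarrow> 'k"
  by standard (simp_all add: algebra_simps)

interpretation hmod_fls: hmod "\<lambda>c g. fls_const c * (g :: 'k::comm_ring_1 fls)"
  by standard (simp_all add: algebra_simps flip: fls_plus_const fls_const_mult_const)

lemma map_times_lookup: "Poly_Mapping.lookup (Poly_Mapping.map ((*) (c::'k::comm_ring_1)) p) s = c * Poly_Mapping.lookup p s"
  by (simp add: Poly_Mapping.map.rep_eq when_def)

interpretation hmod_lin: hmod "\<lambda>c. Poly_Mapping.map ((*) (c :: 'k::comm_ring_1)) :: ('t \<Rightarrow>\<^sub>0 'k) \<Rightarrow> _"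
  by standard (rule poly_mapping_eqI, simp add: map_times_lookup lookup_add algebra_simps)+

lemmas hadd_appl = hmod_appl.hadd_linext[folded appl_def]
lemmas hadd_appl_fls = hmod_fls.hadd_linext[folded appl_fls_def]
lemmas hadd_lin = hmod_lin.hadd_linext[folded lin_def]
lemmas appl_basis [simp] = hmod_appl.linext_basis[folded appl_def]
lemmas appl_fls_basis [simp] = hmod_fls.linext_basis[folded appl_fls_def]
lemmas lin_basis [simp] = hmod_lin.linext_basis[folded lin_def]
lemmas appl_sum_fun = hmod_appl.linext_sum_fun[folded appl_def]
lemmas appl_fls_sum_fun = hmod_fls.linext_sum_fun[folded appl_fls_def]
lemmas appl_zero_fun = hmod_appl.linext_zero_fun[folded appl_def]
lemmas appl_fls_zero_fun = hmod_fls.linext_zero_fun[folded appl_fls_def]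
lemmas appl_Fubini = hmod_appl.linext_Fubini[folded appl_def]
lemmas hadd_lin_arg = hmod_lin.hadd_linext_arg[folded lin_def]

lemma appl_single: "appl \<phi> (fps_const (Poly_Mapping.single s c)) = fps_const c * \<phi> s"
  by (rule fps_ext) (simp add: appl_def hmod_appl.linext_single)

lemma appl_fls_single: "appl_fls \<phi> (fps_const (Poly_Mapping.single s c)) = fps_const (fls_const c) * \<phi> s"
  by (rule fps_ext) (simp add: appl_fls_def hmod_fls.linext_single)

lemma appl_mult_fun: "appl (\<lambda>s. a * \<phi> s) x = a * appl \<phi> x"
  unfolding appl_def by (rule hmod_appl.linext_hadd_fun[OF hadd_mult_left])
    (rule fps_ext, simp add: fps_mult_nth sum_distrib_left mult.left_commute)

lemma appl_fls_mult_fun: "appl_fls (\<lambda>s. a * \<phi> s) x = a * appl_fls \<phi> x"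
  unfolding appl_fls_def by (rule hmod_fls.linext_hadd_fun[OF hadd_mult_left])
    (rule fps_ext, simp add: fps_mult_nth sum_distrib_left mult.left_commute)

lemma hadd_hscale_left: "hadd (\<lambda>a. hscale a x)"
proof (rule haddI)
  fix a b show "hscale (a + b) x = hscale a x + hscale b x"
    by (rule fps_ext) (simp add: hscale_def sum.distrib hmod_lin.sc_left)
next
  fix a show "hscale (hX a) x = hX (hscale a x)"
  proof (rule fps_ext)
    fix n show "fps_nth (hscale (hX a) x) n = fps_nth (hX (hscale a x)) n"
    proof (cases n)
      case (Suc m)
      show ?thesis unfolding Suc hX_nth hscale_def fps_nth_Abs_fps
        by (subst sum.atMost_Suc_shift) simp
    qed (simp add: hscale_def)
  qed
qed

lemma hscale_const: "hscale (fps_const c) x = hmod_lin.hsc c x"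
proof (rule fps_ext)
  fix n
  have "fps_nth (hscale (fps_const c) x) n = (\<Sum>i\<le>n. if i = 0 then Poly_Mapping.map ((*) c) (fps_nth x n) else 0)"
    unfolding hscale_def fps_nth_Abs_fps by (rule sum.cong) auto
  thus "fps_nth (hscale (fps_const c) x) n = fps_nth (hmod_lin.hsc c x) n"
    by simp
qed

lemma hadd_hscale_const: "hadd (hscale (fps_const c))"
proof -
  have "hscale (fps_const c) = (hmod_lin.hsc c :: ('a,'b) cmod \<Rightarrow> _)" by (rule ext, rule hscale_const)
  thus ?thesis by (simp add: hmod_lin.hadd_hsc)
qed

lemma hadd_hscale: "hadd (hscale a)"
proof (rule haddI)
  fix x y :: "('a,'b) cmod"
  show "hscale a (x + y) = hscale a x + hscale a y"
    by (rule hadd_eqI[where f = "\<lambda>a. hscale a (x + y)"])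
       (simp_all add: hadd_hscale_left hadd_plus hadd_add[OF hadd_hscale_const])
  show "hscale a (hX x) = hX (hscale a x)"
    by (rule hadd_eqI[where f = "\<lambda>a. hscale a (hX x)"])
       (simp_all add: hadd_hscale_left hadd_hX[OF hadd_hscale_const] hadd_compose[OF hmod_lin.hadd_hX' hadd_hscale_left])
qed

lemma hscale_single: "hscale (fps_const c) (fps_const (Poly_Mapping.single s d)) = fps_const (Poly_Mapping.single s (c * d))"
  unfolding hscale_const by (rule fps_ext) (simp add: map_single)

lemma hadd_hscale_eq:
  fixes f :: "('s, 'k::comm_ring_1) cmod \<Rightarrow> 'b::ab_group_add fps" and m :: "'k fps \<Rightarrow> 'b fps \<Rightarrow> 'b fps"
  assumes f: "hadd f" and m: "\<And>y. hadd (\<lambda>a. m a y)" "\<And>c. hadd (m (fps_const c))"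
    and "\<And>c s d. f (fps_const (Poly_Mapping.single s (c * d))) = m (fps_const c) (f (fps_const (Poly_Mapping.single s d)))"
  shows "f (hscale a x) = m a (f x)"
proof (rule hadd_eqI[where f = "\<lambda>a. f (hscale a x)", OF hadd_compose[OF f hadd_hscale_left] m(1)])
  fix c show "f (hscale (fps_const c) x) = m (fps_const c) (f x)"
    by (rule cmod_eqI[where f = "\<lambda>x. f (hscale (fps_const c) x)"])
       (auto intro!: hadd_compose[OF f] hadd_hscale hadd_compose[OF m(2) f] simp: hscale_single assms)
qed

lemma appl_hscale: "appl \<phi> (hscale a x) = a * appl \<phi> x"
  by (rule hadd_hscale_eq[OF hadd_appl hadd_mult_right hadd_mult_left])
     (simp add: appl_single mult.assoc[symmetric])

lemma lin_single: "lin \<phi> (fps_const (Poly_Mapping.single s c)) = hscale (fps_const c) (\<phi> s)"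
  by (simp add: lin_def hmod_lin.linext_single hscale_const)

lemma lin_hscale: "lin \<phi> (hscale a x) = hscale a (lin \<phi> x)"
  by (rule hadd_hscale_eq[OF hadd_lin hadd_hscale_left hadd_hscale])
     (simp add: lin_single hscale_const hmod_lin.hsc_hsc)

lemma hadd_hconst: "hadd (hconst :: 'k::comm_ring_1 fps \<Rightarrow> _)"
proof (rule haddI)
  fix a show "hconst (hX a) = hX (hconst (a :: 'k fps))"
  proof (rule fps_ext)
    fix n show "fps_nth (hconst (hX a)) n = fps_nth (hX (hconst a)) n"
      by (cases n) (auto simp: hconst_def)
  qed
qed (rule fps_ext, simp add: hconst_def fls_plus_const)

lemma hconst_fps_const: "hconst (fps_const c) = fps_const (fls_const (c::'k::comm_ring_1))"
  by (rule fps_ext) (simp add: hconst_def)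

lemma hconst_mult: "hconst (a * b) = hconst a * hconst (b :: 'k::comm_ring_1 fps)"
proof (rule hadd_eqI[where f = "\<lambda>a. hconst (a * b)"])
  fix c show "hconst (fps_const c * b) = hconst (fps_const c) * hconst b"
    by (rule hadd_eqI[where f = "\<lambda>b. hconst (fps_const c * b)"])
       (simp_all add: hadd_compose[OF hadd_hconst] hadd_compose[OF hadd_mult_left hadd_hconst] hadd_mult_left
          hconst_fps_const)
qed (auto intro!: hadd_compose[OF hadd_hconst] hadd_mult_right hadd_compose[OF hadd_mult_right hadd_hconst])

lemma appl_fls_hscale:
  fixes x :: "('s, 'k::comm_ring_1) cmod"
  shows "appl_fls \<phi> (hscale a x) = hconst a * appl_fls \<phi> x"
proof (rule hadd_hscale_eq[OF hadd_appl_fls])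
  fix y :: "'k fls fps"
  show "hadd (\<lambda>a. hconst a * y)" by (rule hadd_compose[OF hadd_mult_right hadd_hconst])
qed (simp_all add: hadd_mult_left appl_fls_single hconst_fps_const mult.assoc[symmetric])

lemma appl_lin: "appl \<phi> (lin f x) = appl (\<lambda>s. appl \<phi> (f s)) x"
  by (rule cmod_eqI[OF hadd_compose[OF hadd_appl hadd_lin] hadd_appl])
     (simp add: lin_single appl_single appl_hscale)

lemma lin_lin: "lin g (lin f x) = lin (\<lambda>s. lin g (f s)) x"
  by (rule cmod_eqI[OF hadd_compose[OF hadd_lin hadd_lin] hadd_lin])
     (simp add: lin_single lin_hscale)

lemma lin_id: "lin basis x = x"
  by (rule cmod_eqI[OF hadd_lin hadd_id]) (simp add: lin_single basis_def hscale_single)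

lemma appl_tens: "appl \<phi> (tens x y) = appl (\<lambda>s. appl (\<lambda>t. \<phi> (s, t)) y) x"
  by (simp add: tens_def appl_lin)

lemma lin_tens: "lin \<phi> (tens x y) = lin (\<lambda>s. lin (\<lambda>t. \<phi> (s, t)) y) x"
  by (simp add: tens_def lin_lin)

lemma appl_tens_prod: "appl (\<lambda>(s, t). \<phi> s * \<psi> t) (tens x y) = appl \<phi> x * appl \<psi> y"
proof -
  have "appl (\<lambda>(s, t). \<phi> s * \<psi> t) (tens x y) = appl (\<lambda>s. \<phi> s * appl \<psi> y) x"
    by (simp add: appl_tens appl_mult_fun)
  also have "\<dots> = appl (\<lambda>s. appl \<psi> y * \<phi> s) x"
    by (rule arg_cong[where f = "\<lambda>f. appl f x"], rule ext, rule mult.commute)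
  also have "\<dots> = appl \<psi> y * appl \<phi> x" by (rule appl_mult_fun)
  also have "\<dots> = appl \<phi> x * appl \<psi> y" by (rule mult.commute)
  finally show ?thesis .
qed

lemma single_mult_const: "fps_const (Poly_Mapping.single s c) * fps_const (Poly_Mapping.single t d) =
    fps_const (Poly_Mapping.single (s + t) (c * d :: 'k::comm_ring_1))"
  by (simp add: mult_single)

lemma appl_mult: "appl \<phi> (x * y) = appl (\<lambda>u. appl (\<lambda>v. \<phi> (u + v)) y) x"
proof (rule cmod_eqI[where f = "\<lambda>x. appl \<phi> (x * y)", OF hadd_compose[OF hadd_appl hadd_mult_right] hadd_appl])
  fix s c
  show "appl \<phi> (fps_const (Poly_Mapping.single s c) * y) =
      appl (\<lambda>u. appl (\<lambda>v. \<phi> (u + v)) y) (fps_const (Poly_Mapping.single s c))"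
    unfolding appl_single
    by (rule cmod_eqI[OF hadd_compose[OF hadd_appl hadd_mult_left] hadd_compose[OF hadd_mult_left hadd_appl]])
       (simp add: single_mult_const appl_single mult.assoc[symmetric]
          flip: fps_const_mult)
qed

lemma appl_fls_mult: "appl_fls \<phi> (x * y) = appl_fls (\<lambda>u. appl_fls (\<lambda>v. \<phi> (u + v)) y) x"
proof (rule cmod_eqI[where f = "\<lambda>x. appl_fls \<phi> (x * y)", OF hadd_compose[OF hadd_appl_fls hadd_mult_right] hadd_appl_fls])
  fix s c
  show "appl_fls \<phi> (fps_const (Poly_Mapping.single s c) * y) =
      appl_fls (\<lambda>u. appl_fls (\<lambda>v. \<phi> (u + v)) y) (fps_const (Poly_Mapping.single s c))"
    unfolding appl_fls_single
    by (rule cmod_eqI[OF hadd_compose[OF hadd_appl_fls hadd_mult_left] hadd_compose[OF hadd_mult_left hadd_appl_fls]])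
       (simp add: single_mult_const appl_fls_single mult.assoc[symmetric]
          flip: fps_const_mult fls_const_mult_const)
qed

lemma basis_mult: "basis s * basis t = (basis (s + t) :: ('s::monoid_add, 'k::comm_ring_1) cmod)"
  by (simp add: basis_def single_mult_const[symmetric] mult_single)

lemma basis_0: "basis 0 = 1"
  by (simp add: basis_def)

lemma hadd_scal: "hadd (scal :: 'k::comm_ring_1 fps \<Rightarrow> ('s::monoid_add, 'k) cmod)"
proof (rule haddI)
  fix a show "scal (hX a) = hX (scal a :: ('s, 'k) cmod)"
  proof (rule fps_ext)
    fix n show "fps_nth (scal (hX a)) n = fps_nth (hX (scal a :: ('s, 'k) cmod)) n"
      by (cases n) (auto simp: scal_def)
  qed
qed (rule fps_ext, simp add: scal_def single_add)

lemma scal_const: "scal (fps_const c) = fps_const (Poly_Mapping.single 0 (c::'k::comm_ring_1))"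
  by (rule fps_ext) (simp add: scal_def)

lemma scal_mult_left: "scal a * x = hscale a x"
proof (rule hadd_eqI[where f = "\<lambda>a. scal a * x", OF hadd_compose[OF hadd_mult_right hadd_scal] hadd_hscale_left])
  fix c show "scal (fps_const c) * x = hscale (fps_const c) x"
    by (rule cmod_eqI[OF hadd_mult_left hadd_hscale]) (simp add: scal_const mult_single hscale_single)
qed

lemma scal_mult_right: "x * scal a = hscale a x"
proof (rule hadd_eqI[where f = "\<lambda>a. x * scal a", OF hadd_compose[OF hadd_mult_left hadd_scal] hadd_hscale_left])
  fix c show "x * scal (fps_const c) = hscale (fps_const c) x"
    by (rule cmod_eqI[OF hadd_mult_right hadd_hscale]) (simp add: scal_const mult_single hscale_single mult.commute)
qed

lemma hscale_1: "hscale 1 x = x"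
  by (metis fps_const_1_eq_1 hscale_const hmod_lin.hsc_1)

lemma hscale_hscale: "hscale a (hscale b x) = hscale (a * b) x"
proof (rule hadd_eqI[where f = "\<lambda>a. hscale a (hscale b x)", OF hadd_hscale_left])
  show "hadd (\<lambda>a. hscale (a * b) x)"
    by (rule hadd_compose[OF hadd_hscale_left hadd_mult_right])
  fix c show "hscale (fps_const c) (hscale b x) = hscale (fps_const c * b) x"
  proof (rule hadd_eqI[where f = "\<lambda>b. hscale (fps_const c) (hscale b x)"])
    fix d show "hscale (fps_const c) (hscale (fps_const d) x) = hscale (fps_const c * fps_const d) x"
      by (simp add: hscale_const hmod_lin.hsc_hsc)
  qed (auto intro!: hadd_compose[OF hadd_hscale hadd_hscale_left] hadd_compose[OF hadd_hscale_left hadd_mult_left])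
qed

lemma mult_hscale_left: "hscale a x * y = hscale a (x * y)"
  by (simp add: scal_mult_left[symmetric] mult.assoc)

lemma mult_hscale_right: "x * hscale a y = hscale a (x * y)"
  by (simp add: scal_mult_right[symmetric] mult.assoc)

subsection \<open>Closed submodules\<close>

text \<open>Closed k[[h]]-submodules, the last clause being h-adic closedness. Kernels and preimages
  of the maps in use are of this kind, so an inclusion of a closed span reduces to its
  generators.\<close>

definition csub :: "('s, 'k::comm_ring_1) cmod set \<Rightarrow> bool"
  where "csub J \<longleftrightarrow> 0 \<in> J \<and> (\<forall>x\<in>J. \<forall>y\<in>J. x + y \<in> J) \<and> (\<forall>a. \<forall>x\<in>J. hscale a x \<in> J) \<and>
    (\<forall>x. (\<forall>m. \<exists>y\<in>J. \<forall>l<m. fps_nth x l = fps_nth y l) \<longrightarrow> x \<in> J)"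

lemma csub_0: "csub J \<Longrightarrow> 0 \<in> J"
  and csub_add: "csub J \<Longrightarrow> x \<in> J \<Longrightarrow> y \<in> J \<Longrightarrow> x + y \<in> J"
  and csub_hscale: "csub J \<Longrightarrow> x \<in> J \<Longrightarrow> hscale a x \<in> J"
  and csub_limit: "csub J \<Longrightarrow> (\<And>m. \<exists>y\<in>J. \<forall>l<m. fps_nth x l = fps_nth y l) \<Longrightarrow> x \<in> J"
  unfolding csub_def by blast+

lemma hscale_minus_1: "hscale (- 1) x = - x"
  using hadd_minus[OF hadd_hscale_left, of 1 x] by (simp add: hscale_1)

lemma csub_minus: "csub J \<Longrightarrow> x \<in> J \<Longrightarrow> - x \<in> J"
  using csub_hscale[of J x "- 1"] by (simp add: hscale_minus_1)

lemma csub_sum: "csub J \<Longrightarrow> (\<And>i. i \<in> A \<Longrightarrow> f i \<in> J) \<Longrightarrow> (\<Sum>i\<in>A. f i) \<in> J"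
  by (induction A rule: infinite_finite_induct) (auto simp: csub_0 csub_add)

lemma hscale_fps_X: "hscale fps_X x = hX x"
proof -
  have "hscale (hX 1) x = hX (hscale 1 x)" by (rule hadd_hX[OF hadd_hscale_left])
  thus ?thesis by (simp add: hX_conv_mult hscale_1)
qed

lemma csub_hX: "csub J \<Longrightarrow> x \<in> J \<Longrightarrow> hX x \<in> J"
  by (metis csub_hscale hscale_fps_X)

text \<open>Finite sums handle constant series; the closedness clause handles the limit, one power
  of h being split off at each stage.\<close>

lemma csub_hadd_mem:
  fixes f :: "('s, 'k::comm_ring_1) cmod \<Rightarrow> ('t, 'k) cmod"
  assumes J: "csub J" and f: "hadd f" and s: "\<And>s c. f (fps_const (Poly_Mapping.single s c)) \<in> J"
  shows "f x \<in> J"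
proof (rule csub_limit[OF J])
  fix m
  have const: "f (fps_const p) \<in> J" for p
    by (induction p rule: poly_mapping_additive_induct)
       (auto simp: s fps_const_add' hadd_add[OF f] csub_add[OF J] simp del: fps_const_add)
  show "\<exists>y\<in>J. \<forall>l<m. fps_nth (f x) l = fps_nth y l"
  proof (induction m arbitrary: x)
    case 0 thus ?case using csub_0[OF J] by auto
  next
    case (Suc m)
    obtain y where y: "y \<in> J" "\<forall>l<m. fps_nth (f (fps_shift 1 x)) l = fps_nth y l" using Suc by blast
    have eq: "f x = f (fps_const (fps_nth x 0)) + hX (f (fps_shift 1 x))"
      by (metis fps_split hadd_add[OF f] hadd_hX[OF f])
    have "\<forall>l<Suc m. fps_nth (f x) l = fps_nth (f (fps_const (fps_nth x 0)) + hX y) l"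
    proof (intro allI impI)
      fix l assume "l < Suc m"
      thus "fps_nth (f x) l = fps_nth (f (fps_const (fps_nth x 0)) + hX y) l"
        using y(2) by (subst eq) (cases l; simp)
    qed
    thus ?case using const csub_hX[OF J y(1)] csub_add[OF J] by blast
  qed
qed

lemma hspan_mono_csub:
  assumes "csub J" "X \<subseteq> J" shows "hspan X \<subseteq> J"
proof
  fix x assume "x \<in> hspan X"
  thus "x \<in> J" using assms by induction (auto simp: csub_0 csub_add csub_hscale)
qed

lemma closed_span_least: assumes "csub J" "X \<subseteq> J" shows "closed_span X \<subseteq> J"
proof
  fix x assume x: "x \<in> closed_span X"
  show "x \<in> J"
  proof (rule csub_limit[OF assms(1)])
    fix m
    obtain y where "y \<in> hspan X" "\<forall>l<m. fps_nth x l = fps_nth y l"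
      using x unfolding closed_span_def by blast
    thus "\<exists>y\<in>J. \<forall>l<m. fps_nth x l = fps_nth y l" using hspan_mono_csub[OF assms] by blast
  qed
qed

lemma closed_span_superset: "X \<subseteq> closed_span X"
proof
  fix x assume "x \<in> X"
  hence "hscale 1 x \<in> hspan X" by (rule hspan.intros)
  thus "x \<in> closed_span X" by (auto simp: closed_span_def hscale_1)
qed

lemma hspan_hscale: "x \<in> hspan X \<Longrightarrow> hscale a x \<in> hspan X"
proof (induction rule: hspan.induct)
  case 1 thus ?case by (simp add: hadd_0[OF hadd_hscale] hspan.intros)
next
  case (2 x b) thus ?case by (simp add: hscale_hscale hspan.intros)
next
  case (3 x y) thus ?case by (simp add: hadd_add[OF hadd_hscale] hspan.intros)
qed

lemma csub_closed_span: "csub (closed_span X)"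
  unfolding csub_def
proof (intro conjI ballI allI impI)
  show "0 \<in> closed_span X" unfolding closed_span_def using hspan.intros(1) by blast
next
  fix x y assume "x \<in> closed_span X" "y \<in> closed_span X"
  thus "x + y \<in> closed_span X" unfolding closed_span_def mem_Collect_eq
    by (metis (no_types, lifting) fps_add_nth hspan.intros(3))
next
  fix a x assume x: "x \<in> closed_span X"
  show "hscale a x \<in> closed_span X" unfolding closed_span_def mem_Collect_eq
  proof
    fix m
    obtain y where "y \<in> hspan X" "\<forall>l<m. fps_nth x l = fps_nth y l" using x unfolding closed_span_def by blast
    thus "\<exists>y\<in>hspan X. \<forall>l<m. fps_nth (hscale a x) l = fps_nth y l"
      using hspan_hscale hadd_cong_below[OF hadd_hscale, of m x y] by blast
  qed
next
  fix x assume *: "\<forall>m. \<exists>y\<in>closed_span X. \<forall>l<m. fps_nth x l = fps_nth y l"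
  show "x \<in> closed_span X" unfolding closed_span_def mem_Collect_eq
  proof
    fix m
    obtain y where "y \<in> closed_span X" "\<forall>l<m. fps_nth x l = fps_nth y l" using * by blast
    moreover then obtain w where "w \<in> hspan X" "\<forall>l<m. fps_nth y l = fps_nth w l"
      unfolding closed_span_def by blast
    ultimately show "\<exists>y\<in>hspan X. \<forall>l<m. fps_nth x l = fps_nth y l" by auto
  qed
qed

lemma csub_preimage:
  fixes f :: "('s, 'k::comm_ring_1) cmod \<Rightarrow> ('t, 'k) cmod"
  assumes "csub J" "hadd f" "\<And>a x. f (hscale a x) = hscale a (f x)"
  shows "csub {x. f x \<in> J}"
  unfolding csub_def mem_Collect_eq
proof (intro conjI ballI allI impI)
  fix x assume *: "\<forall>m. \<exists>y\<in>{x. f x \<in> J}. \<forall>l<m. fps_nth x l = fps_nth y l"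
  show "f x \<in> J"
  proof (rule csub_limit[OF assms(1)])
    fix m
    obtain y where "f y \<in> J" "\<forall>l<m. fps_nth x l = fps_nth y l" using * by blast
    thus "\<exists>y\<in>J. \<forall>l<m. fps_nth (f x) l = fps_nth y l"
      using hadd_cong_below[OF assms(2), of m x y] by blast
  qed
qed (auto simp: hadd_0 hadd_add csub_0 csub_add csub_hscale assms)

lemma csub_kernel:
  fixes f :: "('s, 'k::comm_ring_1) cmod \<Rightarrow> 'b::ab_group_add fps"
  assumes "hadd f" "\<And>a x. f x = 0 \<Longrightarrow> f (hscale a x) = 0"
  shows "csub {x. f x = 0}"
  unfolding csub_def mem_Collect_eq
proof (intro conjI ballI allI impI)
  fix x assume *: "\<forall>m. \<exists>y\<in>{x. f x = 0}. \<forall>l<m. fps_nth x l = fps_nth y l"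
  show "f x = 0"
  proof (rule fps_ext)
    fix n
    obtain y where "f y = 0" "\<forall>l<Suc n. fps_nth x l = fps_nth y l" using * by blast
    thus "fps_nth (f x) n = fps_nth 0 n"
      using hadd_cong_below[OF assms(1), of "Suc n" x y n] by simp
  qed
qed (auto simp: hadd_0 hadd_add assms)

lemma appl_closed_span: "(\<And>x. x \<in> X \<Longrightarrow> appl \<phi> x = 0) \<Longrightarrow> x \<in> closed_span X \<Longrightarrow> appl \<phi> x = 0"
  using closed_span_least[OF csub_kernel[OF hadd_appl, of \<phi>], of X] by (auto simp: appl_hscale)

lemma csub_closed_ideal: "csub (closed_ideal X)"
  by (simp add: closed_ideal_def csub_closed_span)

lemma closed_ideal_mult:
  assumes "x \<in> closed_ideal X" shows "a * x * b \<in> closed_ideal X"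
proof -
  have "closed_ideal X \<subseteq> {x. a * x * b \<in> closed_ideal X}"
    unfolding closed_ideal_def
  proof (rule closed_span_least)
    show "csub {x. a * x * b \<in> closed_span {a * x * b |a x b. x \<in> X}}"
      by (rule csub_preimage[OF csub_closed_span hadd_compose[OF hadd_mult_right hadd_mult_left]])
         (simp add: mult_hscale_left mult_hscale_right)
    show "{a * x * b |a x b. x \<in> X} \<subseteq> {x. a * x * b \<in> closed_span {a * x * b |a x b. x \<in> X}}"
    proof clarify
      fix c x d assume "x \<in> X"
      hence "(a * c) * x * (d * b) \<in> closed_span {a * x * b |a x b. x \<in> X}"
        using closed_span_superset[of "{a * x * b |a x b. x \<in> X}"] by blast
      thus "a * (c * x * d) * b \<in> closed_span {a * x * b |a x b. x \<in> X}"
        by (simp only: mult.assoc)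
    qed
  qed
  thus ?thesis using assms by blast
qed

lemma closed_ideal_superset: "X \<subseteq> closed_ideal X"
proof
  fix x assume "x \<in> X"
  hence "1 * x * 1 \<in> {a * x * b |a x b. x \<in> X}" by blast
  thus "x \<in> closed_ideal X" unfolding closed_ideal_def using closed_span_superset by fastforce
qed

text \<open>On a product \<open>a * r * b\<close> the functional is an iterated sum, and
  interchanging the sums puts r innermost; there it meets a two-sided translate of the
  functional.\<close>

lemma appl_closed_ideal:
  assumes "\<And>u r v. r \<in> X \<Longrightarrow> appl (\<lambda>w. \<phi> (u + w + v)) r = 0" "x \<in> closed_ideal X"
  shows "appl \<phi> x = 0"
proof (rule appl_closed_span)
  show "x \<in> closed_span {a * x * b |a x b. x \<in> X}" using assms(2) by (simp add: closed_ideal_def)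
  fix y assume "y \<in> {a * x * b |a x b. x \<in> X}"
  then obtain a r b where y: "y = a * r * b" "r \<in> X" by blast
  have "appl \<phi> y = appl (\<lambda>u. appl (\<lambda>w. appl (\<lambda>v. \<phi> (u + w + v)) b) r) a"
    by (simp add: y appl_mult mult.assoc add.assoc)
  also have "\<dots> = appl (\<lambda>u. appl (\<lambda>v. appl (\<lambda>w. \<phi> (u + w + v)) r) b) a"
    by (subst appl_Fubini) simp
  finally show "appl \<phi> y = 0" by (simp add: assms(1)[OF y(2)] appl_zero_fun)
qed

section \<open>Sweedler sums over words\<close>

text \<open>Sweedler sums with values in any commutative monoid: a function of two words is summed
  over the coproduct without an intermediate element of the tensor square. For \<open>Tic\<close>
  the matrix indices run in the opposite order because inversion reverses the product in
  \<open>\<Delta>(T) = T^12 T^13\<close>.\<close>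

fun swee_gen :: "nat \<Rightarrow> (gen0 word \<Rightarrow> gen0 word \<Rightarrow> 'a::comm_monoid_add) \<Rightarrow> gen0 \<Rightarrow> 'a" where
  "swee_gen N \<Psi> (Tc a c m) = (\<Sum>b<N. \<Sum>l\<le>m. \<Psi> (Word [Tc a b l]) (Word [Tc b c (m - l)]))"
| "swee_gen N \<Psi> (Tic a c m) = (\<Sum>b<N. \<Sum>l\<le>m. \<Psi> (Word [Tic b c l]) (Word [Tic a b (m - l)]))"

primrec sweel :: "nat \<Rightarrow> gen0 list \<Rightarrow> (gen0 word \<Rightarrow> gen0 word \<Rightarrow> 'a::comm_monoid_add) \<Rightarrow> 'a" where
  "sweel N [] \<Psi> = \<Psi> 0 0"
| "sweel N (g # gs) \<Psi> = swee_gen N (\<lambda>x1 x2. sweel N gs (\<lambda>y1 y2. \<Psi> (x1 + y1) (x2 + y2))) g"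

definition swee :: "nat \<Rightarrow> (gen0 word \<Rightarrow> gen0 word \<Rightarrow> 'a::comm_monoid_add) \<Rightarrow> gen0 word \<Rightarrow> 'a"
  where "swee N \<Psi> w = sweel N (letters w) \<Psi>"

lemma letters_simps [simp]: "letters 0 = []" "letters (u + v) = letters u @ letters v"
  by (simp_all add: zero_word_def plus_word_def)

lemma Word_Cons: "Word (g # gs) = Word [g] + Word gs"
  by (simp add: plus_word_def)

lemma word_induct [case_names 0 Cons]:
  assumes "P 0" "\<And>g w. P w \<Longrightarrow> P (Word [g] + w)" shows "P w"
proof -
  have "P (Word gs)" for gs
  proof (induction gs)
    case Nil thus ?case using assms(1) by (simp add: zero_word_def)
  next
    case (Cons g gs) thus ?case using assms(2)[of "Word gs" g] by (simp only: Word_Cons[of g gs])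
  qed
  thus ?thesis by (cases w) auto
qed

lemma swee_0 [simp]: "swee N \<Psi> 0 = \<Psi> 0 0"
  by (simp add: swee_def)

lemma swee_letter [simp]: "swee N \<Psi> (Word [g]) = swee_gen N \<Psi> g"
  by (simp add: swee_def)

lemma swee_Cons: "swee N \<Psi> (Word [g] + w) = swee_gen N (\<lambda>x1 x2. swee N (\<lambda>y1 y2. \<Psi> (x1 + y1) (x2 + y2)) w) g"
  by (simp add: swee_def)

lemma swee_gen_additive:
  assumes "f 0 = 0" "\<And>x y. f (x + y) = f x + f y"
  shows "f (swee_gen N \<Psi> g) = swee_gen N (\<lambda>x y. f (\<Psi> x y)) g"
proof -
  have s: "f (\<Sum>i\<in>A. h i) = (\<Sum>i\<in>A. f (h i))" for A :: "nat set" and h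
    by (induction A rule: infinite_finite_induct) (simp_all add: assms)
  show ?thesis by (cases g) (simp_all add: s)
qed

lemma swee_additive:
  assumes "f 0 = 0" "\<And>x y. f (x + y) = f x + f y"
  shows "f (swee N \<Psi> w) = swee N (\<lambda>x y. f (\<Psi> x y)) w"
  by (induction w arbitrary: \<Psi> rule: word_induct)
     (simp_all add: swee_Cons swee_gen_additive[where f = f, OF assms])

lemma swee_mult_left: "c * swee N \<Psi> w = swee N (\<lambda>x y. c * \<Psi> x y) (w :: gen0 word)" for c :: "'a::comm_ring_1"
  by (rule swee_additive) (simp_all add: algebra_simps)

lemma swee_mult_right: "swee N \<Psi> w * c = swee N (\<lambda>x y. \<Psi> x y * c) (w :: gen0 word)" for c :: "'a::comm_ring_1"
  by (rule swee_additive) (simp_all add: algebra_simps)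

lemma swee_gen_add_fun: "swee_gen N (\<lambda>x y. \<Psi> x y + \<Psi>' x y) g = swee_gen N \<Psi> g + swee_gen N \<Psi>' g"
  by (cases g) (simp_all add: sum.distrib)

lemma swee_add_fun: "swee N (\<lambda>x y. \<Psi> x y + \<Psi>' x y) w = swee N \<Psi> w + swee N \<Psi>' w"
  by (induction w arbitrary: \<Psi> \<Psi>' rule: word_induct) (simp_all add: swee_Cons swee_gen_add_fun)

lemma swee_gen_zero_fun: "swee_gen N (\<lambda>x y. 0) g = 0"
  by (cases g) simp_all

lemma swee_zero_fun: "swee N (\<lambda>x y. 0) w = 0"
  by (induction w rule: word_induct) (simp_all add: swee_Cons swee_gen_zero_fun)

lemma swee_sum_fun: "swee N (\<lambda>x y. \<Sum>i\<in>A. \<Psi> i x y) w = (\<Sum>i\<in>A. swee N (\<Psi> i) w)"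
  by (induction A rule: infinite_finite_induct) (simp_all add: swee_zero_fun swee_add_fun)

lemma swee_gen_swee_Fubini:
  "swee_gen N (\<lambda>x1 x2. swee M (\<lambda>y1 y2. \<Omega> x1 x2 y1 y2) v) g = swee M (\<lambda>y1 y2. swee_gen N (\<lambda>x1 x2. \<Omega> x1 x2 y1 y2) g) v"
  by (cases g) (simp_all add: swee_sum_fun)

lemma swee_Fubini:
  "swee N (\<lambda>x1 x2. swee M (\<lambda>y1 y2. \<Omega> x1 x2 y1 y2) v) u = swee M (\<lambda>y1 y2. swee N (\<lambda>x1 x2. \<Omega> x1 x2 y1 y2) u) v"
  by (induction u arbitrary: \<Omega> rule: word_induct) (simp_all add: swee_Cons swee_gen_swee_Fubini)

lemma swee_append:
  "swee N \<Psi> (u + v) = swee N (\<lambda>x1 x2. swee N (\<lambda>y1 y2. \<Psi> (x1 + y1) (x2 + y2)) v) u"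
  by (induction u arbitrary: \<Psi> rule: word_induct) (simp_all add: swee_Cons add.assoc)

text \<open>On a letter this is associativity of matrix multiplication together with associativity
  of the Cauchy product in u.\<close>

lemma swee_gen_coassoc:
  "swee_gen N (\<lambda>x y. swee N (\<lambda>p q. \<Psi> x p q) y) g = swee_gen N (\<lambda>x y. swee N (\<lambda>p q. \<Psi> p q y) x) g"
proof (cases g)
  case (Tc a c m)
  have "(\<Sum>b<N. \<Sum>l\<le>m. \<Sum>b'<N. \<Sum>l'\<le>m - l. \<Psi> (Word [Tc a b l]) (Word [Tc b b' l']) (Word [Tc b' c (m - l - l')]))
      = (\<Sum>b<N. \<Sum>b'<N. \<Sum>l\<le>m. \<Sum>l'\<le>m - l. \<Psi> (Word [Tc a b l]) (Word [Tc b b' l']) (Word [Tc b' c (m - l - l')]))"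
    by (rule sum.cong[OF refl], rule sum.swap)
  also have "\<dots> = (\<Sum>b<N. \<Sum>b'<N. \<Sum>j\<le>m. \<Sum>i\<le>j. \<Psi> (Word [Tc a b i]) (Word [Tc b b' (j - i)]) (Word [Tc b' c (m - j)]))"
    by (rule sum.cong[OF refl], rule sum.cong[OF refl])
       (rule fps_mult_assoc_lemma[where f = "\<lambda>i j k. \<Psi> (Word [Tc a _ i]) (Word [Tc _ _ j]) (Word [Tc _ c k])",
          unfolded atLeast0AtMost, symmetric])
  also have "\<dots> = (\<Sum>b'<N. \<Sum>j\<le>m. \<Sum>b<N. \<Sum>i\<le>j. \<Psi> (Word [Tc a b i]) (Word [Tc b b' (j - i)]) (Word [Tc b' c (m - j)]))"
    by (subst sum.swap) (intro sum.cong[OF refl], rule sum.swap)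
  finally show ?thesis by (simp add: Tc)
next
  case (Tic a c m)
  have "(\<Sum>b<N. \<Sum>l\<le>m. \<Sum>b'<N. \<Sum>l'\<le>m - l. \<Psi> (Word [Tic b c l]) (Word [Tic b' b l']) (Word [Tic a b' (m - l - l')]))
      = (\<Sum>b<N. \<Sum>b'<N. \<Sum>l\<le>m. \<Sum>l'\<le>m - l. \<Psi> (Word [Tic b c l]) (Word [Tic b' b l']) (Word [Tic a b' (m - l - l')]))"
    by (rule sum.cong[OF refl], rule sum.swap)
  also have "\<dots> = (\<Sum>b<N. \<Sum>b'<N. \<Sum>j\<le>m. \<Sum>i\<le>j. \<Psi> (Word [Tic b c i]) (Word [Tic b' b (j - i)]) (Word [Tic a b' (m - j)]))"
    by (rule sum.cong[OF refl], rule sum.cong[OF refl])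
       (rule fps_mult_assoc_lemma[where f = "\<lambda>i j k. \<Psi> (Word [Tic _ c i]) (Word [Tic _ _ j]) (Word [Tic a _ k])",
          unfolded atLeast0AtMost, symmetric])
  also have "\<dots> = (\<Sum>b'<N. \<Sum>j\<le>m. \<Sum>b<N. \<Sum>i\<le>j. \<Psi> (Word [Tic b c i]) (Word [Tic b' b (j - i)]) (Word [Tic a b' (m - j)]))"
    by (subst sum.swap) (intro sum.cong[OF refl], rule sum.swap)
  finally show ?thesis by (simp add: Tic)
qed

text \<open>The sums over the head letter and over the tail of the word are independent, hence
  interchangeable; the tail is regrouped by induction and the head by the case of a letter.\<close>

lemma swee_coassoc:
  "swee N (\<lambda>x y. swee N (\<lambda>p q. \<Psi> x p q) y) w = swee N (\<lambda>x y. swee N (\<lambda>p q. \<Psi> p q y) x) w"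
proof (induction w arbitrary: \<Psi> rule: word_induct)
  case (Cons g w)
  have "swee N (\<lambda>x y. swee N (\<lambda>p q. \<Psi> x p q) y) (Word [g] + w)
      = swee_gen N (\<lambda>x1 x2. swee N (\<lambda>y1 y2. swee N (\<lambda>p1 p2. swee N (\<lambda>q1 q2.
          \<Psi> (x1 + y1) (p1 + q1) (p2 + q2)) y2) x2) w) g"
    by (simp only: swee_Cons swee_append swee_letter)
  also have "\<dots> = swee_gen N (\<lambda>x1 x2. swee N (\<lambda>p1 p2. swee N (\<lambda>y1 y2. swee N (\<lambda>q1 q2.
          \<Psi> (x1 + y1) (p1 + q1) (p2 + q2)) y2) w) x2) g"
    by (rule arg_cong[where f = "\<lambda>h. swee_gen N h g"], intro ext, rule swee_Fubini)
  also have "\<dots> = swee_gen N (\<lambda>x1 x2. swee N (\<lambda>p1 p2. swee N (\<lambda>y1 y2. swee N (\<lambda>q1 q2.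
          \<Psi> (x1 + q1) (p1 + q2) (p2 + y2)) y1) w) x2) g"
    by (simp only: Cons[where \<Psi> = "\<lambda>a b c. \<Psi> (_ + a) (_ + b) (_ + c)"])
  also have "\<dots> = swee_gen N (\<lambda>x1 x2. swee N (\<lambda>p1 p2. swee N (\<lambda>y1 y2. swee N (\<lambda>q1 q2.
          \<Psi> (p1 + q1) (p2 + q2) (x2 + y2)) y1) w) x1) g"
    by (rule swee_gen_coassoc)
  also have "\<dots> = swee_gen N (\<lambda>x1 x2. swee N (\<lambda>y1 y2. swee N (\<lambda>p1 p2. swee N (\<lambda>q1 q2.
          \<Psi> (p1 + q1) (p2 + q2) (x2 + y2)) y1) x1) w) g"
    by (rule arg_cong[where f = "\<lambda>h. swee_gen N h g"], intro ext, rule swee_Fubini)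
  also have "\<dots> = swee N (\<lambda>x y. swee N (\<lambda>p q. \<Psi> p q y) x) (Word [g] + w)"
    by (simp only: swee_Cons swee_append swee_letter)
  finally show ?case .
qed simp

lemma cop0_gen_swee: "cop0_gen N g = swee_gen N (\<lambda>x y. basis (x, y)) g"
  by (cases g) simp_all

lemma cop0_swee: "cop0 N w = swee N (\<lambda>x y. basis (x, y)) w"
proof (induction w rule: word_induct)
  case 0
  have "(basis (0, 0) :: (gen0 word \<times> gen0 word, 'a) cmod) = 1" by (simp add: basis_0 flip: zero_prod_def)
  thus ?case by (simp add: cop0_def)
next
  case (Cons g w)
  have "cop0 N (Word [g] + w) = cop0_gen N g * (cop0 N w :: (gen0 word \<times> gen0 word, 'a) cmod)"
    by (simp add: cop0_def)
  also have "\<dots> = swee_gen N (\<lambda>x1 x2. basis (x1, x2) * swee N (\<lambda>x y. basis (x, y)) w) g"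
    unfolding Cons cop0_gen_swee
    by (rule swee_gen_additive[where f = "\<lambda>u. u * swee N (\<lambda>x y. basis (x, y)) w"]) (simp_all add: algebra_simps)
  also have "\<dots> = swee_gen N (\<lambda>x1 x2. swee N (\<lambda>y1 y2. basis (x1 + y1, x2 + y2)) w) g"
    by (subst swee_additive[where f = "\<lambda>u. basis _ * u"]) (simp_all add: algebra_simps basis_mult)
  finally show ?case by (simp add: swee_Cons)
qed

lemma hadd_cop0: "hadd L \<Longrightarrow> L (cop0 N w) = swee N (\<lambda>x y. L (basis (x, y))) w"
  unfolding cop0_swee by (rule swee_additive) (simp_all add: hadd_0 hadd_add)

lemma appl_cop0: "appl \<Omega> (cop0 N w) = swee N (\<lambda>x y. \<Omega> (x, y)) w"
  by (simp add: hadd_cop0[OF hadd_appl])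

lemma appl_fls_cop0: "appl_fls \<Omega> (cop0 N w) = swee N (\<lambda>x y. \<Omega> (x, y)) w"
  by (simp add: hadd_cop0[OF hadd_appl_fls])

subsection \<open>Counit and convolution\<close>

text \<open>The counit with values in an arbitrary commutative ring, since it is needed over k[[h]],
  over k((u))[[h]] and as an integer. Testing letters in the rationals makes the choice between 0
  and 1 independent of the target.\<close>

definition cu :: "nat \<Rightarrow> gen0 word \<Rightarrow> 'a::comm_ring_1"
  where "cu N w = (if \<forall>g\<in>set (letters w). eps0_gen N g = (1::rat) then 1 else 0)"

lemma cu_0 [simp]: "cu N 0 = 1"
  and cu_append [simp]: "cu N (u + v) = cu N u * cu N v"
  by (auto simp: cu_def)

lemma eps0_gen_cases: "eps0_gen N g = (if eps0_gen N g = (1::rat) then 1 else (0::'k::field_char_0))"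
  by (cases g) auto

lemma prod_list_eps0: "prod_list (map (eps0_gen N) gs) = (if \<forall>g\<in>set gs. eps0_gen N g = (1::rat) then 1 else (0::'k::field_char_0))"
proof (induction gs)
  case (Cons g gs)
  thus ?case using eps0_gen_cases[of N g, where 'k = 'k] by auto
qed simp

lemma eps0_cu: "eps0 N w = cu N w"
  by (simp add: eps0_def cu_def prod_list_eps0)

lemma hconst_eps0: "hconst (eps0 N w) = cu N w"
  by (simp add: eps0_def cu_def prod_list_eps0 hconst_fps_const)

fun valid_gen :: "nat \<Rightarrow> gen0 \<Rightarrow> bool" where
  "valid_gen N (Tc a b m) \<longleftrightarrow> a < N \<and> b < N"
| "valid_gen N (Tic a b m) \<longleftrightarrow> a < N \<and> b < N"

definition valid :: "nat \<Rightarrow> gen0 word \<Rightarrow> bool" where "valid N w \<longleftrightarrow> (\<forall>g\<in>set (letters w). valid_gen N g)"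

text \<open>The word type contains letters with matrix indices outside \<open>{..<N}\<close>, and
  the counit laws fail on them. Functionals vanishing there are those for which \<open>cu\<close> is
  a unit under convolution.\<close>

definition nullf :: "nat \<Rightarrow> (gen0 word \<Rightarrow> 'a::zero) \<Rightarrow> bool" where "nullf N f \<longleftrightarrow> (\<forall>w. \<not> valid N w \<longrightarrow> f w = 0)"

lemma valid_simps [simp]: "valid N 0" "valid N (u + v) \<longleftrightarrow> valid N u \<and> valid N v" "valid N (Word [g]) \<longleftrightarrow> valid_gen N g"
  by (auto simp: valid_def)

lemma nullf_cu: "nullf N (cu N)"
proof -
  have "eps0_gen N g = (1::rat) \<Longrightarrow> valid_gen N g" for g by (cases g) (auto split: if_splits)
  thus ?thesis unfolding nullf_def valid_def cu_def by auto
qed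

lemma swee_gen_null:
  assumes "\<not> valid_gen N g" "\<And>x y. \<not> valid N x \<or> \<not> valid N y \<Longrightarrow> \<Psi> x y = 0"
  shows "swee_gen N \<Psi> g = 0"
proof (cases g)
  case (Tc a c m)
  have "\<Psi> (Word [Tc a b l]) (Word [Tc b c (m - l)]) = 0" for b l using assms by (auto simp: Tc)
  thus ?thesis by (simp add: Tc)
next
  case (Tic a c m)
  have "\<Psi> (Word [Tic b c l]) (Word [Tic a b (m - l)]) = 0" for b l using assms by (auto simp: Tic)
  thus ?thesis by (simp add: Tic)
qed

lemma swee_null:
  assumes "\<not> valid N w" "\<And>x y. \<not> valid N x \<or> \<not> valid N y \<Longrightarrow> \<Psi> x y = 0"
  shows "swee N \<Psi> w = 0"
  using assms
proof (induction w arbitrary: \<Psi> rule: word_induct)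
  case (Cons g w)
  show ?case
  proof (cases "valid_gen N g")
    case True
    hence "\<not> valid N w" using Cons.prems by auto
    hence "swee N (\<lambda>y1 y2. \<Psi> (x1 + y1) (x2 + y2)) w = 0" for x1 x2
      by (rule Cons.IH) (use Cons.prems(2) in auto)
    thus ?thesis by (simp add: swee_Cons swee_gen_zero_fun)
  next
    case False
    show ?thesis unfolding swee_Cons
    proof (rule swee_gen_null[OF False])
      fix x y assume xy: "\<not> valid N x \<or> \<not> valid N y"
      hence "(\<lambda>y1 y2. \<Psi> (x + y1) (y + y2)) = (\<lambda>y1 y2. 0)" using Cons.prems(2) by auto
      thus "swee N (\<lambda>y1 y2. \<Psi> (x + y1) (y + y2)) w = 0" by (simp only: swee_zero_fun)
    qed
  qed
qed simp

definition conv :: "nat \<Rightarrow> (gen0 word \<Rightarrow> 'a) \<Rightarrow> (gen0 word \<Rightarrow> 'a) \<Rightarrow> gen0 word \<Rightarrow> 'a::comm_ring_1"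
  where "conv N f h w = swee N (\<lambda>x y. f x * h y) w"

lemma conv_assoc: "conv N (conv N f g) h = conv N f (conv N g h)"
proof
  fix w
  show "conv N (conv N f g) h w = conv N f (conv N g h) w"
    unfolding conv_def swee_mult_left swee_mult_right mult.assoc
    by (rule swee_coassoc[symmetric, where \<Psi> = "\<lambda>x y z. f x * (g y * h z)"])
qed

lemma nullf_conv: "nullf N f \<Longrightarrow> nullf N g \<Longrightarrow> nullf N (conv N f g)"
  unfolding nullf_def conv_def by (auto intro!: swee_null)

lemma cu_Tc: "cu N (Word [Tc a b m]) = (if a = b \<and> a < N \<and> m = 0 then 1 else 0)"
  and cu_Tic: "cu N (Word [Tic a b m]) = (if a = b \<and> a < N \<and> m = 0 then 1 else 0)"
  by (simp_all add: cu_def)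

lemma delta_sum2: "(\<Sum>b<N. \<Sum>l\<le>m. if b = c \<and> l = k then f b l else 0) = (if c < (N::nat) \<and> k \<le> (m::nat) then f c k else (0::'a::comm_monoid_add))"
proof -
  have "(\<Sum>b<N. \<Sum>l\<le>m. if b = c \<and> l = k then f b l else 0) = (\<Sum>b<N. if b = c then (\<Sum>l\<le>m. if l = k then f b l else 0) else 0)"
    by (intro sum.cong[OF refl]) auto
  thus ?thesis by simp
qed

lemma swee_gen_counit_right:
  assumes "valid_gen N g"
  shows "swee_gen N (\<lambda>x y. f x * cu N y) g = (f (Word [g]) :: 'a::comm_ring_1)"
proof (cases g)
  case (Tc a c m)
  have "swee_gen N (\<lambda>x y. f x * cu N y) g = (\<Sum>b<N. \<Sum>l\<le>m. if b = c \<and> l = m then f (Word [Tc a b l]) else 0)"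
    unfolding Tc swee_gen.simps using assms by (intro sum.cong[OF refl]) (auto simp: cu_Tc Tc)
  thus ?thesis using assms by (simp add: delta_sum2 Tc)
next
  case (Tic a c m)
  have "swee_gen N (\<lambda>x y. f x * cu N y) g = (\<Sum>b<N. \<Sum>l\<le>m. if b = a \<and> l = m then f (Word [Tic b c l]) else 0)"
    unfolding Tic swee_gen.simps using assms by (intro sum.cong[OF refl]) (auto simp: cu_Tic Tic)
  thus ?thesis using assms by (simp add: delta_sum2 Tic)
qed

lemma swee_gen_counit_left:
  assumes "valid_gen N g"
  shows "swee_gen N (\<lambda>x y. cu N x * f y) g = (f (Word [g]) :: 'a::comm_ring_1)"
proof (cases g)
  case (Tc a c m)
  have "swee_gen N (\<lambda>x y. cu N x * f y) g = (\<Sum>b<N. \<Sum>l\<le>m. if b = a \<and> l = 0 then f (Word [Tc b c (m - l)]) else 0)"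
    unfolding Tc swee_gen.simps using assms by (intro sum.cong[OF refl]) (auto simp: cu_Tc Tc)
  thus ?thesis using assms by (simp add: delta_sum2 Tc)
next
  case (Tic a c m)
  have "swee_gen N (\<lambda>x y. cu N x * f y) g = (\<Sum>b<N. \<Sum>l\<le>m. if b = c \<and> l = 0 then f (Word [Tic a b (m - l)]) else 0)"
    unfolding Tic swee_gen.simps using assms by (intro sum.cong[OF refl]) (auto simp: cu_Tic Tic)
  thus ?thesis using assms by (simp add: delta_sum2 Tic)
qed

lemma conv_cu_right: assumes "nullf N f" shows "conv N f (cu N) = f"
proof
  fix w
  show "conv N f (cu N) w = f w"
  proof (cases "valid N w")
    case False thus ?thesis using assms nullf_conv[OF assms nullf_cu] by (simp add: nullf_def)
  next
    case True
    thus ?thesis unfolding conv_def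
    proof (induction w arbitrary: f rule: word_induct)
      case (Cons g w)
      have "swee N (\<lambda>x y. f x * cu N y) (Word [g] + w)
          = swee_gen N (\<lambda>x1 x2. swee N (\<lambda>y1 y2. f (x1 + y1) * cu N y2) w * cu N x2) g"
        unfolding swee_Cons swee_mult_right by (simp add: algebra_simps)
      also have "\<dots> = swee_gen N (\<lambda>x1 x2. f (x1 + w) * cu N x2) g"
        by (subst Cons.IH[where f = "\<lambda>y. f (_ + y)"]) (use Cons.prems in auto)
      also have "\<dots> = f (Word [g] + w)"
        using Cons.prems by (subst swee_gen_counit_right) auto
      finally show ?case .
    qed simp
  qed
qed

lemma conv_cu_left: assumes "nullf N f" shows "conv N (cu N) f = f"
proof
  fix w
  show "conv N (cu N) f w = f w"
  proof (cases "valid N w")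
    case False thus ?thesis using assms nullf_conv[OF nullf_cu assms] by (simp add: nullf_def)
  next
    case True
    thus ?thesis unfolding conv_def
    proof (induction w arbitrary: f rule: word_induct)
      case (Cons g w)
      have "swee N (\<lambda>x y. cu N x * f y) (Word [g] + w)
          = swee_gen N (\<lambda>x1 x2. cu N x1 * swee N (\<lambda>y1 y2. cu N y1 * f (x2 + y2)) w) g"
        unfolding swee_Cons swee_mult_left by (simp add: algebra_simps)
      also have "\<dots> = swee_gen N (\<lambda>x1 x2. cu N x1 * f (x2 + w)) g"
        by (subst Cons.IH[where f = "\<lambda>y. f (_ + y)"]) (use Cons.prems in auto)
      also have "\<dots> = f (Word [g] + w)"
        using Cons.prems by (subst swee_gen_counit_left) auto
      finally show ?case .
    qed simp
  qed
qed

lemma conv_mult_left: "conv N (\<lambda>w. c * f w) h w = c * conv N f h w"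
  and conv_mult_right: "conv N f (\<lambda>w. c * h w) w = c * conv N f h w"
  by (simp_all add: conv_def swee_mult_left algebra_simps)

lemma conv_sum_left: "conv N (\<lambda>w. \<Sum>i\<in>A. f i w) h w = (\<Sum>i\<in>A. conv N (f i) h w)"
  and conv_sum_right: "conv N h (\<lambda>w. \<Sum>i\<in>A. f i w) w = (\<Sum>i\<in>A. conv N h (f i) w)"
  by (simp_all add: conv_def sum_distrib_left sum_distrib_right swee_sum_fun)

lemma conv_swee_left: "conv N (\<lambda>g. swee M (\<lambda>x y. f x y g) u) h w = swee M (\<lambda>x y. conv N (f x y) h w) u"
  and conv_swee_right: "conv N h (\<lambda>g. swee M (\<lambda>x y. f x y g) u) w = swee M (\<lambda>x y. conv N h (f x y) w) u"
  unfolding conv_def swee_mult_left swee_mult_right by (rule swee_Fubini)+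

section \<open>Laurent series over k[[h]]\<close>

subsection \<open>h-adically convergent sums\<close>

text \<open>The condition under which \<open>hsum\<close> is an h-adic limit: its truncation at k =
  n then loses no contribution to the coefficient of \<open>h^n\<close>.\<close>

definition hdiv :: "(nat \<Rightarrow> 'a::zero fps) \<Rightarrow> bool"
  where "hdiv g \<longleftrightarrow> (\<forall>k. \<forall>l<k. fps_nth (g k) l = 0)"

lemma hsum_nth: "fps_nth (hsum g) n = (\<Sum>k\<le>n. fps_nth (g k) n)"
  by (simp add: hsum_def)

lemma hsum_nth_below:
  assumes "hdiv g" "l < m" shows "fps_nth (hsum g) l = fps_nth (\<Sum>k<m. g k) l"
proof -
  have "(\<Sum>k\<in>{..l}. fps_nth (g k) l) = (\<Sum>k\<in>{..<m}. fps_nth (g k) l)"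
    using assms by (intro sum.mono_neutral_left) (auto simp: hdiv_def)
  thus ?thesis by (simp add: hsum_nth fps_sum_nth)
qed

lemma hsum_0: "hdiv g \<Longrightarrow> (\<And>k. k > 0 \<Longrightarrow> g k = 0) \<Longrightarrow> hsum g = g 0"
proof (rule fps_ext)
  fix n assume "\<And>k. k > 0 \<Longrightarrow> g k = 0"
  hence "(\<Sum>k\<le>n. fps_nth (g k) n) = (\<Sum>k\<le>n. if k = 0 then fps_nth (g 0) n else 0)"
    by (intro sum.cong) auto
  thus "fps_nth (hsum g) n = fps_nth (g 0) n" by (simp add: hsum_nth)
qed

lemma hsum_cong: "(\<And>k. g k = g' k) \<Longrightarrow> hsum g = hsum g'"
  by (simp add: hsum_def)

lemma hadd_hsum:
  assumes "hadd f" "hdiv g"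
  shows "f (hsum g) = hsum (\<lambda>k. f (g k))" and "hdiv (\<lambda>k. f (g k))"
proof -
  show div: "hdiv (\<lambda>k. f (g k))"
    unfolding hdiv_def using hadd_vanish[OF assms(1)] assms(2) unfolding hdiv_def by blast
  show "f (hsum g) = hsum (\<lambda>k. f (g k))"
  proof (rule fps_ext)
    fix n
    have "fps_nth (f (hsum g)) n = fps_nth (f (\<Sum>k<Suc n. g k)) n"
      by (rule hadd_cong_below[OF assms(1), of "Suc n"]) (use hsum_nth_below[OF assms(2)] in auto)
    also have "\<dots> = fps_nth (hsum (\<lambda>k. f (g k))) n"
      by (simp add: hadd_sum[OF assms(1)] hsum_nth_below[OF div lessI] del: sum.lessThan_Suc)
    finally show "fps_nth (f (hsum g)) n = fps_nth (hsum (\<lambda>k. f (g k))) n" .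
  qed
qed

lemma hdiv_mult_power:
  fixes a :: "'a::ring_1 fps"
  assumes "fps_nth a 0 = 0" shows "hdiv (\<lambda>k. g k * a ^ k)"
proof -
  have "a = fps_shift 1 a * fps_X" using assms by (simp add: fps_eq_iff)
  have "fps_nth (a ^ k) l = 0" if "l < k" for k l
    using that
  proof (induction k arbitrary: l)
    case (Suc k)
    have "fps_nth (a * a ^ k) l = (\<Sum>i=0..l. fps_nth a i * fps_nth (a ^ k) (l - i))" by (simp add: fps_mult_nth)
    also have "\<dots> = 0"
    proof (rule sum.neutral, clarify)
      fix i assume "i \<in> {0..l}"
      hence "i = 0 \<or> l - i < k" using Suc.prems by auto
      thus "fps_nth a i * fps_nth (a ^ k) (l - i) = 0"
        using Suc.IH assms by auto
    qed
    finally show ?case by simp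
  qed simp
  thus ?thesis unfolding hdiv_def by (auto simp: fps_mult_nth intro!: sum.neutral)
qed

lemma hsum_hsum:
  fixes g :: "nat \<Rightarrow> nat \<Rightarrow> 'a::comm_monoid_add fps"
  assumes "\<And>m k l. l < m + k \<Longrightarrow> fps_nth (g m k) l = 0"
  shows "hsum (\<lambda>m. hsum (g m)) = hsum (\<lambda>n. \<Sum>m\<le>n. g m (n - m))"
proof (rule fps_ext)
  fix n
  have "(\<Sum>m\<le>n. \<Sum>k\<le>n. fps_nth (g m k) n) = (\<Sum>m\<le>n. \<Sum>k\<le>n - m. fps_nth (g m k) n)"
    by (rule sum.cong[OF refl], rule sum.mono_neutral_right) (auto intro!: assms)
  also have "\<dots> = (\<Sum>(m, k)\<in>Sigma {..n} (\<lambda>m. {..n - m}). fps_nth (g m k) n)"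
    by (simp add: sum.Sigma)
  also have "Sigma {..n} (\<lambda>m. {..n - m}) = {(m, k). m + k \<le> n}" by auto
  also have "(\<Sum>(m, k)\<in>{(m, k). m + k \<le> n}. fps_nth (g m k) n) = (\<Sum>j\<le>n. \<Sum>m\<le>j. fps_nth (g m (j - m)) n)"
    by (rule sum.triangle_reindex_eq)
  finally show "fps_nth (hsum (\<lambda>m. hsum (g m))) n = fps_nth (hsum (\<lambda>n. \<Sum>m\<le>n. g m (n - m))) n"
    by (simp add: hsum_nth fps_sum_nth)
qed

lemma hsum_mult:
  fixes g g' :: "nat \<Rightarrow> 'a::ring_1 fps"
  assumes "hdiv g" "hdiv g'"
  shows "hsum g * hsum g' = hsum (\<lambda>n. \<Sum>i\<le>n. g i * g' (n - i))"
proof -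
  have "hsum g * hsum g' = hsum (\<lambda>m. g m * hsum g')"
    by (rule hadd_hsum(1)[OF hadd_mult_right assms(1)])
  also have "\<dots> = hsum (\<lambda>m. hsum (\<lambda>k. g m * g' k))"
    by (simp add: hadd_hsum(1)[OF hadd_mult_left assms(2)])
  also have "\<dots> = hsum (\<lambda>n. \<Sum>i\<le>n. g i * g' (n - i))"
  proof (rule hsum_hsum)
    fix m k l :: nat assume l: "l < m + k"
    have "fps_nth (g m) i * fps_nth (g' k) (l - i) = 0" if "i \<le> l" for i
      using that l assms unfolding hdiv_def by (cases "i < m") auto
    thus "fps_nth (g m * g' k) l = 0" by (simp add: fps_mult_nth)
  qed
  finally show ?thesis .
qed

subsection \<open>Divided derivatives\<close>

definition hmap :: "('a::zero \<Rightarrow> 'b::zero) \<Rightarrow> 'a fps \<Rightarrow> 'b fps"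
  where "hmap f F = Abs_fps (\<lambda>n. f (fps_nth F n))"

lemma hmap_nth [simp]: "fps_nth (hmap f F) n = f (fps_nth F n)"
  by (simp add: hmap_def)

lemma hadd_hmap:
  assumes "\<And>x y. f (x + y) = f x + (f y :: 'b::ab_group_add)" shows "hadd (hmap f)"
proof (rule haddI)
  have f0: "f 0 = 0" using assms[of 0 0] by simp
  fix x show "hmap f (hX x) = hX (hmap f x)"
  proof (rule fps_ext)
    fix n show "fps_nth (hmap f (hX x)) n = fps_nth (hX (hmap f x)) n" by (cases n) (auto simp: f0)
  qed
qed (rule fps_ext, simp add: assms)

lemma hmap_const: "f 0 = 0 \<Longrightarrow> hmap f (fps_const c) = fps_const (f c)"
  by (rule fps_ext) simp

lemma hadd_bilinear_eqI:
  fixes F :: "'a::ab_group_add fps \<Rightarrow> 'b::ab_group_add fps \<Rightarrow> 'c::ab_group_add fps"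
  assumes "\<And>y. hadd (\<lambda>x. F x y)" "\<And>x. hadd (F x)" "\<And>y. hadd (\<lambda>x. H x y)" "\<And>x. hadd (H x)"
    "\<And>c d. F (fps_const c) (fps_const d) = H (fps_const c) (fps_const d)"
  shows "F x y = H x y"
  by (rule hadd_eqI[where f = "\<lambda>x. F x y" and g = "\<lambda>x. H x y", OF assms(1,3)],
      rule hadd_eqI[OF assms(2,4)], rule assms(5))

definition kD :: "'k::field_char_0 fls fps \<Rightarrow> 'k fls fps" where "kD = hmap fls_deriv"

lemma hadd_kD: "hadd kD"
  unfolding kD_def by (rule hadd_hmap) simp

lemma kD_mult: "kD (F * (H :: 'a::field_char_0 fls fps)) = kD F * H + F * kD H"
proof (rule hadd_bilinear_eqI[where F = "\<lambda>F H. kD (F * H)" and H = "\<lambda>F H. kD F * H + F * kD H"])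
  fix c d :: "'a fls"
  show "kD (fps_const c * fps_const d) = kD (fps_const c) * fps_const d + fps_const c * kD (fps_const d)"
    by (simp add: kD_def hmap_const)
qed (auto intro!: hadd_plus hadd_compose[OF hadd_kD] hadd_mult_left hadd_mult_right
        hadd_compose[OF hadd_mult_right hadd_kD] hadd_compose[OF hadd_mult_left hadd_kD])

lemma kD_hconst: "kD (hconst a) = 0"
  by (rule fps_ext) (simp add: kD_def hconst_def)

definition dd :: "nat \<Rightarrow> 'k::field_char_0 fls fps \<Rightarrow> 'k fls fps"
  where "dd m F = fps_const (fls_const (1 / fact m)) * (kD ^^ m) F"

lemma hadd_kD_pow: "hadd (kD ^^ m)"
proof (induction m)
  case 0 show ?case by (simp add: hadd_id id_def)
next
  case (Suc m) show ?case using hadd_compose[OF hadd_kD Suc] by (simp add: o_def)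
qed

lemma hadd_dd: "hadd (dd m)"
  unfolding dd_def[abs_def] by (rule hadd_compose[OF hadd_mult_left hadd_kD_pow])

lemma kD_const_mult: "kD (fps_const (fls_const c) * F) = fps_const (fls_const c) * kD F"
  using kD_hconst[of "fps_const c"] by (simp add: kD_mult hconst_fps_const)

lemma kD_pow_const_mult: "(kD ^^ m) (fps_const (fls_const c) * F) = fps_const (fls_const c) * (kD ^^ m) F"
  by (induction m) (simp_all add: kD_const_mult)

lemma fps_of_nat_const: "of_nat n = (fps_const (fls_const (of_nat n)) :: 'k::field_char_0 fls fps)"
  by (simp add: fls_of_nat flip: fps_of_nat)

lemma dd_Suc: "of_nat (Suc m) * dd (Suc m) F = kD (dd m (F :: 'k::field_char_0 fls fps))"
proof -
  have "of_nat (Suc m) * (1 / fact (Suc m) :: 'k) = 1 / fact m"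
    by (simp add: field_simps del: of_nat_Suc)
  thus ?thesis
    unfolding dd_def kD_const_mult fps_of_nat_const mult.assoc[symmetric] fps_const_mult fls_const_mult_const
    by simp
qed

lemma dd_0 [simp]: "dd 0 F = F"
  by (simp add: dd_def)

lemma kD_dd: "kD (dd m F) = dd m (kD F)"
  by (simp add: dd_def kD_const_mult funpow_swap1)

lemma dd_mult: "dd m (F * (H :: 'a::field_char_0 fls fps)) = (\<Sum>i\<le>m. dd i F * dd (m - i) H)"
proof (induction m)
  case (Suc m)
  \<comment> \<open>The recurrence for divided derivatives carries the factor m + 1, so the Leibniz
    rule is proved after multiplication by it; the weight splits as i + (m + 1 - i), and the factor
    is cancelled at the end.\<close>
  have "of_nat (Suc m) * dd (Suc m) (F * H) = (\<Sum>i\<le>m. kD (dd i F) * dd (m - i) H) + (\<Sum>i\<le>m. dd i F * kD (dd (m - i) H))"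
    by (simp add: dd_Suc Suc hadd_sum[OF hadd_kD] kD_mult sum.distrib del: of_nat_Suc)
  also have "(\<Sum>i\<le>m. kD (dd i F) * dd (m - i) H) = (\<Sum>i\<le>Suc m. of_nat i * (dd i F * dd (Suc m - i) H))"
    by (subst sum.atMost_Suc_shift) (simp add: dd_Suc[symmetric] mult.assoc del: of_nat_Suc)
  also have "(\<Sum>i\<le>m. dd i F * kD (dd (m - i) H)) = (\<Sum>i\<le>Suc m. of_nat (Suc m - i) * (dd i F * dd (Suc m - i) H))"
    by (subst sum.atMost_Suc, simp only: diff_self_eq_0 of_nat_0 mult_zero_left add_0_right, rule sum.cong[OF refl])
       (simp add: Suc_diff_le dd_Suc[symmetric] mult.left_commute del: of_nat_Suc of_nat_diff)
  also have "(\<Sum>i\<le>Suc m. of_nat i * (dd i F * dd (Suc m - i) H)) + (\<Sum>i\<le>Suc m. of_nat (Suc m - i) * (dd i F * dd (Suc m - i) H))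
      = (\<Sum>i\<le>Suc m. of_nat (Suc m) * (dd i F * dd (Suc m - i) H))"
    unfolding sum.distrib[symmetric] distrib_right[symmetric] of_nat_add[symmetric]
    by (intro sum.cong[OF refl]) auto
  finally have "of_nat (Suc m) * dd (Suc m) (F * H) = of_nat (Suc m) * (\<Sum>i\<le>Suc m. dd i F * dd (Suc m - i) H)"
    by (simp only: sum_distrib_left)
  moreover have "(of_nat (Suc m) :: 'a fls fps) \<noteq> 0" by (rule of_nat_neq_0)
  ultimately show ?case using mult_cancel_left[of "of_nat (Suc m) :: 'a fls fps"] by blast
qed simp

lemma dd_dd: "dd m (dd l F) = fps_const (fls_const (1 / (fact l * fact m))) * (kD ^^ (l + m)) F"
  by (simp add: dd_def kD_pow_const_mult mult.assoc[symmetric] funpow_add add.commute[of l] mult.commute[of "fact m"])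

lemma dd_fps_nth: "fps_nth ((kD ^^ m) F) n = (fls_deriv ^^ m) (fps_nth F n)"
  by (induction m) (simp_all add: kD_def)

subsection \<open>Shifts\<close>

lemma shift_alt: "shift a F = hsum (\<lambda>m. dd m F * hconst a ^ m)"
proof -
  have "Abs_fps (\<lambda>n. Abs_fls (\<lambda>i. fls_nth ((fls_deriv ^^ m) (fps_nth F n)) i / fact m)) = dd m F" for m
  proof (rule fps_ext)
    fix n
    have "(\<lambda>i. fls_nth ((fls_deriv ^^ m) (fps_nth F n)) i / fact m)
        = fls_nth (fls_const (1 / fact m) * (fls_deriv ^^ m) (fps_nth F n))"
      by (auto simp: field_simps)
    thus "fps_nth (Abs_fps (\<lambda>n. Abs_fls (\<lambda>i. fls_nth ((fls_deriv ^^ m) (fps_nth F n)) i / fact m))) n = fps_nth (dd m F) n"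
      by (simp add: fls_nth_inverse dd_def dd_fps_nth)
  qed
  thus ?thesis by (simp add: shift_def taylor_def)
qed

lemma hconst_nth: "fps_nth (hconst a) n = fls_const (fps_nth a n)"
  by (simp add: hconst_def)

lemma hconst_1 [simp]: "hconst 1 = 1" and hconst_0 [simp]: "hconst 0 = 0"
  by (simp_all add: hconst_def fps_eq_iff)

lemma hconst_power: "hconst (a ^ m :: 'k::comm_ring_1 fps) = hconst a ^ m"
  by (induction m) (simp_all add: hconst_mult)

lemma hdiv_shift: "fps_nth a 0 = 0 \<Longrightarrow> hdiv (\<lambda>m. dd m F * hconst a ^ m)"
  by (rule hdiv_mult_power) (simp add: hconst_nth)

lemma shift_nth: "fps_nth (shift a F) n = (\<Sum>k\<le>n. fps_nth (dd k F * hconst a ^ k) n)"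
  by (simp add: shift_alt hsum_nth)

lemma hadd_shift: assumes "fps_nth a 0 = 0" shows "hadd (shift a)"
proof (rule haddI)
  fix F H show "shift a (F + H) = shift a F + shift a H"
    by (rule fps_ext) (simp add: shift_nth hadd_add[OF hadd_dd] algebra_simps sum.distrib)
  show "shift a (hX F) = hX (shift a F)"
    unfolding shift_alt hadd_hX[OF hadd_dd] unfolding hX_conv_mult mult.assoc
    by (rule hadd_hsum(1)[OF hadd_mult_left hdiv_shift[OF assms], symmetric])
qed

lemma shift_mult:
  assumes "fps_nth a 0 = 0" shows "shift a (F * H) = shift a F * shift a H"
proof -
  have "dd m (F * H) * hconst a ^ m = (\<Sum>i\<le>m. (dd i F * hconst a ^ i) * (dd (m - i) H * hconst a ^ (m - i)))" for m
    unfolding dd_mult sum_distrib_right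
    by (intro sum.cong[OF refl]) (simp add: mult_ac power_add[symmetric])
  thus ?thesis unfolding shift_alt hsum_mult[OF hdiv_shift[OF assms] hdiv_shift[OF assms]] by simp
qed

lemma kD_pow_0: "(kD ^^ m) 0 = 0"
  by (rule hadd_0[OF hadd_kD_pow])

lemma dd_hconst: "m > 0 \<Longrightarrow> dd m (hconst a) = 0"
  by (cases m) (simp_all add: dd_def funpow_swap1 kD_hconst kD_pow_0 del: funpow.simps(2) add: funpow_Suc_right)

lemma shift_hconst: assumes "fps_nth a 0 = 0" shows "shift a (hconst b) = hconst b"
  unfolding shift_alt by (subst hsum_0[OF hdiv_shift[OF assms]]) (simp_all add: dd_hconst)

lemma shift_1: "fps_nth a 0 = 0 \<Longrightarrow> shift a 1 = 1"
  using shift_hconst[of a 1] by simp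

lemma shift_0: "shift 0 F = F"
  unfolding shift_alt by (subst hsum_0[OF hdiv_shift]) (simp_all add: power_0_left)

lemma shift_power: "fps_nth a 0 = 0 \<Longrightarrow> shift a (F ^ m) = shift a F ^ m"
  by (induction m) (simp_all add: shift_1 shift_mult)

lemma kD_shift: assumes "fps_nth a 0 = 0" shows "kD (shift a F) = shift a (kD F)"
proof -
  have "kD (dd m F * hconst a ^ m) = dd m (kD F) * hconst a ^ m" for m
    by (simp add: kD_mult kD_dd kD_hconst flip: hconst_power)
  thus ?thesis unfolding shift_alt hadd_hsum(1)[OF hadd_kD hdiv_shift[OF assms]] by simp
qed

lemma dd_shift: assumes "fps_nth a 0 = 0" shows "dd m (shift a F) = shift a (dd m F)"
proof -
  have "(kD ^^ m) (shift a F) = shift a ((kD ^^ m) F)"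
    by (induction m) (simp_all add: kD_shift[OF assms])
  thus ?thesis using shift_hconst[OF assms, of "fps_const (1 / fact m)"]
    by (simp add: dd_def shift_mult[OF assms] hconst_fps_const)
qed

lemma dd_dd_binomial: "dd k (dd m (F :: 'a::field_char_0 fls fps)) = of_nat ((m + k) choose k) * dd (m + k) F"
proof -
  have "(1 / (fact m * fact k) :: 'a) = of_nat ((m + k) choose k) * (1 / fact (m + k))"
    using binomial_fact[of k "m + k", where 'a = 'a] by (simp add: mult.commute)
  thus ?thesis
    unfolding dd_dd dd_def[of "m + k"] fps_of_nat_const mult.assoc[symmetric] fps_const_mult fls_const_mult_const by simp
qed

text \<open>Taylor's theorem twice: the double sum is collected by total degree, and
  \<open>dd_dd_binomial\<close> supplies the coefficients of the binomial expansion of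
  \<open>(a + b)^n\<close>.\<close>

lemma shift_shift:
  assumes a: "fps_nth a 0 = 0" and b: "fps_nth b 0 = 0"
  shows "shift a (shift b F) = shift (a + b) F"
proof -
  define A B where "A = hconst a" and "B = hconst b"
  have "shift a (shift b F) = hsum (\<lambda>m. shift a (dd m F * B ^ m))"
    unfolding shift_alt[of b] B_def by (rule hadd_hsum(1)[OF hadd_shift[OF a] hdiv_shift[OF b]])
  also have "\<dots> = hsum (\<lambda>m. shift a (dd m F) * B ^ m)"
    by (simp add: shift_mult[OF a] shift_power[OF a] shift_hconst[OF a] B_def)
  also have "\<dots> = hsum (\<lambda>m. hsum (\<lambda>k. dd k (dd m F) * A ^ k * B ^ m))"
    unfolding shift_alt[of a] A_def by (subst hadd_hsum(1)[OF hadd_mult_right hdiv_shift[OF a]]) simp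
  also have "\<dots> = hsum (\<lambda>n. \<Sum>m\<le>n. dd (n - m) (dd m F) * A ^ (n - m) * B ^ m)"
  proof (rule hsum_hsum)
    fix m k l :: nat assume "l < m + k"
    have A: "\<And>l k. l < k \<Longrightarrow> fps_nth (A ^ k) l = 0" and B: "\<And>l k. l < k \<Longrightarrow> fps_nth (B ^ k) l = 0"
      using hdiv_mult_power[of A "\<lambda>_. 1"] hdiv_mult_power[of B "\<lambda>_. 1"] a b
      by (auto simp: hdiv_def A_def B_def hconst_nth)
    have AB: "fps_nth (A ^ k * B ^ m) i = 0" if "i < m + k" for i
      unfolding fps_mult_nth
    proof (rule sum.neutral, clarify)
      fix j assume "j \<in> {0..i}"
      thus "fps_nth (A ^ k) j * fps_nth (B ^ m) (i - j) = 0"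
        using that A[of j k] B[of "i - j" m] by (cases "j < k") auto
    qed
    show "fps_nth (dd k (dd m F) * A ^ k * B ^ m) l = 0"
      unfolding mult.assoc fps_mult_nth[of "dd k (dd m F)"]
      using AB \<open>l < m + k\<close> by (intro sum.neutral) auto
  qed
  also have "\<dots> = hsum (\<lambda>n. dd n F * (B + A) ^ n)"
  proof (rule hsum_cong)
    fix n
    show "(\<Sum>m\<le>n. dd (n - m) (dd m F) * A ^ (n - m) * B ^ m) = dd n F * (B + A) ^ n"
      unfolding binomial_ring sum_distrib_left
    proof (rule sum.cong[OF refl])
      fix m assume "m \<in> {..n}"
      hence "n choose (n - m) = n choose m" "m + (n - m) = n" by (auto simp: binomial_symmetric[of m n])
      thus "dd (n - m) (dd m F) * A ^ (n - m) * B ^ m = dd n F * (of_nat (n choose m) * B ^ m * A ^ (n - m))"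
        by (simp add: dd_dd_binomial mult_ac)
    qed
  qed
  also have "\<dots> = shift (a + b) F"
    by (simp add: shift_alt A_def B_def hadd_add[OF hadd_hconst] add.commute)
  finally show ?thesis .
qed

subsection \<open>Reflection, regular part and evaluation\<close>

definition reflc :: "'k::field_char_0 fls fps \<Rightarrow> 'k fls fps"
  where "reflc = hmap (\<lambda>f. fls_compose_fps f (- fps_X))"

lemma minus_fps_X: "- fps_X \<noteq> (0 :: 'k::field_char_0 fps)" "fps_nth (- fps_X :: 'k::field_char_0 fps) 0 = 0"
  by (simp_all)

lemma hadd_reflc: "hadd reflc"
  unfolding reflc_def by (rule hadd_hmap) (simp add: fls_compose_fps_add minus_fps_X)

lemma reflc_mult: "reflc (F * (H :: 'a::field_char_0 fls fps)) = reflc F * reflc H"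
proof (rule hadd_bilinear_eqI[where F = "\<lambda>F H. reflc (F * H)" and H = "\<lambda>F H. reflc F * reflc H"])
  fix c d :: "'a fls"
  show "reflc (fps_const c * fps_const d) = reflc (fps_const c) * reflc (fps_const d)"
    by (simp add: reflc_def hmap_const fls_compose_fps_mult minus_fps_X)
qed (auto intro!: hadd_compose[OF hadd_reflc] hadd_mult_left hadd_mult_right
        hadd_compose[OF hadd_mult_right hadd_reflc] hadd_compose[OF hadd_mult_left hadd_reflc])

lemma reflc_nth: "fls_nth (fps_nth (reflc F) n) j = (- 1) powi j * fls_nth (fps_nth F n) j"
proof -
  have "fls_compose_fps f (- fps_X) = fls_compose_fps f (fps_const (- 1) * fps_X :: 'a fps)" for f
    by (rule arg_cong[where f = "fls_compose_fps f"]) (simp add: fps_eq_iff)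
  thus ?thesis by (simp add: reflc_def fls_nth_fls_compose_fps_linear)
qed

lemma reflc_hconst: "reflc (hconst a) = hconst a"
proof (rule fps_ext, rule fls_eqI)
  fix n j show "fls_nth (fps_nth (reflc (hconst a)) n) j = fls_nth (fps_nth (hconst a) n) j"
    by (cases "j = 0") (simp_all add: reflc_nth hconst_nth)
qed

lemma reflc_1: "reflc 1 = 1" using reflc_hconst[of 1] by simp

lemma kD_reflc: "kD (reflc F) = - reflc (kD F)"
proof (rule fps_ext, rule fls_eqI)
  fix n j
  have "(- 1) powi (j + 1) = - ((- 1) powi j :: 'a)" by (simp add: power_int_add)
  thus "fls_nth (fps_nth (kD (reflc F)) n) j = fls_nth (fps_nth (- reflc (kD F)) n) j"
    by (simp add: kD_def reflc_nth)
qed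

lemma dd_reflc: "dd m (reflc (F :: 'a::field_char_0 fls fps)) = (- 1) ^ m * reflc (dd m F)"
proof -
  have "(kD ^^ m) (reflc F) = (- 1) ^ m * reflc ((kD ^^ m) F)"
  proof (induction m)
    case (Suc m)
    have "kD ((- 1) ^ m * reflc ((kD ^^ m) F)) = (- 1) ^ m * kD (reflc ((kD ^^ m) F))"
      using kD_const_mult[of "(- 1) ^ m"] by (cases "even m") (simp_all add: hadd_minus[OF hadd_kD])
    thus ?case by (simp add: Suc kD_reflc)
  qed simp
  thus ?thesis using reflc_hconst[of "fps_const (1 / fact m :: 'a)"] by (simp add: dd_def reflc_mult hconst_fps_const)
qed

lemma reflc_power: "reflc (F ^ m) = reflc F ^ m"
  by (induction m) (simp_all add: reflc_1 reflc_mult)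

lemma hconst_minus: "hconst (- a) = - hconst (a :: 'k::comm_ring_1 fps)"
  by (rule hadd_minus[OF hadd_hconst])

lemma reflc_shift: assumes "fps_nth a 0 = 0" shows "reflc (shift a F) = shift (- a) (reflc F)"
proof -
  have "reflc (dd m F * hconst a ^ m) = dd m (reflc F) * hconst (- a) ^ m" for m
    by (cases "even m") (simp_all add: reflc_mult reflc_power reflc_hconst dd_reflc hconst_minus)
  thus ?thesis unfolding shift_alt hadd_hsum(1)[OF hadd_reflc hdiv_shift[OF assms]] by simp
qed

definition reg :: "'k::field_char_0 fls fps \<Rightarrow> bool"
  where "reg F \<longleftrightarrow> (\<forall>n. fls_subdegree (fps_nth F n) \<ge> 0)"

lemma reg_iff: "reg F \<longleftrightarrow> (\<forall>n j. j < 0 \<longrightarrow> fls_nth (fps_nth F n) j = 0)"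
proof -
  have "fls_subdegree f \<ge> 0 \<longleftrightarrow> (\<forall>j<0. fls_nth f j = 0)" for f :: "'a fls"
    by (cases "f = 0") (auto simp: fls_subdegree_geI intro: fls_eq0_below_subdegree)
  thus ?thesis by (simp add: reg_def)
qed

definition plusK :: "'k::field_char_0 fps fps \<Rightarrow> 'k fls fps" where "plusK = hmap fps_to_fls"

lemma hadd_plusK: "hadd plusK"
  unfolding plusK_def by (rule hadd_hmap) simp

lemma plusK_mult: "plusK (F * (H :: 'a::field_char_0 fps fps)) = plusK F * plusK H"
proof (rule hadd_bilinear_eqI[where F = "\<lambda>F H. plusK (F * H)" and H = "\<lambda>F H. plusK F * plusK H"])
  fix c d :: "'a fps"
  show "plusK (fps_const c * fps_const d) = plusK (fps_const c) * plusK (fps_const d)"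
    by (simp add: plusK_def hmap_const fls_times_fps_to_fls)
qed (auto intro!: hadd_compose[OF hadd_plusK] hadd_mult_left hadd_mult_right
        hadd_compose[OF hadd_mult_right hadd_plusK] hadd_compose[OF hadd_mult_left hadd_plusK])

lemma reg_plusK: "reg (plusK F)"
  by (simp add: reg_iff plusK_def)

lemma reg_plusKE: assumes "reg F" obtains H where "F = plusK H"
proof
  show "F = plusK (hmap fls_regpart F)"
    by (rule fps_ext) (use assms in \<open>simp add: plusK_def reg_def\<close>)
qed

lemma reg_mult: "reg F \<Longrightarrow> reg H \<Longrightarrow> reg (F * H)"
  by (metis reg_plusKE reg_plusK plusK_mult)

lemma reg_add: "reg F \<Longrightarrow> reg H \<Longrightarrow> reg (F + H)"
  by (simp add: reg_iff)

lemma reg_minus: "reg F \<Longrightarrow> reg (- F)"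
  by (simp add: reg_iff)

lemma reg_diff: "reg F \<Longrightarrow> reg H \<Longrightarrow> reg (F - H)"
  by (simp add: reg_iff)

lemma reg_0 [simp]: "reg 0" by (simp add: reg_iff)

lemma reg_sum: "(\<And>i. i \<in> A \<Longrightarrow> reg (f i)) \<Longrightarrow> reg (\<Sum>i\<in>A. f i)"
  by (induction A rule: infinite_finite_induct) (simp_all add: reg_add)

lemma reg_hconst [simp]: "reg (hconst a)"
  by (simp add: reg_iff hconst_nth)

lemma reg_1 [simp]: "reg 1"
  using reg_hconst[of 1] by simp

lemma reg_kD: "reg F \<Longrightarrow> reg (kD F)"
proof -
  assume F: "reg F"
  have "of_int (j + 1) * fls_nth (fps_nth F n) (j + 1) = 0" if "j < 0" for n j
    using F that by (cases "j = - 1") (auto simp: reg_iff)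
  thus "reg (kD F)" by (simp add: reg_iff kD_def)
qed

lemma reg_dd: assumes "reg F" shows "reg (dd m F)"
proof -
  have "reg ((kD ^^ m) F)" by (induction m) (simp_all add: assms reg_kD)
  thus ?thesis unfolding dd_def by (intro reg_mult) (simp_all flip: hconst_fps_const)
qed

lemma reg_power: "reg F \<Longrightarrow> reg (F ^ m)"
  by (induction m) (simp_all add: reg_mult)

lemma reg_hsum: "(\<And>k. reg (g k)) \<Longrightarrow> reg (hsum g)"
  by (simp add: reg_iff hsum_nth fls_nth_sum)

lemma reg_shift: "reg F \<Longrightarrow> reg (shift a F)"
  unfolding shift_alt by (intro reg_hsum reg_mult reg_dd reg_power reg_hconst)

lemma reg_reflc: "reg F \<Longrightarrow> reg (reflc F)"
  by (simp add: reg_iff reflc_nth)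

definition c0 :: "'k::field_char_0 fls fps \<Rightarrow> 'k fps" where "c0 = hmap (\<lambda>f. fls_nth f 0)"

lemma hadd_c0: "hadd c0"
  unfolding c0_def by (rule hadd_hmap) simp

lemma c0_plusK: "c0 (plusK F) = hmap (\<lambda>f. fps_nth f 0) F"
  by (rule fps_ext) (simp add: c0_def plusK_def)

text \<open>Regularity is essential here: for series with poles the constant term is not
  multiplicative. This is why regularity accompanies every later evaluation at a point.\<close>

lemma c0_mult: assumes "reg F" "reg H" shows "c0 (F * H) = c0 F * c0 H"
proof -
  obtain F' H' where FG: "F = plusK F'" "H = plusK H'" using assms by (metis reg_plusKE)
  have "hmap (\<lambda>f. fps_nth f 0) (F' * H') = hmap (\<lambda>f. fps_nth f 0) F' * hmap (\<lambda>f. fps_nth f 0) H'"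
    by (rule fps_ext) (simp add: fps_mult_nth fps_sum_nth)
  thus ?thesis by (simp add: FG c0_plusK flip: plusK_mult)
qed

lemma c0_hconst: "c0 (hconst a) = a"
  by (rule fps_ext) (simp add: c0_def hconst_nth)

lemma c0_hconst_mult: "c0 (hconst a * F) = a * c0 F"
proof (rule hadd_bilinear_eqI[where F = "\<lambda>a F. c0 (hconst a * F)" and H = "\<lambda>a F. a * c0 F"])
  fix c d show "c0 (hconst (fps_const c) * fps_const d) = fps_const c * c0 (fps_const d)"
    by (simp add: hconst_fps_const c0_def hmap_const)
qed (auto intro!: hadd_compose[OF hadd_c0] hadd_mult_left hadd_mult_right hadd_compose[OF hadd_mult_right hadd_hconst]
       hadd_compose[OF hadd_mult_left hadd_c0])

lemma c0_reflc: "c0 (reflc F) = c0 F"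
  by (rule fps_ext) (simp add: c0_def reflc_nth)

definition ev :: "'k::field_char_0 fps \<Rightarrow> 'k fls fps \<Rightarrow> 'k fps" where "ev a F = c0 (shift a F)"

lemma val_ev: "val f x = ev (snd x) (f (fst x))"
  by (rule fps_ext) (simp add: val_def expand_def ev_def c0_def)

lemma hadd_ev: "fps_nth a 0 = 0 \<Longrightarrow> hadd (ev a)"
  unfolding ev_def[abs_def] by (rule hadd_compose[OF hadd_c0 hadd_shift])

lemma ev_mult: "fps_nth a 0 = 0 \<Longrightarrow> reg F \<Longrightarrow> reg H \<Longrightarrow> ev a (F * H) = ev a F * ev a H"
  by (simp add: ev_def shift_mult c0_mult reg_shift)

lemma ev_hconst: "fps_nth a 0 = 0 \<Longrightarrow> ev a (hconst b) = b"
  by (simp add: ev_def shift_hconst c0_hconst)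

lemma ev_hconst_mult: "fps_nth a 0 = 0 \<Longrightarrow> ev a (hconst b * F) = b * ev a F"
  by (simp add: ev_def shift_mult shift_hconst c0_hconst_mult)

lemma ev_shift: "fps_nth a 0 = 0 \<Longrightarrow> fps_nth b 0 = 0 \<Longrightarrow> ev a (shift b F) = ev (a + b) F"
  by (simp add: ev_def shift_shift)

lemma ev_reflc: "fps_nth a 0 = 0 \<Longrightarrow> ev a (reflc F) = ev (- a) F"
  using reflc_shift[of "- a" F] c0_reflc[of "shift (- a) F"] by (simp add: ev_def)

lemma ev_appl_fls: assumes "fps_nth a 0 = 0" shows "ev a (appl_fls \<phi> x) = appl (\<lambda>w. ev a (\<phi> w)) x"
proof (rule cmod_eqI[OF hadd_compose[OF hadd_ev[OF assms] hadd_appl_fls] hadd_appl])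
  fix s c
  show "ev a (appl_fls \<phi> (fps_const (Poly_Mapping.single s c))) = appl (\<lambda>w. ev a (\<phi> w)) (fps_const (Poly_Mapping.single s c))"
    unfolding appl_fls_single appl_single hconst_fps_const[symmetric] by (rule ev_hconst_mult[OF assms])
qed

subsection \<open>Expansion in two variables\<close>

text \<open>The Taylor coefficients of \<open>F(w + u - v)\<close>, the outer series variable being u.\<close>

definition TT :: "'k::field_char_0 fls fps \<Rightarrow> 'k fls fps fps fps"
  where "TT F = Abs_fps (\<lambda>l. Abs_fps (\<lambda>m. (- 1) ^ m * dd m (dd l F)))"

lemma TT_nth: "fps_nth (fps_nth (TT F) l) m = (- 1) ^ m * dd m (dd l F)"
  by (simp add: TT_def)

lemma TT_add: "TT (F + H) = TT F + TT H"
  by (rule fps_ext, rule fps_ext) (simp add: TT_nth hadd_add[OF hadd_dd] algebra_simps)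

lemma TT_0: "TT 0 = 0"
  by (rule fps_ext, rule fps_ext) (simp add: TT_nth hadd_0[OF hadd_dd])

lemma TT_sum: "TT (\<Sum>i\<in>A. f i) = (\<Sum>i\<in>A. TT (f i))"
  by (induction A rule: infinite_finite_induct) (simp_all add: TT_0 TT_add)

lemma TT_mult: "TT (F * H) = TT F * TT H"
proof (rule fps_ext, rule fps_ext)
  fix l m
  have "fps_nth (fps_nth (TT (F * H)) l) m =
      (\<Sum>i\<le>l. \<Sum>j\<le>m. (- 1) ^ m * (dd j (dd i F) * dd (m - j) (dd (l - i) H)))"
    by (simp add: TT_nth dd_mult hadd_sum[OF hadd_dd] sum_distrib_left)
  also have "\<dots> = (\<Sum>i\<le>l. \<Sum>j\<le>m. ((- 1) ^ j * dd j (dd i F)) * ((- 1) ^ (m - j) * dd (m - j) (dd (l - i) H)))"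
  proof (intro sum.cong[OF refl])
    fix i j assume "j \<in> {..m}"
    hence "(- 1) ^ m = ((- 1) ^ j * (- 1) ^ (m - j) :: 'a fls fps)" by (simp flip: power_add)
    thus "(- 1) ^ m * (dd j (dd i F) * dd (m - j) (dd (l - i) H)) =
        ((- 1) ^ j * dd j (dd i F)) * ((- 1) ^ (m - j) * dd (m - j) (dd (l - i) H))" by (simp add: mult_ac)
  qed
  also have "\<dots> = fps_nth (fps_nth (TT F * TT H) l) m"
    by (simp add: fps_mult_nth fps_sum_nth TT_nth atLeast0AtMost)
  finally show "fps_nth (fps_nth (TT (F * H)) l) m = fps_nth (fps_nth (TT F * TT H) l) m" .
qed

lemma TT_1: "TT 1 = 1"
proof (rule fps_ext, rule fps_ext)
  fix l m
  have "dd m (dd l (hconst 1)) = (if l = 0 \<and> m = 0 then 1 else 0)"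
    by (cases "l = 0"; cases "m = 0") (simp_all add: dd_hconst hadd_0[OF hadd_dd] del: hconst_1, simp_all)
  thus "fps_nth (fps_nth (TT 1) l) m = fps_nth (fps_nth 1 l) m" by (auto simp: TT_nth)
qed

lemma sum_swap4: "(\<Sum>a\<in>A. \<Sum>b\<in>B. \<Sum>c\<in>C. \<Sum>d\<in>D. f a b c d) = (\<Sum>c\<in>C. \<Sum>d\<in>D. \<Sum>a\<in>A. \<Sum>b\<in>B. f a b c d)"
proof -
  have "(\<Sum>a\<in>A. \<Sum>b\<in>B. \<Sum>c\<in>C. \<Sum>d\<in>D. f a b c d) = (\<Sum>a\<in>A. \<Sum>c\<in>C. \<Sum>d\<in>D. \<Sum>b\<in>B. f a b c d)"
    by (intro sum.cong[OF refl], subst sum.swap) (intro sum.cong[OF refl] sum.swap)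
  also have "\<dots> = (\<Sum>c\<in>C. \<Sum>d\<in>D. \<Sum>a\<in>A. \<Sum>b\<in>B. f a b c d)"
    by (subst sum.swap) (intro sum.cong[OF refl] sum.swap)
  finally show ?thesis .
qed

subsection \<open>Four-index tensors\<close>

lemma tmul_assoc: "tmul N (tmul N X Y) Z a b c d = tmul N X (tmul N Y Z) a b c d"
  unfolding tmul_def sum_distrib_left sum_distrib_right mult.assoc by (rule sum_swap4)

lemma teq_refl: "teq N X X" by (simp add: teq_def)
lemma teq_sym: "teq N X Y \<Longrightarrow> teq N Y X" by (simp add: teq_def)
lemma teq_trans [trans]: "teq N X Y \<Longrightarrow> teq N Y Z \<Longrightarrow> teq N X Z" by (simp add: teq_def)

lemma tmul_cong: "teq N X X' \<Longrightarrow> teq N Y Y' \<Longrightarrow> teq N (tmul N X Y) (tmul N X' Y')"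
  by (simp add: teq_def tmul_def)

lemma tid_alt: "tid a b c d = (if c = a then if d = b then 1 else 0 else (0::'a::zero_neq_one))"
  by (auto simp: tid_def)

lemma if_zero_mult: "(if P then x else (0::'a::semiring_1)) * y = (if P then x * y else 0)"
  "y * (if P then x else 0) = (if P then y * x else 0)"
  by simp_all

lemma sum_if_const: "(\<Sum>q\<in>A. if P then f q else 0) = (if P then \<Sum>q\<in>A. f q else 0)"
  by simp

lemma tmul_tid_left: "teq N (tmul N tid X) (X :: 'a::comm_ring_1 tmat)"
  unfolding teq_def tmul_def tid_alt by (auto simp: if_zero_mult sum_if_const cong: if_cong)

lemma tmul_tid_right: "teq N (tmul N X tid) (X :: 'a::comm_ring_1 tmat)"
proof -
  have e: "tid p q c d = (if p = c then if q = d then 1 else 0 else (0::'a))" for p q c d by (auto simp: tid_def)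
  show ?thesis unfolding teq_def tmul_def e by (auto simp: if_zero_mult sum_if_const cong: if_cong)
qed

text \<open>A left inverse equals a right inverse. All values of a pairing on letters of
  \<open>T^-1\<close> are identified in this way, by exhibiting two inverses of one tensor.\<close>

lemma tinverse_unique:
  fixes X :: "'a::comm_ring_1 tmat"
  assumes "teq N (tmul N Y X) tid" "teq N (tmul N X Z) tid" shows "teq N Y Z"
proof -
  have "teq N Y (tmul N Y tid)" by (rule teq_sym[OF tmul_tid_right])
  also have "teq N \<dots> (tmul N Y (tmul N X Z))" by (rule tmul_cong[OF teq_refl teq_sym[OF assms(2)]])
  also have "teq N \<dots> (tmul N (tmul N Y X) Z)" by (simp add: teq_def tmul_assoc)
  also have "teq N \<dots> (tmul N tid Z)" by (rule tmul_cong[OF assms(1) teq_refl])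
  also have "teq N \<dots> Z" by (rule tmul_tid_left)
  finally show ?thesis .
qed

lemma transp1_transp1 [simp]: "transp1 (transp1 X) = X" and transp2_transp2 [simp]: "transp2 (transp2 X) = X"
  by (intro ext, simp add: transp1_def transp2_def)+

lemma teq_transp1: "teq N (transp1 X) (transp1 Y) \<longleftrightarrow> teq N X Y"
  and teq_transp2: "teq N (transp2 X) (transp2 Y) \<longleftrightarrow> teq N X Y"
  unfolding teq_def transp1_def transp2_def by blast+

text \<open>Total transposition reverses products, which turns \<open>transp1\<close> into \<open>transp2\<close>.\<close>

lemma tmul_transp12:
  fixes X Y :: "'a::comm_ring_1 tmat"
  assumes "teq N (tmul N (transp1 X) (transp1 Y)) tid"
  shows "teq N (tmul N (transp2 Y) (transp2 X)) tid"
  unfolding teq_def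
proof (intro allI impI)
  fix a b c d assume "a < N" "b < N" "c < N" "d < N"
  hence "tmul N (transp1 X) (transp1 Y) c d a b = tid c d a b" using assms by (simp add: teq_def)
  thus "tmul N (transp2 Y) (transp2 X) a b c d = tid a b c d"
    by (auto simp: tmul_def transp1_def transp2_def tid_def mult.commute)
qed

subsection \<open>Pairings and their values on generators\<close>

text \<open>The properties of B expanded at one point, stated abstractly so that its reflected and
  shifted copies satisfy them too. Products in the second argument come out in reversed
  order.\<close>

definition pairing :: "nat \<Rightarrow> (gen0 word, 'k) cmod set \<Rightarrow> (gen0 word \<Rightarrow> gen0 word \<Rightarrow> 'k::field_char_0 fls fps) \<Rightarrow> bool"
  where "pairing N J \<beta> \<longleftrightarrow>
    (\<forall>u v w. \<beta> (u + v) w = swee N (\<lambda>w1 w2. \<beta> u w1 * \<beta> v w2) w) \<and>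
    (\<forall>u v w. \<beta> u (v + w) = swee N (\<lambda>u1 u2. \<beta> u1 w * \<beta> u2 v) u) \<and>
    (\<forall>x\<in>J. \<forall>w. appl_fls (\<lambda>v. \<beta> v w) x = 0 \<and> appl_fls (\<lambda>v. \<beta> w v) x = 0) \<and>
    (\<forall>w. \<beta> 0 w = cu N w \<and> \<beta> w 0 = cu N w)"

lemma pairing_left: "pairing N J \<beta> \<Longrightarrow> \<beta> (u + v) w = swee N (\<lambda>w1 w2. \<beta> u w1 * \<beta> v w2) w"
  and pairing_right: "pairing N J \<beta> \<Longrightarrow> \<beta> u (v + w) = swee N (\<lambda>u1 u2. \<beta> u1 w * \<beta> u2 v) u"
  and pairing_kill: "pairing N J \<beta> \<Longrightarrow> x \<in> J \<Longrightarrow> appl_fls (\<lambda>v. \<beta> v w) x = 0" "pairing N J \<beta> \<Longrightarrow> x \<in> J \<Longrightarrow> appl_fls (\<beta> w) x = 0"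
  and pairing_0: "pairing N J \<beta> \<Longrightarrow> \<beta> 0 w = cu N w" "pairing N J \<beta> \<Longrightarrow> \<beta> w 0 = cu N w"
  unfolding pairing_def by blast+

text \<open>Isolates the relations that make \<open>T^-1\<close> the inverse matrix and discard
  indices out of range; they determine a pairing on \<open>T^-1\<close> from its values on
  T.\<close>

definition unit_ideal :: "nat \<Rightarrow> (gen0 word, 'k::field_char_0) cmod set \<Rightarrow> bool"
  where "unit_ideal N J \<longleftrightarrow> (\<exists>Y. J = closed_ideal (range_rels N T0 \<union> range_rels N T0' \<union> inverse_rels N T0 T0' \<union> inverse_rels N T0' T0 \<union> Y))"

text \<open>Lets the relations \<open>T T^-1 = 1\<close> and \<open>T^-1 T = 1\<close> be treated by
  one argument.\<close>

definition gen_pair :: "(nat \<Rightarrow> nat \<Rightarrow> nat \<Rightarrow> gen0) \<Rightarrow> (nat \<Rightarrow> nat \<Rightarrow> nat \<Rightarrow> gen0) \<Rightarrow> bool"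
  where "gen_pair \<kappa> \<kappa>' \<longleftrightarrow> (\<kappa>, \<kappa>') \<in> {(Tc, Tic), (Tic, Tc)}"

lemma unit_ideal_csub: "unit_ideal N J \<Longrightarrow> csub J"
  unfolding unit_ideal_def using csub_closed_ideal by blast

lemma unit_ideal_mult: "unit_ideal N J \<Longrightarrow> x \<in> J \<Longrightarrow> a * x * b \<in> J"
  unfolding unit_ideal_def using closed_ideal_mult by blast

lemma unit_ideal_mult_left: "unit_ideal N J \<Longrightarrow> x \<in> J \<Longrightarrow> a * x \<in> J"
  and unit_ideal_mult_right: "unit_ideal N J \<Longrightarrow> x \<in> J \<Longrightarrow> x * b \<in> J"
  using unit_ideal_mult[of N J x a 1] unit_ideal_mult[of N J x 1 b] by simp_all

lemma basis_letter: "basis (Word [g]) = fps_const (letter g)"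
  by (simp add: basis_def letter_def)

lemma basis_append: "basis (u + v :: 's::monoid_add) = basis u * (basis v :: ('s, 'k::comm_ring_1) cmod)"
  by (simp add: basis_mult)

lemma fps_const_sum': "fps_const (\<Sum>i\<in>A. f i) = (\<Sum>i\<in>A. fps_const (f i :: 'a::ab_group_add))"
  by (induction A rule: infinite_finite_induct) (simp_all add: fps_const_add' del: fps_const_add)

lemma closed_ideal_mem: "x \<in> X \<Longrightarrow> x \<in> closed_ideal X"
  using closed_ideal_superset[of X] by (rule subsetD)

lemma unit_ideal_inverse:
  assumes J: "unit_ideal N J" and "gen_pair \<kappa> \<kappa>'" "a < N" "c < N"
  shows "(\<Sum>b<N. \<Sum>l\<le>m. basis (Word [\<kappa> a b l] + Word [\<kappa>' b c (m - l)])) - (if a = c \<and> m = 0 then 1 else 0) \<in> J"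
proof -
  obtain Y where Y: "J = closed_ideal (range_rels N T0 \<union> range_rels N T0' \<union> inverse_rels N T0 T0' \<union> inverse_rels N T0' T0 \<union> Y)"
    using J unfolding unit_ideal_def by blast
  have e: "fps_const ((\<Sum>b<N. \<Sum>l\<le>m. letter (\<kappa> a b l) * letter (\<kappa>' b c (m - l))) - (if a = c \<and> m = 0 then 1 else 0))
    = (\<Sum>b<N. \<Sum>l\<le>m. basis (Word [\<kappa> a b l] + Word [\<kappa>' b c (m - l)]) :: (gen0 word, 'a) cmod) - (if a = c \<and> m = 0 then 1 else 0)"
    by (auto simp: basis_append basis_letter fps_const_sum' simp flip: fps_const_sub)
  have "fps_const ((\<Sum>b<N. \<Sum>l\<le>m. letter (\<kappa> a b l) * letter (\<kappa>' b c (m - l))) - (if a = c \<and> m = 0 then 1 else 0))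
      \<in> inverse_rels N T0 T0' \<union> inverse_rels N T0' (T0 :: (gen0, 'a) mser)"
  proof (cases "\<kappa> = Tc")
    case True
    hence "\<kappa>' = Tic" using assms(2) by (auto simp: gen_pair_def fun_eq_iff)
    thus ?thesis unfolding True inverse_rels_def T0_def T0'_def using assms(3,4) by blast
  next
    case False
    hence "\<kappa> = Tic" "\<kappa>' = Tc" using assms(2) by (auto simp: gen_pair_def)
    thus ?thesis unfolding inverse_rels_def T0_def T0'_def using assms(3,4) by blast
  qed
  thus ?thesis unfolding Y e[symmetric] by (intro closed_ideal_mem) blast
qed

lemma unit_ideal_range:
  assumes J: "unit_ideal N J" and "\<not> valid N w" shows "basis w \<in> J"
proof -
  obtain Y where Y: "J = closed_ideal (range_rels N T0 \<union> range_rels N T0' \<union> inverse_rels N T0 T0' \<union> inverse_rels N T0' T0 \<union> Y)"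
    using J unfolding unit_ideal_def by blast
  obtain g where g: "g \<in> set (letters w)" "\<not> valid_gen N g" using assms(2) by (auto simp: valid_def)
  then obtain us vs where "letters w = us @ g # vs" by (meson split_list)
  hence w: "w = Word us + Word [g] + Word vs" by (cases w) (simp add: plus_word_def)
  have "basis (Word [g]) \<in> range_rels N T0 \<union> range_rels N (T0' :: (gen0, 'a) mser)"
  proof (cases g)
    case (Tc a b m)
    thus ?thesis using g(2) unfolding range_rels_def T0_def basis_letter
      by (intro UnI1 CollectI exI[of _ a] exI[of _ b] exI[of _ m]) auto
  next
    case (Tic a b m)
    thus ?thesis using g(2) unfolding range_rels_def T0'_def basis_letter
      by (intro UnI2 CollectI exI[of _ a] exI[of _ b] exI[of _ m]) auto
  qed
  hence "basis (Word [g]) \<in> J" unfolding Y by (intro closed_ideal_mem) blast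
  thus ?thesis unfolding w basis_append by (rule unit_ideal_mult[OF J])
qed

lemma pairing_null:
  assumes "unit_ideal N J" "pairing N J \<beta>"
  shows "\<not> valid N u \<Longrightarrow> \<beta> u w = 0" "\<not> valid N u \<Longrightarrow> \<beta> w u = 0"
  using pairing_kill[OF assms(2) unit_ideal_range[OF assms(1)], of u w] by simp_all

definition flip2 :: "('x \<Rightarrow> 'x \<Rightarrow> 'y) \<Rightarrow> 'x \<Rightarrow> 'x \<Rightarrow> 'y" where "flip2 f x y = f y x"

text \<open>Generating function of the values on two generators, as an operator on
  \<open>k^N \<otimes> k^N\<close>; the outer series variable belongs to the first argument, the
  inner one to the second. Combined with \<open>flip2\<close>, the second argument of the form
  occupies the first tensor factor, as in \<open>R^21\<close>.\<close>

definition tens4 :: "(gen0 word \<Rightarrow> gen0 word \<Rightarrow> 'b) \<Rightarrow> (nat \<Rightarrow> nat \<Rightarrow> nat \<Rightarrow> gen0) \<Rightarrow> (nat \<Rightarrow> nat \<Rightarrow> nat \<Rightarrow> gen0) \<Rightarrow> 'b::zero fps fps tmat"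
  where "tens4 \<beta> \<kappa> \<mu> a b c d = Abs_fps (\<lambda>l. Abs_fps (\<lambda>m. \<beta> (Word [\<kappa> a c l]) (Word [\<mu> b d m])))"

lemma tens4_nth [simp]: "fps_nth (fps_nth (tens4 \<beta> \<kappa> \<mu> a b c d) l) m = \<beta> (Word [\<kappa> a c l]) (Word [\<mu> b d m])"
  by (simp add: tens4_def)

lemma teq_nthI:
  assumes "\<And>a b c d l m. a < N \<Longrightarrow> b < N \<Longrightarrow> c < N \<Longrightarrow> d < N \<Longrightarrow> fps_nth (fps_nth (X a b c d) l) m = fps_nth (fps_nth (Y a b c d) l) m"
  shows "teq N X Y"
  unfolding teq_def by (intro allI impI, rule fps_ext, rule fps_ext) (use assms in auto)

lemma teq_nthD: "teq N X Y \<Longrightarrow> a < N \<Longrightarrow> b < N \<Longrightarrow> c < N \<Longrightarrow> d < N \<Longrightarrow> fps_nth (fps_nth (X a b c d) l) m = fps_nth (fps_nth (Y a b c d) l) m"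
  by (simp add: teq_def)

lemma tid_nth: "fps_nth (fps_nth (tid a b c d) l) m = (if a = c \<and> b = d \<and> l = 0 \<and> m = 0 then 1 else (0 :: 'a::comm_ring_1))"
  by (auto simp: tid_def)

lemma fps_nth2_mult: "fps_nth (fps_nth (F * H) l) m = (\<Sum>i\<le>l. \<Sum>j\<le>m. fps_nth (fps_nth F i) j * fps_nth (fps_nth H (l - i)) (m - j))"
  for F H :: "'a::comm_ring_1 fps fps"
  by (simp add: fps_mult_nth fps_sum_nth atLeast0AtMost)

lemma tmul_nth: "fps_nth (fps_nth (tmul N X Y a b c d) l) m =
    (\<Sum>p<N. \<Sum>i\<le>l. \<Sum>q<N. \<Sum>j\<le>m. fps_nth (fps_nth (X a b p q) i) j * fps_nth (fps_nth (Y p q c d) (l - i)) (m - j))"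
  for X Y :: "'a::comm_ring_1 fps fps tmat"
  by (simp add: tmul_def fps_sum_nth fps_nth2_mult) (intro sum.cong[OF refl] sum.swap)

lemma sum_rev: "(\<Sum>l\<le>(m::nat). f l (m - l)) = (\<Sum>l\<le>m. f (m - l) l)"
  by (rule sum.reindex_bij_witness[where i = "\<lambda>l. m - l" and j = "\<lambda>l. m - l"]) auto

lemma sum_rev2: "(\<Sum>j\<le>(k::nat). \<Sum>l\<le>(m::nat). f j l (k - j) (m - l)) = (\<Sum>j\<le>k. \<Sum>l\<le>m. f (k - j) (m - l) j l)"
  by (subst sum_rev) (intro sum.cong[OF refl] sum_rev)

lemma pairing_inverse_left:
  assumes "unit_ideal N (J :: (gen0 word, 'a::field_char_0) cmod set)" "pairing N J \<beta>" "gen_pair \<kappa> \<kappa>'" "a < N" "c < N"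
  shows "(\<Sum>b<N. \<Sum>l\<le>m. swee N (\<lambda>w1 w2. \<beta> (Word [\<kappa> a b l]) w1 * \<beta> (Word [\<kappa>' b c (m - l)]) w2) w)
    = (if a = c \<and> m = 0 then cu N w else 0)"
proof -
  let ?s = "\<Sum>b<N. \<Sum>l\<le>m. basis (Word [\<kappa> a b l] + Word [\<kappa>' b c (m - l)]) :: (gen0 word, 'a) cmod"
  have "appl_fls (\<lambda>v. \<beta> v w) (?s - (if a = c \<and> m = 0 then 1 else 0)) = 0"
    by (rule pairing_kill(1)[OF assms(2) unit_ideal_inverse[OF assms(1,3-5)]])
  hence "appl_fls (\<lambda>v. \<beta> v w) ?s = appl_fls (\<lambda>v. \<beta> v w) (if a = c \<and> m = 0 then basis 0 else 0)"
    by (simp only: hadd_diff[OF hadd_appl_fls] right_minus_eq basis_0)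
  also have "\<dots> = (if a = c \<and> m = 0 then cu N w else 0)"
    by (auto simp: pairing_0[OF assms(2)] hadd_0[OF hadd_appl_fls])
  finally show ?thesis
    by (simp only: hadd_sum[OF hadd_appl_fls] appl_fls_basis pairing_left[OF assms(2)])
qed

lemma pairing_inverse_right:
  assumes "unit_ideal N (J :: (gen0 word, 'a::field_char_0) cmod set)" "pairing N J \<beta>" "gen_pair \<kappa> \<kappa>'" "a < N" "c < N"
  shows "(\<Sum>b<N. \<Sum>l\<le>m. swee N (\<lambda>w1 w2. \<beta> w1 (Word [\<kappa>' b c (m - l)]) * \<beta> w2 (Word [\<kappa> a b l])) w)
    = (if a = c \<and> m = 0 then cu N w else 0)"
proof -
  let ?s = "\<Sum>b<N. \<Sum>l\<le>m. basis (Word [\<kappa> a b l] + Word [\<kappa>' b c (m - l)]) :: (gen0 word, 'a) cmod"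
  have "appl_fls (\<beta> w) (?s - (if a = c \<and> m = 0 then 1 else 0)) = 0"
    by (rule pairing_kill(2)[OF assms(2) unit_ideal_inverse[OF assms(1,3-5)]])
  hence "appl_fls (\<beta> w) ?s = appl_fls (\<beta> w) (if a = c \<and> m = 0 then basis 0 else 0)"
    by (simp only: hadd_diff[OF hadd_appl_fls] right_minus_eq basis_0)
  also have "\<dots> = (if a = c \<and> m = 0 then cu N w else 0)"
    by (auto simp: pairing_0[OF assms(2)] hadd_0[OF hadd_appl_fls])
  finally show ?thesis
    by (simp only: hadd_sum[OF hadd_appl_fls] appl_fls_basis pairing_right[OF assms(2)])
qed

context
  fixes N J \<beta> \<kappa> \<kappa>'
  assumes J: "unit_ideal N J" and \<beta>: "pairing N J \<beta>" and \<kappa>: "gen_pair \<kappa> \<kappa>'"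
begin

text \<open>Here and in the next lemmas the relation between T and its inverse in one argument is
  paired with a letter in the other. The coproduct of a \<open>Tc\<close> letter gives ordinary
  products, that of a \<open>Tic\<close> letter reversed ones in its tensor factor; the reversal is
  absorbed by a partial transposition. The second argument of a pairing contributes one more
  reversal.\<close>

lemma tens4_left_Tc: "teq N (tmul N (tens4 \<beta> \<kappa> Tc) (tens4 \<beta> \<kappa>' Tc)) tid"
proof (rule teq_nthI)
  fix a e c f m k assume "a < N" "e < N" "c < N" "f < N"
  thus "fps_nth (fps_nth (tmul N (tens4 \<beta> \<kappa> Tc) (tens4 \<beta> \<kappa>' Tc) a e c f) m) k = fps_nth (fps_nth (tid a e c f) m) k"
    using pairing_inverse_left[OF J \<beta> \<kappa>, of a c m "Word [Tc e f k]"]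
    by (auto simp: tmul_nth tid_nth cu_Tc)
qed

lemma tens4_left_Tic: "teq N (tmul N (transp2 (tens4 \<beta> \<kappa> Tic)) (transp2 (tens4 \<beta> \<kappa>' Tic))) tid"
proof (rule teq_nthI)
  fix a f c e m k assume "a < N" "f < N" "c < N" "e < N"
  thus "fps_nth (fps_nth (tmul N (transp2 (tens4 \<beta> \<kappa> Tic)) (transp2 (tens4 \<beta> \<kappa>' Tic)) a f c e) m) k = fps_nth (fps_nth (tid a f c e) m) k"
    using pairing_inverse_left[OF J \<beta> \<kappa>, of a c m "Word [Tic e f k]"]
    by (auto simp: tmul_nth tid_nth cu_Tic transp2_def)
qed

lemma tens4_right_Tc: "teq N (tmul N (transp2 (tens4 \<beta> Tc \<kappa>')) (transp2 (tens4 \<beta> Tc \<kappa>))) tid"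
proof (rule teq_nthI)
  fix e c f a k m assume "e < N" "c < N" "f < N" "a < N"
  have "fps_nth (fps_nth (tmul N (transp2 (tens4 \<beta> Tc \<kappa>')) (transp2 (tens4 \<beta> Tc \<kappa>)) e c f a) k) m
      = (\<Sum>q<N. \<Sum>j\<le>k. \<Sum>b<N. \<Sum>l\<le>m. \<beta> (Word [Tc e q j]) (Word [\<kappa>' b c (m - l)]) * \<beta> (Word [Tc q f (k - j)]) (Word [\<kappa> a b l]))"
    unfolding tmul_nth transp2_def tens4_nth
    by (rule sum.cong[OF refl], rule sum.cong[OF refl], rule sum.cong[OF refl], rule sum_rev)
  also have "\<dots> = (\<Sum>b<N. \<Sum>l\<le>m. \<Sum>q<N. \<Sum>j\<le>k. \<beta> (Word [Tc e q j]) (Word [\<kappa>' b c (m - l)]) * \<beta> (Word [Tc q f (k - j)]) (Word [\<kappa> a b l]))"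
    by (rule sum_swap4)
  finally show "fps_nth (fps_nth (tmul N (transp2 (tens4 \<beta> Tc \<kappa>')) (transp2 (tens4 \<beta> Tc \<kappa>)) e c f a) k) m = fps_nth (fps_nth (tid e c f a) k) m"
    using pairing_inverse_right[OF J \<beta> \<kappa>, of a c m "Word [Tc e f k]"] \<open>a < N\<close> \<open>c < N\<close> \<open>e < N\<close>
    by (auto simp: tid_nth cu_Tc)
qed

lemma tens4_flip_left_Tc: "teq N (tmul N (transp1 (tens4 (flip2 \<beta>) \<kappa>' Tc)) (transp1 (tens4 (flip2 \<beta>) \<kappa> Tc))) tid"
proof (rule teq_nthI)
  fix c e a f m k assume "c < N" "e < N" "a < N" "f < N"
  have "fps_nth (fps_nth (tmul N (transp1 (tens4 (flip2 \<beta>) \<kappa>' Tc)) (transp1 (tens4 (flip2 \<beta>) \<kappa> Tc)) c e a f) m) k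
      = (\<Sum>b<N. \<Sum>l\<le>m. \<Sum>q<N. \<Sum>j\<le>k. \<beta> (Word [Tc e q j]) (Word [\<kappa>' b c (m - l)]) * \<beta> (Word [Tc q f (k - j)]) (Word [\<kappa> a b l]))"
    unfolding tmul_nth transp1_def tens4_nth flip2_def by (rule sum.cong[OF refl]) (rule sum_rev)
  thus "fps_nth (fps_nth (tmul N (transp1 (tens4 (flip2 \<beta>) \<kappa>' Tc)) (transp1 (tens4 (flip2 \<beta>) \<kappa> Tc)) c e a f) m) k = fps_nth (fps_nth (tid c e a f) m) k"
    using pairing_inverse_right[OF J \<beta> \<kappa>, of a c m "Word [Tc e f k]"] \<open>a < N\<close> \<open>c < N\<close> \<open>e < N\<close>
    by (auto simp: tid_nth cu_Tc)
qed

lemma tens4_flip_right_Tc: "teq N (tmul N (tens4 (flip2 \<beta>) Tc \<kappa>) (tens4 (flip2 \<beta>) Tc \<kappa>')) tid"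
proof (rule teq_nthI)
  fix e a f c k m assume "e < N" "a < N" "f < N" "c < N"
  have "fps_nth (fps_nth (tmul N (tens4 (flip2 \<beta>) Tc \<kappa>) (tens4 (flip2 \<beta>) Tc \<kappa>') e a f c) k) m
      = (\<Sum>q<N. \<Sum>j\<le>k. \<Sum>b<N. \<Sum>l\<le>m. \<beta> (Word [\<kappa> a b l]) (Word [Tc e q j]) * \<beta> (Word [\<kappa>' b c (m - l)]) (Word [Tc q f (k - j)]))"
    unfolding tmul_nth tens4_nth flip2_def ..
  also have "\<dots> = (\<Sum>b<N. \<Sum>l\<le>m. \<Sum>q<N. \<Sum>j\<le>k. \<beta> (Word [\<kappa> a b l]) (Word [Tc e q j]) * \<beta> (Word [\<kappa>' b c (m - l)]) (Word [Tc q f (k - j)]))"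
    by (rule sum_swap4)
  finally show "fps_nth (fps_nth (tmul N (tens4 (flip2 \<beta>) Tc \<kappa>) (tens4 (flip2 \<beta>) Tc \<kappa>') e a f c) k) m = fps_nth (fps_nth (tid e a f c) k) m"
    using pairing_inverse_left[OF J \<beta> \<kappa>, of a c m "Word [Tc e f k]"] \<open>a < N\<close> \<open>c < N\<close> \<open>e < N\<close>
    by (auto simp: tid_nth cu_Tc)
qed

lemma tens4_flip_right_Tic: "teq N (tmul N (transp1 (tens4 (flip2 \<beta>) Tic \<kappa>)) (transp1 (tens4 (flip2 \<beta>) Tic \<kappa>'))) tid"
proof (rule teq_nthI)
  fix f a e c k m assume "f < N" "a < N" "e < N" "c < N"
  have "fps_nth (fps_nth (tmul N (transp1 (tens4 (flip2 \<beta>) Tic \<kappa>)) (transp1 (tens4 (flip2 \<beta>) Tic \<kappa>')) f a e c) k) m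
      = (\<Sum>q<N. \<Sum>j\<le>k. \<Sum>b<N. \<Sum>l\<le>m. \<beta> (Word [\<kappa> a b l]) (Word [Tic q f j]) * \<beta> (Word [\<kappa>' b c (m - l)]) (Word [Tic e q (k - j)]))"
    unfolding tmul_nth tens4_nth flip2_def transp1_def ..
  also have "\<dots> = (\<Sum>b<N. \<Sum>l\<le>m. \<Sum>q<N. \<Sum>j\<le>k. \<beta> (Word [\<kappa> a b l]) (Word [Tic q f j]) * \<beta> (Word [\<kappa>' b c (m - l)]) (Word [Tic e q (k - j)]))"
    by (rule sum_swap4)
  finally show "fps_nth (fps_nth (tmul N (transp1 (tens4 (flip2 \<beta>) Tic \<kappa>)) (transp1 (tens4 (flip2 \<beta>) Tic \<kappa>')) f a e c) k) m = fps_nth (fps_nth (tid f a e c) k) m"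
    using pairing_inverse_left[OF J \<beta> \<kappa>, of a c m "Word [Tic e f k]"] \<open>a < N\<close> \<open>c < N\<close> \<open>e < N\<close>
    by (auto simp: tid_nth cu_Tic)
qed

end

lemma cu_pair:
  assumes "\<kappa> = Tc \<or> \<kappa> = Tic" "\<mu> = Tc \<or> \<mu> = Tic" "a < N" "b < N"
  shows "cu N (Word [\<kappa> a c k]) * cu N (Word [\<mu> b d m]) = (if a = c \<and> b = d \<and> k = 0 \<and> m = 0 then 1 else (0::'a::comm_ring_1))"
  using assms by (auto simp: cu_Tc cu_Tic)

lemma gen_pairs [simp]: "gen_pair Tc Tic" "gen_pair Tic Tc"
  by (simp_all add: gen_pair_def)

subsection \<open>Unitarity and crossing for generators\<close>

text \<open>Hopf form of \<open>R(u) R^21(-u) = 1\<close>, with \<open>\<beta>'\<close> playing the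
  role of the form at the opposite spectral parameter.\<close>

definition unitary :: "nat \<Rightarrow> (gen0 word \<Rightarrow> gen0 word \<Rightarrow> 'a) \<Rightarrow> (gen0 word \<Rightarrow> gen0 word \<Rightarrow> 'a::comm_ring_1) \<Rightarrow> gen0 word \<Rightarrow> gen0 word \<Rightarrow> bool"
  where "unitary N \<beta> \<beta>' g y \<longleftrightarrow> swee N (\<lambda>g1 g2. swee N (\<lambda>y1 y2. \<beta> g1 y1 * \<beta>' y2 g2) y) g = cu N g * cu N y"

text \<open>Differs from \<open>unitary\<close> by the opposite coproduct in g. On T-letters this
  becomes invertibility after a partial transposition, which is the crossing symmetry of the
  R-matrix.\<close>

definition crossing :: "nat \<Rightarrow> (gen0 word \<Rightarrow> gen0 word \<Rightarrow> 'a) \<Rightarrow> (gen0 word \<Rightarrow> gen0 word \<Rightarrow> 'a::comm_ring_1) \<Rightarrow> gen0 word \<Rightarrow> gen0 word \<Rightarrow> bool"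
  where "crossing N \<beta> \<beta>' g y \<longleftrightarrow> swee N (\<lambda>g1 g2. swee N (\<lambda>y1 y2. \<beta> g2 y1 * \<beta>' y2 g1) y) g = cu N g * cu N y"

context
  fixes N J \<beta> \<beta>'
  assumes J: "unit_ideal N J" and \<beta>: "pairing N J \<beta>" and \<beta>': "pairing N J \<beta>'"
begin

text \<open>Invariance of the form under the antipode in both arguments: after the second
  transposition, the tensors on (\<open>Tic\<close>, \<open>Tic\<close>) and on (\<open>Tc\<close>,
  \<open>Tc\<close>) are both inverse to the one on (\<open>Tc\<close>, \<open>Tic\<close>).\<close>

lemma tens4_TicTic: "teq N (tens4 \<beta> Tic Tic) (tens4 \<beta> Tc Tc)"
  using tinverse_unique[OF tens4_left_Tic[OF J \<beta> gen_pairs(2)] tens4_right_Tc[OF J \<beta> gen_pairs(1)]]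
  by (simp add: teq_transp2)

lemma tens4_flip_TicTic: "teq N (tens4 (flip2 \<beta>') Tic Tic) (tens4 (flip2 \<beta>') Tc Tc)"
  using tinverse_unique[OF tens4_flip_right_Tic[OF J \<beta>' gen_pairs(2)] tens4_flip_left_Tc[OF J \<beta>' gen_pairs(1)]]
  by (simp add: teq_transp1)

lemma unitary_TicTc:
  assumes "teq N (tmul N (tens4 \<beta> Tc Tc) (tens4 (flip2 \<beta>') Tc Tc)) tid"
  shows "teq N (tens4 \<beta> Tic Tc) (tens4 (flip2 \<beta>') Tc Tc)"
  by (rule tinverse_unique[OF tens4_left_Tc[OF J \<beta> gen_pairs(2)] assms])

lemma crossing_TcTic:
  assumes "teq N (tmul N (transp1 (tens4 (flip2 \<beta>') Tc Tc)) (transp1 (tens4 \<beta> Tc Tc))) tid"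
  shows "teq N (tens4 \<beta> Tc Tic) (tens4 (flip2 \<beta>') Tc Tc)"
  using tinverse_unique[OF tens4_right_Tc[OF J \<beta> gen_pairs(1)] tmul_transp12[OF assms]]
  by (simp add: teq_transp2)

lemma invalid_letter_swee:
  assumes "\<not> valid_gen N g \<or> \<not> valid_gen N y"
  shows "unitary N \<beta> \<beta>' (Word [g]) (Word [y])" "crossing N \<beta> \<beta>' (Word [g]) (Word [y])"
proof -
  note null = pairing_null[OF J \<beta>] pairing_null[OF J \<beta>']
  have cu: "(cu N (Word [g]) * cu N (Word [y]) :: 'a fls fps) = 0"
    using assms nullf_cu[of N, where 'a = "'a fls fps"] by (auto simp: nullf_def)
  show "unitary N \<beta> \<beta>' (Word [g]) (Word [y])"
  proof (cases "valid_gen N g")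
    case True
    hence "(\<lambda>g1 g2. swee N (\<lambda>y1 y2. \<beta> g1 y1 * \<beta>' y2 g2) (Word [y])) = (\<lambda>g1 g2. 0)"
      using assms by (intro ext swee_null) (auto simp: null)
    thus ?thesis unfolding unitary_def cu by (simp only: swee_zero_fun)
  next
    case False
    have "swee N (\<lambda>g1 g2. swee N (\<lambda>y1 y2. \<beta> g1 y1 * \<beta>' y2 g2) (Word [y])) (Word [g]) = 0"
    proof (rule swee_null)
      fix x z assume "\<not> valid N x \<or> \<not> valid N z"
      hence "(\<lambda>y1 y2. \<beta> x y1 * \<beta>' y2 z) = (\<lambda>y1 y2. 0)" by (auto simp: null)
      thus "swee N (\<lambda>y1 y2. \<beta> x y1 * \<beta>' y2 z) (Word [y]) = 0" by (simp only: swee_zero_fun)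
    qed (use False in simp)
    thus ?thesis unfolding unitary_def cu .
  qed
  show "crossing N \<beta> \<beta>' (Word [g]) (Word [y])"
  proof (cases "valid_gen N g")
    case True
    hence "(\<lambda>g1 g2. swee N (\<lambda>y1 y2. \<beta> g2 y1 * \<beta>' y2 g1) (Word [y])) = (\<lambda>g1 g2. 0)"
      using assms by (intro ext swee_null) (auto simp: null)
    thus ?thesis unfolding crossing_def cu by (simp only: swee_zero_fun)
  next
    case False
    have "swee N (\<lambda>g1 g2. swee N (\<lambda>y1 y2. \<beta> g2 y1 * \<beta>' y2 g1) (Word [y])) (Word [g]) = 0"
    proof (rule swee_null)
      fix x z assume "\<not> valid N x \<or> \<not> valid N z"
      hence "(\<lambda>y1 y2. \<beta> z y1 * \<beta>' y2 x) = (\<lambda>y1 y2. 0)" by (auto simp: null)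
      thus "swee N (\<lambda>y1 y2. \<beta> z y1 * \<beta>' y2 x) (Word [y]) = 0" by (simp only: swee_zero_fun)
    qed (use False in simp)
    thus ?thesis unfolding crossing_def cu .
  qed
qed

text \<open>The hypothesis concerns T-letters only. It identifies each mixed tensor of one form with
  a known tensor of the other, so the remaining three types of letters reduce to inverse relations
  already available.\<close>

lemma unitary_letter:
  assumes u: "teq N (tmul N (tens4 \<beta> Tc Tc) (tens4 (flip2 \<beta>') Tc Tc)) tid"
  shows "unitary N \<beta> \<beta>' (Word [g]) (Word [y])"
proof (cases "valid_gen N g \<and> valid_gen N y")
  case True
  let ?t = "tens4 \<beta>" and ?s = "tens4 (flip2 \<beta>')"
  note b = unitary_TicTc[OF u]
  have rev: "teq N (tmul N (?s Tc Tc) (?t Tc Tc)) tid"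
    by (rule teq_trans[OF tmul_cong[OF teq_sym[OF b] teq_refl] tens4_left_Tc[OF J \<beta> gen_pairs(2)]])
  have c': "teq N (?t Tc Tc) (?s Tc Tic)"
    by (rule tinverse_unique[OF u tens4_flip_right_Tc[OF J \<beta>' gen_pairs(1)]])
  have TicTc: "teq N (tmul N (transp1 (?t Tic Tc)) (transp1 (?s Tic Tc))) tid"
    by (rule teq_trans[OF tmul_cong[OF _ teq_refl] tens4_flip_left_Tc[OF J \<beta>' gen_pairs(2)]])
       (simp add: teq_transp1 b)
  have TcTic: "teq N (tmul N (transp2 (?t Tc Tic)) (transp2 (?s Tc Tic))) tid"
    by (rule teq_trans[OF tmul_cong[OF teq_refl] tens4_right_Tc[OF J \<beta> gen_pairs(1)]])
       (simp add: teq_transp2 teq_sym[OF c'])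
  have TicTic: "teq N (tmul N (?s Tic Tic) (?t Tic Tic)) tid"
    by (rule teq_trans[OF tmul_cong[OF tens4_flip_TicTic tens4_TicTic] rev])
  show ?thesis
  proof (cases g; cases y)
    fix a c k b d m assume *: "g = Tc a c k" "y = Tc b d m"
    thus ?thesis using teq_nthD[OF u, of a b c d k m] True *
      by (auto simp: unitary_def tmul_nth tid_nth flip2_def transp1_def transp2_def cu_pair simp del: mult_eq_if cong: if_cong)
  next
    fix a c k b d m assume *: "g = Tic a c k" "y = Tc b d m"
    thus ?thesis using teq_nthD[OF TicTc, of c b a d k m] True *
      by (auto simp: unitary_def tmul_nth tid_nth flip2_def transp1_def transp2_def cu_pair simp del: mult_eq_if cong: if_cong)
  next
    fix a c k b d m assume *: "g = Tc a c k" "y = Tic b d m"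
    thus ?thesis using teq_nthD[OF TcTic, of a d c b k m] True *
      by (auto simp: unitary_def tmul_nth tid_nth flip2_def transp1_def transp2_def cu_pair simp del: mult_eq_if cong: if_cong)
  next
    fix a c k b d m assume *: "g = Tic a c k" "y = Tic b d m"
    have "swee N (\<lambda>g1 g2. swee N (\<lambda>y1 y2. \<beta> g1 y1 * \<beta>' y2 g2) (Word [y])) (Word [g])
      = (\<Sum>p<N. \<Sum>j\<le>k. \<Sum>q<N. \<Sum>l\<le>m. \<beta>' (Word [Tic b q (m - l)]) (Word [Tic a p (k - j)]) * \<beta> (Word [Tic p c j]) (Word [Tic q d l]))"
      by (simp add: * mult.commute)
    also have "\<dots> = (\<Sum>p<N. \<Sum>q<N. \<Sum>j\<le>k. \<Sum>l\<le>m. \<beta>' (Word [Tic b q (m - l)]) (Word [Tic a p (k - j)]) * \<beta> (Word [Tic p c j]) (Word [Tic q d l]))"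
      by (rule sum.cong[OF refl], rule sum.swap)
    also have "\<dots> = (\<Sum>p<N. \<Sum>q<N. \<Sum>j\<le>k. \<Sum>l\<le>m. \<beta>' (Word [Tic b q l]) (Word [Tic a p j]) * \<beta> (Word [Tic p c (k - j)]) (Word [Tic q d (m - l)]))"
      by (rule sum.cong[OF refl], rule sum.cong[OF refl])
         (rule sum_rev2[where f = "\<lambda>j l j' l'. \<beta>' (Word [Tic b _ l']) (Word [Tic a _ j']) * \<beta> (Word [Tic _ c j]) (Word [Tic _ d l])"])
    also have "\<dots> = (\<Sum>p<N. \<Sum>j\<le>k. \<Sum>q<N. \<Sum>l\<le>m. \<beta>' (Word [Tic b q l]) (Word [Tic a p j]) * \<beta> (Word [Tic p c (k - j)]) (Word [Tic q d (m - l)]))"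
      by (rule sum.cong[OF refl], rule sum.swap)
    finally show ?thesis using teq_nthD[OF TicTic, of a b c d k m] True *
      by (auto simp: unitary_def tmul_nth tid_nth flip2_def transp1_def transp2_def cu_pair simp del: mult_eq_if cong: if_cong)
  qed
qed (use invalid_letter_swee in blast)

text \<open>Same scheme as for unitarity. Both orders of the product are assumed because the
  partially transposed tensors are used as left and as right inverses.\<close>

lemma crossing_letter:
  assumes u: "teq N (tmul N (transp1 (tens4 \<beta> Tc Tc)) (transp1 (tens4 (flip2 \<beta>') Tc Tc))) tid"
    and u': "teq N (tmul N (transp1 (tens4 (flip2 \<beta>') Tc Tc)) (transp1 (tens4 \<beta> Tc Tc))) tid"
  shows "crossing N \<beta> \<beta>' (Word [g]) (Word [y])"
proof (cases "valid_gen N g \<and> valid_gen N y")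
  case True
  let ?t = "tens4 \<beta>" and ?s = "tens4 (flip2 \<beta>')"
  note c = crossing_TcTic[OF u']
  have b': "teq N (?s Tic Tc) (?t Tc Tc)"
    using tinverse_unique[OF tens4_flip_left_Tc[OF J \<beta>' gen_pairs(1)] u'] by (simp add: teq_transp1)
  have TicTc: "teq N (tmul N (?t Tic Tc) (?s Tic Tc)) tid"
    by (rule teq_trans[OF tmul_cong[OF teq_refl b'] tens4_left_Tc[OF J \<beta> gen_pairs(2)]])
  have TcTic: "teq N (tmul N (?s Tc Tic) (?t Tc Tic)) tid"
    by (rule teq_trans[OF tmul_cong[OF teq_refl c] tens4_flip_right_Tc[OF J \<beta>' gen_pairs(2)]])
  have TicTic: "teq N (tmul N (transp2 (?t Tic Tic)) (transp2 (?s Tic Tic))) tid"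
    by (rule teq_trans[OF tmul_cong tmul_transp12[OF u']])
       (simp_all add: teq_transp2 tens4_TicTic tens4_flip_TicTic)
  show ?thesis
  proof (cases g; cases y)
    fix a c k b d m assume *: "g = Tc a c k" "y = Tc b d m"
    have "swee N (\<lambda>g1 g2. swee N (\<lambda>y1 y2. \<beta> g2 y1 * \<beta>' y2 g1) (Word [y])) (Word [g])
      = (\<Sum>p<N. \<Sum>j\<le>k. \<Sum>q<N. \<Sum>l\<le>m. \<beta> (Word [Tc p c j]) (Word [Tc b q l]) * \<beta>' (Word [Tc q d (m - l)]) (Word [Tc a p (k - j)]))"
      unfolding * swee_letter swee_gen.simps by (rule sum.cong[OF refl], rule sum_rev)
    thus ?thesis using teq_nthD[OF u, of c b a d k m] True *
      by (auto simp: crossing_def tmul_nth tid_nth flip2_def transp1_def transp2_def cu_pair simp del: mult_eq_if cong: if_cong)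
  next
    fix a c k b d m assume *: "g = Tic a c k" "y = Tc b d m"
    have "swee N (\<lambda>g1 g2. swee N (\<lambda>y1 y2. \<beta> g2 y1 * \<beta>' y2 g1) (Word [y])) (Word [g])
      = (\<Sum>p<N. \<Sum>j\<le>k. \<Sum>q<N. \<Sum>l\<le>m. \<beta> (Word [Tic a p j]) (Word [Tc b q l]) * \<beta>' (Word [Tc q d (m - l)]) (Word [Tic p c (k - j)]))"
      unfolding * swee_letter swee_gen.simps by (rule sum.cong[OF refl], rule sum_rev)
    thus ?thesis using teq_nthD[OF TicTc, of a b c d k m] True *
      by (auto simp: crossing_def tmul_nth tid_nth flip2_def transp1_def transp2_def cu_pair simp del: mult_eq_if cong: if_cong)
  next
    fix a c k b d m assume *: "g = Tc a c k" "y = Tic b d m"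
    have "swee N (\<lambda>g1 g2. swee N (\<lambda>y1 y2. \<beta> g2 y1 * \<beta>' y2 g1) (Word [y])) (Word [g])
      = (\<Sum>p<N. \<Sum>j\<le>k. \<Sum>q<N. \<Sum>l\<le>m. \<beta>' (Word [Tic b q (m - l)]) (Word [Tc a p j]) * \<beta> (Word [Tc p c (k - j)]) (Word [Tic q d l]))"
      by (simp add: * mult.commute)
    also have "\<dots> = (\<Sum>p<N. \<Sum>j\<le>k. \<Sum>q<N. \<Sum>l\<le>m. \<beta>' (Word [Tic b q l]) (Word [Tc a p j]) * \<beta> (Word [Tc p c (k - j)]) (Word [Tic q d (m - l)]))"
      by (rule sum.cong[OF refl], rule sum.cong[OF refl], rule sum.cong[OF refl], rule sum_rev[symmetric])
    finally show ?thesis using teq_nthD[OF TcTic, of a b c d k m] True *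
      by (auto simp: crossing_def tmul_nth tid_nth flip2_def transp1_def transp2_def cu_pair simp del: mult_eq_if cong: if_cong)
  next
    fix a c k b d m assume *: "g = Tic a c k" "y = Tic b d m"
    have "swee N (\<lambda>g1 g2. swee N (\<lambda>y1 y2. \<beta> g2 y1 * \<beta>' y2 g1) (Word [y])) (Word [g])
      = (\<Sum>p<N. \<Sum>j\<le>k. \<Sum>q<N. \<Sum>l\<le>m. \<beta> (Word [Tic a p j]) (Word [Tic q d l]) * \<beta>' (Word [Tic b q (m - l)]) (Word [Tic p c (k - j)]))"
      unfolding * swee_letter swee_gen.simps by (rule sum.cong[OF refl], rule sum_rev)
    thus ?thesis using teq_nthD[OF TicTic, of a d c b k m] True *
      by (auto simp: crossing_def tmul_nth tid_nth flip2_def transp1_def transp2_def cu_pair simp del: mult_eq_if cong: if_cong)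
  qed
qed (use invalid_letter_swee in blast)

end

subsection \<open>Unitarity and crossing for words\<close>

lemma swee_gen_cong:
  assumes "\<And>g1 g2. \<Psi> (Word [g1]) (Word [g2]) = \<Psi>' (Word [g1]) (Word [g2])"
  shows "swee_gen N \<Psi> g = swee_gen N \<Psi>' g"
  by (cases g) (simp_all add: assms)

text \<open>The coproduct of a letter involves letters only, so the middle functional of a triple
  convolution is evaluated on letters only. Therefore hypotheses about letters suffice when the
  other argument is extended.\<close>

lemma conv_middle_cong:
  assumes "\<And>x. M (Word [x]) = M' (Word [x])"
  shows "conv N A (conv N M B) (Word [g]) = conv N A (conv N M' B) (Word [g])"
  unfolding conv_def swee_letter by (intro swee_gen_cong) (simp add: assms cong: swee_gen_cong)

lemma conv_swee_middle:
  "conv N A (conv N (\<lambda>x. swee M (\<lambda>s1 s2. F s1 s2 x) u) B) g = swee M (\<lambda>s1 s2. conv N A (conv N (F s1 s2) B) g) u"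
proof -
  have "conv N (\<lambda>x. swee M (\<lambda>s1 s2. F s1 s2 x) u) B = (\<lambda>w. swee M (\<lambda>s1 s2. conv N (F s1 s2) B w) u)"
    by (rule ext, rule conv_swee_left)
  thus ?thesis by (simp only: conv_swee_right)
qed

lemma conv_cu_middle:
  assumes "nullf N B" shows "conv N A (conv N (\<lambda>x. c * cu N x) B) g = c * conv N A B g"
proof -
  have "conv N (\<lambda>x. c * cu N x) B = (\<lambda>w. c * B w)"
    by (rule ext) (simp add: conv_mult_left conv_cu_left[OF assms])
  thus ?thesis by (simp only: conv_mult_right)
qed

lemma unitary_conv: "unitary N \<beta> \<beta>' g y \<longleftrightarrow> swee N (\<lambda>y1 y2. conv N (\<lambda>g. \<beta> g y1) (\<beta>' y2) g) y = cu N g * cu N y"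
  unfolding unitary_def conv_def by (subst swee_Fubini) (rule refl)

lemma unitary_conv': "unitary N \<beta> \<beta>' g y \<longleftrightarrow> swee N (\<lambda>g1 g2. conv N (\<beta> g1) (\<lambda>y. \<beta>' y g2) y) g = cu N g * cu N y"
  unfolding unitary_def conv_def ..

lemma crossing_conv: "crossing N \<beta> \<beta>' g y \<longleftrightarrow> swee N (\<lambda>y1 y2. conv N (\<beta>' y2) (\<lambda>g. \<beta> g y1) g) y = cu N g * cu N y"
  unfolding crossing_def conv_def by (subst swee_Fubini) (simp only: mult.commute)

lemma crossing_conv': "crossing N \<beta> \<beta>' g y \<longleftrightarrow> swee N (\<lambda>g1 g2. conv N (\<beta> g2) (\<lambda>y. \<beta>' y g1) y) g = cu N g * cu N y"
  unfolding crossing_def conv_def ..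

lemma swee_mult_const: "swee N (\<lambda>x y. c * \<Psi> x y) w = c * swee N \<Psi> w" for c :: "'a::comm_ring_1"
  by (simp add: swee_mult_left)

lemma pairing_0': "pairing N J \<beta> \<Longrightarrow> \<beta> 0 = cu N" "pairing N J \<beta> \<Longrightarrow> (\<lambda>g. \<beta> g 0) = cu N"
  by (auto simp: pairing_0)

context
  fixes N J \<beta>
  assumes J: "unit_ideal N J" and \<beta>: "pairing N J \<beta>"
begin

lemma conv_right_append: "(\<lambda>g. \<beta> g (v + w)) = conv N (\<lambda>g. \<beta> g w) (\<lambda>g. \<beta> g v)"
  by (rule ext) (simp add: conv_def pairing_right[OF \<beta>])

lemma conv_left_append: "\<beta> (u + v) = conv N (\<beta> u) (\<beta> v)"
  by (rule ext) (simp add: conv_def pairing_left[OF \<beta>])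

lemma nullf_pairing: "nullf N (\<beta> w)" "nullf N (\<lambda>g. \<beta> g w)"
  using pairing_null[OF J \<beta>] by (auto simp: nullf_def)

end

context
  fixes N J \<beta> \<beta>'
  assumes J: "unit_ideal N J" and \<beta>: "pairing N J \<beta>" and \<beta>': "pairing N J \<beta>'"
begin

lemma conv_assoc4: "conv N (conv N a b) (conv N c d) = conv N a (conv N (conv N b c) d)"
  by (simp add: conv_assoc)

text \<open>Appending to y produces four convolution factors in which the two belonging to u are
  adjacent. They contract to the counit by hypothesis, and the outer two, belonging to v, are
  left.\<close>

lemma unitary_append_right:
  assumes "\<And>x. unitary N \<beta> \<beta>' (Word [x]) u" "unitary N \<beta> \<beta>' (Word [g]) v"
  shows "unitary N \<beta> \<beta>' (Word [g]) (u + v)"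
proof -
  have "swee N (\<lambda>y1 y2. conv N (\<lambda>g. \<beta> g y1) (\<beta>' y2) (Word [g])) (u + v)
      = swee N (\<lambda>y1 y2. swee N (\<lambda>s1 s2. conv N (\<lambda>x. \<beta> x y1) (conv N (conv N (\<lambda>x. \<beta> x s1) (\<beta>' s2)) (\<beta>' y2)) (Word [g])) u) v"
    unfolding swee_append conv_right_append[OF J \<beta>] conv_left_append[OF J \<beta>'] conv_assoc4 by (rule swee_Fubini)
  also have "\<dots> = swee N (\<lambda>y1 y2. conv N (\<lambda>x. \<beta> x y1) (conv N
        (\<lambda>x. swee N (\<lambda>s1 s2. conv N (\<lambda>x. \<beta> x s1) (\<beta>' s2) x) u) (\<beta>' y2)) (Word [g])) v"
    by (simp only: conv_swee_middle)
  also have "\<dots> = swee N (\<lambda>y1 y2. conv N (\<lambda>x. \<beta> x y1) (conv N (\<lambda>x. cu N u * cu N x) (\<beta>' y2)) (Word [g])) v"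
    by (subst conv_middle_cong[where M' = "\<lambda>x. cu N u * cu N x"])
       (use assms(1)[unfolded unitary_conv] in \<open>simp_all add: mult.commute\<close>)
  also have "\<dots> = cu N u * swee N (\<lambda>y1 y2. conv N (\<lambda>x. \<beta> x y1) (\<beta>' y2) (Word [g])) v"
    by (simp add: conv_cu_middle[OF nullf_pairing(1)[OF J \<beta>']] swee_mult_const)
  finally show ?thesis using assms(2) by (simp add: unitary_conv mult_ac)
qed

lemma unitary_0: "unitary N \<beta> \<beta>' g 0" "unitary N \<beta> \<beta>' 0 y"
proof -
  show "unitary N \<beta> \<beta>' g 0"
    unfolding unitary_conv by (simp only: swee_0 pairing_0'[OF \<beta>] pairing_0'[OF \<beta>'] conv_cu_left[OF nullf_cu]) simp
  show "unitary N \<beta> \<beta>' 0 y"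
    unfolding unitary_conv' by (simp only: swee_0 pairing_0'[OF \<beta>] pairing_0'[OF \<beta>'] conv_cu_left[OF nullf_cu]) simp
qed

lemma unitary_append_left:
  assumes "\<And>y. unitary N \<beta> \<beta>' u y" "\<And>y. unitary N \<beta> \<beta>' v y"
  shows "unitary N \<beta> \<beta>' (u + v) y"
proof -
  have "swee N (\<lambda>g1 g2. conv N (\<beta> g1) (\<lambda>y. \<beta>' y g2) y) (u + v)
      = swee N (\<lambda>s1 s2. swee N (\<lambda>g1 g2. conv N (\<beta> s1) (conv N (conv N (\<beta> g1) (\<lambda>y. \<beta>' y g2)) (\<lambda>y. \<beta>' y s2)) y) v) u"
    unfolding swee_append conv_right_append[OF J \<beta>'] conv_left_append[OF J \<beta>] conv_assoc4 ..
  also have "\<dots> = swee N (\<lambda>s1 s2. conv N (\<beta> s1) (conv N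
        (\<lambda>x. swee N (\<lambda>g1 g2. conv N (\<beta> g1) (\<lambda>y. \<beta>' y g2) x) v) (\<lambda>y. \<beta>' y s2)) y) u"
    by (simp only: conv_swee_middle)
  also have "\<dots> = cu N v * swee N (\<lambda>s1 s2. conv N (\<beta> s1) (\<lambda>y. \<beta>' y s2) y) u"
    using assms(2) by (simp add: unitary_conv' conv_cu_middle[OF nullf_pairing(2)[OF J \<beta>']] swee_mult_const)
  finally show ?thesis using assms(1)[of y] by (simp add: unitary_conv' mult_ac)
qed

text \<open>The word y is extended while g stays a letter, as the contraction step for y needs; the
  word g is extended afterwards for arbitrary y.\<close>

lemma unitary_words:
  assumes "\<And>g y. unitary N \<beta> \<beta>' (Word [g]) (Word [y])"
  shows "unitary N \<beta> \<beta>' g y"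
proof -
  have 1: "unitary N \<beta> \<beta>' (Word [g]) y" for g y
    by (induction y arbitrary: g rule: word_induct) (simp_all add: unitary_0 unitary_append_right assms)
  show ?thesis
    by (induction g arbitrary: y rule: word_induct) (simp_all add: unitary_0 unitary_append_left 1)
qed

text \<open>In the opposite coproduct the nesting is reversed: now the factors belonging to v are
  the inner pair.\<close>

lemma crossing_append_right:
  assumes "unitary N \<beta> \<beta>' (Word [g]) 0" "crossing N \<beta> \<beta>' (Word [g]) u" "\<And>x. crossing N \<beta> \<beta>' (Word [x]) v"
  shows "crossing N \<beta> \<beta>' (Word [g]) (u + v)"
proof -
  have "swee N (\<lambda>y1 y2. conv N (\<beta>' y2) (\<lambda>g. \<beta> g y1) (Word [g])) (u + v)
      = swee N (\<lambda>s1 s2. swee N (\<lambda>y1 y2. conv N (\<beta>' s2) (conv N (conv N (\<beta>' y2) (\<lambda>x. \<beta> x y1)) (\<lambda>x. \<beta> x s1)) (Word [g])) v) u"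
    unfolding swee_append conv_right_append[OF J \<beta>] conv_left_append[OF J \<beta>'] conv_assoc4 ..
  also have "\<dots> = swee N (\<lambda>s1 s2. conv N (\<beta>' s2) (conv N
        (\<lambda>x. swee N (\<lambda>y1 y2. conv N (\<beta>' y2) (\<lambda>x. \<beta> x y1) x) v) (\<lambda>x. \<beta> x s1)) (Word [g])) u"
    by (simp only: conv_swee_middle)
  also have "\<dots> = swee N (\<lambda>s1 s2. conv N (\<beta>' s2) (conv N (\<lambda>x. cu N v * cu N x) (\<lambda>x. \<beta> x s1)) (Word [g])) u"
    by (subst conv_middle_cong[where M' = "\<lambda>x. cu N v * cu N x"])
       (use assms(3)[unfolded crossing_conv] in \<open>simp_all add: mult.commute\<close>)
  also have "\<dots> = cu N v * swee N (\<lambda>s1 s2. conv N (\<beta>' s2) (\<lambda>x. \<beta> x s1) (Word [g])) u"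
    by (simp add: conv_cu_middle[OF nullf_pairing(2)[OF J \<beta>]] swee_mult_const)
  finally show ?thesis using assms(2) by (simp add: crossing_conv mult_ac)
qed

lemma crossing_0: "crossing N \<beta> \<beta>' g 0" "crossing N \<beta> \<beta>' 0 y"
proof -
  show "crossing N \<beta> \<beta>' g 0"
    unfolding crossing_conv by (simp only: swee_0 pairing_0'[OF \<beta>] pairing_0'[OF \<beta>'] conv_cu_left[OF nullf_cu]) simp
  show "crossing N \<beta> \<beta>' 0 y"
    unfolding crossing_conv' by (simp only: swee_0 pairing_0'[OF \<beta>] pairing_0'[OF \<beta>'] conv_cu_left[OF nullf_cu]) simp
qed

lemma crossing_append_left:
  assumes "\<And>y. crossing N \<beta> \<beta>' u y" "\<And>y. crossing N \<beta> \<beta>' v y"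
  shows "crossing N \<beta> \<beta>' (u + v) y"
proof -
  have "swee N (\<lambda>g1 g2. conv N (\<beta> g2) (\<lambda>y. \<beta>' y g1) y) (u + v)
      = swee N (\<lambda>g1 g2. swee N (\<lambda>s1 s2. conv N (\<beta> s2) (conv N (conv N (\<beta> g2) (\<lambda>y. \<beta>' y g1)) (\<lambda>y. \<beta>' y s1)) y) u) v"
    unfolding swee_append conv_right_append[OF J \<beta>'] conv_left_append[OF J \<beta>] conv_assoc4 by (rule swee_Fubini)
  also have "\<dots> = swee N (\<lambda>s1 s2. swee N (\<lambda>g1 g2. conv N (\<beta> s2) (conv N (conv N (\<beta> g2) (\<lambda>y. \<beta>' y g1)) (\<lambda>y. \<beta>' y s1)) y) v) u"
    by (rule swee_Fubini)
  also have "\<dots> = swee N (\<lambda>s1 s2. conv N (\<beta> s2) (conv N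
        (\<lambda>x. swee N (\<lambda>g1 g2. conv N (\<beta> g2) (\<lambda>y. \<beta>' y g1) x) v) (\<lambda>y. \<beta>' y s1)) y) u"
    by (simp only: conv_swee_middle)
  also have "\<dots> = cu N v * swee N (\<lambda>s1 s2. conv N (\<beta> s2) (\<lambda>y. \<beta>' y s1) y) u"
    using assms(2) by (simp add: crossing_conv' conv_cu_middle[OF nullf_pairing(2)[OF J \<beta>']] swee_mult_const)
  finally show ?thesis using assms(1)[of y] by (simp add: crossing_conv' mult_ac)
qed

lemma crossing_words:
  assumes "\<And>g y. crossing N \<beta> \<beta>' (Word [g]) (Word [y])"
  shows "crossing N \<beta> \<beta>' g y"
proof -
  have 1: "crossing N \<beta> \<beta>' (Word [g]) y" for g y
    by (induction y arbitrary: g rule: word_induct) (simp_all add: crossing_0 unitary_0 crossing_append_right assms)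
  show ?thesis
    by (induction g arbitrary: y rule: word_induct) (simp_all add: crossing_0 crossing_append_left 1)
qed

end

subsection \<open>Translation automorphisms\<close>

lemma swee_appl_fls_fun: "swee N (\<lambda>x y. appl_fls (\<lambda>s. \<Psi> s x y) X) w = appl_fls (\<lambda>s. swee N (\<Psi> s) w) X"
proof (induction w arbitrary: \<Psi> rule: word_induct)
  case (Cons g w)
  show ?case unfolding swee_Cons Cons by (cases g) (simp_all add: appl_fls_sum_fun)
qed simp

lemma swee_appl_fun: "swee N (\<lambda>x y. appl (\<lambda>s. \<Psi> s x y) X) w = appl (\<lambda>s. swee N (\<Psi> s) w) X"
proof (induction w arbitrary: \<Psi> rule: word_induct)
  case (Cons g w)
  show ?case unfolding swee_Cons Cons by (cases g) (simp_all add: appl_sum_fun)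
qed simp

lemma pairing_mult_left:
  assumes "pairing N J \<beta>"
  shows "appl_fls (\<lambda>v. \<beta> v w) (x * y) = swee N (\<lambda>w1 w2. appl_fls (\<lambda>v. \<beta> v w1) x * appl_fls (\<lambda>v. \<beta> v w2) y) w"
proof -
  have "appl_fls (\<lambda>v. \<beta> v w) (x * y) = appl_fls (\<lambda>u. appl_fls (\<lambda>v. swee N (\<lambda>w1 w2. \<beta> u w1 * \<beta> v w2) w) y) x"
    by (simp add: appl_fls_mult pairing_left[OF assms])
  also have "\<dots> = appl_fls (\<lambda>u. swee N (\<lambda>w1 w2. appl_fls (\<lambda>v. \<beta> u w1 * \<beta> v w2) y) w) x"
    by (simp only: swee_appl_fls_fun)
  also have "\<dots> = swee N (\<lambda>w1 w2. appl_fls (\<lambda>u. appl_fls (\<lambda>v. \<beta> u w1 * \<beta> v w2) y) x) w"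
    by (simp only: swee_appl_fls_fun)
  also have "\<dots> = swee N (\<lambda>w1 w2. appl_fls (\<lambda>v. \<beta> v w1) x * appl_fls (\<lambda>v. \<beta> v w2) y) w"
    by (simp only: appl_fls_mult_fun mult.commute[of _ "appl_fls _ y"])
  finally show ?thesis .
qed

lemma pairing_mult_right:
  assumes "pairing N J \<beta>"
  shows "appl_fls (\<beta> w) (x * y) = swee N (\<lambda>w1 w2. appl_fls (\<beta> w1) y * appl_fls (\<beta> w2) x) w"
proof -
  have "appl_fls (\<beta> w) (x * y) = appl_fls (\<lambda>u. appl_fls (\<lambda>v. swee N (\<lambda>w1 w2. \<beta> w1 v * \<beta> w2 u) w) y) x"
    by (simp add: appl_fls_mult pairing_right[OF assms])
  also have "\<dots> = appl_fls (\<lambda>u. swee N (\<lambda>w1 w2. appl_fls (\<lambda>v. \<beta> w1 v * \<beta> w2 u) y) w) x"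
    by (simp only: swee_appl_fls_fun)
  also have "\<dots> = swee N (\<lambda>w1 w2. appl_fls (\<lambda>u. appl_fls (\<lambda>v. \<beta> w2 u * \<beta> w1 v) y) x) w"
    by (simp only: swee_appl_fls_fun mult.commute)
  also have "\<dots> = swee N (\<lambda>w1 w2. appl_fls (\<beta> w1) y * appl_fls (\<beta> w2) x) w"
    by (simp only: appl_fls_mult_fun mult.commute[of _ "appl_fls _ y"])
  finally show ?thesis .
qed

lemma scal_1: "scal 1 = (1 :: ('s::monoid_add, 'k::comm_ring_1) cmod)"
  by (rule fps_ext) (simp add: scal_def)

lemma scal_mult: "scal (a * b) = scal a * (scal b :: ('s::monoid_add, 'k::comm_ring_1) cmod)"
proof -
  have "scal a * (scal b * 1) = (scal (a * b) * 1 :: ('s, 'k) cmod)" unfolding scal_mult_left by (rule hscale_hscale)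
  thus ?thesis by simp
qed

lemma scal_power: "scal (a ^ k) = (scal a :: ('s::monoid_add, 'k::comm_ring_1) cmod) ^ k"
  by (induction k) (simp_all add: scal_1 scal_mult)

lemma scal_of_nat: "scal (of_nat n) = (of_nat n :: ('s::monoid_add, 'k::comm_ring_1) cmod)"
  by (induction n) (simp_all add: scal_1 hadd_0[OF hadd_scal] hadd_add[OF hadd_scal])

lemma scal_nth_0: "fps_nth a 0 = 0 \<Longrightarrow> fps_nth (scal a) 0 = 0"
  by (simp add: scal_def)

lemma translate_scal: "translate L (scal a) m = hsum (\<lambda>k. hscale (of_nat ((m + k) choose k) * a ^ k) (L (m + k)))"
  unfolding translate_def
  by (simp add: scal_of_nat[symmetric] scal_power[symmetric] scal_mult_left scal_mult_right hscale_hscale mult.commute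
      flip: scal_mult)

lemma hdiv_hscale_power: assumes "fps_nth a 0 = 0" shows "hdiv (\<lambda>k. hscale (f k * a ^ k) (x k))"
  unfolding hdiv_def
proof (intro allI impI)
  fix k l :: nat assume l: "l < k"
  have "fps_nth (f k * a ^ k) j = 0" if "j < k" for j
    using hdiv_mult_power[OF assms, of f] that by (auto simp: hdiv_def)
  thus "fps_nth (hscale (f k * a ^ k) (x k)) l = 0" using l
    using hadd_vanish[OF hadd_hscale_left, of k "f k * a ^ k" l "x k"] by blast
qed

lemma appl_translate:
  assumes "fps_nth a 0 = 0"
  shows "appl f (translate (\<lambda>k. basis (s k)) (scal a) m) = hsum (\<lambda>k. of_nat ((m + k) choose k) * f (s (m + k)) * a ^ k)"
  unfolding translate_scal
  by (subst hadd_hsum(1)[OF hadd_appl hdiv_hscale_power[OF assms]]) (simp add: appl_hscale mult_ac)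

lemma hconst_of_nat: "hconst (of_nat n) = (of_nat n :: 'k::field_char_0 fls fps)"
  by (induction n) (simp_all add: hadd_add[OF hadd_hconst])

lemma appl_fls_translate:
  fixes a :: "'k::field_char_0 fps"
  assumes "fps_nth a 0 = 0"
  shows "appl_fls f (translate (\<lambda>k. basis (s k)) (scal a) m) = hsum (\<lambda>k. of_nat ((m + k) choose k) * f (s (m + k)) * hconst a ^ k)"
  unfolding translate_scal
  by (subst hadd_hsum(1)[OF hadd_appl_fls hdiv_hscale_power[OF assms]])
     (simp add: appl_fls_hscale hconst_mult hconst_power hconst_of_nat mult_ac)

lemma dd_shift_sum:
  assumes "\<And>k. f (s k) = dd k F0"
  shows "hsum (\<lambda>k. of_nat ((m + k) choose k) * f (s (m + k)) * hconst a ^ k) = shift a (f (s m))"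
  unfolding shift_alt by (simp add: assms dd_dd_binomial)

lemma minus_one_power_const: "dd k ((- 1) ^ m * F) = (- 1) ^ m * dd k F"
  by (cases "even m") (simp_all add: hadd_minus[OF hadd_dd])

text \<open>The second argument enters through \<open>u - v\<close>, so its coefficients are divided
  derivatives with alternating signs, and translating v by a shifts the spectral variable by
  -a.\<close>

lemma dd_shift_sum':
  assumes "\<And>k. f (s k) = (- 1) ^ k * dd k F0"
  shows "hsum (\<lambda>k. of_nat ((m + k) choose k) * f (s (m + k)) * hconst a ^ k) = shift (- a) (f (s m))"
proof -
  have "of_nat ((m + k) choose k) * f (s (m + k)) * hconst a ^ k = dd k (f (s m)) * hconst (- a) ^ k" for k
    by (cases "even k") (simp_all add: assms dd_dd_binomial minus_one_power_const power_add hconst_minus)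
  thus ?thesis unfolding shift_alt by simp
qed

definition tauw :: "'k::field_char_0 fps \<Rightarrow> gen0 word \<Rightarrow> (gen0 word, 'k) cmod"
  where "tauw a w = prod_list (map (tau0_gen a) (letters w))"

lemma tauw_simps [simp]: "tauw a 0 = 1" "tauw a (u + v) = tauw a u * tauw a v" "tauw a (Word [g]) = tau0_gen a g"
  by (simp_all add: tauw_def)

lemma tau0_lin: "tau0 a = lin (tauw a)"
  unfolding tau0_def tauw_def by (rule refl)

text \<open>The first argument of a pairing depends on \<open>u\<close> only through the sum of \<open>u\<close> and the spectral variable.\<close>

definition transl_left :: "(gen0 word \<Rightarrow> gen0 word \<Rightarrow> 'k::field_char_0 fls fps) \<Rightarrow> gen0 word \<Rightarrow> bool"
  where "transl_left \<beta> y \<longleftrightarrow> (\<forall>\<kappa> a b l. \<kappa> = Tc \<or> \<kappa> = Tic \<longrightarrow> \<beta> (Word [\<kappa> a b l]) y = dd l (\<beta> (Word [\<kappa> a b 0]) y))"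

definition transl_right :: "(gen0 word \<Rightarrow> gen0 word \<Rightarrow> 'k::field_char_0 fls fps) \<Rightarrow> gen0 word \<Rightarrow> bool"
  where "transl_right \<beta> y \<longleftrightarrow> (\<forall>\<kappa> a b l. \<kappa> = Tc \<or> \<kappa> = Tic \<longrightarrow> \<beta> y (Word [\<kappa> a b l]) = (- 1) ^ l * dd l (\<beta> y (Word [\<kappa> a b 0])))"

lemma dd_cu: "dd l (cu N w) = (if l = 0 then cu N w else 0)"
  using dd_hconst[of l 1] dd_hconst[of l 0] by (auto simp: cu_def)

lemma transl_left_append:
  assumes \<beta>: "pairing N J \<beta>" and v: "transl_left \<beta> v" and w: "transl_left \<beta> w"
  shows "transl_left \<beta> (v + w)"
  unfolding transl_left_def
proof (intro allI impI)
  fix \<kappa> a c l assume "\<kappa> = Tc \<or> \<kappa> = Tic"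
  thus "\<beta> (Word [\<kappa> a c l]) (v + w) = dd l (\<beta> (Word [\<kappa> a c 0]) (v + w))"
  proof
    assume [simp]: "\<kappa> = Tc"
    have "\<beta> (Word [Tc a c l]) (v + w) = (\<Sum>b<N. \<Sum>i\<le>l. \<beta> (Word [Tc a b i]) w * \<beta> (Word [Tc b c (l - i)]) v)"
      by (simp add: pairing_right[OF \<beta>])
    also have "\<dots> = (\<Sum>b<N. \<Sum>i\<le>l. dd i (\<beta> (Word [Tc a b 0]) w) * dd (l - i) (\<beta> (Word [Tc b c 0]) v))"
      using v w unfolding transl_left_def by (intro sum.cong refl arg_cong2[where f = "(*)"]) blast+
    also have "\<dots> = dd l (\<beta> (Word [Tc a c 0]) (v + w))"
      by (simp add: pairing_right[OF \<beta>] hadd_sum[OF hadd_dd] dd_mult)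
    finally show ?thesis by simp
  next
    assume [simp]: "\<kappa> = Tic"
    have "\<beta> (Word [Tic a c l]) (v + w) = (\<Sum>b<N. \<Sum>i\<le>l. \<beta> (Word [Tic b c i]) w * \<beta> (Word [Tic a b (l - i)]) v)"
      by (simp add: pairing_right[OF \<beta>])
    also have "\<dots> = (\<Sum>b<N. \<Sum>i\<le>l. dd i (\<beta> (Word [Tic b c 0]) w) * dd (l - i) (\<beta> (Word [Tic a b 0]) v))"
      using v w unfolding transl_left_def by (intro sum.cong refl arg_cong2[where f = "(*)"]) blast+
    also have "\<dots> = dd l (\<beta> (Word [Tic a c 0]) (v + w))"
      by (simp add: pairing_right[OF \<beta>] hadd_sum[OF hadd_dd] dd_mult)
    finally show ?thesis by simp
  qed
qed

lemma sign_dd_mult: "(- 1) ^ l * dd l (F * H) = (\<Sum>i\<le>l. ((- 1) ^ i * dd i F) * ((- 1) ^ (l - i) * dd (l - i) H))"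
  unfolding dd_mult sum_distrib_left
proof (rule sum.cong[OF refl])
  fix i assume "i \<in> {..l}"
  hence "(- 1) ^ l = ((- 1) ^ i * (- 1) ^ (l - i) :: 'a fls fps)" by (simp flip: power_add)
  thus "(- 1) ^ l * (dd i F * dd (l - i) H) = ((- 1) ^ i * dd i F) * ((- 1) ^ (l - i) * dd (l - i) H)" by (simp add: mult_ac)
qed

lemma sum_sign_dd: "(\<Sum>b\<in>A. \<Sum>i\<le>l. ((- 1) ^ i * dd i (F b)) * ((- 1) ^ (l - i) * dd (l - i) (H b))) = (- 1) ^ l * dd l (\<Sum>b\<in>A. F b * H b)"
  unfolding sign_dd_mult[symmetric] hadd_sum[OF hadd_dd] sum_distrib_left ..

lemma transl_right_append:
  assumes \<beta>: "pairing N J \<beta>" and v: "transl_right \<beta> v" and w: "transl_right \<beta> w"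
  shows "transl_right \<beta> (v + w)"
  unfolding transl_right_def
proof (intro allI impI)
  fix \<kappa> a c l assume "\<kappa> = Tc \<or> \<kappa> = Tic"
  thus "\<beta> (v + w) (Word [\<kappa> a c l]) = (- 1) ^ l * dd l (\<beta> (v + w) (Word [\<kappa> a c 0]))"
  proof
    assume [simp]: "\<kappa> = Tc"
    have "\<beta> (v + w) (Word [Tc a c l]) = (\<Sum>b<N. \<Sum>i\<le>l. \<beta> v (Word [Tc a b i]) * \<beta> w (Word [Tc b c (l - i)]))"
      by (simp add: pairing_left[OF \<beta>])
    also have "\<dots> = (\<Sum>b<N. \<Sum>i\<le>l. ((- 1) ^ i * dd i (\<beta> v (Word [Tc a b 0]))) * ((- 1) ^ (l - i) * dd (l - i) (\<beta> w (Word [Tc b c 0]))))"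
      using v w unfolding transl_right_def by (intro sum.cong refl arg_cong2[where f = "(*)"]) blast+
    also have "\<dots> = (- 1) ^ l * dd l (\<beta> (v + w) (Word [Tc a c 0]))"
      unfolding sum_sign_dd by (simp add: pairing_left[OF \<beta>])
    finally show ?thesis by simp
  next
    assume [simp]: "\<kappa> = Tic"
    have "\<beta> (v + w) (Word [Tic a c l]) = (\<Sum>b<N. \<Sum>i\<le>l. \<beta> v (Word [Tic b c i]) * \<beta> w (Word [Tic a b (l - i)]))"
      by (simp add: pairing_left[OF \<beta>])
    also have "\<dots> = (\<Sum>b<N. \<Sum>i\<le>l. ((- 1) ^ i * dd i (\<beta> v (Word [Tic b c 0]))) * ((- 1) ^ (l - i) * dd (l - i) (\<beta> w (Word [Tic a b 0]))))"
      using v w unfolding transl_right_def by (intro sum.cong refl arg_cong2[where f = "(*)"]) blast+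
    also have "\<dots> = (- 1) ^ l * dd l (\<beta> (v + w) (Word [Tic a c 0]))"
      unfolding sum_sign_dd by (simp add: pairing_left[OF \<beta>])
    finally show ?thesis by simp
  qed
qed

lemma transl_words:
  assumes \<beta>: "pairing N J \<beta>"
  shows "(\<And>s. transl_left \<beta> (Word [s])) \<Longrightarrow> transl_left \<beta> y" "(\<And>s. transl_right \<beta> (Word [s])) \<Longrightarrow> transl_right \<beta> y"
proof -
  have "transl_left \<beta> 0" "transl_right \<beta> 0"
    by (auto simp: transl_left_def transl_right_def pairing_0[OF \<beta>] dd_cu cu_Tc cu_Tic)
  thus "(\<And>s. transl_left \<beta> (Word [s])) \<Longrightarrow> transl_left \<beta> y" "(\<And>s. transl_right \<beta> (Word [s])) \<Longrightarrow> transl_right \<beta> y"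
    by (induction y rule: word_induct) (blast intro: transl_left_append[OF \<beta>] transl_right_append[OF \<beta>])+
qed

text \<open>\<open>tauw a\<close> replaces \<open>T(u)\<close> by \<open>T(u - a)\<close>, whence
  the sign. Once letters are known, multiplicativity of the pairing and of \<open>shift\<close>
  extends the statement to words; \<open>tau_right\<close> has the other sign because of
  \<open>u - v\<close>.\<close>

lemma tau_left:
  assumes \<beta>: "pairing N J \<beta>" and tr: "\<And>y. transl_left \<beta> y" and a: "fps_nth a 0 = 0"
  shows "appl_fls (\<lambda>w. \<beta> w y) (tauw a x) = shift (- a) (\<beta> x y)"
proof (induction x arbitrary: y rule: word_induct)
  case 0
  have "shift (- a) (cu N y) = cu N y" using a by (auto simp: cu_def shift_1 hadd_0[OF hadd_shift])
  thus ?case by (simp add: pairing_0[OF \<beta>] flip: basis_0)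
next
  case (Cons g x)
  have a': "fps_nth (- a) 0 = 0" using a by simp
  have g: "appl_fls (\<lambda>w. \<beta> w y) (tau0_gen a g) = shift (- a) (\<beta> (Word [g]) y)" for y
  proof (cases g)
    case (Tc i j m)
    show ?thesis unfolding Tc tau0_gen_def gen0.case appl_fls_translate[OF a']
      by (rule dd_shift_sum[where f = "\<lambda>w. \<beta> w y"]) (use tr[of y, unfolded transl_left_def] in blast)
  next
    case (Tic i j m)
    show ?thesis unfolding Tic tau0_gen_def gen0.case appl_fls_translate[OF a']
      by (rule dd_shift_sum[where f = "\<lambda>w. \<beta> w y"]) (use tr[of y, unfolded transl_left_def] in blast)
  qed
  have "appl_fls (\<lambda>w. \<beta> w y) (tauw a (Word [g] + x)) = swee N (\<lambda>y1 y2. shift (- a) (\<beta> (Word [g]) y1) * shift (- a) (\<beta> x y2)) y"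
    unfolding tauw_simps pairing_mult_left[OF \<beta>] g Cons ..
  also have "\<dots> = shift (- a) (\<beta> (Word [g] + x) y)"
    unfolding pairing_left[OF \<beta>] shift_mult[OF a', symmetric]
    by (rule swee_additive[where f = "shift (- a)", symmetric])
       (rule hadd_0[OF hadd_shift[OF a']], rule hadd_add[OF hadd_shift[OF a']])
  finally show ?case .
qed

lemma tau_right:
  assumes \<beta>: "pairing N J \<beta>" and tr: "\<And>y. transl_right \<beta> y" and a: "fps_nth a 0 = 0"
  shows "appl_fls (\<beta> y) (tauw a x) = shift a (\<beta> y x)"
proof (induction x arbitrary: y rule: word_induct)
  case 0
  have "shift a (cu N y) = cu N y" using a by (auto simp: cu_def shift_1 hadd_0[OF hadd_shift])
  thus ?case by (simp add: pairing_0[OF \<beta>] flip: basis_0)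
next
  case (Cons g x)
  have a': "fps_nth (- a) 0 = 0" using a by simp
  have g: "appl_fls (\<beta> y) (tau0_gen a g) = shift a (\<beta> y (Word [g]))" for y
  proof (cases g)
    case (Tc i j m)
    have "hsum (\<lambda>k. of_nat ((m + k) choose k) * \<beta> y (Word [Tc i j (m + k)]) * hconst (- a) ^ k) = shift (- (- a)) (\<beta> y (Word [Tc i j m]))"
      by (rule dd_shift_sum'[where f = "\<beta> y"]) (use tr[of y, unfolded transl_right_def] in blast)
    thus ?thesis unfolding Tc tau0_gen_def gen0.case appl_fls_translate[OF a'] by simp
  next
    case (Tic i j m)
    have "hsum (\<lambda>k. of_nat ((m + k) choose k) * \<beta> y (Word [Tic i j (m + k)]) * hconst (- a) ^ k) = shift (- (- a)) (\<beta> y (Word [Tic i j m]))"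
      by (rule dd_shift_sum'[where f = "\<beta> y"]) (use tr[of y, unfolded transl_right_def] in blast)
    thus ?thesis unfolding Tic tau0_gen_def gen0.case appl_fls_translate[OF a'] by simp
  qed
  have "appl_fls (\<beta> y) (tauw a (Word [g] + x)) = swee N (\<lambda>y1 y2. shift a (\<beta> y1 x) * shift a (\<beta> y2 (Word [g]))) y"
    unfolding tauw_simps pairing_mult_right[OF \<beta>] g Cons ..
  also have "\<dots> = shift a (\<beta> y (Word [g] + x))"
    unfolding pairing_right[OF \<beta>] shift_mult[OF a, symmetric]
    by (rule swee_additive[where f = "shift a", symmetric])
       (rule hadd_0[OF hadd_shift[OF a]], rule hadd_add[OF hadd_shift[OF a]])
  finally show ?case .
qed

section \<open>Matrix identities from the quantum determinant\<close>

definition mm :: "nat \<Rightarrow> (nat \<Rightarrow> nat \<Rightarrow> 'a::comm_ring_1) \<Rightarrow> (nat \<Rightarrow> nat \<Rightarrow> 'a) \<Rightarrow> nat \<Rightarrow> nat \<Rightarrow> 'a"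
  where "mm N A B a c = (\<Sum>q<N. A a q * B q c)"

definition idm :: "nat \<Rightarrow> nat \<Rightarrow> nat \<Rightarrow> 'a::comm_ring_1"
  where "idm N a c = (if a = c \<and> a < N then 1 else 0)"

definition msupp :: "nat \<Rightarrow> (nat \<Rightarrow> nat \<Rightarrow> 'a::zero) \<Rightarrow> bool"
  where "msupp N A \<longleftrightarrow> (\<forall>a c. a \<ge> N \<or> c \<ge> N \<longrightarrow> A a c = 0)"

definition mprod :: "nat \<Rightarrow> (nat \<Rightarrow> nat \<Rightarrow> 'a::comm_ring_1) list \<Rightarrow> nat \<Rightarrow> nat \<Rightarrow> 'a"
  where "mprod N As = foldr (mm N) As (idm N)"

lemma mm_assoc: "mm N (mm N A B) D = mm N A (mm N B D)"
proof (intro ext)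
  fix a c show "mm N (mm N A B) D a c = mm N A (mm N B D) a c"
    unfolding mm_def sum_distrib_left sum_distrib_right mult.assoc by (rule sum.swap)
qed

lemma mm_idm_left: "msupp N A \<Longrightarrow> mm N (idm N) A = A"
proof (intro ext)
  fix a c assume A: "msupp N A"
  have "mm N (idm N) A a c = (\<Sum>q<N. if q = a then A a c else 0)"
    unfolding mm_def by (rule sum.cong) (auto simp: idm_def)
  thus "mm N (idm N) A a c = A a c" using A by (auto simp: msupp_def)
qed

lemma mm_idm_right: "msupp N A \<Longrightarrow> mm N A (idm N) = A"
proof (intro ext)
  fix a c assume A: "msupp N A"
  have "mm N A (idm N) a c = (\<Sum>q<N. if q = c then A a c else 0)"
    unfolding mm_def by (rule sum.cong) (auto simp: idm_def)
  thus "mm N A (idm N) a c = A a c" using A by (auto simp: msupp_def)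
qed

lemma msupp_idm: "msupp N (idm N)" by (auto simp: msupp_def idm_def)
lemma msupp_mm: "msupp N A \<Longrightarrow> msupp N B \<Longrightarrow> msupp N (mm N A B)" by (auto simp: msupp_def mm_def)
lemma mprod_Nil: "mprod N [] = idm N" and mprod_Cons: "mprod N (A # As) = mm N A (mprod N As)"
  by (simp_all add: mprod_def)

lemma msupp_mprod: "(\<And>A. A \<in> set As \<Longrightarrow> msupp N A) \<Longrightarrow> msupp N (mprod N As)"
  by (induction As) (simp_all add: mprod_Nil mprod_Cons msupp_idm msupp_mm)

lemma mprod_append:
  assumes "\<And>A. A \<in> set Bs \<Longrightarrow> msupp N A"
  shows "mprod N (As @ Bs) = mm N (mprod N As) (mprod N Bs)"
  by (induction As) (simp_all add: mprod_Nil mprod_Cons mm_assoc mm_idm_left msupp_mprod assms)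

lemma mm_sum_left: "mm N (\<lambda>a c. \<Sum>i\<in>I. A i a c) B a c = (\<Sum>i\<in>I. mm N (A i) B a c)"
  unfolding mm_def sum_distrib_right by (rule sum.swap)

lemma mm_sum_right: "mm N A (\<lambda>a c. \<Sum>i\<in>I. B i a c) a c = (\<Sum>i\<in>I. mm N A (B i) a c)"
  unfolding mm_def sum_distrib_left by (rule sum.swap)

lemma mm_scale_left: "mm N (\<lambda>a c. s * A a c) B a c = s * mm N A B a c"
  and mm_scale_right: "mm N A (\<lambda>a c. s * B a c) a c = s * mm N A B a c"
  unfolding mm_def sum_distrib_left by (simp_all add: mult_ac)

definition idx :: "nat \<Rightarrow> nat \<Rightarrow> nat list set" where "idx N m = {I. length I = m \<and> set I \<subseteq> {..<N}}"

lemma idx_Suc: "idx N (Suc m) = (\<lambda>(I, a). I @ [a]) ` (idx N m \<times> {..<N})"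
proof (intro set_eqI iffI)
  fix I assume I: "I \<in> idx N (Suc m)"
  hence "I \<noteq> []" by (auto simp: idx_def)
  hence "I = butlast I @ [last I]" by simp
  moreover have "butlast I \<in> idx N m" "last I < N"
    using I last_in_set[OF \<open>I \<noteq> []\<close>] by (auto simp: idx_def dest: in_set_butlastD)
  ultimately show "I \<in> (\<lambda>(I, a). I @ [a]) ` (idx N m \<times> {..<N})" by force
qed (auto simp: idx_def)

lemma finite_idx: "finite (idx N m)"
  using finite_lists_length_eq[of "{..<N}" m] by (simp add: idx_def conj_commute)

lemma sum_idx_Suc: "(\<Sum>I\<in>idx N (Suc m). f I) = (\<Sum>I\<in>idx N m. \<Sum>a<N. f (I @ [a]))"
proof -
  have "inj_on (\<lambda>(I, a). I @ [a]) (idx N m \<times> {..<N})" by (auto simp: inj_on_def)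
  thus ?thesis unfolding idx_Suc by (simp add: sum.reindex sum.cartesian_product split_def)
qed

lemma idx_0: "idx N 0 = {[]}" by (auto simp: idx_def)

text \<open>The innermost factors \<open>P 0\<close> and \<open>Q 0\<close> meet and are contracted first.\<close>

lemma telescope:
  fixes P Q :: "nat \<Rightarrow> nat \<Rightarrow> nat \<Rightarrow> nat \<Rightarrow> 'a::comm_ring_1"
  assumes PQ: "\<And>r b d. r < m \<Longrightarrow> (\<Sum>a<N. mm N (P r a) (Q r a) b d) = s r * idm N b d"
    and supp: "\<And>r a. msupp N (P r a)" "\<And>r a. msupp N (Q r a)"
  shows "(\<Sum>I\<in>idx N m. mm N (mprod N (map (\<lambda>r. P r (I ! r)) (rev [0..<m]))) (mprod N (map (\<lambda>r. Q r (I ! r)) [0..<m])) b d)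
    = (\<Prod>r<m. s r) * idm N b d"
  using PQ
proof (induction m arbitrary: b d)
  case 0
  show ?case by (simp add: idx_0 mprod_Nil mm_idm_left msupp_idm)
next
  case (Suc m)
  let ?P = "\<lambda>I. mprod N (map (\<lambda>r. P r (I ! r)) (rev [0..<m]))" and ?Q = "\<lambda>I. mprod N (map (\<lambda>r. Q r (I ! r)) [0..<m])"
  have IH: "(\<Sum>I\<in>idx N m. mm N (?P I) (?Q I) b d) = (\<Prod>r<m. s r) * idm N b d" for b d
    using Suc.IH Suc.prems by simp
  have P: "mprod N (map (\<lambda>r. P r ((I @ [a]) ! r)) (rev [0..<Suc m])) = mm N (P m a) (?P I)" if "I \<in> idx N m" for I a
  proof -
    have "map (\<lambda>r. P r ((I @ [a]) ! r)) (rev [0..<m]) = map (\<lambda>r. P r (I ! r)) (rev [0..<m])"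
      using that by (intro map_cong) (auto simp: idx_def nth_append)
    moreover have "(I @ [a]) ! m = a" using that by (simp add: idx_def nth_append)
    ultimately show ?thesis by (simp add: mprod_Cons del: map_eq_conv)
  qed
  have Q: "mprod N (map (\<lambda>r. Q r ((I @ [a]) ! r)) [0..<Suc m]) = mm N (?Q I) (Q m a)" if "I \<in> idx N m" for I a
  proof -
    have "map (\<lambda>r. Q r ((I @ [a]) ! r)) [0..<m] = map (\<lambda>r. Q r (I ! r)) [0..<m]"
      using that by (intro map_cong) (auto simp: idx_def nth_append)
    moreover have "(I @ [a]) ! m = a" using that by (simp add: idx_def nth_append)
    moreover have "mprod N (xs @ [Q m a]) = mm N (mprod N xs) (Q m a)" for xs
      by (subst mprod_append) (auto simp: supp mprod_Cons mprod_Nil mm_idm_right)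
    ultimately show ?thesis by (simp del: map_eq_conv)
  qed
  have "(\<Sum>I\<in>idx N (Suc m). mm N (mprod N (map (\<lambda>r. P r (I ! r)) (rev [0..<Suc m]))) (mprod N (map (\<lambda>r. Q r (I ! r)) [0..<Suc m])) b d)
      = (\<Sum>I\<in>idx N m. \<Sum>a<N. mm N (mm N (P m a) (mm N (?P I) (?Q I))) (Q m a) b d)"
    unfolding sum_idx_Suc by (intro sum.cong refl) (simp only: P Q mm_assoc)
  also have "\<dots> = (\<Sum>a<N. mm N (mm N (P m a) (\<lambda>b d. \<Sum>I\<in>idx N m. mm N (?P I) (?Q I) b d)) (Q m a) b d)"
  proof (subst sum.swap, rule sum.cong[OF refl])
    fix a
    have "mm N (P m a) (\<lambda>b d. \<Sum>I\<in>idx N m. mm N (?P I) (?Q I) b d) = (\<lambda>b d. \<Sum>I\<in>idx N m. mm N (P m a) (mm N (?P I) (?Q I)) b d)"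
      by (intro ext, rule mm_sum_right)
    thus "(\<Sum>I\<in>idx N m. mm N (mm N (P m a) (mm N (?P I) (?Q I))) (Q m a) b d) =
        mm N (mm N (P m a) (\<lambda>b d. \<Sum>I\<in>idx N m. mm N (?P I) (?Q I) b d)) (Q m a) b d"
      by (simp only: mm_sum_left)
  qed
  also have "\<dots> = (\<Sum>a<N. (\<Prod>r<m. s r) * mm N (P m a) (Q m a) b d)"
  proof (rule sum.cong[OF refl])
    fix a
    have "mm N (P m a) (\<lambda>b d. (\<Prod>r<m. s r) * idm N b d) = (\<lambda>b d. (\<Prod>r<m. s r) * P m a b d)"
      by (intro ext) (simp add: mm_scale_right mm_idm_right supp)
    thus "mm N (mm N (P m a) (\<lambda>b d. \<Sum>I\<in>idx N m. mm N (?P I) (?Q I) b d)) (Q m a) b d = (\<Prod>r<m. s r) * mm N (P m a) (Q m a) b d"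
      by (simp only: IH mm_scale_left)
  qed
  also have "\<dots> = (\<Prod>r<Suc m. s r) * idm N b d"
    by (simp add: sum_distrib_left[symmetric] Suc.prems mult.assoc)
  finally show ?case .
qed

subsection \<open>Leading coefficients of products of shifts\<close>

lemma shift_nth_0: "fps_nth (shift a F) 0 = fps_nth F 0"
  by (simp add: shift_nth)

lemma mult_nth_vanish:
  fixes A :: "'a::ring_1 fps"
  assumes "\<And>l. l < n \<Longrightarrow> fps_nth A l = 0"
  shows "fps_nth (A * F) n = fps_nth A n * fps_nth F 0" "l < n \<Longrightarrow> fps_nth (A * F) l = 0"
proof -
  have "fps_nth (A * F) n = (\<Sum>i=0..n. if i = n then fps_nth A n * fps_nth F 0 else 0)"
    unfolding fps_mult_nth by (rule sum.cong) (auto simp: assms)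
  thus "fps_nth (A * F) n = fps_nth A n * fps_nth F 0" by simp
  show "l < n \<Longrightarrow> fps_nth (A * F) l = 0" by (auto simp: fps_mult_nth assms intro!: sum.neutral)
qed

lemma shift_nth_vanish:
  assumes "fps_nth a 0 = 0" "\<And>l. l < n \<Longrightarrow> fps_nth F l = 0"
  shows "fps_nth (shift a F) n = fps_nth F n"
proof -
  have "fps_nth (dd k F * hconst a ^ k) n = 0" if "k > 0" for k
  proof -
    have "fps_nth (dd k F * hconst a ^ k) n = fps_nth (dd k F) n * fps_nth (hconst a ^ k) 0"
      by (rule mult_nth_vanish(1)) (rule hadd_vanish[OF hadd_dd assms(2)])
    also have "fps_nth (hconst a ^ k) 0 = 0" using that assms(1) by (simp add: fps_power_zeroth hconst_nth)
    finally show ?thesis by simp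
  qed
  hence "(\<Sum>k\<le>n. fps_nth (dd k F * hconst a ^ k) n) = (\<Sum>k\<le>n. if k = 0 then fps_nth F n else 0)"
    by (intro sum.cong) auto
  thus ?thesis by (simp add: shift_nth)
qed

lemma prod_shift_nth_0: "fps_nth F 0 = 1 \<Longrightarrow> fps_nth (\<Prod>r<(M::nat). shift (u r) F) 0 = 1"
  by (induction M) (simp_all add: shift_nth_0)

text \<open>A shift by a multiple of h leaves the lowest coefficient of a difference unchanged, and
  all other factors are 1 modulo h. Replacing the M factors one at a time therefore contributes the
  same difference M times.\<close>

lemma prod_shift_diff:
  assumes u: "\<And>r. fps_nth (u r) 0 = 0" and F: "fps_nth F 0 = 1" "fps_nth H 0 = 1"
    and eq: "\<And>l. l < n \<Longrightarrow> fps_nth F l = fps_nth H l"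
  shows "fps_nth ((\<Prod>r<(M::nat). shift (u r) F) - (\<Prod>r<M. shift (u r) H)) n = of_nat M * (fps_nth F n - fps_nth H n) \<and>
    (\<forall>l<n. fps_nth ((\<Prod>r<M. shift (u r) F) - (\<Prod>r<M. shift (u r) H)) l = 0)"
proof (induction M)
  case (Suc M)
  let ?A = "(\<Prod>r<M. shift (u r) F) - (\<Prod>r<M. shift (u r) H)"
  let ?D = "shift (u M) F - shift (u M) H"
  have D: "?D = shift (u M) (F - H)" by (simp add: hadd_diff[OF hadd_shift[OF u]])
  have D0: "fps_nth ?D l = 0" if "l < n" for l
    unfolding D by (rule hadd_vanish[OF hadd_shift[OF u] _ that]) (simp add: eq)
  have Dn: "fps_nth ?D n = fps_nth F n - fps_nth H n"
    unfolding D by (subst shift_nth_vanish[OF u]) (simp_all add: eq)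
  have split: "(\<Prod>r<Suc M. shift (u r) F) - (\<Prod>r<Suc M. shift (u r) H) = ?A * shift (u M) F + ?D * (\<Prod>r<M. shift (u r) H)"
    by (simp add: algebra_simps)
  define A D where "A = ?A" and "D = ?D"
  have A: "fps_nth A n = of_nat M * (fps_nth F n - fps_nth H n)" "\<And>l. l < n \<Longrightarrow> fps_nth A l = 0"
    using Suc by (auto simp: A_def)
  have D: "fps_nth D n = fps_nth F n - fps_nth H n" "\<And>l. l < n \<Longrightarrow> fps_nth D l = 0"
    using Dn D0 by (auto simp: D_def)
  show ?case
    unfolding split A_def[symmetric] D_def[symmetric]
    using mult_nth_vanish[where A = A and n = n, OF A(2)] mult_nth_vanish[where A = D and n = n, OF D(2)]
      mult_nth_vanish(2)[where A = A and n = n, OF A(2)] mult_nth_vanish(2)[where A = D and n = n, OF D(2)]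
    by (simp add: A(1) D(1) shift_nth_0 F prod_shift_nth_0) (simp add: algebra_simps)
qed simp

text \<open>The lowest coefficient in which F differs from 1 would occur M times in the product; in
  characteristic 0 it must vanish.\<close>

lemma prod_shift_eq_1:
  assumes u: "\<And>r. fps_nth (u r) 0 = 0" and F: "fps_nth F 0 = 1" and "M > 0" and one: "(\<Prod>r<(M::nat). shift (u r) F) = 1"
  shows "F = (1 :: 'k::field_char_0 fls fps)"
proof (rule fps_ext)
  fix n show "fps_nth F n = fps_nth 1 n"
  proof (induction n rule: less_induct)
    case (less n)
    have "(\<Prod>r<M. shift (u r) 1) = 1" by (simp add: shift_1 u)
    hence "of_nat M * (fps_nth F n - fps_nth 1 n) = fps_nth (1 - 1) n"
      using prod_shift_diff[of u F 1 n M] u F less one by simp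
    thus ?case using \<open>M > 0\<close> by simp
  qed
qed

text \<open>F is compared with its truncation below order n, which is regular by induction; the
  product difference then exhibits M times the next coefficient of F as regular.\<close>

lemma reg_of_prod_shift:
  assumes u: "\<And>r. fps_nth (u r) 0 = 0" and F: "fps_nth F 0 = 1" and "M > 0" and R: "reg (\<Prod>r<(M::nat). shift (u r) F)"
  shows "reg (F :: 'k::field_char_0 fls fps)"
proof -
  have "\<forall>j<0. fls_nth (fps_nth F n) j = 0" for n
  proof (induction n rule: less_induct)
    case (less n)
    show ?case
    proof (cases "n = 0")
      case False
      let ?H = "fps_cutoff n F"
      have H: "reg ?H" using less by (auto simp: reg_iff)
      have "reg (\<Prod>r<M. shift (u r) ?H)" by (induction M) (simp_all add: reg_mult reg_shift H)
      hence "reg ((\<Prod>r<M. shift (u r) F) - (\<Prod>r<M. shift (u r) ?H))" by (intro reg_diff R)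
      moreover have "fps_nth ((\<Prod>r<M. shift (u r) F) - (\<Prod>r<M. shift (u r) ?H)) n = of_nat M * (fps_nth F n - fps_nth ?H n)"
        using prod_shift_diff[of u F ?H n M] u F False by simp
      ultimately have "\<forall>j<0. fls_nth (of_nat M * fps_nth F n) j = 0" unfolding reg_iff by (metis diff_zero fps_cutoff_nth less_irrefl)
      thus ?thesis using \<open>M > 0\<close> by (simp add: fls_mult_of_nat_nth)
    qed (simp add: F)
  qed
  thus ?thesis by (simp add: reg_iff)
qed

text \<open>W can be inverted already in k[[u]][[h]], its leading coefficient being 1; by uniqueness
  of inverses F comes from there.\<close>

lemma reg_of_mult_eq_1:
  assumes "reg W" "fps_nth W 0 = 1" "F * W = 1" shows "reg (F :: 'k::field_char_0 fls fps)"
proof -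
  obtain W' where W: "W = plusK W'" using assms(1) by (rule reg_plusKE)
  have "fps_to_fls (fps_nth W' 0) = fps_to_fls 1" using assms(2) by (simp add: W plusK_def)
  hence "fps_nth W' 0 = 1" by (simp only: fps_to_fls_eq_iff)
  hence "W' * fps_right_inverse W' 1 = 1" by (intro fps_right_inverse) simp
  hence "W * plusK (fps_right_inverse W' 1) = plusK 1" by (simp add: W flip: plusK_mult)
  hence "W * plusK (fps_right_inverse W' 1) = 1" by (simp add: plusK_def fps_eq_iff)
  hence "F = F * W * plusK (fps_right_inverse W' 1)" by (simp add: mult.assoc)
  hence F: "F = plusK (fps_right_inverse W' 1)" by (simp add: assms(3))
  show ?thesis unfolding F by (rule reg_plusK)
qed

lemma matprod_scale: "matprod N (map (\<lambda>r a b. f r * M r a b) rs) a b = prod_list (map f rs) * matprod N (map M rs) a (b :: nat)"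
  for f :: "nat \<Rightarrow> 'a::comm_ring_1"
  by (induction rs arbitrary: a) (simp_all add: matprod_def sum_distrib_left mult_ac)

lemma reg_matprod:
  "(\<And>r a b. r \<in> set rs \<Longrightarrow> a < N \<Longrightarrow> b < N \<Longrightarrow> reg (M r a b)) \<Longrightarrow> a < N \<Longrightarrow> b < N \<Longrightarrow> reg (matprod N (map M rs) a b)"
  by (induction rs arbitrary: a) (auto simp: matprod_def intro!: reg_sum reg_mult)

lemma prod_list_upt: "prod_list (map f [0..<N]) = (\<Prod>r<N. f r :: 'a::comm_monoid_mult)"
  by (induction N) (simp_all add: mult.commute)

section \<open>The form B on expansions at points\<close>

lemma points_neg: "p \<in> points \<Sigma> \<Longrightarrow> neg p \<in> points \<Sigma>"
  by (cases \<Sigma>) auto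

lemma neg_neg [simp]: "neg (neg p) = p"
  by (cases p) auto

definition ringhom :: "('k::field_char_0 fls fps \<Rightarrow> 'k fls fps) \<Rightarrow> bool"
  where "ringhom \<phi> \<longleftrightarrow> hadd \<phi> \<and> (\<forall>F H. \<phi> (F * H) = \<phi> F * \<phi> H) \<and> (\<forall>a. \<phi> (hconst a) = hconst a)"

lemma ringhom_shift: "fps_nth a 0 = 0 \<Longrightarrow> ringhom (shift a)"
  by (simp add: ringhom_def hadd_shift shift_mult shift_hconst)

lemma ringhom_reflc: "ringhom reflc"
  by (simp add: ringhom_def hadd_reflc reflc_mult reflc_hconst)

lemma ringhom_cu: "ringhom \<phi> \<Longrightarrow> \<phi> (cu N w) = cu N w"
proof -
  assume "ringhom \<phi>"
  hence "\<phi> (hconst 0) = hconst 0" "\<phi> (hconst 1) = hconst 1" unfolding ringhom_def by blast+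
  thus "\<phi> (cu N w) = cu N w" by (simp add: cu_def)
qed

lemma appl_fls_ringhom:
  assumes "ringhom \<phi>" shows "appl_fls (\<lambda>v. \<phi> (f v)) x = \<phi> (appl_fls f x)"
  unfolding appl_fls_def
proof (rule hmod_fls.linext_hadd_fun)
  show "hadd \<phi>" using assms by (simp add: ringhom_def)
  fix c y
  have e: "hmod_fls.hsc c y = hconst (fps_const c) * y" for y :: "'a fls fps"
    by (rule fps_ext) (simp add: hconst_fps_const)
  show "\<phi> (hmod_fls.hsc c y) = hmod_fls.hsc c (\<phi> y)"
    using assms by (simp add: e ringhom_def)
qed

lemma pairing_ringhom:
  assumes "pairing N J \<beta>" "ringhom \<phi>" shows "pairing N J (\<lambda>v w. \<phi> (\<beta> v w))"
proof -
  have h: "hadd \<phi>" "\<And>F H. \<phi> (F * H) = \<phi> F * \<phi> H" using assms(2) by (auto simp: ringhom_def)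
  have sw: "\<phi> (swee N \<Psi> w) = swee N (\<lambda>x y. \<phi> (\<Psi> x y)) w" for \<Psi> w
    by (rule swee_additive) (simp_all add: hadd_0[OF h(1)] hadd_add[OF h(1)])
  show ?thesis
    using assms(1) unfolding pairing_def
    by (simp add: sw h(2) ringhom_cu[OF assms(2)] appl_fls_ringhom[OF assms(2)] hadd_0[OF h(1)])
qed

lemma teq_TT:
  assumes "teq N (tmul N X Y) tid"
  shows "teq N (tmul N (\<lambda>a b c d. TT (X a b c d)) (\<lambda>a b c d. TT (Y a b c d))) tid"
  unfolding teq_def
proof (intro allI impI)
  fix a b c d assume "a < N" "b < N" "c < N" "d < N"
  hence "TT (tmul N X Y a b c d) = TT (tid a b c d)" using assms by (simp add: teq_def)
  thus "tmul N (\<lambda>a b c d. TT (X a b c d)) (\<lambda>a b c d. TT (Y a b c d)) a b c d = tid a b c d"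
    by (auto simp: tmul_def TT_sum TT_mult tid_def TT_0 TT_1 split: if_splits)
qed

lemma fps_nth_prod_list_0: "fps_nth (prod_list xs) 0 = prod_list (map (\<lambda>x. fps_nth x 0) xs)"
  for xs :: "'a::ring_1 fps list"
  by (induction xs) simp_all

text \<open>The factor \<open>T_ab(u_(r+1))\<close> at u = 0. The determinant relation enters
  through its coefficient at \<open>u^0\<close>; the dependence on the spectral parameter comes back
  from the form B.\<close>

definition te :: "nat \<Rightarrow> nat \<Rightarrow> nat \<Rightarrow> nat \<Rightarrow> (gen0 word, 'k::field_char_0) cmod"
  where "te N a b r = translate (\<lambda>k. basis (Word [Tc a b k])) (scal (u_shift N r)) 0"

lemma u_shift_0 [simp]: "fps_nth (u_shift N r) 0 = 0"
  by (simp add: u_shift_def)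

lemma midx_idx: "midx N = idx N N" by (simp add: midx_def idx_def)

lemma qmonomial_nth_0: "fps_nth (qmonomial N T0 I J) 0 = prod_list (map (\<lambda>r. te N (I ! r) (J ! r) r) [0..<N])"
  by (simp add: qmonomial_def fps_nth_prod_list_0 te_def T0_def basis_letter o_def)

definition smul4 :: "'a::times \<Rightarrow> 'a tmat \<Rightarrow> 'a tmat" where "smul4 s X a b c d = s * X a b c d"

lemma tmul_smul4: "tmul N (smul4 s X) Y = smul4 s (tmul N X Y)" "tmul N X (smul4 s Y) = smul4 s (tmul N X Y)"
  for s :: "'a::comm_ring_1"
  by (intro ext, simp add: tmul_def smul4_def sum_distrib_left mult_ac)+

lemma smul4_smul4: "smul4 s (smul4 t X) = smul4 (s * t) X" for s :: "'a::comm_ring_1"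
  by (intro ext) (simp add: smul4_def mult.assoc)

lemma smul4_1: "smul4 1 X = X" for X :: "'a::comm_ring_1 tmat"
  by (intro ext) (simp add: smul4_def)

lemma smul4_cong: "teq N X Y \<Longrightarrow> teq N (smul4 s X) (smul4 s Y)"
  by (simp add: teq_def smul4_def)

lemma smul4_transp1: "transp1 (smul4 s X) = smul4 s (transp1 X)"
  by (intro ext) (simp add: smul4_def transp1_def)

locale qkz =
  fixes \<Sigma> :: "'k::field_char_0 curve" and N :: nat and R :: "'k hfun tmat" and C :: "nat list \<Rightarrow> 'k fps"
    and f0 :: "'k hfun" and B :: "gen0 word \<Rightarrow> gen0 word \<Rightarrow> 'k hfun"
  assumes N_pos: "N > 0" and R_ids: "R_identities \<Sigma> N R" and qv: "qdet_vector \<Sigma> N R C"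
    and nz: "normalizing \<Sigma> N R C f0" and BF: "B_form \<Sigma> N R C f0 B"
begin

abbreviation "J \<equiv> F0_ideal \<Sigma> N R C"

lemma J_unit: "unit_ideal N J"
  unfolding unit_ideal_def F0_ideal_def F_rels_def Un_assoc by (rule exI) (rule refl)

lemma F_ideal_subset: "F_ideal \<Sigma> N R \<subseteq> J"
proof -
  have "F_rels \<Sigma> N R \<subseteq> J" unfolding F0_ideal_def by (meson Un_upper1 closed_ideal_superset order_trans)
  hence "{a * x * b |a x b. x \<in> F_rels \<Sigma> N R} \<subseteq> J" using unit_ideal_mult[OF J_unit] by blast
  thus ?thesis unfolding F_ideal_def closed_ideal_def[of "F_rels \<Sigma> N R"]
    by (intro closed_span_least unit_ideal_csub[OF J_unit])
qed

text \<open>Expansions at p, with u the local parameter: \<open>bB\<close> is B, and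
  \<open>bN\<close> is B at the opposite argument, obtained by expanding at \<open>neg p\<close> and
  reflecting u. \<open>XX\<close> and \<open>ZZ\<close> are the normalized \<open>R(u)\<close> and
  \<open>R^21(-u)\<close>. \<open>ZS\<close> and \<open>bS\<close> carry the crossing shift; it is
  -Nh here and becomes +Nh in the argument of B because of the reflection.\<close>

definition bB where "bB p v w = B v w p"
definition bN where "bN p v w = reflc (B v w (neg p))"
definition XX where "XX p a b c d = Rbar f0 R a b c d p"
definition ZZ where "ZZ p a b c d = reflc (Rbar f0 R b a d c (neg p))"
abbreviation Nh :: "'k fps" where "Nh \<equiv> of_nat N * fps_X"
definition ZS where "ZS p a b c d = shift (- Nh) (ZZ p a b c d)"
definition bS where "bS p v w = shift (- Nh) (bN p v w)"

lemma Nh_0 [simp]: "fps_nth Nh 0 = 0" by simp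

lemma pairing_bB: assumes p: "p \<in> points \<Sigma>" shows "pairing N J (bB p)"
proof -
  note BF' = BF[unfolded B_form_def, THEN conjunct2, rule_format, OF p]
  have "\<forall>x\<in>J. \<forall>w. appl_fls (\<lambda>v. B v w p) x = 0 \<and> appl_fls (\<lambda>v. B w v p) x = 0"
  proof (intro ballI allI)
    fix x w assume "x \<in> J"
    hence "Bext B x (basis w) p = 0 \<and> Bext B (basis w) x p = 0" using BF' by blast
    thus "appl_fls (\<lambda>v. B v w p) x = 0 \<and> appl_fls (\<lambda>v. B w v p) x = 0" by (simp add: Bext_def)
  qed
  moreover have "B (u + v) w p = swee N (\<lambda>w1 w2. B u w1 p * B v w2 p) w" for u v w
  proof -
    have "B (u + v) w p = appl_fls (\<lambda>(w1, w2). B u w1 p * B v w2 p) (cop0 N w)" using BF' by blast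
    thus ?thesis by (simp add: appl_fls_cop0)
  qed
  moreover have "B u (v + w) p = swee N (\<lambda>u1 u2. B u1 w p * B u2 v p) u" for u v w
  proof -
    have "B u (v + w) p = appl_fls (\<lambda>(u1, u2). B u1 w p * B u2 v p) (cop0 N u)" using BF' by blast
    thus ?thesis by (simp add: appl_fls_cop0)
  qed
  moreover have "B 0 w p = cu N w" "B w 0 p = cu N w" for w
  proof -
    have "B 0 w p = hconst (eps0 N w) \<and> B w 0 p = hconst (eps0 N w)" using BF' by blast
    thus "B 0 w p = cu N w" "B w 0 p = cu N w" by (simp_all add: hconst_eps0)
  qed
  ultimately show ?thesis unfolding pairing_def bB_def by blast
qed

lemma pairing_bN: "p \<in> points \<Sigma> \<Longrightarrow> pairing N J (bN p)"
  using pairing_ringhom[OF pairing_bB[OF points_neg] ringhom_reflc] by (simp add: bN_def[abs_def] bB_def)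

lemma pairing_bS: "p \<in> points \<Sigma> \<Longrightarrow> pairing N J (bS p)"
  unfolding bS_def[abs_def] by (rule pairing_ringhom[OF pairing_bN ringhom_shift]) simp_all

lemma B_letters:
  assumes p: "p \<in> points \<Sigma>" and "a < N" "b < N" "c < N" "d < N"
  shows "B (Word [Tc a c l]) (Word [Tc b d m]) p = fps_nth (fps_nth (TT (Rbar f0 R a b c d p)) l) m"
proof -
  have "B (Word [Tc a c l]) (Word [Tc b d m]) p = Abs_fps (\<lambda>n. fls_const ((- 1) ^ m / (fact l * fact m)) *
      (fls_deriv ^^ (l + m)) (fps_nth (Rbar f0 R a b c d p) n))"
    using BF[unfolded B_form_def, THEN conjunct2, rule_format, OF p] assms(2-5) by blast
  also have "\<dots> = (- 1) ^ m * dd m (dd l (Rbar f0 R a b c d p))"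
    by (rule fps_ext, cases "even m") (simp_all add: dd_dd dd_fps_nth[unfolded comp_def])
  finally show ?thesis by (simp add: TT_nth)
qed

lemma dd_commute: "dd l (dd m F) = dd m (dd l F)"
  by (simp add: dd_dd add.commute mult.commute)

lemma tens4_bB: "p \<in> points \<Sigma> \<Longrightarrow> teq N (tens4 (bB p) Tc Tc) (\<lambda>a b c d. TT (XX p a b c d))"
  by (rule teq_nthI) (simp add: bB_def B_letters XX_def)

lemma tens4_bN: assumes p: "p \<in> points \<Sigma>" shows "teq N (tens4 (flip2 (bN p)) Tc Tc) (\<lambda>a b c d. TT (ZZ p a b c d))"
proof (rule teq_nthI)
  fix a b c d l m assume "a < N" "b < N" "c < N" "d < N"
  have s: "reflc ((- 1) ^ l * F) = (- 1) ^ l * reflc F" for F :: "'k fls fps"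
    by (cases "even l") (simp_all add: hadd_minus[OF hadd_reflc])
  have "fps_nth (fps_nth (tens4 (flip2 (bN p)) Tc Tc a b c d) l) m = (- 1) ^ l * reflc (dd l (dd m (Rbar f0 R b a d c (neg p))))"
    using \<open>a < N\<close> \<open>b < N\<close> \<open>c < N\<close> \<open>d < N\<close> by (simp add: flip2_def bN_def B_letters[OF points_neg[OF p]] TT_nth s)
  also have "\<dots> = (- 1) ^ m * dd m (dd l (ZZ p a b c d))"
    unfolding ZZ_def dd_commute[of m]
    by (cases "even l"; cases "even m") (simp_all add: dd_reflc hadd_minus[OF hadd_dd])
  finally show "fps_nth (fps_nth (tens4 (flip2 (bN p)) Tc Tc a b c d) l) m = fps_nth (fps_nth (TT (ZZ p a b c d)) l) m"
    by (simp add: TT_nth)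
qed

lemma TT_shift: "fps_nth a 0 = 0 \<Longrightarrow> fps_nth (fps_nth (TT (shift a F)) l) m = shift a (fps_nth (fps_nth (TT F) l) m)"
  by (cases "even m") (simp_all add: TT_nth dd_shift hadd_minus[OF hadd_shift])

lemma tens4_bS: assumes p: "p \<in> points \<Sigma>" shows "teq N (tens4 (flip2 (bS p)) Tc Tc) (\<lambda>a b c d. TT (ZS p a b c d))"
proof (rule teq_nthI)
  fix a b c d l m assume *: "a < N" "b < N" "c < N" "d < N"
  show "fps_nth (fps_nth (tens4 (flip2 (bS p)) Tc Tc a b c d) l) m = fps_nth (fps_nth (TT (ZS p a b c d)) l) m"
    using teq_nthD[OF tens4_bN[OF p] *, of l m]
    by (simp add: ZS_def TT_shift flip2_def bS_def)
qed

subsection \<open>The two quantum determinant identities\<close>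

text \<open>Pairing with the constant coefficient of T in the other argument gives a representation
  by N by N matrices; \<open>thR\<close>, which puts the algebra into the second argument, reverses
  products.\<close>

definition thL :: "'k pt \<Rightarrow> (gen0 word, 'k) cmod \<Rightarrow> nat \<Rightarrow> nat \<Rightarrow> 'k fls fps"
  where "thL p x b d = appl_fls (\<lambda>w. bB p w (Word [Tc b d 0])) x"

definition thR :: "'k pt \<Rightarrow> (gen0 word, 'k) cmod \<Rightarrow> nat \<Rightarrow> nat \<Rightarrow> 'k fls fps"
  where "thR p x a c = appl_fls (bN p (Word [Tc a c 0])) x"

text \<open>The relation is needed for every row index I, not only for the row defining
  \<open>qdet\<close>: this is the eigenvector property of C, with eigenvalue 1 in the
  quotient.\<close>

lemma qdet_relation:
  assumes I: "I \<in> midx N"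
  shows "(\<Sum>K\<in>midx N. scal (C K) * prod_list (map (\<lambda>r. te N (I ! r) (K ! r) r) [0..<N])) - scal (C I) \<in> J"
proof -
  let ?Q = "fps_nth (qdet N C T0) 0 :: (gen0 word, 'k) cmod"
  let ?S = "\<Sum>K\<in>midx N. scal (C K) * prod_list (map (\<lambda>r. te N (I ! r) (K ! r) r) [0..<N]) :: (gen0 word, 'k) cmod"
  have "fps_nth ((\<Sum>K\<in>midx N. fps_const (scal (C K)) * qmonomial N T0 I K) - fps_const (scal (C I)) * qdet N C T0) 0 \<in> J"
    using qv I F_ideal_subset unfolding qdet_vector_def by blast
  hence 1: "?S - scal (C I) * ?Q \<in> J"
    by (simp add: fps_sum_nth qmonomial_nth_0)
  have "?Q - 1 \<in> qdet_rels N C T0" unfolding qdet_rels_def by force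
  hence "?Q - 1 \<in> J" unfolding F0_ideal_def by (intro closed_ideal_mem) blast
  hence "scal (C I) * (?Q - 1) \<in> J" by (rule unit_ideal_mult_left[OF J_unit])
  hence "(?S - scal (C I) * ?Q) + scal (C I) * (?Q - 1) \<in> J" using 1 by (intro csub_add[OF unit_ideal_csub[OF J_unit]])
  thus ?thesis by (simp add: algebra_simps)
qed

context
  fixes p assumes p: "p \<in> points \<Sigma>"
begin

lemma thL_mult: "thL p (x * y) = mm N (thL p x) (thL p y)"
  by (intro ext) (simp add: thL_def mm_def pairing_mult_left[OF pairing_bB[OF p]])

lemma thR_mult: "thR p (x * y) = mm N (thR p y) (thR p x)"
  by (intro ext) (simp add: thR_def mm_def pairing_mult_right[OF pairing_bN[OF p]])

lemma th_1: "thL p 1 = idm N" "thR p 1 = idm N"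
  by (intro ext, simp add: thL_def thR_def idm_def cu_Tc pairing_0[OF pairing_bB[OF p]] pairing_0[OF pairing_bN[OF p]] flip: basis_0)+

lemma thL_prod_list: "thL p (prod_list xs) = mprod N (map (thL p) xs)"
  by (induction xs) (simp_all add: th_1 thL_mult mprod_Nil mprod_Cons)

lemma msupp_th: "msupp N (thL p x)" "msupp N (thR p x)"
proof -
  have "thL p x b d = 0 \<and> thR p x b d = 0" if "b \<ge> N \<or> d \<ge> N" for b d
  proof -
    have inv: "\<not> valid N (Word [Tc b d 0])" using that by auto
    have "(\<lambda>w. bB p w (Word [Tc b d 0])) = (\<lambda>w. 0)" "bN p (Word [Tc b d 0]) = (\<lambda>w. 0)"
      using pairing_null[OF J_unit pairing_bB[OF p] inv] pairing_null[OF J_unit pairing_bN[OF p] inv] by auto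
    thus ?thesis unfolding thL_def thR_def by (simp add: appl_fls_zero_fun)
  qed
  thus "msupp N (thL p x)" "msupp N (thR p x)" by (auto simp: msupp_def)
qed

lemma thR_prod_list: "thR p (prod_list xs) = mprod N (map (thR p) (rev xs))"
proof (induction xs)
  case (Cons x xs)
  have "mprod N (map (thR p) (rev xs) @ [thR p x]) = mm N (mprod N (map (thR p) (rev xs))) (mprod N [thR p x])"
    by (rule mprod_append) (auto simp: msupp_th)
  thus ?case using Cons by (simp add: thR_mult mprod_Cons mprod_Nil mm_idm_right msupp_th)
qed (simp add: th_1 mprod_Nil)

lemma thL_te: assumes "a < N" "b < N" "c < N" "d < N" shows "thL p (te N a c r) b d = shift (u_shift N r) (XX p a b c d)"
proof -
  have e: "bB p (Word [Tc a c k]) (Word [Tc b d 0]) = dd k (XX p a b c d)" for k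
    using teq_nthD[OF tens4_bB[OF p] assms, of k 0] by (simp add: TT_nth)
  show ?thesis
    unfolding thL_def te_def by (subst appl_fls_translate) (simp_all add: e shift_alt)
qed

lemma thR_te: assumes "a < N" "b < N" "c < N" "d < N" shows "thR p (te N b d r) a c = shift (u_shift N r) (ZZ p b a d c)"
proof -
  have e: "bN p (Word [Tc a c 0]) (Word [Tc b d k]) = dd k (ZZ p b a d c)" for k
    using teq_nthD[OF tens4_bN[OF p] assms(2,1,4,3), of k 0] by (simp add: TT_nth flip2_def)
  show ?thesis
    unfolding thR_def te_def by (subst appl_fls_translate) (simp_all add: e shift_alt)
qed

lemma thL_scal: "thL p (scal s * x) b d = hconst s * thL p x b d" and thR_scal: "thR p (scal s * x) b d = hconst s * thR p x b d"
  by (simp_all add: thL_def thR_def scal_mult_left appl_fls_hscale)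

lemma th_sum: "thL p (\<Sum>i\<in>A. f i) b d = (\<Sum>i\<in>A. thL p (f i) b d)" "thR p (\<Sum>i\<in>A. f i) b d = (\<Sum>i\<in>A. thR p (f i) b d)"
  by (simp_all add: thL_def thR_def hadd_sum[OF hadd_appl_fls])

lemma qdet_left:
  assumes I: "I \<in> midx N"
  shows "(\<Sum>K\<in>midx N. hconst (C K) * mprod N (map (\<lambda>r. thL p (te N (I ! r) (K ! r) r)) [0..<N]) b d) = hconst (C I) * idm N b d"
proof -
  let ?S = "\<Sum>K\<in>midx N. scal (C K) * prod_list (map (\<lambda>r. te N (I ! r) (K ! r) r) [0..<N]) :: (gen0 word, 'k) cmod"
  have "thL p (?S - scal (C I)) b d = 0"
    unfolding thL_def by (rule pairing_kill(1)[OF pairing_bB[OF p] qdet_relation[OF I]])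
  hence "thL p ?S b d = thL p (scal (C I) * 1) b d" by (simp add: thL_def hadd_diff[OF hadd_appl_fls])
  thus ?thesis unfolding thL_scal th_sum thL_prod_list th_1 by (simp add: o_def)
qed

lemma qdet_right:
  assumes I: "I \<in> midx N"
  shows "(\<Sum>K\<in>midx N. hconst (C K) * mprod N (map (\<lambda>r. thR p (te N (I ! r) (K ! r) r)) (rev [0..<N])) a c) = hconst (C I) * idm N a c"
proof -
  let ?S = "\<Sum>K\<in>midx N. scal (C K) * prod_list (map (\<lambda>r. te N (I ! r) (K ! r) r) [0..<N]) :: (gen0 word, 'k) cmod"
  have "thR p (?S - scal (C I)) a c = 0"
    unfolding thR_def by (rule pairing_kill(2)[OF pairing_bN[OF p] qdet_relation[OF I]])
  hence "thR p ?S a c = thR p (scal (C I) * 1) a c" by (simp add: thR_def hadd_diff[OF hadd_appl_fls])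
  thus ?thesis unfolding thR_scal th_sum thR_prod_list th_1 by (simp add: o_def rev_map)
qed

lemma C_id: "C [0..<N] = 1" using qv by (simp add: qdet_vector_def)

lemma id_midx: "[0..<N] \<in> midx N" by (auto simp: midx_def)

lemma prod_delta:
  assumes "K \<in> midx N"
  shows "(\<Prod>r<N. if r = K ! r then f r else (0::'a::comm_ring_1)) = (if K = [0..<N] then \<Prod>r<N. f r else 0)"
proof (cases "K = [0..<N]")
  case False
  have "length K = N" using assms by (simp add: midx_def)
  then obtain r where "r < N" "K ! r \<noteq> r" using False by (metis length_upt minus_nat.diff_0 nth_equalityI nth_upt plus_nat.add_0)
  hence "(\<Prod>r<N. if r = K ! r then f r else (0::'a)) = 0" by (intro prod_zero bexI[of _ r]) auto
  thus ?thesis using False by simp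
qed simp

lemma mprod_ringhom:
  assumes "ringhom \<phi>" shows "\<phi> (mprod N As a c) = mprod N (map (\<lambda>A a c. \<phi> (A a c)) As) a c"
proof -
  have "\<phi> (hconst 1) = hconst 1" using assms unfolding ringhom_def by blast
  hence h: "hadd \<phi>" "\<And>F H. \<phi> (F * H) = \<phi> F * \<phi> H" "\<phi> 1 = 1"
    using assms unfolding ringhom_def by simp_all
  show ?thesis
    by (induction As arbitrary: a c) (simp_all add: mprod_Nil mprod_Cons idm_def mm_def h hadd_0[OF h(1)] hadd_sum[OF h(1)])
qed

text \<open>
  Inserting one determinant identity into the other and telescoping shows that the scalar by which
  unitarity, respectively crossing, could fail has trivial product over the shifts \<open>u_m\<close>, hence is 1.
\<close>

lemma scalar_unitary:
  assumes "teq N (tmul N (ZZ p) (XX p)) (smul4 s tid)" "fps_nth s 0 = 1"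
  shows "s = 1"
proof (rule prod_shift_eq_1[where u = "u_shift N" and M = N])
  let ?Z = "\<lambda>I. mprod N (map (\<lambda>r. thR p (te N r (I ! r) r)) (rev [0..<N]))"
  let ?X = "\<lambda>I K. mprod N (map (\<lambda>r. thL p (te N (I ! r) (K ! r) r)) [0..<N])"
  have ids: "map (\<lambda>r. thR p (te N ([0..<N] ! r) (I ! r) r)) (rev [0..<N]) = map (\<lambda>r. thR p (te N r (I ! r) r)) (rev [0..<N])" for I
    by (intro map_cong) auto
  \<comment> \<open>Contraction at position r leaves the shifted scalar times the delta of r and
    \<open>K ! r\<close>. Only the identity multi-index survives, and there C equals 1.\<close>
  have tele: "(\<Sum>I\<in>midx N. mm N (?Z I) (?X I K) 0 0) = (if K = [0..<N] then \<Prod>r<N. shift (u_shift N r) s else 0)"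
    if K: "K \<in> midx N" for K
  proof -
    have "(\<Sum>I\<in>idx N N. mm N (?Z I) (?X I K) 0 0) = (\<Prod>r<N. if r = K ! r then shift (u_shift N r) s else 0) * idm N 0 0"
    proof (rule telescope[where P = "\<lambda>r a. thR p (te N r a r)" and Q = "\<lambda>r a. thL p (te N a (K ! r) r)"])
      fix r b d assume r: "r < N"
      have Kr: "K ! r < N" using K r by (auto simp: midx_def dest: nth_mem)
      show "(\<Sum>a<N. mm N (thR p (te N r a r)) (thL p (te N a (K ! r) r)) b d) = (if r = K ! r then shift (u_shift N r) s else 0) * idm N b d"
      proof (cases "b < N \<and> d < N")
        case True
        have "(\<Sum>a<N. mm N (thR p (te N r a r)) (thL p (te N a (K ! r) r)) b d)
            = shift (u_shift N r) (tmul N (ZZ p) (XX p) r b (K ! r) d)"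
          using r Kr True by (simp add: mm_def thR_te thL_te tmul_def hadd_sum[OF hadd_shift] shift_mult)
        also have "tmul N (ZZ p) (XX p) r b (K ! r) d = s * tid r b (K ! r) d"
          using assms(1) r Kr True by (simp add: teq_def smul4_def)
        finally show ?thesis using True by (auto simp: tid_def idm_def hadd_0[OF hadd_shift])
      next
        case False
        thus ?thesis using msupp_th by (auto simp: mm_def msupp_def idm_def intro!: sum.neutral)
      qed
    qed (rule msupp_th)+
    thus ?thesis using N_pos by (simp add: prod_delta[OF K] idm_def midx_idx)
  qed
  have "1 = (\<Sum>I\<in>midx N. hconst (C I) * ?Z I 0 0)"
    using qdet_right[OF id_midx, of 0 0] N_pos by (simp add: C_id idm_def ids)
  also have "\<dots> = (\<Sum>I\<in>midx N. mm N (?Z I) (\<lambda>b d. hconst (C I) * idm N b d) 0 0)"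
  proof (rule sum.cong[OF refl])
    fix I
    have "msupp N (?Z I)" by (rule msupp_mprod) (auto simp: msupp_th)
    thus "hconst (C I) * ?Z I 0 0 = mm N (?Z I) (\<lambda>b d. hconst (C I) * idm N b d) 0 0"
      by (simp add: mm_scale_right mm_idm_right)
  qed
  also have "\<dots> = (\<Sum>I\<in>midx N. \<Sum>K\<in>midx N. hconst (C K) * mm N (?Z I) (?X I K) 0 0)"
  proof (rule sum.cong[OF refl])
    fix I assume "I \<in> midx N"
    hence "mm N (?Z I) (\<lambda>b d. hconst (C I) * idm N b d) 0 0 = mm N (?Z I) (\<lambda>b d. \<Sum>K\<in>midx N. hconst (C K) * ?X I K b d) 0 0"
      by (simp only: qdet_left)
    thus "mm N (?Z I) (\<lambda>b d. hconst (C I) * idm N b d) 0 0 = (\<Sum>K\<in>midx N. hconst (C K) * mm N (?Z I) (?X I K) 0 0)"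
      by (simp only: mm_sum_right mm_scale_right)
  qed
  also have "\<dots> = (\<Sum>K\<in>midx N. hconst (C K) * (\<Sum>I\<in>midx N. mm N (?Z I) (?X I K) 0 0))"
    by (subst sum.swap) (simp only: sum_distrib_left)
  also have "\<dots> = (\<Sum>K\<in>midx N. if K = [0..<N] then \<Prod>r<N. shift (u_shift N r) s else 0)"
    by (intro sum.cong refl) (auto simp: tele C_id)
  also have "\<dots> = (\<Prod>r<N. shift (u_shift N r) s)"
    using id_midx finite_idx by (simp add: midx_idx)
  finally show "(\<Prod>r<N. shift (u_shift N r) s) = 1" ..
qed (use assms N_pos in auto)

lemma scalar_crossing:
  assumes "teq N (tmul N (transp1 (ZZ p)) (transp1 (\<lambda>a b c d. shift Nh (XX p a b c d)))) (smul4 s tid)" "fps_nth s 0 = 1"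
  shows "s = 1"
proof (rule prod_shift_eq_1[where u = "u_shift N" and M = N])
  let ?q = "\<lambda>r a c b d. shift Nh (thL p (te N a c r) b d)"
  let ?X = "\<lambda>K. mprod N (map (\<lambda>r. ?q r r (K ! r)) [0..<N])"
  let ?Z = "\<lambda>K I. mprod N (map (\<lambda>r. thR p (te N (K ! r) (I ! r) r)) (rev [0..<N]))"
  have msq: "msupp N (?q r a c)" for r a c using msupp_th by (auto simp: msupp_def hadd_0[OF hadd_shift])
  have tele: "(\<Sum>K\<in>midx N. mm N (?Z K I) (?X K) 0 0) = (if I = [0..<N] then \<Prod>r<N. shift (u_shift N r) s else 0)"
    if I: "I \<in> midx N" for I
  proof -
    have "(\<Sum>K\<in>idx N N. mm N (?Z K I) (?X K) 0 0) = (\<Prod>r<N. if r = I ! r then shift (u_shift N r) s else 0) * idm N 0 0"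
    proof (rule telescope[where P = "\<lambda>r a. thR p (te N a (I ! r) r)" and Q = "\<lambda>r a. ?q r r a"])
      fix r b d assume r: "r < N"
      have Ir: "I ! r < N" using I r by (auto simp: midx_def dest: nth_mem)
      show "(\<Sum>a<N. mm N (thR p (te N a (I ! r) r)) (?q r r a) b d) = (if r = I ! r then shift (u_shift N r) s else 0) * idm N b d"
      proof (cases "b < N \<and> d < N")
        case True
        have comm: "shift Nh (shift (u_shift N r) F) = shift (u_shift N r) (shift Nh F)" for F :: "'k fls fps"
          by (simp add: shift_shift add.commute)
        have "(\<Sum>a<N. mm N (thR p (te N a (I ! r) r)) (?q r r a) b d)
            = shift (u_shift N r) (tmul N (transp1 (ZZ p)) (transp1 (\<lambda>a b c d. shift Nh (XX p a b c d))) (I ! r) b r d)"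
          using r Ir True by (simp add: mm_def thR_te thL_te tmul_def transp1_def hadd_sum[OF hadd_shift] shift_mult comm)
        also have "tmul N (transp1 (ZZ p)) (transp1 (\<lambda>a b c d. shift Nh (XX p a b c d))) (I ! r) b r d = s * tid (I ! r) b r d"
          using assms(1) r Ir True by (simp add: teq_def smul4_def)
        finally show ?thesis using True by (auto simp: tid_def idm_def hadd_0[OF hadd_shift])
      next
        case False
        thus ?thesis using msupp_th msq by (auto simp: mm_def msupp_def idm_def intro!: sum.neutral)
      qed
    qed (rule msupp_th msq)+
    thus ?thesis using N_pos by (simp add: prod_delta[OF I] idm_def midx_idx)
  qed
  have hom: "ringhom (shift Nh)" by (rule ringhom_shift) simp
  have "(\<Sum>K\<in>midx N. hconst (C K) * mprod N (map (\<lambda>r. thL p (te N ([0..<N] ! r) (K ! r) r)) [0..<N]) 0 0) = 1"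
    using qdet_left[OF id_midx, of 0 0] N_pos by (simp add: C_id idm_def)
  hence "shift Nh (\<Sum>K\<in>midx N. hconst (C K) * mprod N (map (\<lambda>r. thL p (te N ([0..<N] ! r) (K ! r) r)) [0..<N]) 0 0) = shift Nh 1" by simp
  hence "(\<Sum>K\<in>midx N. hconst (C K) * mprod N (map (\<lambda>r. ?q r ([0..<N] ! r) (K ! r)) [0..<N]) 0 0) = 1"
    by (simp add: hadd_sum[OF hadd_shift] shift_mult shift_hconst shift_1 mprod_ringhom[OF hom] o_def)
  moreover have "map (\<lambda>r. ?q r ([0..<N] ! r) (K ! r)) [0..<N] = map (\<lambda>r. ?q r r (K ! r)) [0..<N]" for K
    by (intro map_cong) auto
  ultimately have "1 = (\<Sum>K\<in>midx N. hconst (C K) * ?X K 0 0)" by simp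
  also have "\<dots> = (\<Sum>K\<in>midx N. mm N (\<lambda>b d. hconst (C K) * idm N b d) (?X K) 0 0)"
  proof (rule sum.cong[OF refl])
    fix K
    have "msupp N (?X K)" by (rule msupp_mprod) (auto simp: msq)
    thus "hconst (C K) * ?X K 0 0 = mm N (\<lambda>b d. hconst (C K) * idm N b d) (?X K) 0 0"
      by (simp add: mm_scale_left mm_idm_left)
  qed
  also have "\<dots> = (\<Sum>K\<in>midx N. \<Sum>I\<in>midx N. hconst (C I) * mm N (?Z K I) (?X K) 0 0)"
  proof (rule sum.cong[OF refl])
    fix K assume "K \<in> midx N"
    hence "mm N (\<lambda>b d. hconst (C K) * idm N b d) (?X K) 0 0 = mm N (\<lambda>b d. \<Sum>I\<in>midx N. hconst (C I) * ?Z K I b d) (?X K) 0 0"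
      by (simp only: qdet_right)
    thus "mm N (\<lambda>b d. hconst (C K) * idm N b d) (?X K) 0 0 = (\<Sum>I\<in>midx N. hconst (C I) * mm N (?Z K I) (?X K) 0 0)"
      by (simp only: mm_sum_left mm_scale_left)
  qed
  also have "\<dots> = (\<Sum>I\<in>midx N. hconst (C I) * (\<Sum>K\<in>midx N. mm N (?Z K I) (?X K) 0 0))"
    by (subst sum.swap) (simp only: sum_distrib_left)
  also have "\<dots> = (\<Sum>I\<in>midx N. if I = [0..<N] then \<Prod>r<N. shift (u_shift N r) s else 0)"
    by (intro sum.cong refl) (auto simp: tele C_id)
  also have "\<dots> = (\<Prod>r<N. shift (u_shift N r) s)"
    using id_midx finite_idx by (simp add: midx_idx)
  finally show "(\<Prod>r<N. shift (u_shift N r) s) = 1" ..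
qed (use assms N_pos in auto)

end

end

lemma reflc_nth_0_tid:
  assumes "fps_nth F 0 = tid a b c d" shows "fps_nth (reflc F) 0 = tid a b c d"
  using assms by (auto simp: reflc_def tid_def)

lemma reg_swee: "(\<And>x y. reg (\<Psi> x y)) \<Longrightarrow> reg (swee N \<Psi> w)"
proof (induction w arbitrary: \<Psi> rule: word_induct)
  case (Cons g w)
  have "reg (swee N (\<lambda>y1 y2. \<Psi> (x1 + y1) (x2 + y2)) w)" for x1 x2 by (rule Cons.IH) (rule Cons.prems)
  thus ?case unfolding swee_Cons by (cases g) (simp_all add: reg_sum)
qed simp

lemma inverse_K:
  fixes f :: "'k::field_char_0 fls fps"
  assumes "fps_nth f 0 = 1" shows "inverse f * f = 1" "f * inverse f = 1" "fps_nth (inverse f) 0 = 1"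
  using assms inverse_mult_eq_1[of f] inverse_mult_eq_1'[of f] by simp_all

lemma teq_smul4_inverse:
  assumes "teq N (smul4 e X) tid" "fps_nth e 0 = 1"
  shows "teq N X (smul4 (inverse e) (tid :: 'k::field_char_0 fls fps tmat))"
proof -
  have "teq N (smul4 (inverse e) (smul4 e X)) (smul4 (inverse e) tid)" by (rule smul4_cong[OF assms(1)])
  thus ?thesis by (simp add: smul4_smul4 inverse_K[OF assms(2)] smul4_1)
qed

lemma transp1_cong: "teq N X Y \<Longrightarrow> teq N (transp1 X) (transp1 Y)"
  by (simp add: teq_transp1)

lemma teq_shift:
  assumes a: "fps_nth a 0 = 0" and t: "teq N (tmul N X Y) tid"
  shows "teq N (tmul N (\<lambda>a' b c d. shift a (X a' b c d)) (\<lambda>a' b c d. shift a (Y a' b c d))) tid"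
  unfolding teq_def
proof (intro allI impI)
  fix a' b c d assume "a' < N" "b < N" "c < N" "d < N"
  hence "shift a (tmul N X Y a' b c d) = shift a (tid a' b c d)" using t by (simp add: teq_def)
  thus "tmul N (\<lambda>a' b c d. shift a (X a' b c d)) (\<lambda>a' b c d. shift a (Y a' b c d)) a' b c d = tid a' b c d"
    by (auto simp: tmul_def hadd_sum[OF hadd_shift[OF a]] shift_mult[OF a] tid_def shift_1[OF a] hadd_0[OF hadd_shift[OF a]] split: if_splits)
qed

section \<open>Exact unitarity and crossing, translation and regularity of B at a point\<close>

context qkz
begin

context
  fixes p assumes p: "p \<in> points \<Sigma>"
begin

lemma f0_0: "fps_nth (f0 p) 0 = 1" "fps_nth (f0 (neg p)) 0 = 1"
  using nz p points_neg[OF p] by (auto simp: normalizing_def)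

lemma R_0: "a < N \<Longrightarrow> b < N \<Longrightarrow> c < N \<Longrightarrow> d < N \<Longrightarrow> fps_nth (R a b c d p) 0 = tid a b c d"
  "a < N \<Longrightarrow> b < N \<Longrightarrow> c < N \<Longrightarrow> d < N \<Longrightarrow> fps_nth (R a b c d (neg p)) 0 = tid a b c d"
  using R_ids[unfolded R_identities_def, THEN conjunct1, rule_format, OF p]
    R_ids[unfolded R_identities_def, THEN conjunct1, rule_format, OF points_neg[OF p]] by simp_all

lemma XX_smul4: "XX p = smul4 (f0 p) (tat R p)"
  by (intro ext) (simp add: XX_def Rbar_def smul4_def tat_def)

lemma ZZ_smul4: "ZZ p = smul4 (reflc (f0 (neg p))) (opposite_R R p)"
proof (intro ext)
  fix a b c d
  have "opposite_R R p a b c d = reflc (R b a d c (neg p))"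
    by (simp add: opposite_R_def reflc_def hmap_def)
  thus "ZZ p a b c d = smul4 (reflc (f0 (neg p))) (opposite_R R p) a b c d"
    by (simp add: ZZ_def Rbar_def smul4_def reflc_mult)
qed

lemma R_inverse:
  obtains Y Z1 g where "teq N (tmul N (tat R p) Y) tid" "teq N (tmul N Y (tat R p)) tid"
    "teq N (tmul N (transp1 Y) Z1) tid" "teq N (tmul N Z1 (transp1 Y)) tid" "fps_nth g 0 = 1"
    "teq N (transp1 Z1) (smul4 g (\<lambda>a b c d. shift Nh (R a b c d p)))"
proof -
  have "\<exists>Y Z1 Z2 g. tinv N (tat R p) Y \<and> tinv N (transp1 Y) Z1 \<and> tinv N (transp2 Y) Z2 \<and> fps_nth g 0 = 1 \<and>
      (let R' = (\<lambda>a b c d. g * shift (of_nat N * fps_X) (R a b c d p)) in teq N (transp1 Z1) R' \<and> teq N (transp2 Z2) R')"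
    using R_ids[unfolded R_identities_def, THEN conjunct2, THEN conjunct2, THEN conjunct2, THEN conjunct1] p by blast
  then obtain Y Z1 g where "tinv N (tat R p) Y" "tinv N (transp1 Y) Z1" "fps_nth g 0 = 1"
    "teq N (transp1 Z1) (\<lambda>a b c d. g * shift (of_nat N * fps_X) (R a b c d p))"
    by (auto simp: Let_def)
  moreover have "smul4 g (\<lambda>a b c d. shift Nh (R a b c d p)) = (\<lambda>a b c d. g * shift (of_nat N * fps_X) (R a b c d p))"
    by (intro ext) (simp add: smul4_def)
  ultimately show ?thesis using that[of Y Z1 g] unfolding tinv_def by simp
qed

text \<open>Unitarity is given up to a scalar s in one order. Since R has a left inverse, the other
  order carries the same s, and it is that order which \<open>scalar_unitary\<close> can
  contract.\<close>

lemma XZ: "teq N (tmul N (XX p) (ZZ p)) tid" and ZX: "teq N (tmul N (ZZ p) (XX p)) tid"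
proof -
  obtain Y where Y: "teq N (tmul N Y (tat R p)) tid" by (rule R_inverse)
  obtain g where g: "teq N (tmul N (tat R p) (opposite_R R p)) (\<lambda>a b c d. g * tid a b c d)"
    using R_ids[unfolded R_identities_def, THEN conjunct2, THEN conjunct2, THEN conjunct2, THEN conjunct2] p by blast
  define s where "s = f0 p * (reflc (f0 (neg p)) * g)"
  have XZs: "teq N (tmul N (XX p) (ZZ p)) (smul4 s tid)"
    unfolding XX_smul4 ZZ_smul4 tmul_smul4 smul4_smul4
    using g by (simp add: teq_def smul4_def s_def mult_ac)
  let ?Y = "smul4 (inverse (f0 p)) Y"
  have YX: "teq N (tmul N ?Y (XX p)) tid"
    using Y unfolding XX_smul4 tmul_smul4 smul4_smul4 by (simp add: inverse_K[OF f0_0(1)] smul4_1)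
  have "teq N (ZZ p) (tmul N tid (ZZ p))" by (rule teq_sym[OF tmul_tid_left])
  also have "teq N \<dots> (tmul N (tmul N ?Y (XX p)) (ZZ p))" by (rule tmul_cong[OF teq_sym[OF YX] teq_refl])
  also have "teq N \<dots> (tmul N ?Y (tmul N (XX p) (ZZ p)))" by (simp add: teq_def tmul_assoc)
  also have "teq N \<dots> (tmul N ?Y (smul4 s tid))" by (rule tmul_cong[OF teq_refl XZs])
  also have "teq N \<dots> (smul4 s ?Y)" unfolding tmul_smul4(2) by (rule smul4_cong[OF tmul_tid_right])
  finally have "teq N (tmul N (ZZ p) (XX p)) (tmul N (smul4 s ?Y) (XX p))" by (rule tmul_cong[OF _ teq_refl])
  also have "teq N \<dots> (smul4 s tid)" unfolding tmul_smul4(1)[of N s] by (rule smul4_cong[OF YX])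
  finally have ZXs: "teq N (tmul N (ZZ p) (XX p)) (smul4 s tid)" .
  \<comment> \<open>Modulo h both factors are the identity, so s is 1 modulo h; this can be read off
    from a single diagonal entry.\<close>
  have "fps_nth s 0 = fps_nth (tmul N (XX p) (ZZ p) 0 0 0 0) 0"
    using XZs N_pos by (simp add: teq_def smul4_def tid_def)
  also have "\<dots> = tmul N tid tid 0 0 0 0"
    unfolding tmul_def fps_sum_nth
  proof (intro sum.cong refl)
    fix i j assume "i \<in> {..<N}" "j \<in> {..<N}"
    hence "fps_nth (XX p 0 0 i j) 0 = tid 0 0 i j" "fps_nth (ZZ p i j 0 0) 0 = tid j i 0 0"
      using N_pos by (simp_all add: XX_def ZZ_def Rbar_def f0_0 R_0 reflc_nth_0_tid)
    thus "fps_nth (XX p 0 0 i j * ZZ p i j 0 0) 0 = tid 0 0 i j * tid i j 0 0" by (simp add: tid_def)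
  qed
  also have "\<dots> = 1" using tmul_tid_left[of N "tid :: 'k fls tmat"] N_pos by (auto simp: teq_def tid_def)
  finally have "fps_nth s 0 = 1" .
  hence "s = 1" by (rule scalar_unitary[OF p ZXs])
  thus "teq N (tmul N (XX p) (ZZ p)) tid" "teq N (tmul N (ZZ p) (XX p)) tid" using XZs ZXs by (simp_all add: smul4_1)
qed

text \<open>Unitarity identifies the inverse of R with a multiple of \<open>ZZ\<close>. Crossing
  then says that the partial transpose of \<open>ZZ\<close> is inverse, up to a scalar, to that of
  the shifted \<open>XX\<close>; the scalar is 1 by the determinant argument.\<close>

lemma crossing_matrices:
  "teq N (tmul N (transp1 (ZZ p)) (transp1 (\<lambda>a b c d. shift Nh (XX p a b c d)))) tid" (is "teq N (tmul N ?Z ?S) tid")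
  "teq N (tmul N (transp1 (\<lambda>a b c d. shift Nh (XX p a b c d))) (transp1 (ZZ p))) tid"
proof -
  obtain Y Z1 g where Y: "teq N (tmul N (tat R p) Y) tid" "teq N (tmul N Y (tat R p)) tid"
    and Z1: "teq N (tmul N (transp1 Y) Z1) tid" "teq N (tmul N Z1 (transp1 Y)) tid" and g: "fps_nth g 0 = 1"
    and cr: "teq N (transp1 Z1) (smul4 g (\<lambda>a b c d. shift Nh (R a b c d p)))" by (rule R_inverse)
  have "teq N (tmul N (tat R p) (smul4 (f0 p) (ZZ p))) tid"
    using XZ unfolding XX_smul4 tmul_smul4 .
  hence "teq N Y (smul4 (f0 p) (ZZ p))" by (rule tinverse_unique[OF Y(2)])
  hence Y': "teq N (transp1 Y) (smul4 (f0 p) ?Z)" by (simp only: smul4_transp1[symmetric] teq_transp1)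
  let ?sf = "shift Nh (f0 p)"
  have sf: "fps_nth ?sf 0 = 1" unfolding shift_nth_0 by (rule f0_0)
  have "(\<lambda>a b c d. shift Nh (XX p a b c d)) = smul4 ?sf (\<lambda>a b c d. shift Nh (R a b c d p))"
    by (intro ext) (simp add: XX_def Rbar_def smul4_def shift_mult)
  hence "smul4 (inverse ?sf) (\<lambda>a b c d. shift Nh (XX p a b c d)) = (\<lambda>a b c d. shift Nh (R a b c d p))"
    by (simp add: smul4_smul4 inverse_K[OF sf] smul4_1)
  hence "teq N (transp1 Z1) (smul4 (g * inverse ?sf) (\<lambda>a b c d. shift Nh (XX p a b c d)))"
    using cr by (simp flip: smul4_smul4)
  hence "teq N (transp1 (transp1 Z1)) (transp1 (smul4 (g * inverse ?sf) (\<lambda>a b c d. shift Nh (XX p a b c d))))"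
    by (rule transp1_cong)
  hence Z1': "teq N Z1 (smul4 (g * inverse ?sf) ?S)" by (simp add: smul4_transp1)
  define e where "e = f0 p * (g * inverse ?sf)"
  have e0: "fps_nth e 0 = 1" using f0_0(1) g inverse_K(3)[OF sf] unfolding e_def fps_mult_nth_0 by simp
  have 1: "teq N (smul4 e (tmul N ?Z ?S)) tid"
    using teq_trans[OF teq_sym[OF tmul_cong[OF Y' Z1']] Z1(1)] unfolding tmul_smul4 smul4_smul4 e_def by (simp add: mult_ac)
  have 2: "teq N (smul4 e (tmul N ?S ?Z)) tid"
    using teq_trans[OF teq_sym[OF tmul_cong[OF Z1' Y']] Z1(2)] unfolding tmul_smul4 smul4_smul4 e_def by (simp add: mult_ac)
  have "inverse e = 1"
    by (rule scalar_crossing[OF p teq_smul4_inverse[OF 1 e0] inverse_K(3)[OF e0]])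
  thus "teq N (tmul N ?Z ?S) tid" "teq N (tmul N ?S ?Z) tid"
    using teq_smul4_inverse[OF 1 e0] teq_smul4_inverse[OF 2 e0] by (simp_all add: smul4_1)
qed

lemma shift_back: "shift (- Nh) (shift Nh F) = F"
  by (simp add: shift_shift shift_0)

lemma crossing_matrices':
  "teq N (tmul N (transp1 (ZS p)) (transp1 (XX p))) tid" "teq N (tmul N (transp1 (XX p)) (transp1 (ZS p))) tid"
proof -
  have e: "(\<lambda>a b c d. shift (- Nh) (transp1 (ZZ p) a b c d)) = transp1 (ZS p)"
    "(\<lambda>a b c d. shift (- Nh) (transp1 (\<lambda>a b c d. shift Nh (XX p a b c d)) a b c d)) = transp1 (XX p)"
    by (intro ext, simp add: transp1_def ZS_def shift_back)+
  have Nh: "fps_nth (- Nh) 0 = 0" by simp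
  show "teq N (tmul N (transp1 (ZS p)) (transp1 (XX p))) tid" "teq N (tmul N (transp1 (XX p)) (transp1 (ZS p))) tid"
    using teq_shift[OF Nh crossing_matrices(1)] teq_shift[OF Nh crossing_matrices(2)] unfolding e by simp_all
qed

lemma base_unitary: "teq N (tmul N (tens4 (bB p) Tc Tc) (tens4 (flip2 (bN p)) Tc Tc)) tid"
  by (rule teq_trans[OF tmul_cong[OF tens4_bB[OF p] tens4_bN[OF p]] teq_TT[OF XZ]])

lemma base_crossing:
  "teq N (tmul N (transp1 (tens4 (bB p) Tc Tc)) (transp1 (tens4 (flip2 (bS p)) Tc Tc))) tid"
  "teq N (tmul N (transp1 (tens4 (flip2 (bS p)) Tc Tc)) (transp1 (tens4 (bB p) Tc Tc))) tid"
proof -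
  have t: "transp1 (\<lambda>a b c d. TT (X a b c d)) = (\<lambda>a b c d. TT (transp1 X a b c d))" for X :: "'k fls fps tmat"
    by (intro ext) (simp add: transp1_def)
  show "teq N (tmul N (transp1 (tens4 (bB p) Tc Tc)) (transp1 (tens4 (flip2 (bS p)) Tc Tc))) tid"
    by (rule teq_trans[OF tmul_cong[OF transp1_cong[OF tens4_bB[OF p]] transp1_cong[OF tens4_bS[OF p]]]])
       (unfold t, rule teq_TT[OF crossing_matrices'(2)])
  show "teq N (tmul N (transp1 (tens4 (flip2 (bS p)) Tc Tc)) (transp1 (tens4 (bB p) Tc Tc))) tid"
    by (rule teq_trans[OF tmul_cong[OF transp1_cong[OF tens4_bS[OF p]] transp1_cong[OF tens4_bB[OF p]]]])
       (unfold t, rule teq_TT[OF crossing_matrices'(1)])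
qed

lemma unitary_bB: "unitary N (bB p) (bN p) g y"
  by (rule unitary_words[OF J_unit pairing_bB[OF p] pairing_bN[OF p]],
      rule unitary_letter[OF J_unit pairing_bB[OF p] pairing_bN[OF p] base_unitary])

lemma crossing_bB: "crossing N (bB p) (bS p) g y"
  by (rule crossing_words[OF J_unit pairing_bB[OF p] pairing_bS[OF p]],
      rule crossing_letter[OF J_unit pairing_bB[OF p] pairing_bS[OF p] base_crossing])

text \<open>Unitarity and crossing also express the values on entries of \<open>T\<^sup>-\<^sup>1\<close> through shifted R-matrices.\<close>

lemma tens4_explicit:
  assumes "\<kappa> = Tc \<or> \<kappa> = Tic" "\<mu> = Tc \<or> \<mu> = Tic"
  shows "\<exists>F\<in>{XX p, ZZ p, ZS p}. teq N (tens4 (bB p) \<kappa> \<mu>) (\<lambda>a b c d. TT (F a b c d))"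
proof -
  have "teq N (tens4 (bB p) Tic Tc) (\<lambda>a b c d. TT (ZZ p a b c d))"
    by (rule teq_trans[OF unitary_TicTc[OF J_unit pairing_bB[OF p] pairing_bN[OF p] base_unitary] tens4_bN[OF p]])
  moreover have "teq N (tens4 (bB p) Tc Tic) (\<lambda>a b c d. TT (ZS p a b c d))"
    by (rule teq_trans[OF crossing_TcTic[OF J_unit pairing_bB[OF p] pairing_bS[OF p] base_crossing(2)] tens4_bS[OF p]])
  moreover have "teq N (tens4 (bB p) Tic Tic) (\<lambda>a b c d. TT (XX p a b c d))"
    by (rule teq_trans[OF tens4_TicTic[OF J_unit pairing_bB[OF p] pairing_bB[OF p]] tens4_bB[OF p]])
  ultimately show ?thesis using assms tens4_bB[OF p] by auto
qed

lemma gen_cases: obtains \<kappa> a b m where "g = \<kappa> a b m" "\<kappa> = Tc \<or> \<kappa> = Tic" "valid_gen N g \<longleftrightarrow> a < N \<and> b < N"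
  by (cases g) auto

lemma bB_letters:
  assumes "\<kappa> = Tc \<or> \<kappa> = Tic" "\<mu> = Tc \<or> \<mu> = Tic"
  obtains F where "F \<in> {XX p, ZZ p, ZS p}"
    "\<And>a b c d l m. a < N \<Longrightarrow> b < N \<Longrightarrow> c < N \<Longrightarrow> d < N \<Longrightarrow> bB p (Word [\<kappa> a c l]) (Word [\<mu> b d m]) = (- 1) ^ m * dd m (dd l (F a b c d))"
proof -
  obtain F where F: "F \<in> {XX p, ZZ p, ZS p}" "teq N (tens4 (bB p) \<kappa> \<mu>) (\<lambda>a b c d. TT (F a b c d))"
    using tens4_explicit[OF assms] by blast
  show ?thesis using that[OF F(1)] teq_nthD[OF F(2)] by (simp add: TT_nth)
qed

lemma valid_letter: "\<kappa> = Tc \<or> \<kappa> = Tic \<Longrightarrow> valid N (Word [\<kappa> a b m]) \<longleftrightarrow> a < N \<and> b < N"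
  by auto

text \<open>Every type of letter pair has values given by Taylor coefficients of a function of
  \<open>w + u - v\<close>, and this makes the two variables move together. Letters out of range
  pair to 0 on both sides.\<close>

lemma transl_bB_letter: "transl_left (bB p) (Word [s])" "transl_right (bB p) (Word [s])"
proof -
  note null = pairing_null[OF J_unit pairing_bB[OF p]]
  obtain \<mu> b d m where s: "s = \<mu> b d m" "\<mu> = Tc \<or> \<mu> = Tic" by (rule gen_cases)
  show "transl_left (bB p) (Word [s])"
    unfolding transl_left_def s(1)
  proof (intro allI impI)
    fix \<kappa> a c l assume \<kappa>: "\<kappa> = Tc \<or> \<kappa> = Tic"
    show "bB p (Word [\<kappa> a c l]) (Word [\<mu> b d m]) = dd l (bB p (Word [\<kappa> a c 0]) (Word [\<mu> b d m]))"
    proof (cases "a < N \<and> b < N \<and> c < N \<and> d < N")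
      case True
      obtain F where "\<And>a b c d l m. a < N \<Longrightarrow> b < N \<Longrightarrow> c < N \<Longrightarrow> d < N \<Longrightarrow> bB p (Word [\<kappa> a c l]) (Word [\<mu> b d m]) = (- 1) ^ m * dd m (dd l (F a b c d))"
        by (rule bB_letters[OF \<kappa> s(2)]) blast
      thus ?thesis using True by (simp add: minus_one_power_const dd_commute[of l])
    next
      case False
      hence "\<not> valid N (Word [\<kappa> a c l]) \<and> \<not> valid N (Word [\<kappa> a c 0]) \<or> \<not> valid N (Word [\<mu> b d m])"
        unfolding valid_letter[OF \<kappa>] valid_letter[OF s(2)] by blast
      thus ?thesis using null hadd_0[OF hadd_dd] by metis
    qed
  qed
  show "transl_right (bB p) (Word [s])"
    unfolding transl_right_def s(1)
  proof (intro allI impI)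
    fix \<kappa> a c l assume \<kappa>: "\<kappa> = Tc \<or> \<kappa> = Tic"
    show "bB p (Word [\<mu> b d m]) (Word [\<kappa> a c l]) = (- 1) ^ l * dd l (bB p (Word [\<mu> b d m]) (Word [\<kappa> a c 0]))"
    proof (cases "a < N \<and> b < N \<and> c < N \<and> d < N")
      case True
      obtain F where "\<And>a b c d l m. a < N \<Longrightarrow> b < N \<Longrightarrow> c < N \<Longrightarrow> d < N \<Longrightarrow> bB p (Word [\<mu> a c l]) (Word [\<kappa> b d m]) = (- 1) ^ m * dd m (dd l (F a b c d))"
        by (rule bB_letters[OF s(2) \<kappa>]) blast
      thus ?thesis using True by simp
    next
      case False
      hence "\<not> valid N (Word [\<kappa> a c l]) \<and> \<not> valid N (Word [\<kappa> a c 0]) \<or> \<not> valid N (Word [\<mu> b d m])"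
        unfolding valid_letter[OF \<kappa>] valid_letter[OF s(2)] by blast
      thus ?thesis using null hadd_0[OF hadd_dd] mult_zero_right by metis
    qed
  qed
qed

lemma transl_bB: "transl_left (bB p) y" "transl_right (bB p) y"
  by (rule transl_words[OF pairing_bB[OF p]], rule transl_bB_letter)+

text \<open>By \<open>qdet = 1\<close>, the product of the shifts of \<open>f0\<close> is inverse to
  a polynomial expression W in shifts of regular entries of R. So that product is regular, and with
  it each of its factors.\<close>

lemma reg_f0:
  assumes R: "\<And>a b c d. a < N \<Longrightarrow> b < N \<Longrightarrow> c < N \<Longrightarrow> d < N \<Longrightarrow> reg (R a b c d p)"
  shows "reg (f0 p)"
proof -
  let ?W = "\<Sum>K\<in>midx N. hconst (C K) * matprod N (map (\<lambda>r a b. shift (u_shift N r) (R r a (K ! r) b p)) [0..<N]) 0 0"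
  let ?P = "\<Prod>r<N. shift (u_shift N r) (f0 p)"
  have W: "reg ?W"
  proof (intro reg_sum reg_mult reg_hconst reg_matprod reg_shift R)
    fix K r assume "K \<in> midx N" "r \<in> set [0..<N]"
    thus "r < N" "K ! r < N" by (auto simp: midx_def dest: nth_mem)
  qed (use N_pos in auto)
  have "(\<Sum>K\<in>midx N. hconst (C K) * matprod N (map (\<lambda>r a b. shift (u_shift N r) (Rbar f0 R r a (K ! r) b p)) [0..<N]) 0 0) = 1"
    using nz p N_pos unfolding normalizing_def by auto
  hence eq: "?P * ?W = 1"
    unfolding Rbar_def shift_mult[OF u_shift_0] matprod_scale prod_list_upt sum_distrib_left by (simp only: mult.left_commute)
  have "fps_nth ?P 0 = 1" by (rule prod_shift_nth_0[OF f0_0(1)])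
  moreover have "fps_nth (?P * ?W) 0 = 1" by (simp add: eq)
  ultimately have "fps_nth ?W 0 = 1" by simp
  hence "reg ?P" by (rule reg_of_mult_eq_1[OF W _ eq])
  thus ?thesis by (intro reg_of_prod_shift[OF _ f0_0(1) N_pos]) simp_all
qed

end

text \<open>Regularity of R at both p and its negative is assumed because \<open>ZZ\<close> and
  \<open>ZS\<close>, the values on letters of \<open>T^-1\<close>, come from the expansion at
  \<open>neg p\<close>. Words inherit regularity since the values are sums of products.\<close>

lemma reg_bB:
  assumes p: "p \<in> points \<Sigma>"
    and R: "\<And>a b c d. a < N \<Longrightarrow> b < N \<Longrightarrow> c < N \<Longrightarrow> d < N \<Longrightarrow> reg (R a b c d p)"
    and R': "\<And>a b c d. a < N \<Longrightarrow> b < N \<Longrightarrow> c < N \<Longrightarrow> d < N \<Longrightarrow> reg (R a b c d (neg p))"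
  shows "reg (bB p v w)"
proof -
  have X: "reg (XX p a b c d)" if "a < N" "b < N" "c < N" "d < N" for a b c d
    unfolding XX_def Rbar_def using that R by (intro reg_mult reg_f0[OF p])
  have Z: "reg (ZZ p a b c d)" if "a < N" "b < N" "c < N" "d < N" for a b c d
    unfolding ZZ_def Rbar_def using that R' by (intro reg_reflc reg_mult reg_f0[OF points_neg[OF p]])
  have "reg (bB p (Word [g]) (Word [s]))" for g s
  proof (cases "valid_gen N g \<and> valid_gen N s")
    case True
    obtain \<kappa> a c l where g: "g = \<kappa> a c l" "\<kappa> = Tc \<or> \<kappa> = Tic" "valid_gen N g \<longleftrightarrow> a < N \<and> c < N" by (rule gen_cases[OF p])
    obtain \<mu> b d m where s: "s = \<mu> b d m" "\<mu> = Tc \<or> \<mu> = Tic" "valid_gen N s \<longleftrightarrow> b < N \<and> d < N" by (rule gen_cases[OF p])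
    obtain F where F: "F \<in> {XX p, ZZ p, ZS p}"
      "\<And>a b c d l m. a < N \<Longrightarrow> b < N \<Longrightarrow> c < N \<Longrightarrow> d < N \<Longrightarrow> bB p (Word [\<kappa> a c l]) (Word [\<mu> b d m]) = (- 1) ^ m * dd m (dd l (F a b c d))"
      by (rule bB_letters[OF p g(2) s(2)]) blast
    have "reg (F a b c d)" using F(1) X Z True g(3) s(3) by (auto simp: ZS_def reg_shift)
    hence "reg (dd m (dd l (F a b c d)))" by (intro reg_dd)
    thus ?thesis using True g s F(2)[of a b c d l m] by (cases "even m") (auto simp: reg_minus)
  qed (use pairing_null[OF J_unit pairing_bB[OF p]] in auto)
  hence 1: "reg (bB p (Word [g]) w)" for g w
  proof (induction w arbitrary: g rule: word_induct)
    case 0 show ?case by (simp add: pairing_0[OF pairing_bB[OF p]] cu_def)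
  next
    case (Cons s w)
    have "reg (swee_gen N (\<lambda>u1 u2. bB p u1 w * bB p u2 (Word [s])) g)"
      using Cons by (cases g) (simp_all add: reg_sum reg_mult)
    thus ?case by (simp add: pairing_right[OF pairing_bB[OF p]])
  qed
  show ?thesis
  proof (induction v arbitrary: w rule: word_induct)
    case 0 show ?case by (simp add: pairing_0[OF pairing_bB[OF p]] cu_def)
  next
    case (Cons g v)
    show ?case unfolding pairing_left[OF pairing_bB[OF p]] by (intro reg_swee reg_mult 1 Cons)
  qed
qed

end

section \<open>Values at points of the group\<close>

subsection \<open>Differences of points\<close>

text \<open>The cubic minus the square of a line has the three abscissae as roots up to a linear
  remainder \<open>\<alpha> X + \<beta>\<close>; the choice of x3 is the Vieta relation for the
  quadratic coefficient.\<close>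

lemma chord_identity:
  fixes x1 :: "'a::field_char_0"
  assumes "4 * x3 = m ^ 2 - 4 * x1 - 4 * x2"
    and "\<alpha> = - g2 - 2 * m * (y1 - m * x1) - 4 * (x1 * x2 + x1 * x3 + x2 * x3)"
    and "\<beta> = - g3 - (y1 - m * x1) ^ 2 + 4 * (x1 * x2 * x3)"
  shows "4 * X ^ 3 - g2 * X - g3 - (y1 + m * (X - x1)) ^ 2 = 4 * (X - x1) * (X - x2) * (X - x3) + \<alpha> * X + \<beta>"
  using assms by algebra

text \<open>The linear remainder vanishes at the two distinct points x1 and x2, hence identically,
  and evaluation at x3 gives the curve equation.\<close>

lemma chord_closed:
  fixes x1 :: "'a::field_char_0"
  assumes "x1 \<noteq> x2" "y1 ^ 2 = 4 * x1 ^ 3 - g2 * x1 - g3" "y2 ^ 2 = 4 * x2 ^ 3 - g2 * x2 - g3"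
    and m: "m = (y2 - y1) / (x2 - x1)" and x3: "x3 = m ^ 2 / 4 - x1 - x2"
  shows "(y1 + m * (x3 - x1)) ^ 2 = 4 * x3 ^ 3 - g2 * x3 - g3"
proof -
  define \<alpha> \<beta> where "\<alpha> = - g2 - 2 * m * (y1 - m * x1) - 4 * (x1 * x2 + x1 * x3 + x2 * x3)"
    and "\<beta> = - g3 - (y1 - m * x1) ^ 2 + 4 * (x1 * x2 * x3)"
  have x3': "4 * x3 = m ^ 2 - 4 * x1 - 4 * x2" by (simp add: x3 field_simps)
  note id = chord_identity[OF x3' \<alpha>_def \<beta>_def]
  have "y1 + m * (x2 - x1) = y2" using assms(1) by (simp add: m)
  hence 2: "\<alpha> * x2 + \<beta> = 0" using id[of x2] assms(3) by simp
  have 1: "\<alpha> * x1 + \<beta> = 0" using id[of x1] assms(2) by simp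
  have "\<alpha> * (x1 - x2) = 0" using 1 2 by algebra
  hence "\<alpha> = 0" using assms(1) by simp
  hence "\<beta> = 0" using 1 by simp
  thus ?thesis using id[of x3] \<open>\<alpha> = 0\<close> by simp
qed

text \<open>Only one root x1 is available; the vanishing of \<open>\<alpha>\<close> is instead the
  equation defining the slope of the tangent, and then \<open>\<beta>\<close> vanishes by the
  root.\<close>

lemma tangent_closed:
  fixes x1 :: "'a::field_char_0"
  assumes "y1 \<noteq> 0" "y1 ^ 2 = 4 * x1 ^ 3 - g2 * x1 - g3"
    and m: "m = (12 * x1 ^ 2 - g2) / (2 * y1)" and x3: "x3 = m ^ 2 / 4 - x1 - x1"
  shows "(y1 + m * (x3 - x1)) ^ 2 = 4 * x3 ^ 3 - g2 * x3 - g3"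
proof -
  define \<alpha> \<beta> where "\<alpha> = - g2 - 2 * m * (y1 - m * x1) - 4 * (x1 * x1 + x1 * x3 + x1 * x3)"
    and "\<beta> = - g3 - (y1 - m * x1) ^ 2 + 4 * (x1 * x1 * x3)"
  have x3': "4 * x3 = m ^ 2 - 4 * x1 - 4 * x1" by (simp add: x3 field_simps)
  note id = chord_identity[OF x3' \<alpha>_def \<beta>_def]
  have 1: "\<alpha> * x1 + \<beta> = 0" using id[of x1] assms(2) by simp
  have "2 * m * y1 = 12 * x1 ^ 2 - g2" using assms(1) by (simp add: m)
  hence "\<alpha> = 0" using x3' unfolding \<alpha>_def by algebra
  hence "\<beta> = 0" using 1 by simp
  thus ?thesis using id[of x3] \<open>\<alpha> = 0\<close> by simp
qed

lemma points_add:
  assumes "P \<in> points \<Sigma>" "Q \<in> points (\<Sigma> :: 'k::field_char_0 curve)"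
  shows "add \<Sigma> P Q \<in> points \<Sigma>"
proof (cases \<Sigma>)
  case (Elliptic g2 g3)
  show ?thesis
  proof (cases "P = EO \<or> Q = EO")
    case True
    thus ?thesis using assms by (cases P; cases Q) (auto simp: Elliptic)
  next
    case False
    then obtain x1 y1 x2 y2 where PQ: "P = EP x1 y1" "Q = EP x2 y2"
      and 1: "y1 ^ 2 = 4 * x1 ^ 3 - g2 * x1 - g3" and 2: "y2 ^ 2 = 4 * x2 ^ 3 - g2 * x2 - g3"
      using assms by (auto simp: Elliptic)
    show ?thesis
    proof (cases "x1 = x2")
      case True
      show ?thesis
      proof (cases "y1 = - y2")
        case False
        have "y1 ^ 2 = y2 ^ 2" using 1 2 True by simp
        hence "y1 = y2" using False by (simp add: power2_eq_iff)
        hence "y1 \<noteq> 0" using False by auto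
        define m X where "m = (12 * x1 ^ 2 - g2) / (2 * y1)" and "X = m ^ 2 / 4 - x1 - x1"
        have "add \<Sigma> P Q = EP X (- (y1 + m * (X - x1)))"
          using True False \<open>y1 = y2\<close> by (simp add: Elliptic PQ Let_def m_def X_def)
        thus ?thesis using tangent_closed[OF \<open>y1 \<noteq> 0\<close> 1 m_def X_def]
          by (simp add: Elliptic del: minus_add_distrib)
      qed (use True in \<open>simp add: Elliptic PQ\<close>)
    next
      case False
      define m X where "m = (y2 - y1) / (x2 - x1)" and "X = m ^ 2 / 4 - x1 - x2"
      have "add \<Sigma> P Q = EP X (- (y1 + m * (X - x1)))"
        using False by (simp add: Elliptic PQ Let_def m_def X_def)
      thus ?thesis using chord_closed[OF False 1 2 m_def X_def]
        by (simp add: Elliptic del: minus_add_distrib)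
    qed
  qed
qed (use assms in auto)

text \<open>The consequence of the group law that inversion of the equations rests on: unitarity
  relates \<open>z_i - z_j\<close> to its negative, which has to be recognized as
  \<open>z_j - z_i\<close>.\<close>

lemma neg_add_swap:
  assumes "P \<in> points \<Sigma>" "Q \<in> points (\<Sigma> :: 'k::field_char_0 curve)"
  shows "add \<Sigma> Q (neg P) = neg (add \<Sigma> P (neg Q))"
proof (cases \<Sigma>)
  case Additive thus ?thesis using assms by auto
next
  case Multiplicative thus ?thesis using assms by (auto simp: mult.commute)
next
  case (Elliptic g2 g3)
  show ?thesis
  proof (cases "P = EO \<or> Q = EO")
    case True
    thus ?thesis using assms by (cases P; cases Q) (auto simp: Elliptic)
  next
    case False
    then obtain x1 y1 x2 y2 where PQ: "P = EP x1 y1" "Q = EP x2 y2" using assms by (auto simp: Elliptic)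
    show ?thesis
    proof (cases "x1 = x2")
      case True
      have "(12 * x2 ^ 2 - g2) / (2 * y2) = - ((12 * x2 ^ 2 - g2) / (2 * y1))" if "y1 \<noteq> y2" "y1 ^ 2 = y2 ^ 2"
        using that by (auto simp: power2_eq_iff)
      moreover have "y1 ^ 2 = y2 ^ 2" using assms True by (auto simp: Elliptic PQ)
      moreover have "y1 \<noteq> y2 \<Longrightarrow> y1 = - y2" using \<open>y1 ^ 2 = y2 ^ 2\<close> by (simp add: power2_eq_iff)
      ultimately show ?thesis using True by (auto simp: Elliptic PQ Let_def)
    next
      case False
      define m where "m = (- y2 - y1) / (x2 - x1)"
      have m': "(- y1 - y2) / (x1 - x2) = - m" using False by (simp add: m_def field_simps)
      have m2: "m * (x1 - x2) = y1 + y2" using False by (simp add: m_def field_simps)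
      have 1: "add \<Sigma> P (neg Q) = EP (m ^ 2 / 4 - x1 - x2) (- (y1 + m * ((m ^ 2 / 4 - x1 - x2) - x1)))"
        using False by (simp add: Elliptic PQ Let_def m_def)
      have 2: "add \<Sigma> Q (neg P) = EP (m ^ 2 / 4 - x2 - x1) (- (y2 + - m * ((m ^ 2 / 4 - x2 - x1) - x2)))"
        using False m' by (simp add: Elliptic PQ Let_def)
      have "- (y2 + - m * ((q - x2 - x1) - x2)) = y1 + m * ((q - x1 - x2) - x1)" for q
        using m2 by algebra
      note Y = this[of "m ^ 2 / 4"]
      have "m ^ 2 / 4 - x2 - x1 = m ^ 2 / 4 - x1 - x2" by simp
      with Y show ?thesis unfolding 1 2 neg.simps pt.inject minus_minus by blast
    qed
  qed
qed

subsection \<open>Values of B\<close>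

context qkz
begin

definition pr :: "'k hpt \<Rightarrow> gen0 word \<Rightarrow> gen0 word \<Rightarrow> 'k fps" where "pr x v w = val (B v w) x"

text \<open>Regularity is required at the point and at its negative, which makes the condition
  stable under \<open>opp\<close>. Moving by a multiple of h does not change the reduction and hence
  preserves it.\<close>

definition good :: "'k hpt \<Rightarrow> bool" where "good x \<longleftrightarrow> fst x \<in> points \<Sigma> \<and> fps_nth (snd x) 0 = 0 \<and>
  (\<forall>a<N. \<forall>b<N. \<forall>c<N. \<forall>d<N. reg (R a b c d (fst x)) \<and> reg (R a b c d (neg (fst x))))"

definition opp :: "'k hpt \<Rightarrow> 'k hpt" where "opp x = (neg (fst x), - snd x)"

lemma good_opp: "good x \<Longrightarrow> good (opp x)"
  by (auto simp: good_def opp_def points_neg)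

lemma good_hmove: "good x \<Longrightarrow> fps_nth a 0 = 0 \<Longrightarrow> good (hmove x a)"
  by (auto simp: good_def hmove_def)

lemma pr_ev: "pr x v w = ev (snd x) (bB (fst x) v w)"
  by (simp add: pr_def val_ev bB_def)

context
  fixes x :: "'k hpt" assumes x: "good x"
begin

lemma goodD: "fst x \<in> points \<Sigma>" "fps_nth (snd x) 0 = 0" "reg (bB (fst x) v w)" "reg (bN (fst x) v w)" "reg (bS (fst x) v w)"
proof -
  show 1: "fst x \<in> points \<Sigma>" "fps_nth (snd x) 0 = 0" using x by (auto simp: good_def)
  show "reg (bB (fst x) v w)" by (rule reg_bB[OF 1(1)]) (use x in \<open>auto simp: good_def\<close>)
  have "reg (bB (neg (fst x)) v w)" for v w by (rule reg_bB[OF points_neg[OF 1(1)]]) (use x in \<open>auto simp: good_def\<close>)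
  thus "reg (bN (fst x) v w)" "reg (bS (fst x) v w)" by (simp_all add: bS_def bN_def bB_def reg_reflc reg_shift)
qed

lemma ev_swee: "ev (snd x) (swee N \<Psi> w) = swee N (\<lambda>a b. ev (snd x) (\<Psi> a b)) w"
  by (rule swee_additive) (simp_all add: hadd_0[OF hadd_ev[OF goodD(2)]] hadd_add[OF hadd_ev[OF goodD(2)]])

lemma ev_cu: "ev (snd x) (cu N w) = cu N w"
  using ev_hconst[OF goodD(2), of 1] ev_hconst[OF goodD(2), of 0] by (auto simp: cu_def)

lemma pr_left: "pr x (u + v) w = swee N (\<lambda>w1 w2. pr x u w1 * pr x v w2) w"
  unfolding pr_ev pairing_left[OF pairing_bB[OF goodD(1)]] ev_swee ev_mult[OF goodD(2) goodD(3) goodD(3)] ..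

lemma pr_right: "pr x u (v + w) = swee N (\<lambda>u1 u2. pr x u1 w * pr x u2 v) u"
  unfolding pr_ev pairing_right[OF pairing_bB[OF goodD(1)]] ev_swee ev_mult[OF goodD(2) goodD(3) goodD(3)] ..

lemma pr_0: "pr x 0 w = cu N w" "pr x w 0 = cu N w"
  by (simp_all add: pr_ev pairing_0[OF pairing_bB[OF goodD(1)]] ev_cu)

lemma pr_kill:
  assumes "y \<in> J" shows "appl (\<lambda>v. pr x v w) y = 0" "appl (pr x w) y = 0"
  using pairing_kill[OF pairing_bB[OF goodD(1)] assms, of w] hadd_0[OF hadd_ev[OF goodD(2)]]
  by (simp_all add: pr_ev[abs_def] flip: ev_appl_fls[OF goodD(2)])

lemma ev_bN: "ev (snd x) (bN (fst x) v w) = pr (opp x) v w"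
  by (simp add: bN_def ev_reflc[OF goodD(2)] pr_ev opp_def bB_def)

lemma ev_bS: "ev (snd x) (bS (fst x) v w) = pr (hmove (opp x) Nh) v w"
proof -
  have n: "fps_nth (- Nh) 0 = 0" "fps_nth (snd x + - Nh) 0 = 0" using goodD(2) by simp_all
  show ?thesis
    unfolding bS_def ev_shift[OF goodD(2) n(1)] bN_def ev_reflc[OF n(2)] pr_ev opp_def bB_def hmove_def by simp
qed

lemma pr_unitary: "swee N (\<lambda>g1 g2. swee N (\<lambda>y1 y2. pr x g1 y1 * pr (opp x) y2 g2) y) g = cu N g * cu N y"
proof -
  have "ev (snd x) (swee N (\<lambda>g1 g2. swee N (\<lambda>y1 y2. bB (fst x) g1 y1 * bN (fst x) y2 g2) y) g) = ev (snd x) (cu N g * cu N y)"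
    using unitary_bB[OF goodD(1)] by (simp add: unitary_def)
  \<comment> \<open>The counit occurs here with values in k((u))[[h]] and afterwards in k[[h]];
    deciding it in the integers makes the two comparable.\<close>
  also have "(cu N g * cu N y :: 'k fls fps) = (if cu N g = (1::int) \<and> cu N y = (1::int) then 1 else 0)" by (auto simp: cu_def)
  also have "ev (snd x) \<dots> = cu N g * cu N y"
    using ev_hconst[OF goodD(2), of 1] ev_hconst[OF goodD(2), of 0] by (auto simp: cu_def)
  finally show ?thesis
    unfolding ev_swee ev_mult[OF goodD(2) goodD(3) goodD(4)] ev_bN pr_ev[symmetric] .
qed

lemma pr_crossing: "swee N (\<lambda>g1 g2. swee N (\<lambda>y1 y2. pr x g2 y1 * pr (hmove (opp x) Nh) y2 g1) y) g = cu N g * cu N y"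
proof -
  have "ev (snd x) (swee N (\<lambda>g1 g2. swee N (\<lambda>y1 y2. bB (fst x) g2 y1 * bS (fst x) y2 g1) y) g) = ev (snd x) (cu N g * cu N y)"
    using crossing_bB[OF goodD(1)] by (simp add: crossing_def)
  also have "(cu N g * cu N y :: 'k fls fps) = (if cu N g = (1::int) \<and> cu N y = (1::int) then 1 else 0)" by (auto simp: cu_def)
  also have "ev (snd x) \<dots> = cu N g * cu N y"
    using ev_hconst[OF goodD(2), of 1] ev_hconst[OF goodD(2), of 0] by (auto simp: cu_def)
  finally show ?thesis
    unfolding ev_swee ev_mult[OF goodD(2) goodD(3) goodD(5)] ev_bS pr_ev[symmetric] .
qed

lemma pr_tau_left:
  assumes a: "fps_nth a 0 = 0" shows "appl (\<lambda>w. pr x w y) (tauw a g) = pr (hmove x (- a)) g y"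
proof -
  have "appl (\<lambda>w. pr x w y) (tauw a g) = ev (snd x) (shift (- a) (bB (fst x) g y))"
    unfolding pr_ev ev_appl_fls[OF goodD(2), symmetric] tau_left[OF pairing_bB[OF goodD(1)] transl_bB(1)[OF goodD(1)] a] ..
  also have "\<dots> = ev (snd x + - a) (bB (fst x) g y)" by (rule ev_shift[OF goodD(2)]) (simp add: a)
  finally show ?thesis by (simp add: pr_ev hmove_def)
qed

lemma pr_tau_right:
  assumes a: "fps_nth a 0 = 0" shows "appl (pr x y) (tauw a g) = pr (hmove x a) y g"
proof -
  have "appl (pr x y) (tauw a g) = ev (snd x) (shift a (bB (fst x) y g))"
    unfolding pr_ev[abs_def] ev_appl_fls[OF goodD(2), symmetric] tau_right[OF pairing_bB[OF goodD(1)] transl_bB(2)[OF goodD(1)] a] ..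
  also have "\<dots> = ev (snd x + a) (bB (fst x) y g)" by (rule ev_shift[OF goodD(2) a])
  finally show ?thesis by (simp add: pr_ev hmove_def)
qed

end

lemma good_hsub:
  assumes "z \<in> config_space \<Sigma> N R n" "i < n" "j < n" "i \<noteq> j"
  shows "good (hsub \<Sigma> (z i) (z j))" and "opp (hsub \<Sigma> (z i) (z j)) = hsub \<Sigma> (z j) (z i)"
proof -
  have pts: "fst (z i) \<in> points \<Sigma>" "fst (z j) \<in> points \<Sigma>" "fps_nth (snd (z i)) 0 = 0" "fps_nth (snd (z j)) 0 = 0"
    using assms unfolding config_space_def hpoints_def by (auto split: prod.splits)
  have sw: "fst (hsub \<Sigma> (z j) (z i)) = neg (fst (hsub \<Sigma> (z i) (z j)))"
    using neg_add_swap[OF pts(1,2)] by (simp add: hsub_def)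
  thus "opp (hsub \<Sigma> (z i) (z j)) = hsub \<Sigma> (z j) (z i)" by (simp add: opp_def hsub_def)
  have "tregular N R (hsub \<Sigma> (z i) (z j))" "tregular N R (hsub \<Sigma> (z j) (z i))"
    using assms unfolding config_space_def by auto
  thus "good (hsub \<Sigma> (z i) (z j))"
    using pts points_add[OF pts(1) points_neg[OF pts(2)]]
    unfolding good_def tregular_def regular_def sw reg_def by (simp add: hsub_def)
qed

end

section \<open>The Hopf algebra structure\<close>

subsection \<open>Translations of series\<close>

text \<open>Collecting terms by i = j + p turns the weights into a Vandermonde convolution, whose
  value does not depend on i.\<close>

lemma binomial_antidiagonal:
  fixes F :: "nat \<Rightarrow> 'a::ring_1"
  shows "(\<Sum>j\<le>n. \<Sum>p\<le>k. of_nat (((j + p) choose p) * ((n - j + (k - p)) choose (k - p))) * F (j + p)) =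
    of_nat ((n + k) choose k) * (\<Sum>i\<le>n + k. F i)"
proof -
  let ?g = "\<lambda>p i. of_nat ((i choose p) * ((n + k - i) choose (k - p))) * F i"
  have "(\<Sum>j\<le>n. of_nat (((j + p) choose p) * ((n - j + (k - p)) choose (k - p))) * F (j + p)) = (\<Sum>i\<le>n + k. ?g p i)"
    if p: "p \<le> k" for p
  proof -
    have "(\<Sum>j\<le>n. of_nat (((j + p) choose p) * ((n - j + (k - p)) choose (k - p))) * F (j + p)) = (\<Sum>j\<le>n. ?g p (j + p))"
      using p by (intro sum.cong refl) simp
    also have "\<dots> = (\<Sum>i\<in>(\<lambda>j. j + p) ` {..n}. ?g p i)" by (simp add: sum.reindex)
    also have "\<dots> = (\<Sum>i\<le>n + k. ?g p i)"
    proof (rule sum.mono_neutral_left)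
      show "\<forall>i\<in>{..n + k} - (\<lambda>j. j + p) ` {..n}. ?g p i = 0"
      proof
        fix i assume i: "i \<in> {..n + k} - (\<lambda>j. j + p) ` {..n}"
        have "i < p \<or> i > n + p"
        proof (rule ccontr)
          assume "\<not> ?thesis"
          hence "i = (i - p) + p" "i - p \<le> n" by auto
          thus False using i by blast
        qed
        thus "?g p i = 0"
        proof
          assume "i < p" thus ?thesis by (simp add: binomial_eq_0)
        next
          assume "i > n + p"
          hence "n + k - i < k - p" using p i by auto
          thus ?thesis by (simp add: binomial_eq_0)
        qed
      qed
    qed (use p in auto)
    finally show ?thesis .
  qed
  note inner = this
  have "(\<Sum>p\<le>k. \<Sum>j\<le>n. of_nat (((j + p) choose p) * ((n - j + (k - p)) choose (k - p))) * F (j + p)) = (\<Sum>p\<le>k. \<Sum>i\<le>n + k. ?g p i)"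
    by (rule sum.cong[OF refl], rule inner) simp
  also have "\<dots> = (\<Sum>i\<le>n + k. of_nat (\<Sum>p\<le>k. (i choose p) * ((n + k - i) choose (k - p))) * F i)"
    by (subst sum.swap) (simp add: sum_distrib_right)
  also have "\<dots> = (\<Sum>i\<le>n + k. of_nat ((n + k) choose k) * F i)"
    by (intro sum.cong refl) (simp only: vandermonde atMost_iff le_add_diff_inverse)
  finally show ?thesis by (subst sum.swap) (simp add: sum_distrib_left)
qed

lemma hsum_sum: "hsum (\<lambda>k. \<Sum>j\<in>A. g j k) = (\<Sum>j\<in>A. hsum (g j))"
  by (rule fps_ext) (simp add: hsum_nth fps_sum_nth sum.swap[of _ A])

text \<open>Substituting \<open>u + a\<close> is multiplicative even over noncommuting coefficients,
  provided a commutes with the coefficients of the right factor, past which its powers have to be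
  moved.\<close>

lemma translate_mult:
  fixes a :: "'a::ring_1 fps"
  assumes a: "fps_nth a 0 = 0" and comm: "\<And>j. a * B j = B j * a"
  shows "translate (\<lambda>m. \<Sum>i\<le>m. A i * B (m - i)) a n = (\<Sum>j\<le>n. translate A a j * translate B a (n - j))"
proof -
  have power: "a ^ p * (x * a ^ q) = x * a ^ (p + q)" if "a * x = x * a" for x and p q :: nat
    using power_commuting_commutes[OF that, of p] by (simp add: power_add mult.assoc[symmetric])
  have of_nat: "x * (of_nat c * y) = of_nat c * (x * y)" for x y :: "'a fps" and c
    by (metis mult.assoc mult_of_nat_commute)
  have "translate A a j * translate B a (n - j) = hsum (\<lambda>k. \<Sum>p\<le>k.
      of_nat (((j + p) choose p) * ((n - j + (k - p)) choose (k - p))) * (A (j + p) * B (n + k - (j + p)) * a ^ k))"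
    if j: "j \<le> n" for j
    unfolding translate_def hsum_mult[OF hdiv_mult_power[OF a] hdiv_mult_power[OF a]]
  proof (intro hsum_cong sum.cong refl)
    fix k p :: nat assume "p \<in> {..k}"
    hence p: "p \<le> k" by simp
    have e: "n - j + (k - p) = n + k - (j + p)" using p j by linarith
    let ?c = "of_nat ((j + p) choose p) :: 'a fps" and ?d = "of_nat ((n - j + (k - p)) choose (k - p)) :: 'a fps"
    let ?x = "B (n - j + (k - p))"
    have "?c * A (j + p) * a ^ p * (?d * ?x * a ^ (k - p)) = ?c * (A (j + p) * (a ^ p * (?d * (?x * a ^ (k - p)))))"
      by (simp add: mult.assoc)
    also have "\<dots> = ?c * (?d * (A (j + p) * (a ^ p * (?x * a ^ (k - p)))))" 
      by (simp only: of_nat[of "A (j + p)"] of_nat[of "a ^ p"])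
    also have "a ^ p * (?x * a ^ (k - p)) = ?x * a ^ k" using power[OF comm, of p _ "k - p"] p by simp
    finally show "?c * A (j + p) * a ^ p * (?d * ?x * a ^ (k - p)) =
        of_nat (((j + p) choose p) * ((n - j + (k - p)) choose (k - p))) * (A (j + p) * B (n + k - (j + p)) * a ^ k)"
      by (simp add: mult.assoc e)
  qed
  hence "(\<Sum>j\<le>n. translate A a j * translate B a (n - j)) = hsum (\<lambda>k. \<Sum>j\<le>n. \<Sum>p\<le>k.
      of_nat (((j + p) choose p) * ((n - j + (k - p)) choose (k - p))) * (A (j + p) * B (n + k - (j + p)) * a ^ k))"
    by (simp add: hsum_sum)
  also have "\<dots> = hsum (\<lambda>k. of_nat ((n + k) choose k) * (\<Sum>i\<le>n + k. A i * B (n + k - i) * a ^ k))"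
    by (rule hsum_cong, rule binomial_antidiagonal)
  finally show ?thesis unfolding translate_def by (simp add: sum_distrib_right mult.assoc)
qed

lemma translate_sum: "translate (\<lambda>m. \<Sum>j\<in>X. L j m) a n = (\<Sum>j\<in>X. translate (L j) a n)"
  unfolding translate_def by (simp add: sum_distrib_left sum_distrib_right hsum_sum)

definition ahom :: "('a::ring_1 fps \<Rightarrow> 'b::ring_1 fps) \<Rightarrow> bool"
  where "ahom f \<longleftrightarrow> hadd f \<and> f 1 = 1 \<and> (\<forall>x y. f (x * y) = f x * f y)"

lemma ahomD: "ahom f \<Longrightarrow> hadd f" "ahom f \<Longrightarrow> f 1 = 1" "ahom f \<Longrightarrow> f (x * y) = f x * f y"
  by (simp_all add: ahom_def)

lemma ahom_of_nat: "ahom f \<Longrightarrow> f (of_nat n) = of_nat n"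
  by (induction n) (simp_all add: ahomD hadd_0[OF ahomD(1)] hadd_add[OF ahomD(1)])

lemma ahom_power: "ahom f \<Longrightarrow> f (x ^ n) = f x ^ n"
  by (induction n) (simp_all add: ahomD)

lemma ahom_translate:
  assumes "ahom f" "fps_nth a 0 = 0" shows "f (translate L a m) = translate (\<lambda>k. f (L k)) (f a) m"
  unfolding translate_def
  by (subst hadd_hsum(1)[OF ahomD(1)[OF assms(1)] hdiv_mult_power[OF assms(2)]])
    (simp add: ahomD(3)[OF assms(1)] ahom_of_nat[OF assms(1)] ahom_power[OF assms(1)])

lemma lin_mult:
  fixes x y :: "('s::monoid_add, 'k::comm_ring_1) cmod"
  assumes "\<And>u v. \<phi> (u + v) = \<phi> u * \<phi> v"
  shows "lin \<phi> (x * y) = (lin \<phi> x * lin \<phi> y :: ('t::monoid_add, 'k) cmod)"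
proof (rule hadd_bilinear_eqI[of "\<lambda>x y. lin \<phi> (x * y)" "\<lambda>x y. lin \<phi> x * lin \<phi> y"])
  fix c d :: "'s \<Rightarrow>\<^sub>0 'k"
  show "lin \<phi> (fps_const c * fps_const d) = lin \<phi> (fps_const c) * lin \<phi> (fps_const d)"
  proof (induction c rule: poly_mapping_additive_induct)
    case (single s c)
    show ?case
    proof (induction d rule: poly_mapping_additive_induct)
      case (single t d)
      show ?case by (simp add: single_mult_const lin_single assms mult_hscale_left mult_hscale_right hscale_hscale mult.commute
            flip: fps_const_mult)
    next
      case (add p q)
      thus ?case by (simp add: fps_const_add' distrib_left hadd_add[OF hadd_lin] del: fps_const_mult fps_const_add)
    qed
  next
    case (add p q)
    thus ?case by (simp add: fps_const_add' distrib_right hadd_add[OF hadd_lin] del: fps_const_mult fps_const_add)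
  qed
qed (intro hadd_lin hadd_compose[OF hadd_lin] hadd_mult_left hadd_mult_right hadd_compose[OF hadd_mult_left hadd_lin]
    hadd_compose[OF hadd_mult_right hadd_lin])+

lemma ahom_lin:
  assumes "\<And>u v. \<phi> (u + v) = \<phi> u * \<phi> v" "\<phi> 0 = 1"
  shows "ahom (lin \<phi> :: _ \<Rightarrow> ('t::monoid_add, 'k::comm_ring_1) cmod)"
  using assms by (simp add: ahom_def hadd_lin lin_mult flip: basis_0)

lemma lin_scal: "\<phi> 0 = 1 \<Longrightarrow> lin \<phi> (scal a) = (scal a :: ('t::monoid_add, 'k::comm_ring_1) cmod)"
  using lin_hscale[of \<phi> a 1] by (metis basis_0 lin_basis scal_mult_left mult.right_neutral)

definition inL :: "('s, 'k::comm_ring_1) cmod \<Rightarrow> ('s \<times> 's::monoid_add, 'k) cmod" where "inL = lin (\<lambda>w. basis (w, 0))"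
definition inR :: "('s, 'k::comm_ring_1) cmod \<Rightarrow> ('s \<times> 's::monoid_add, 'k) cmod" where "inR = lin (\<lambda>w. basis (0, w))"

lemma ahom_inL: "ahom inL" and ahom_inR: "ahom inR"
  unfolding inL_def inR_def by (intro ahom_lin; simp add: basis_mult basis_0[unfolded zero_prod_def] plus_prod_def zero_prod_def flip: basis_0)+

lemma inL_inR: "inL x * inR y = tens x y"
  unfolding inL_def inR_def tens_def
proof (rule hadd_bilinear_eqI[of "\<lambda>x y. lin (\<lambda>w. basis (w, 0)) x * lin (\<lambda>w. basis (0, w)) y"])
  fix c d :: "'a \<Rightarrow>\<^sub>0 'b"
  show "lin (\<lambda>w. basis (w, 0)) (fps_const c) * lin (\<lambda>w. basis (0, w)) (fps_const d) = lin (\<lambda>s. lin (\<lambda>t. basis (s, t)) (fps_const d)) (fps_const c)"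
  proof (induction c rule: poly_mapping_additive_induct)
    case (single s c)
    show ?case
    proof (induction d rule: poly_mapping_additive_induct)
      case (single t d)
      show ?case by (simp add: lin_single mult_hscale_left mult_hscale_right basis_mult hscale_hscale mult.commute)
    qed (simp add: fps_const_add' distrib_left hadd_add[OF hadd_lin] hadd_add[OF hadd_hscale] lin_single del: fps_const_add)
  qed (simp add: fps_const_add' distrib_right hadd_add[OF hadd_lin] del: fps_const_add)
qed (intro hadd_lin hadd_lin_arg hadd_compose[OF hadd_mult_left hadd_lin] hadd_compose[OF hadd_mult_right hadd_lin])+

lemma inR_inL: "inR y * inL x = tens x y"
  unfolding inL_def inR_def tens_def
proof (rule hadd_bilinear_eqI[of "\<lambda>x y. lin (\<lambda>w. basis (0, w)) y * lin (\<lambda>w. basis (w, 0)) x"])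
  fix c d :: "'a \<Rightarrow>\<^sub>0 'b"
  show "lin (\<lambda>w. basis (0, w)) (fps_const d) * lin (\<lambda>w. basis (w, 0)) (fps_const c) = lin (\<lambda>s. lin (\<lambda>t. basis (s, t)) (fps_const d)) (fps_const c)"
  proof (induction c rule: poly_mapping_additive_induct)
    case (single s c)
    show ?case
    proof (induction d rule: poly_mapping_additive_induct)
      case (single t d)
      show ?case by (simp add: lin_single mult_hscale_left mult_hscale_right basis_mult hscale_hscale mult.commute)
    qed (simp add: fps_const_add' distrib_right hadd_add[OF hadd_lin] hadd_add[OF hadd_hscale] lin_single del: fps_const_add)
  qed (simp add: fps_const_add' distrib_left hadd_add[OF hadd_lin] del: fps_const_add)
qed (intro hadd_lin hadd_lin_arg hadd_compose[OF hadd_mult_left hadd_lin] hadd_compose[OF hadd_mult_right hadd_lin])+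

lemma cop0_append: "cop0 N (u + v) = cop0 N u * cop0 N v" and cop0_0: "cop0 N 0 = 1" and cop0_letter: "cop0 N (Word [g]) = cop0_gen N g"
  by (simp_all add: cop0_def)

lemma ahom_cop0: "ahom (lin (cop0 N))"
  by (intro ahom_lin cop0_append cop0_0)

lemma appl_conv: "appl (conv N f h) x = appl (\<lambda>(s, t). f s * h t) (lin (cop0 N) x)"
  unfolding appl_lin appl_cop0 by (simp add: conv_def[abs_def])

lemma inL_scal: "inL (scal a) = scal a" and inR_scal: "inR (scal a) = scal a" and cop0_scal: "lin (cop0 N) (scal a) = scal a"
  unfolding inL_def inR_def by (rule lin_scal, simp add: cop0_0 basis_0 flip: zero_prod_def)+

lemma tens_basis: "tens (basis s) (basis t) = basis (s, t)" by (simp add: tens_def)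

lemma scal_commute: "scal a * x = (x * scal a :: ('s::monoid_add, 'k::comm_ring_1) cmod)" by (simp add: scal_mult_left scal_mult_right)

lemma cop0_translate:
  assumes a: "fps_nth a 0 = 0"
  shows "lin (cop0 N) (translate (\<lambda>k. basis (Word [Tc i j k])) (scal a) m) =
    (\<Sum>p<N. \<Sum>l\<le>m. tens (translate (\<lambda>k. basis (Word [Tc i p k])) (scal a) l) (translate (\<lambda>k. basis (Word [Tc p j k])) (scal a) (m - l)))"
    (is "?A m = ?B m")
  and "lin (cop0 N) (translate (\<lambda>k. basis (Word [Tic i j k])) (scal a) m) =
    (\<Sum>p<N. \<Sum>l\<le>m. tens (translate (\<lambda>k. basis (Word [Tic p j k])) (scal a) l) (translate (\<lambda>k. basis (Word [Tic i p k])) (scal a) (m - l)))"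
    (is "?A' m = ?B' m")
proof -
  have t: "(\<Sum>l\<le>m. tens (translate (\<lambda>k. basis (x k)) (scal a) l) (translate (\<lambda>k. basis (y k)) (scal a) (m - l))) =
      translate (\<lambda>n. \<Sum>l\<le>n. basis (x l, y (n - l))) (scal a) m" for x y :: "nat \<Rightarrow> gen0 word"
  proof -
    have "(\<Sum>l\<le>m. tens (translate (\<lambda>k. basis (x k)) (scal a) l) (translate (\<lambda>k. basis (y k)) (scal a) (m - l))) =
      (\<Sum>l\<le>m. translate (\<lambda>k. inL (basis (x k))) (scal a) l * translate (\<lambda>k. inR (basis (y k))) (scal a) (m - l))"
      using a by (simp add: ahom_translate[OF ahom_inL] ahom_translate[OF ahom_inR] scal_nth_0 inL_scal inR_scal flip: inL_inR)
    also have "\<dots> = translate (\<lambda>n. \<Sum>l\<le>n. inL (basis (x l)) * inR (basis (y (n - l)))) (scal a) m"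
      by (rule translate_mult[symmetric]) (simp_all add: a scal_nth_0 scal_commute)
    finally show ?thesis by (simp add: inL_inR tens_basis)
  qed
  show "?A m = ?B m" "?A' m = ?B' m"
    using a by (simp_all add: ahom_translate[OF ahom_cop0] scal_nth_0 cop0_scal cop0_letter t flip: translate_sum)
qed

lemma ahom_tens:
  fixes f h :: "('s::monoid_add, 'k::comm_ring_1) cmod \<Rightarrow> ('t::monoid_add, 'k) cmod"
  assumes "ahom f" "ahom h"
  shows "ahom (lin (\<lambda>(x, y). tens (f (basis x)) (h (basis y)) :: ('t \<times> 't, 'k) cmod) :: ('s \<times> 's, 'k) cmod \<Rightarrow> _)"
proof (rule ahom_lin)
  have *: "inR y * (inL x * z) = inL x * (inR y * z)" for x y :: "('t, 'k) cmod" and z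
    by (simp add: inL_inR inR_inL flip: mult.assoc)
  let ?\<phi> = "\<lambda>(x, y). tens (f (basis x)) (h (basis y)) :: ('t \<times> 't, 'k) cmod"
  show "?\<phi> (u + v) = ?\<phi> u * ?\<phi> v" for u v :: "'s \<times> 's"
    by (cases u; cases v) (simp add: basis_append ahomD(3)[OF assms(1)] ahomD(3)[OF assms(2)] ahomD(3)[OF ahom_inL] ahomD(3)[OF ahom_inR]
        mult.assoc * flip: inL_inR)
qed (simp add: zero_prod_def basis_0 ahomD(2)[OF assms(1)] ahomD(2)[OF assms(2)] ahomD(2)[OF ahom_inL] ahomD(2)[OF ahom_inR] flip: inL_inR)

lemma ahom_tauw: "ahom (lin (tauw a))" by (rule ahom_lin) simp_all

text \<open>Translation is a coalgebra map. Both sides are algebra homomorphisms in the word, so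
  letters suffice, and there it is multiplicativity of translation on matrix products.\<close>

lemma cop0_tauw:
  assumes a: "fps_nth a 0 = 0"
  shows "lin (cop0 N) (tauw a w) = lin (\<lambda>(x, y). tens (tauw a x) (tauw a y)) (cop0 N w)"
proof -
  let ?T = "lin (\<lambda>(x, y). tens (tauw a x) (tauw a y)) :: (gen0 word \<times> gen0 word, 'a) cmod \<Rightarrow> _"
  have T: "ahom ?T" using ahom_tens[OF ahom_tauw[of a] ahom_tauw[of a]] by simp
  show ?thesis
  proof (induction w rule: word_induct)
    case 0
    show ?case by (simp add: ahomD(2)[OF ahom_cop0] cop0_0 ahomD(2)[OF T])
  next
    case (Cons g w)
    have na: "fps_nth (- a) 0 = 0" using a by simp
    have "lin (cop0 N) (tau0_gen a g) = ?T (cop0_gen N g)"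
      by (cases g) (simp_all add: tau0_gen_def cop0_translate[OF na] hadd_sum[OF hadd_lin])
    thus ?case by (simp add: cop0_append ahomD(3)[OF ahom_cop0] ahomD(3)[OF T] Cons cop0_letter)
  qed
qed

lemma swee_tauw:
  assumes a: "fps_nth a 0 = 0"
  shows "appl (swee N \<Psi>) (tauw a w) = swee N (\<lambda>x y. appl (\<lambda>s. appl (\<Psi> s) (tauw a y)) (tauw a x)) w"
proof -
  have "appl (swee N \<Psi>) (tauw a w) = appl (\<lambda>(s, t). \<Psi> s t) (lin (cop0 N) (tauw a w))"
    unfolding appl_lin appl_cop0 by (simp add: split_def)
  also have "\<dots> = swee N (\<lambda>x y. appl (\<lambda>s. appl (\<Psi> s) (tauw a y)) (tauw a x)) w"
    unfolding cop0_tauw[OF a] appl_lin appl_cop0 by (simp add: appl_tens)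
  finally show ?thesis .
qed

subsection \<open>Convolution of functionals on the relations\<close>

text \<open>Values of a functional on two-letter words as a series in two variables, the outer one
  for the left letter. In this form convolution of functionals becomes matrix
  multiplication.\<close>

definition ser2 :: "(gen0 word \<Rightarrow> 'k fps) \<Rightarrow> (nat \<Rightarrow> nat \<Rightarrow> nat \<Rightarrow> gen0) \<Rightarrow> (nat \<Rightarrow> nat \<Rightarrow> nat \<Rightarrow> gen0) \<Rightarrow>
    nat \<Rightarrow> nat \<Rightarrow> nat \<Rightarrow> nat \<Rightarrow> 'k fps fps fps"
  where "ser2 f \<kappa> \<mu> a p q c = Abs_fps (\<lambda>l. Abs_fps (\<lambda>m. f (Word [\<kappa> a p l, \<mu> q c m])))"

lemma Word2: "Word [x, y] = Word [x] + Word [y]" by (simp add: plus_word_def)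

lemma ser2_conv:
  fixes f h :: "gen0 word \<Rightarrow> 'k::comm_ring_1 fps"
  shows "ser2 (conv N f h) Tc Tc a p q c = (\<Sum>r<N. \<Sum>s<N. ser2 f Tc Tc a r q s * ser2 h Tc Tc r p s c)"
    and "ser2 (conv N f h) Tc Tic a p q c = (\<Sum>r<N. \<Sum>s<N. ser2 f Tc Tic a r s c * ser2 h Tc Tic r p q s)"
    and "ser2 (conv N f h) Tic Tc a p q c = (\<Sum>r<N. \<Sum>s<N. ser2 f Tic Tc r p q s * ser2 h Tic Tc a r s c)"
proof -
  have sw: "(\<Sum>r<N. \<Sum>i\<le>l. \<Sum>s<N. \<Sum>j\<le>m. g r i s j) = (\<Sum>r<N. \<Sum>s<N. \<Sum>i\<le>l. \<Sum>j\<le>m. g r i s j)"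
    for l m and g :: "nat \<Rightarrow> nat \<Rightarrow> nat \<Rightarrow> nat \<Rightarrow> 'k fps"
    by (rule sum.cong[OF refl], rule sum.swap)
  show "ser2 (conv N f h) Tc Tc a p q c = (\<Sum>r<N. \<Sum>s<N. ser2 f Tc Tc a r q s * ser2 h Tc Tc r p s c)"
    "ser2 (conv N f h) Tc Tic a p q c = (\<Sum>r<N. \<Sum>s<N. ser2 f Tc Tic a r s c * ser2 h Tc Tic r p q s)"
    "ser2 (conv N f h) Tic Tc a p q c = (\<Sum>r<N. \<Sum>s<N. ser2 f Tic Tc r p q s * ser2 h Tic Tc a r s c)"
    by (rule fps_ext, rule fps_ext, simp add: fps_sum_nth fps_nth2_mult ser2_def conv_def Word2 swee_append sw)+
qed

lemma translate_X_nth: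
  fixes F :: "nat \<Rightarrow> 'a::comm_ring_1 fps"
  shows "fps_nth (translate F fps_X k) m = (\<Sum>l\<le>m. of_nat ((k + l) choose l) * fps_nth (F (k + l)) (m - l))"
  unfolding translate_def hsum_nth
proof (rule sum.cong[OF refl])
  fix l assume "l \<in> {..m}"
  thus "fps_nth (of_nat (k + l choose l) * F (k + l) * fps_X ^ l) m = of_nat (k + l choose l) * fps_nth (F (k + l)) (m - l)"
    by (simp add: fps_X_power_mult_right_nth fps_of_nat[symmetric] del: fps_of_nat)
qed

text \<open>Restriction to the diagonal u = v, as the inverse relations
  \<open>T(u) T(u)^-1 = 1\<close> require; it is written as a translation so that multiplicativity
  comes from \<open>translate_mult\<close>.\<close>

definition diag :: "'a::comm_ring_1 fps fps \<Rightarrow> 'a fps" where "diag F = translate (fps_nth F) fps_X 0"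

lemma diag_nth: "fps_nth (diag F) m = (\<Sum>l\<le>m. fps_nth (fps_nth F l) (m - l))"
  by (simp add: diag_def translate_X_nth)

lemma translate_X_mult:
  fixes F H :: "'a::comm_ring_1 fps fps"
  shows "translate (fps_nth (F * H)) fps_X k = (\<Sum>j\<le>k. translate (fps_nth F) fps_X j * translate (fps_nth H) fps_X (k - j))"
proof -
  have "fps_nth (F * H) = (\<lambda>m. \<Sum>i\<le>m. fps_nth F i * fps_nth H (m - i))" by (simp add: fps_mult_nth fun_eq_iff atLeast0AtMost)
  thus ?thesis by (simp only:) (rule translate_mult, simp_all add: mult.commute)
qed

lemma diag_mult: "diag (F * H) = diag F * diag H"
  by (simp add: diag_def translate_X_mult)

lemma translate_fps_sum: "translate (fps_nth (\<Sum>i\<in>A. F i)) a k = (\<Sum>i\<in>A. translate (fps_nth (F i)) a k)"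
  for F :: "'i \<Rightarrow> 'a::ring_1 fps fps"
  unfolding fps_sum_nth by (rule translate_sum)

lemma diag_sum: "diag (\<Sum>i\<in>A. F i) = (\<Sum>i\<in>A. diag (F i))"
  unfolding diag_def by (rule translate_fps_sum)

text \<open>Regroups a power series in w with coefficients in k[[h]] as a series in h whose
  coefficients are Laurent series in w.\<close>

definition swz :: "(nat \<Rightarrow> 'k::field_char_0 fps) \<Rightarrow> 'k fls fps"
  where "swz f = plusK (Abs_fps (\<lambda>n. Abs_fps (\<lambda>k. fps_nth (f k) n)))"

lemma swz_nth: "fps_nth (swz f) n = fps_to_fls (Abs_fps (\<lambda>k. fps_nth (f k) n))"
  by (simp add: swz_def plusK_def)

lemma swz_mult: "swz (\<lambda>k. \<Sum>j\<le>k. f j * h (k - j)) = swz f * swz h"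
  unfolding swz_def plusK_mult[symmetric]
proof (intro arg_cong[of _ _ plusK], rule fps_ext, rule fps_ext)
  fix n k
  show "fps_nth (fps_nth (Abs_fps (\<lambda>n. Abs_fps (\<lambda>k. fps_nth (\<Sum>j\<le>k. f j * h (k - j)) n))) n) k =
    fps_nth (fps_nth (Abs_fps (\<lambda>n. Abs_fps (\<lambda>k. fps_nth (f k) n)) * Abs_fps (\<lambda>n. Abs_fps (\<lambda>k. fps_nth (h k) n))) n) k"
    unfolding fps_nth2_mult by (simp add: fps_sum_nth fps_mult_nth atLeast0AtMost) (rule sum.swap)
qed

lemma swz_sum: "swz (\<lambda>k. \<Sum>i\<in>A. f i k) = (\<Sum>i\<in>A. swz (f i))"
  unfolding swz_def hadd_sum[OF hadd_plusK, symmetric]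
  by (intro arg_cong[of _ _ plusK], rule fps_ext, rule fps_ext) (simp add: fps_sum_nth)

text \<open>The substitution \<open>u = v + w\<close>, the result being a series in \<open>v\<close> with coefficients in k((w))[[h]].\<close>

definition subst_sum :: "'k::field_char_0 fps fps fps \<Rightarrow> 'k fls fps fps"
  where "subst_sum F = Abs_fps (\<lambda>m. swz (\<lambda>k. fps_nth (translate (fps_nth F) fps_X k) m))"

lemma subst_sum_mult: "subst_sum (F * H) = subst_sum F * subst_sum H"
proof (rule fps_ext)
  fix m
  have "fps_nth (subst_sum (F * H)) m = swz (\<lambda>k. \<Sum>i\<le>m. \<Sum>j\<le>k.
      fps_nth (translate (fps_nth F) fps_X j) i * fps_nth (translate (fps_nth H) fps_X (k - j)) (m - i))"
    by (simp add: subst_sum_def translate_X_mult fps_sum_nth fps_mult_nth atLeast0AtMost sum.swap[of _ "{..m}"])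
  also have "\<dots> = fps_nth (subst_sum F * subst_sum H) m"
    unfolding swz_sum by (simp add: subst_sum_def fps_mult_nth atLeast0AtMost flip: swz_mult)
  finally show "fps_nth (subst_sum (F * H)) m = fps_nth (subst_sum F * subst_sum H) m" .
qed

lemma subst_sum_sum: "subst_sum (\<Sum>i\<in>A. F i) = (\<Sum>i\<in>A. subst_sum (F i))"
  by (rule fps_ext) (simp add: subst_sum_def translate_fps_sum fps_sum_nth swz_sum)

text \<open>Writes a coefficient of a product as a finite sum over a bound M at the caller's choice.
  The same M can then serve for a scalar Laurent series and for its image in the free algebra, so
  that a functional may be applied term by term.\<close>

lemma fls_times_fps_nth:
  fixes x :: "'a::ring_1 fls"
  assumes M: "\<And>k. k > M \<Longrightarrow> fls_nth x (i - int k) = 0"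
  shows "fls_nth (x * fps_to_fls y) i = (\<Sum>k\<le>M. fls_nth x (i - int k) * fps_nth y k)"
    and "fls_nth (fps_to_fls y * x) i = (\<Sum>k\<le>M. fps_nth y k * fls_nth x (i - int k))"
proof -
  let ?d = "fls_subdegree x" and ?e = "fls_subdegree (fps_to_fls y)"
  let ?L = "nat (i - ?d)"
  have x0: "fls_nth x (i - int k) = 0" if "int k > i - ?d" for k using that by (intro fls_eq0_below_subdegree) linarith
  have e: "?e \<ge> 0" by (rule fls_subdegree_fls_to_fps_gt0)
  have y0: "fps_nth y k = 0" if "int k < ?e" for k
    using fls_eq0_below_subdegree[OF that] by simp
  have *: "(\<Sum>j\<in>{?e..i - ?d}. g j) = (\<Sum>k\<le>M. g (int k))"
    if g: "\<And>k. int k > i - ?d \<Longrightarrow> g (int k) = 0" "\<And>k. k > M \<Longrightarrow> g (int k) = 0" "\<And>k. int k < ?e \<Longrightarrow> g (int k) = 0" for g :: "int \<Rightarrow> 'a"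
  proof -
    have "(\<Sum>k\<le>M. g (int k)) = (\<Sum>k\<le>max M ?L. g (int k))" by (rule sum.mono_neutral_left) (auto simp: g(2))
    also have "\<dots> = (\<Sum>j\<in>int ` {..max M ?L}. g j)" by (simp add: sum.reindex)
    also have "\<dots> = (\<Sum>j\<in>{?e..i - ?d}. g j)"
    proof (rule sum.mono_neutral_right)
      show "{?e..i - ?d} \<subseteq> int ` {..max M ?L}"
      proof
        fix j assume "j \<in> {?e..i - ?d}"
        hence "j = int (nat j)" "nat j \<le> ?L" using e by auto
        thus "j \<in> int ` {..max M ?L}" by (metis atMost_iff imageI max.coboundedI2)
      qed
      show "\<forall>j\<in>int ` {..max M ?L} - {?e..i - ?d}. g j = 0"
      proof
        fix j assume "j \<in> int ` {..max M ?L} - {?e..i - ?d}"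
        then obtain k where k: "j = int k" "\<not> (?e \<le> int k \<and> int k \<le> i - ?d)" by auto
        hence "int k < ?e \<or> int k > i - ?d" by linarith
        thus "g j = 0" using g k by auto
      qed
    qed simp
    finally show ?thesis by simp
  qed
  have "fls_nth (x * fps_to_fls y) i = (\<Sum>j\<in>{?e..i - ?d}. fls_nth x (i - j) * fls_nth (fps_to_fls y) j)"
    unfolding fls_times_nth(3)
    by (rule sum.reindex_bij_witness[of _ "\<lambda>j. ?e + i - ?d - j" "\<lambda>j. ?e + i - ?d - j"]) auto
  also have "\<dots> = (\<Sum>k\<le>M. fls_nth x (i - int k) * fls_nth (fps_to_fls y) (int k))"
    by (rule *) (simp_all add: x0 M y0)
  finally show "fls_nth (x * fps_to_fls y) i = (\<Sum>k\<le>M. fls_nth x (i - int k) * fps_nth y k)" by simp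
  have "fls_nth (fps_to_fls y * x) i = (\<Sum>j\<in>{?e..i - ?d}. fls_nth (fps_to_fls y) j * fls_nth x (i - j))"
    by (rule fls_times_nth(2))
  also have "\<dots> = (\<Sum>k\<le>M. fls_nth (fps_to_fls y) (int k) * fls_nth x (i - int k))"
    by (rule *) (simp_all add: x0 M y0)
  finally show "fls_nth (fps_to_fls y * x) i = (\<Sum>k\<le>M. fps_nth y k * fls_nth x (i - int k))" by simp
qed

lemma appl_nth: "fps_nth (appl f x) n = (\<Sum>i\<le>n. fps_nth (appl f (fps_const (fps_nth x i))) (n - i))"
proof -
  have c: "fps_nth (appl f (fps_const c)) m = (\<Sum>s\<in>Poly_Mapping.keys c. Poly_Mapping.lookup c s * fps_nth (f s) m)" for c m
  proof -
    have "fps_nth (appl f (fps_const c)) m = (\<Sum>i\<in>{..m}. if i = 0 then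
        (\<Sum>s\<in>Poly_Mapping.keys c. Poly_Mapping.lookup c s * fps_nth (f s) m) else 0)"
      unfolding appl_def hmod_appl.linext_nth by (rule sum.cong) auto
    thus ?thesis by simp
  qed
  show ?thesis unfolding c by (simp add: appl_def hmod_appl.linext_nth)
qed

lemma const_coeff_nth: "fls_nth (fps_nth (const_coeff F) n) i = Poly_Mapping.single 0 (fls_nth (fps_nth F n) i)"
proof -
  have 1: "const_coeff F = Abs_fps (\<lambda>n. Abs_fls (\<lambda>i. Poly_Mapping.single 0 (fls_nth (fps_nth F n) i / fact 0))) * 0 ^ 0"
    unfolding const_coeff_def taylor_def by (subst hsum_0[OF hdiv_mult_power]) (auto simp: power_0_left)
  show ?thesis
    unfolding 1 by (simp, subst nth_Abs_fls_lower_bound[of "fls_subdegree (fps_nth F n)"]) auto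
qed

lemma appl_central: "appl f (fps_const (Poly_Mapping.single 0 c * y)) = fps_const c * appl f (fps_const y)"
    "appl f (fps_const (y * Poly_Mapping.single 0 c)) = fps_const c * appl f (fps_const y)"
  for y :: "'g word \<Rightarrow>\<^sub>0 'k::comm_ring_1"
  by (simp_all flip: fps_const_mult scal_const add: scal_mult_left scal_mult_right appl_hscale)

lemma appl_fps_const_sum: "appl f (fps_const (\<Sum>i\<in>A. g i)) = (\<Sum>i\<in>A. appl f (fps_const (g i)))"
  unfolding fps_const_sum' hadd_sum[OF hadd_appl] ..

text \<open>The coefficients of \<open>const_coeff F\<close> are scalars, hence central, so F leaves
  the functional on whichever side it stands.\<close>

lemma appl_const_coeff:
  fixes Y :: "('g word \<Rightarrow>\<^sub>0 'k::field_char_0) fps"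
  shows "appl f (hmap (\<lambda>x. fls_nth x i) (const_coeff F * fps_const (fps_to_fls Y))) =
      hmap (\<lambda>x. fls_nth x i) (F * swz (\<lambda>k. appl f (fps_const (fps_nth Y k))))"
    and "appl f (hmap (\<lambda>x. fls_nth x i) (fps_const (fps_to_fls Y) * const_coeff F)) =
      hmap (\<lambda>x. fls_nth x i) (F * swz (\<lambda>k. appl f (fps_const (fps_nth Y k))))"
proof -
  have eq: "fps_nth (appl f (fps_const (fls_nth (fps_nth (const_coeff F) j * fps_to_fls Y) i))) (n - j) =
        fls_nth (fps_nth F j * fps_nth (swz (\<lambda>k. appl f (fps_const (fps_nth Y k)))) (n - j)) i \<and>
      fps_nth (appl f (fps_const (fls_nth (fps_to_fls Y * fps_nth (const_coeff F) j) i))) (n - j) =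
        fls_nth (fps_nth F j * fps_nth (swz (\<lambda>k. appl f (fps_const (fps_nth Y k)))) (n - j)) i" for n j
  proof -
    let ?M = "nat (i - fls_subdegree (fps_nth F j))"
    have M: "fls_nth (fps_nth F j) (i - int k) = 0" if "k > ?M" for k using that by (intro fls_eq0_below_subdegree) linarith
    hence M': "fls_nth (fps_nth (const_coeff F) j) (i - int k) = (0 :: 'g word \<Rightarrow>\<^sub>0 'k)" if "k > ?M" for k using that by (simp add: const_coeff_nth)
    have 1: "fls_nth (fps_nth (const_coeff F) j * fps_to_fls Y) i = (\<Sum>k\<le>?M. fls_nth (fps_nth (const_coeff F) j) (i - int k) * fps_nth Y k)"
      "fls_nth (fps_to_fls Y * fps_nth (const_coeff F) j) i = (\<Sum>k\<le>?M. fps_nth Y k * fls_nth (fps_nth (const_coeff F) j) (i - int k))"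
      by (rule fls_times_fps_nth, erule M')+
    have 2: "fls_nth (fps_nth F j * fps_to_fls y) i = (\<Sum>k\<le>?M. fls_nth (fps_nth F j) (i - int k) * fps_nth y k)" for y
      by (rule fls_times_fps_nth, erule M)
    show ?thesis
      unfolding swz_nth 1 2 by (simp add: const_coeff_nth appl_fps_const_sum appl_central fps_sum_nth)
  qed
  show "appl f (hmap (\<lambda>x. fls_nth x i) (const_coeff F * fps_const (fps_to_fls Y))) =
      hmap (\<lambda>x. fls_nth x i) (F * swz (\<lambda>k. appl f (fps_const (fps_nth Y k))))"
    "appl f (hmap (\<lambda>x. fls_nth x i) (fps_const (fps_to_fls Y) * const_coeff F)) =
      hmap (\<lambda>x. fls_nth x i) (F * swz (\<lambda>k. appl f (fps_const (fps_nth Y k))))"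
    by (rule fps_ext, subst appl_nth, simp only: hmap_nth fps_mult_right_const_nth fps_mult_left_const_nth,
      simp add: fps_mult_nth fls_nth_sum atLeast0AtMost eq)+
qed

lemma appl_of_nat_mult: "appl f (of_nat c * x) = of_nat c * appl f (x :: ('g word, 'k::comm_ring_1) cmod)"
  by (simp add: scal_mult_left appl_hscale flip: scal_of_nat)

lemma appl_letters2: "appl f (fps_const (of_nat c * (letter x * letter y))) = of_nat c * (f (Word [x, y]) :: 'k::comm_ring_1 fps)"
proof -
  have "fps_const (of_nat c * (letter x * letter y)) = of_nat c * (basis (Word [x, y]) :: ('a word, 'k) cmod)"
    by (simp add: Word2 basis_append basis_letter fps_of_nat[symmetric] del: fps_of_nat)
  thus ?thesis by (simp add: appl_of_nat_mult)
qed

lemma mser_prod_alt: "mser_prod st s t m = fps_const (fps_to_fls (Abs_fps (\<lambda>k. \<Sum>l\<le>m. of_nat ((k + l) choose l) *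
    (if st then s (k + l) * t (m - l) else t (m - l) * s (k + l)))))"
  unfolding mser_prod_def fps_to_fls_def by (auto intro!: arg_cong[of _ _ fps_const] arg_cong[of _ _ Abs_fls])

definition ser2r :: "(gen0 word \<Rightarrow> 'k fps) \<Rightarrow> nat \<Rightarrow> nat \<Rightarrow> nat \<Rightarrow> nat \<Rightarrow> 'k fps fps fps"
  where "ser2r f a p b q = Abs_fps (\<lambda>l. Abs_fps (\<lambda>m. f (Word [Tc b q m, Tc a p l])))"

lemma ser2r_conv:
  fixes f h :: "gen0 word \<Rightarrow> 'k::comm_ring_1 fps"
  shows "ser2r (conv N f h) a p b q = (\<Sum>r<N. \<Sum>s<N. ser2r f a r b s * ser2r h r p s q)"
proof (rule fps_ext, rule fps_ext)
  fix l m
  have "fps_nth (fps_nth (ser2r (conv N f h) a p b q) l) m = (\<Sum>s<N. \<Sum>j\<le>m. \<Sum>r<N. \<Sum>i\<le>l.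
      f (Word [Tc b s j, Tc a r i]) * h (Word [Tc s q (m - j), Tc r p (l - i)]))"
    by (simp add: ser2r_def conv_def Word2 swee_append)
  also have "\<dots> = (\<Sum>r<N. \<Sum>i\<le>l. \<Sum>s<N. \<Sum>j\<le>m.
      f (Word [Tc b s j, Tc a r i]) * h (Word [Tc s q (m - j), Tc r p (l - i)]))"
    by (rule sum_swap4)
  also have "\<dots> = (\<Sum>r<N. \<Sum>s<N. \<Sum>i\<le>l. \<Sum>j\<le>m.
      f (Word [Tc b s j, Tc a r i]) * h (Word [Tc s q (m - j), Tc r p (l - i)]))"
    by (rule sum.cong[OF refl], rule sum.swap)
  finally show "fps_nth (fps_nth (ser2r (conv N f h) a p b q) l) m = fps_nth (fps_nth (\<Sum>r<N. \<Sum>s<N. ser2r f a r b s * ser2r h r p s q) l) m"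
    by (simp add: fps_sum_nth fps_nth2_mult ser2r_def)
qed

text \<open>With \<open>u = v + w\<close> the two sides of the relation become two-letter series of
  f in the two orders, multiplied by entries of X; the coefficient of \<open>v^m\<close> and
  \<open>w^i\<close> is taken at the end.\<close>

lemma appl_RTT:
  fixes X :: "'k::field_char_0 fls fps tmat"
  shows "appl f (Abs_fps (\<lambda>n. fls_nth (fps_nth
      ((\<Sum>p<N. \<Sum>q<N. const_coeff (X a b p q) * mser_prod True (T0 p c) (T0 q d) m)
       - (\<Sum>p<N. \<Sum>q<N. mser_prod False (T0 a p) (T0 b q) m * const_coeff (X p q c d))) n) i)) =
    hmap (\<lambda>x. fls_nth x i) (\<Sum>p<N. \<Sum>q<N. X a b p q * fps_nth (subst_sum (ser2 f Tc Tc p c q d)) m) -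
    hmap (\<lambda>x. fls_nth x i) (\<Sum>p<N. \<Sum>q<N. fps_nth (subst_sum (ser2r f a p b q)) m * X p q c d)"
proof -
  have h: "hadd (hmap (\<lambda>x :: 'x::ab_group_add fls. fls_nth x i))" by (rule hadd_hmap) simp
  have 1: "appl f (fps_const (\<Sum>l\<le>m. of_nat ((k + l) choose l) * (T0 p c (k + l) * T0 q d (m - l)))) =
      fps_nth (translate (fps_nth (ser2 f Tc Tc p c q d)) fps_X k) m" for p q c d k
    by (simp add: appl_fps_const_sum T0_def appl_letters2 translate_X_nth ser2_def)
  have 2: "appl f (fps_const (\<Sum>l\<le>m. of_nat ((k + l) choose l) * (T0 b q (m - l) * T0 a p (k + l)))) =
      fps_nth (translate (fps_nth (ser2r f a p b q)) fps_X k) m" for p q a b k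
    by (simp add: appl_fps_const_sum T0_def appl_letters2 translate_X_nth ser2r_def)
  have 3: "Abs_fps (\<lambda>n. fls_nth (fps_nth S n) i) = hmap (\<lambda>x. fls_nth x i) S" for S :: "'x::zero fls fps"
    by (simp add: hmap_def)
  show ?thesis
    unfolding 3
    by (simp add: hadd_diff[OF h] hadd_diff[OF hadd_appl] hadd_sum[OF h] hadd_sum[OF hadd_appl] mser_prod_alt appl_const_coeff
        1 2 subst_sum_def mult.commute[of "swz _"])
qed

lemma appl_inverse_rel:
  fixes f :: "gen0 word \<Rightarrow> 'k::field_char_0 fps"
  shows "appl f (fps_const ((\<Sum>b<N. \<Sum>l\<le>m. letter (\<kappa> a b l) * letter (\<mu> b c (m - l))) - (if a = c \<and> m = 0 then 1 else 0))) =
    fps_nth ((\<Sum>b<N. diag (ser2 f \<kappa> \<mu> a b b c)) - (if a = c then fps_const (f 0) else 0)) m"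
proof -
  have 1: "appl f (fps_const (letter x * letter y)) = (f (Word [x, y]) :: 'k fps)" for x y using appl_letters2[of f 1] by simp
  have 2: "appl f (1 :: (gen0 word, 'k) cmod) = f 0" using appl_basis[of f 0] by (simp add: basis_0)
  show ?thesis
    by (simp add: hadd_diff[OF hadd_appl] appl_fps_const_sum 1 2 hadd_0[OF hadd_appl] fps_sum_nth diag_nth ser2_def
        flip: fps_const_sub)
qed

lemma hmap_mult: "ahom \<phi> \<Longrightarrow> hmap \<phi> (F * H) = hmap \<phi> F * hmap \<phi> H"
  by (rule fps_ext) (simp add: fps_mult_nth hadd_sum[OF ahomD(1)] ahomD(3))

lemma hmap_1: "ahom \<phi> \<Longrightarrow> hmap \<phi> 1 = 1"
  by (rule fps_ext) (simp add: ahomD(2) hadd_0[OF ahomD(1)])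

lemma hmap_prod_list: "ahom \<phi> \<Longrightarrow> hmap \<phi> (prod_list Fs) = prod_list (map (hmap \<phi>) Fs)"
  by (induction Fs) (simp_all add: hmap_1 hmap_mult)

lemma hmap_sum: "ahom \<phi> \<Longrightarrow> hmap \<phi> (\<Sum>i\<in>A. F i) = (\<Sum>i\<in>A. hmap \<phi> (F i))"
  by (rule fps_ext) (simp add: fps_sum_nth hadd_sum[OF ahomD(1)])

lemma hmap_fps_const: "ahom \<phi> \<Longrightarrow> hmap \<phi> (fps_const c) = fps_const (\<phi> c)"
  by (rule hmap_const) (simp add: hadd_0[OF ahomD(1)])

lemma prod_list_sum_idx:
  "prod_list (map (\<lambda>r. \<Sum>p<N. g r p) [0..<n]) = (\<Sum>P\<in>idx N n. prod_list (map (\<lambda>r. g r (P ! r)) [0..<n]))"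
  for g :: "nat \<Rightarrow> nat \<Rightarrow> 'a::semiring_1"
proof (induction n)
  case (Suc n)
  have "(\<Sum>P\<in>idx N (Suc n). prod_list (map (\<lambda>r. g r (P ! r)) [0..<Suc n])) =
    (\<Sum>P\<in>idx N n. \<Sum>a<N. prod_list (map (\<lambda>r. g r ((P @ [a]) ! r)) [0..<n]) * g n ((P @ [a]) ! n))"
    unfolding sum_idx_Suc by simp
  also have "\<dots> = (\<Sum>P\<in>idx N n. \<Sum>a<N. prod_list (map (\<lambda>r. g r (P ! r)) [0..<n]) * g n a)"
  proof (intro sum.cong[OF refl])
    fix P a assume "P \<in> idx N n"
    hence l: "length P = n" by (simp add: idx_def)
    have "map (\<lambda>r. g r ((P @ [a]) ! r)) [0..<n] = map (\<lambda>r. g r (P ! r)) [0..<n]"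
      using l by (intro map_cong refl) (simp add: nth_append)
    from this show "prod_list (map (\<lambda>r. g r ((P @ [a]) ! r)) [0..<n]) * g n ((P @ [a]) ! n) = prod_list (map (\<lambda>r. g r (P ! r)) [0..<n]) * g n a"
      by (simp only:) (simp add: l[symmetric])
  qed
  finally show ?case by (simp add: Suc sum_product)
qed (simp add: idx_0)

lemma prod_list_commuting:
  fixes l \<rho> :: "'i \<Rightarrow> 'a::monoid_mult"
  assumes "\<And>r s. \<rho> r * l s = l s * \<rho> r"
  shows "prod_list (map (\<lambda>r. l r * \<rho> r) xs) = prod_list (map l xs) * prod_list (map \<rho> xs)"
proof (induction xs)
  case (Cons x xs)
  have c: "\<rho> x * prod_list (map l xs) = prod_list (map l xs) * \<rho> x"
  proof (induction xs)
    case (Cons y ys)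
    have "\<rho> x * (l y * prod_list (map l ys)) = l y * (\<rho> x * prod_list (map l ys))" by (simp add: assms flip: mult.assoc)
    thus ?case by (simp add: Cons mult.assoc)
  qed simp
  have "l x * \<rho> x * (prod_list (map l xs) * prod_list (map \<rho> xs)) = l x * (\<rho> x * prod_list (map l xs)) * prod_list (map \<rho> xs)"
    by (simp add: mult.assoc)
  thus ?case unfolding c by (simp add: Cons mult.assoc)
qed simp

definition qfac :: "nat \<Rightarrow> nat \<Rightarrow> nat \<Rightarrow> nat \<Rightarrow> (gen0 word, 'k::field_char_0) cmod fps"
  where "qfac N r a b = Abs_fps (\<lambda>m. translate (\<lambda>k. basis (Word [Tc a b k])) (scal (u_shift N r)) m)"

lemma qmonomial_qfac: "qmonomial N T0 I J = prod_list (map (\<lambda>r. qfac N r (I ! r) (J ! r)) [0..<N])"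
  by (simp add: qmonomial_def qfac_def T0_def basis_letter)

lemma hmap_inR_inL: "hmap inR F * hmap inL H = hmap inL H * hmap inR F"
proof (rule fps_ext)
  fix m
  have "fps_nth (hmap inR F * hmap inL H) m = (\<Sum>i\<le>m. tens (fps_nth H (m - i)) (fps_nth F i))"
    by (simp add: fps_mult_nth inR_inL atLeast0AtMost)
  also have "\<dots> = (\<Sum>i\<le>m. tens (fps_nth H i) (fps_nth F (m - i)))" by (rule sum_rev)
  finally show "fps_nth (hmap inR F * hmap inL H) m = fps_nth (hmap inL H * hmap inR F) m"
    by (simp add: fps_mult_nth inL_inR atLeast0AtMost)
qed

lemma cop0_qfac: "hmap (lin (cop0 N)) (qfac N r a b) = (\<Sum>p<N. hmap inL (qfac N r a p) * hmap inR (qfac N r p b))"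
  by (rule fps_ext) (simp add: qfac_def cop0_translate fps_sum_nth fps_mult_nth atLeast0AtMost inL_inR)

text \<open>Left and right tensor factors commute, so the coproduct of a product of matrix entries
  is again a matrix product, over multi-indices.\<close>

lemma cop0_qmonomial:
  "hmap (lin (cop0 N)) (qmonomial N T0 I J) = (\<Sum>P\<in>midx N. hmap inL (qmonomial N T0 I P) * hmap inR (qmonomial N T0 P J))"
  unfolding qmonomial_qfac hmap_prod_list[OF ahom_cop0] hmap_prod_list[OF ahom_inL] hmap_prod_list[OF ahom_inR] map_map o_def
    cop0_qfac prod_list_sum_idx midx_idx
  by (simp add: prod_list_commuting hmap_inR_inL)

section \<open>Functionals vanishing on the relations are closed under convolution\<close>

context qkz
begin

definition kills :: "(gen0 word \<Rightarrow> 'k fps) \<Rightarrow> bool" where "kills f \<longleftrightarrow> (\<forall>x\<in>J. appl f x = 0)"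

lemma csub_J: "csub J" by (rule unit_ideal_csub[OF J_unit])

lemma kills_cong: "kills f \<Longrightarrow> x - y \<in> J \<Longrightarrow> appl f x = appl f y"
  unfolding kills_def by (metis hadd_diff[OF hadd_appl] eq_iff_diff_eq_0)

lemma kills_surround: assumes "kills f" shows "kills (\<lambda>w. f (u + w + v))"
  unfolding kills_def
proof
  fix x assume "x \<in> J"
  hence "appl f (basis u * x * basis v) = 0" using assms unit_ideal_mult[OF J_unit] unfolding kills_def by blast
  thus "appl (\<lambda>w. f (u + w + v)) x = 0" by (simp add: appl_mult)
qed

lemma kills_nullf: "kills f \<Longrightarrow> nullf N f"
  unfolding kills_def nullf_def using unit_ideal_range[OF J_unit] by (metis appl_basis)

lemma kills_inverse:
  assumes f: "kills f" and g: "gen_pair \<kappa> \<mu>" "a < N" "c < N"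
  shows "(\<Sum>b<N. diag (ser2 f \<kappa> \<mu> a b b c)) = (if a = c then fps_const (f 0) else 0)"
proof (rule fps_ext)
  fix m
  have "appl f (\<Sum>b<N. \<Sum>l\<le>m. basis (Word [\<kappa> a b l] + Word [\<mu> b c (m - l)])) = appl f (if a = c \<and> m = 0 then 1 else 0)"
    by (rule kills_cong[OF f unit_ideal_inverse[OF J_unit g]])
  thus "fps_nth (\<Sum>b<N. diag (ser2 f \<kappa> \<mu> a b b c)) m = fps_nth (if a = c then fps_const (f 0) else 0) m"
    using appl_basis[of f 0]
    by (simp add: hadd_sum[OF hadd_appl] hadd_0[OF hadd_appl] fps_sum_nth diag_nth ser2_def Word2 basis_0 split: if_splits)
qed

abbreviation (input) "R0 \<equiv> \<lambda>a b c d. R a b c d (origin \<Sigma>)"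

definition RE :: "'k fls fps fps tmat" where "RE a b c d = fps_const (R0 a b c d)"
definition SE :: "(gen0 word \<Rightarrow> 'k fps) \<Rightarrow> 'k fls fps fps tmat" where "SE f a b c d = subst_sum (ser2 f Tc Tc a c b d)"
definition SF :: "(gen0 word \<Rightarrow> 'k fps) \<Rightarrow> 'k fls fps fps tmat" where "SF f a b c d = subst_sum (ser2r f a c b d)"

lemma appl_RTT':
  "appl f (Abs_fps (\<lambda>n. fls_nth (fps_nth
      ((\<Sum>p<N. \<Sum>q<N. const_coeff (R0 a b p q) * mser_prod True (T0 p c) (T0 q d) m)
       - (\<Sum>p<N. \<Sum>q<N. mser_prod False (T0 a p) (T0 b q) m * const_coeff (R0 p q c d))) n) i)) =
    hmap (\<lambda>x. fls_nth x i) (fps_nth (tmul N RE (SE f) a b c d) m) - hmap (\<lambda>x. fls_nth x i) (fps_nth (tmul N (SF f) RE a b c d) m)"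
  unfolding appl_RTT[where X = R0] by (simp add: tmul_def RE_def SE_def SF_def fps_sum_nth)

lemma F_rels_subset: "F_rels \<Sigma> N R \<subseteq> J"
  unfolding F0_ideal_def by (meson Un_upper1 closed_ideal_superset order_trans)

text \<open>Membership of the RTT relations in the kernel of f, rewritten as one tensor identity. In
  this shape it is visibly stable under products, because the \<open>SE\<close> and
  \<open>SF\<close> of a convolution are products.\<close>

lemma kills_RTT: assumes f: "kills f" shows "teq N (tmul N RE (SE f)) (tmul N (SF f) RE)"
  unfolding teq_def
proof (intro allI impI, rule fps_ext, rule fps_ext, rule fls_eqI)
  fix a b c d m n i assume l: "a < N" "b < N" "c < N" "d < N"
  let ?r = "Abs_fps (\<lambda>n. fls_nth (fps_nth
      ((\<Sum>p<N. \<Sum>q<N. const_coeff (R0 a b p q) * mser_prod True (T0 p c) (T0 q d) m)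
       - (\<Sum>p<N. \<Sum>q<N. mser_prod False (T0 a p) (T0 b q) m * const_coeff (R0 p q c d))) n) i) :: (gen0 word, 'k) cmod"
  have "?r \<in> F_rels \<Sigma> N R" unfolding F_rels_def Let_def RTT_rels_def using l by blast
  hence "appl f ?r = 0" using f F_rels_subset unfolding kills_def by blast
  hence "hmap (\<lambda>x. fls_nth x i) (fps_nth (tmul N RE (SE f) a b c d) m) = hmap (\<lambda>x. fls_nth x i) (fps_nth (tmul N (SF f) RE a b c d) m)"
    unfolding appl_RTT' by simp
  from arg_cong[OF this, of "\<lambda>F. fps_nth F n"]
  show "fls_nth (fps_nth (fps_nth (tmul N RE (SE f) a b c d) m) n) i = fls_nth (fps_nth (fps_nth (tmul N (SF f) RE a b c d) m) n) i"
    by simp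
qed

lemma SE_conv: "SE (conv N f h) = tmul N (SE f) (SE h)" "SF (conv N f h) = tmul N (SF f) (SF h)"
  by (intro ext, simp add: SE_def SF_def tmul_def ser2_conv ser2r_conv subst_sum_sum subst_sum_mult)+

lemma kills_qdet:
  assumes h: "kills h" and P: "P \<in> midx N"
  shows "appl h (fps_nth (\<Sum>K\<in>midx N. fps_const (scal (C K)) * qmonomial N T0 P K) j) = (if j = 0 then C P * h 0 else 0)"
proof -
  have "fps_nth ((\<Sum>K\<in>midx N. fps_const (scal (C K)) * qmonomial N T0 P K) - fps_const (scal (C P)) * qdet N C T0) j \<in> J"
    using qv P F_ideal_subset unfolding qdet_vector_def by blast
  hence 1: "appl h (fps_nth (\<Sum>K\<in>midx N. fps_const (scal (C K)) * qmonomial N T0 P K) j) = appl h (scal (C P) * fps_nth (qdet N C T0) j)"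
    using kills_cong[OF h] by simp
  have "fps_nth (qdet N C T0) j - (if j = 0 then 1 else 0) \<in> J"
    unfolding F0_ideal_def qdet_rels_def by (intro closed_ideal_mem) blast
  from kills_cong[OF h this] have "appl h (fps_nth (qdet N C T0) j) = (if j = 0 then h 0 else 0)"
    using appl_basis[of h 0] by (simp add: basis_0 hadd_0[OF hadd_appl])
  thus ?thesis unfolding 1 by (simp add: scal_mult_left appl_hscale)
qed

text \<open>The determinant is grouplike: h contracts the right tensor factor to C by the
  eigenvector property in every row, and what is left for f is the determinant itself.\<close>

lemma conv_qdet:
  assumes f: "kills f" and h: "kills h"
  shows "appl (conv N f h) (fps_nth (qdet N C T0) m) = (if m = 0 then f 0 * h 0 else 0)"
proof -
  let ?id = "[0..<N]"
  let ?\<Delta> = "lin (cop0 N) :: (gen0 word, 'k) cmod \<Rightarrow> _"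
  let ?V = "\<lambda>P. \<Sum>K\<in>midx N. fps_const (scal (C K)) * qmonomial N T0 P K :: (gen0 word, 'k) cmod fps"
  have sc: "fps_const (scal c) * (F * H) = F * (fps_const (scal c) * H)" for c and F H :: "(gen0 word \<times> gen0 word, 'k) cmod fps"
  proof -
    have c: "fps_const (scal c) * F = F * fps_const (scal c)" by (rule fps_ext) (simp add: scal_commute)
    show ?thesis unfolding mult.assoc[symmetric] c ..
  qed
  have "hmap ?\<Delta> (qdet N C T0) = (\<Sum>K\<in>midx N. \<Sum>P\<in>midx N. hmap inL (qmonomial N T0 ?id P) * (fps_const (scal (C K)) * hmap inR (qmonomial N T0 P K)))"
    by (simp add: qdet_def hmap_sum[OF ahom_cop0] hmap_mult[OF ahom_cop0] hmap_fps_const[OF ahom_cop0] cop0_scal cop0_qmonomial sum_distrib_left sc)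
  also have "\<dots> = (\<Sum>P\<in>midx N. hmap inL (qmonomial N T0 ?id P) * hmap inR (?V P))"
    by (subst sum.swap) (simp add: hmap_sum[OF ahom_inR] hmap_mult[OF ahom_inR] hmap_fps_const[OF ahom_inR] inR_scal sum_distrib_left)
  finally have "?\<Delta> (fps_nth (qdet N C T0) m) = (\<Sum>P\<in>midx N. \<Sum>i\<le>m. tens (fps_nth (qmonomial N T0 ?id P) i) (fps_nth (?V P) (m - i)))"
    by (subst hmap_nth[symmetric]) (simp add: fps_sum_nth fps_mult_nth inL_inR atLeast0AtMost)
  hence "appl (conv N f h) (fps_nth (qdet N C T0) m) =
      (\<Sum>P\<in>midx N. \<Sum>i\<le>m. appl f (fps_nth (qmonomial N T0 ?id P) i) * appl h (fps_nth (?V P) (m - i)))"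
    unfolding appl_conv by (simp add: hadd_sum[OF hadd_appl] appl_tens_prod)
  also have "\<dots> = (\<Sum>P\<in>midx N. \<Sum>i\<le>m. if i = m then appl f (fps_nth (qmonomial N T0 ?id P) m) * (C P * h 0) else 0)"
    by (intro sum.cong refl) (auto simp: kills_qdet[OF h])
  also have "\<dots> = appl f (fps_nth (?V ?id) m) * h 0"
    by (simp add: fps_sum_nth hadd_sum[OF hadd_appl] scal_mult_left appl_hscale sum_distrib_left mult_ac)
  moreover have "?id \<in> midx N" "C ?id = 1" using qv by (auto simp: midx_def qdet_vector_def)
  ultimately show ?thesis using kills_qdet[OF f] by simp
qed

text \<open>The coideal property, verified dually and for one relation at a time; relations with
  indices out of range are covered by \<open>nullf_conv\<close>.\<close>

lemma kills_conv_rels: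
  assumes f: "kills f" and h: "kills h" and r: "r \<in> F_rels \<Sigma> N R \<union> qdet_rels N C T0"
  shows "appl (conv N f h) r = 0"
proof -
  consider (range) w where "r = basis w" "\<not> valid N w" | (inv1) "r \<in> inverse_rels N T0 T0'" | (inv2) "r \<in> inverse_rels N T0' T0" |
    (RTT) "r \<in> RTT_rels N (\<lambda>a b c d. const_coeff (R0 a b c d)) (\<lambda>a b c d. const_coeff (R0 a b c d)) T0 T0" | (qdet) "r \<in> qdet_rels N C T0"
  proof -
    have "\<exists>w. r = basis w \<and> \<not> valid N w" if "r \<in> range_rels N T0 \<union> range_rels N T0'"
    proof -
      from that consider a b m where "r = fps_const (T0 a b m)" "a \<ge> N \<or> b \<ge> N" | a b m where "r = fps_const (T0' a b m)" "a \<ge> N \<or> b \<ge> N"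
        unfolding range_rels_def by blast
      thus ?thesis
      proof cases
        case (1 a b m) thus ?thesis by (intro exI[of _ "Word [Tc a b m]"]) (auto simp: T0_def basis_letter)
      next
        case (2 a b m) thus ?thesis by (intro exI[of _ "Word [Tic a b m]"]) (auto simp: T0'_def basis_letter)
      qed
    qed
    thus thesis using r that unfolding F_rels_def Let_def by blast
  qed
  thus ?thesis
  proof cases
    case range
    thus ?thesis using nullf_conv[OF kills_nullf[OF f] kills_nullf[OF h]] by (simp add: nullf_def)
  next
    case inv1
    then obtain a c m where ac: "a < N" "c < N" and
      r: "r = fps_const ((\<Sum>b<N. \<Sum>l\<le>m. letter (Tc a b l) * letter (Tic b c (m - l))) - (if a = c \<and> m = 0 then 1 else 0))"
      unfolding inverse_rels_def T0_def T0'_def by blast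
    \<comment> \<open>The summed index b occurs only in the series of h. Its inverse relation
      contracts to a delta, after which the inverse relation of f applies.\<close>
    have "(\<Sum>b<N. diag (ser2 (conv N f h) Tc Tic a b b c)) =
      (\<Sum>r<N. \<Sum>s<N. diag (ser2 f Tc Tic a r s c) * (\<Sum>b<N. diag (ser2 h Tc Tic r b b s)))"
      by (simp add: ser2_conv diag_sum diag_mult sum_distrib_left)
        (subst sum.swap, rule sum.cong[OF refl], rule sum.swap)
    also have "\<dots> = (\<Sum>r<N. diag (ser2 f Tc Tic a r r c)) * fps_const (h 0)"
      by (simp add: kills_inverse[OF h] if_zero_mult sum_distrib_right)
    finally show ?thesis unfolding r appl_inverse_rel by (simp add: kills_inverse[OF f _ ac] conv_def)
  next
    case inv2
    then obtain a c m where ac: "a < N" "c < N" and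
      r: "r = fps_const ((\<Sum>b<N. \<Sum>l\<le>m. letter (Tic a b l) * letter (Tc b c (m - l))) - (if a = c \<and> m = 0 then 1 else 0))"
      unfolding inverse_rels_def T0_def T0'_def by blast
    have "(\<Sum>b<N. diag (ser2 (conv N f h) Tic Tc a b b c)) =
      (\<Sum>r<N. \<Sum>s<N. (\<Sum>b<N. diag (ser2 f Tic Tc r b b s)) * diag (ser2 h Tic Tc a r s c))"
      by (simp add: ser2_conv diag_sum diag_mult sum_distrib_right)
        (subst sum.swap, rule sum.cong[OF refl], rule sum.swap)
    also have "\<dots> = fps_const (f 0) * (\<Sum>r<N. diag (ser2 h Tic Tc a r r c))"
      by (simp add: kills_inverse[OF f] if_zero_mult sum_distrib_left)
    finally show ?thesis unfolding r appl_inverse_rel by (simp add: kills_inverse[OF h _ ac] conv_def)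
  next
    case RTT
    then obtain a b c d m i where l: "a < N" "b < N" "c < N" "d < N" and
      r: "r = Abs_fps (\<lambda>n. fls_nth (fps_nth
      ((\<Sum>p<N. \<Sum>q<N. const_coeff (R0 a b p q) * mser_prod True (T0 p c) (T0 q d) m)
       - (\<Sum>p<N. \<Sum>q<N. mser_prod False (T0 a p) (T0 b q) m * const_coeff (R0 p q c d))) n) i)"
      unfolding RTT_rels_def by blast
    note kf = kills_RTT[OF f] and kh = kills_RTT[OF h]
    have "teq N (tmul N RE (tmul N (SE f) (SE h))) (tmul N (tmul N RE (SE f)) (SE h))" by (simp add: teq_def tmul_assoc)
    also have "teq N \<dots> (tmul N (tmul N (SF f) RE) (SE h))" by (rule tmul_cong[OF kf teq_refl])
    also have "teq N \<dots> (tmul N (SF f) (tmul N RE (SE h)))" by (simp add: teq_def tmul_assoc)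
    also have "teq N \<dots> (tmul N (SF f) (tmul N (SF h) RE))" by (rule tmul_cong[OF teq_refl kh])
    also have "teq N \<dots> (tmul N (tmul N (SF f) (SF h)) RE)" by (simp add: teq_def tmul_assoc)
    finally show ?thesis unfolding r appl_RTT' SE_conv teq_def using l by simp
  next
    case qdet
    then obtain m where r: "r = fps_nth (qdet N C T0) m - (if m = 0 then 1 else 0)" unfolding qdet_rels_def by blast
    have "appl (conv N f h) 1 = f 0 * h 0" using appl_basis[of "conv N f h" 0] by (simp add: basis_0 conv_def)
    thus ?thesis unfolding r hadd_diff[OF hadd_appl] conv_qdet[OF f h] by (simp add: hadd_0[OF hadd_appl])
  qed
qed

text \<open>A translate of a convolution is a sum of convolutions of translates, and translates of
  functionals killing the ideal kill it too. Hence checking the relations alone is enough.\<close>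

lemma kills_conv: assumes f: "kills f" and h: "kills h" shows "kills (conv N f h)"
  unfolding kills_def
proof
  fix x assume "x \<in> J"
  thus "appl (conv N f h) x = 0"
    unfolding F0_ideal_def
  proof (rule appl_closed_ideal[rotated])
    fix u r v assume r: "r \<in> F_rels \<Sigma> N R \<union> qdet_rels N C T0"
    have "conv N f h (u + w + v) = swee N (\<lambda>u1 u2. swee N (\<lambda>v1 v2. conv N (\<lambda>a. f (u1 + a + v1)) (\<lambda>b. h (u2 + b + v2)) w) v) u" for w
      unfolding conv_def swee_append by (subst swee_Fubini[of N N _ v w]) (rule refl)
    thus "appl (\<lambda>w. conv N f h (u + w + v)) r = 0"
      by (simp add: swee_appl_fun[symmetric] kills_conv_rels[OF kills_surround[OF f] kills_surround[OF h] r] swee_zero_fun)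
  qed
qed

end

subsection \<open>The antipode on comodules\<close>

context qkz
begin

definition eqJ :: "(gen0 word, 'k) cmod \<Rightarrow> (gen0 word, 'k) cmod \<Rightarrow> bool" (infix \<open>\<equiv>J\<close> 50)
  where "x \<equiv>J y \<longleftrightarrow> x - y \<in> J"

lemma eqJ_refl: "x \<equiv>J x" by (simp add: eqJ_def csub_0[OF csub_J])
lemma eqJ_sym: "x \<equiv>J y \<Longrightarrow> y \<equiv>J x" unfolding eqJ_def using csub_minus[OF csub_J] by fastforce
lemma eqJ_trans [trans]: "x \<equiv>J y \<Longrightarrow> y \<equiv>J w \<Longrightarrow> x \<equiv>J w"
  unfolding eqJ_def using csub_add[OF csub_J] by fastforce
lemma eqJ_eq_trans [trans]: "x \<equiv>J y \<Longrightarrow> y = w \<Longrightarrow> x \<equiv>J w" "x = y \<Longrightarrow> y \<equiv>J w \<Longrightarrow> x \<equiv>J w" by simp_all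
lemma eqJ_sum: "(\<And>i. i \<in> A \<Longrightarrow> f i \<equiv>J g i) \<Longrightarrow> (\<Sum>i\<in>A. f i) \<equiv>J (\<Sum>i\<in>A. g i)"
  unfolding eqJ_def sum_subtractf[symmetric] by (rule csub_sum[OF csub_J])
lemma eqJ_mult_left: "x \<equiv>J y \<Longrightarrow> a * x \<equiv>J a * y"
  unfolding eqJ_def right_diff_distrib[symmetric] by (rule unit_ideal_mult_left[OF J_unit])
lemma eqJ_mult_right: "x \<equiv>J y \<Longrightarrow> x * a \<equiv>J y * a"
  unfolding eqJ_def left_diff_distrib[symmetric] by (rule unit_ideal_mult_right[OF J_unit])
lemma eqJ_lin: assumes "\<And>w. f w \<equiv>J g w" shows "lin f x \<equiv>J lin g x"
  unfolding eqJ_def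
  by (rule csub_hadd_mem[OF csub_J, where f = "\<lambda>x. lin f x - lin g x"])
    (use assms in \<open>auto simp: eqJ_def lin_single csub_hscale[OF csub_J] hadd_subtract hadd_lin simp flip: hadd_diff[OF hadd_hscale]\<close>)
lemma eqJ_swee_gen: "(\<And>x y. \<Psi> x y \<equiv>J \<Psi>' x y) \<Longrightarrow> swee_gen N \<Psi> g \<equiv>J swee_gen N \<Psi>' g"
  by (cases g) (simp_all add: eqJ_sum)
lemma eqJ_range: "\<not> valid N w \<Longrightarrow> basis w \<equiv>J 0"
  unfolding eqJ_def using unit_ideal_range[OF J_unit] by simp

context
  fixes S S' assumes SS: "antipode_pair J S S'"
begin

lemma S_0: "S 0 \<equiv>J 1" and S_append: "S (u + v) \<equiv>J S v * S u" and S_Tc: "S (Word [Tc a b m]) \<equiv>J basis (Word [Tic a b m])"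
  and S_J: "x \<in> J \<Longrightarrow> lin S x \<in> J" and S'_J: "x \<in> J \<Longrightarrow> lin S' x \<in> J"
  and SS': "lin S (S' w) \<equiv>J basis w" and S'S: "lin S' (S w) \<equiv>J basis w"
  using SS unfolding antipode_pair_def eqJ_def by blast+

lemma S_cong: "x \<equiv>J y \<Longrightarrow> lin S x \<equiv>J lin S y" and S'_cong: "x \<equiv>J y \<Longrightarrow> lin S' x \<equiv>J lin S' y"
  unfolding eqJ_def hadd_diff[OF hadd_lin, symmetric] by (rule S_J S'_J; assumption)+

lemma S_S': "lin S (lin S' x) \<equiv>J x" and S'_S: "lin S' (lin S x) \<equiv>J x"
  unfolding lin_lin using eqJ_lin[of "\<lambda>w. lin S (S' w)" basis x] eqJ_lin[of "\<lambda>w. lin S' (S w)" basis x] SS' S'S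
  by (simp_all add: lin_id)

lemma S_mult: "lin S (x * y) \<equiv>J lin S y * lin S x"
  unfolding eqJ_def
proof (rule csub_hadd_mem[OF csub_J, where f = "\<lambda>x. lin S (x * y) - lin S y * lin S x"])
  show "hadd (\<lambda>x. lin S (x * y) - lin S y * lin S x)"
    by (intro hadd_subtract hadd_compose[OF hadd_lin hadd_mult_right] hadd_compose[OF hadd_mult_left hadd_lin])
  fix s c
  let ?s = "fps_const (Poly_Mapping.single s c) :: (gen0 word, 'k) cmod"
  show "lin S (?s * y) - lin S y * lin S ?s \<in> J"
  proof (rule csub_hadd_mem[OF csub_J, where f = "\<lambda>y. lin S (?s * y) - lin S y * lin S ?s"])
    show "hadd (\<lambda>y. lin S (?s * y) - lin S y * lin S ?s)"
      by (intro hadd_subtract hadd_compose[OF hadd_lin hadd_mult_left] hadd_compose[OF hadd_mult_right hadd_lin])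
    fix t e
    have "lin S (?s * fps_const (Poly_Mapping.single t e)) - lin S (fps_const (Poly_Mapping.single t e)) * lin S ?s =
      hscale (fps_const (c * e)) (S (s + t) - S t * S s)"
      by (simp add: single_mult_const lin_single mult_hscale_left mult_hscale_right hscale_hscale hadd_diff[OF hadd_hscale] mult.commute
          del: fps_const_mult) (simp add: mult.commute)
    thus "lin S (?s * fps_const (Poly_Mapping.single t e)) - lin S (fps_const (Poly_Mapping.single t e)) * lin S ?s \<in> J"
      using S_append[of s t] csub_hscale[OF csub_J] by (simp add: eqJ_def)
  qed
qed

lemma S_1: "lin S 1 \<equiv>J 1"
  using S_0 by (simp flip: basis_0)

lemma inverse_J:
  assumes "gen_pair \<kappa> \<kappa>'"
  shows "(\<Sum>b<N. \<Sum>l\<le>m. basis (Word [\<kappa> a b l]) * basis (Word [\<kappa>' b c (m - l)])) \<equiv>J (if a = c \<and> a < N \<and> m = 0 then 1 else 0)"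
proof (cases "a < N \<and> c < N")
  case True
  thus ?thesis using unit_ideal_inverse[OF J_unit assms, of a c m] by (simp add: eqJ_def basis_append)
next
  case False
  have v: "valid_gen N (\<kappa> a b l) \<longleftrightarrow> a < N \<and> b < N" "valid_gen N (\<kappa>' a b l) \<longleftrightarrow> a < N \<and> b < N" for a b l
    using assms by (auto simp: gen_pair_def)
  have "basis (Word [\<kappa> a b l]) * basis (Word [\<kappa>' b c l']) \<equiv>J 0" for b l l'
    using False eqJ_range[of "Word [\<kappa> a b l] + Word [\<kappa>' b c l']"] by (auto simp: v basis_append)
  hence "(\<Sum>b<N. \<Sum>l\<le>m. basis (Word [\<kappa> a b l]) * basis (Word [\<kappa>' b c (m - l)])) \<equiv>J (\<Sum>b<N. \<Sum>l\<le>m. 0)"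
    by (intro eqJ_sum)
  thus ?thesis using False by auto
qed

lemma S_inverse_J:
  assumes "gen_pair \<kappa> \<kappa>'"
  shows "(\<Sum>b<N. \<Sum>l\<le>m. S (Word [\<kappa>' b c (m - l)]) * S (Word [\<kappa> a b l])) \<equiv>J (if a = c \<and> a < N \<and> m = 0 then 1 else 0)"
proof -
  have "(\<Sum>b<N. \<Sum>l\<le>m. S (Word [\<kappa>' b c (m - l)]) * S (Word [\<kappa> a b l])) \<equiv>J
    lin S (\<Sum>b<N. \<Sum>l\<le>m. basis (Word [\<kappa> a b l]) * basis (Word [\<kappa>' b c (m - l)]))"
    using S_append by (auto simp: hadd_sum[OF hadd_lin] simp flip: basis_append intro!: eqJ_sum intro: eqJ_sym)
  also have "\<dots> \<equiv>J lin S (if a = c \<and> a < N \<and> m = 0 then 1 else 0)"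
    by (rule S_cong[OF inverse_J[OF assms]])
  also have "\<dots> \<equiv>J (if a = c \<and> a < N \<and> m = 0 then 1 else 0)" by (simp add: S_1 hadd_0[OF hadd_lin] eqJ_refl)
  finally show ?thesis .
qed

text \<open>S is prescribed on T-letters only. For a letter of \<open>T^-1\<close> the other tensor
  factor is rewritten as S of a T-letter, and the sum becomes S applied to an inverse
  relation.\<close>

lemma antipode_gen:
  "swee_gen N (\<lambda>x y. basis x * S y) g \<equiv>J scal (cu N (Word [g]))" "swee_gen N (\<lambda>x y. S x * basis y) g \<equiv>J scal (cu N (Word [g]))"
proof -
  have d: "(if P then 1 else 0 :: (gen0 word, 'k) cmod) = scal (if P then 1 else 0)" for P
    by (simp add: scal_1 hadd_0[OF hadd_scal])
  show "swee_gen N (\<lambda>x y. basis x * S y) g \<equiv>J scal (cu N (Word [g]))"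
  proof (cases g)
    case (Tc a c m)
    have "(\<Sum>b<N. \<Sum>l\<le>m. basis (Word [Tc a b l]) * S (Word [Tc b c (m - l)])) \<equiv>J
        (\<Sum>b<N. \<Sum>l\<le>m. basis (Word [Tc a b l]) * basis (Word [Tic b c (m - l)]))"
      by (intro eqJ_sum eqJ_mult_left S_Tc)
    also have "\<dots> \<equiv>J (if a = c \<and> a < N \<and> m = 0 then 1 else 0)" by (rule inverse_J) simp
    finally show ?thesis unfolding Tc cu_Tc d by simp
  next
    case (Tic a c m)
    have "(\<Sum>b<N. \<Sum>l\<le>m. basis (Word [Tic b c l]) * S (Word [Tic a b (m - l)])) \<equiv>J
        (\<Sum>b<N. \<Sum>l\<le>m. S (Word [Tc b c l]) * S (Word [Tic a b (m - l)]))"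
      by (intro eqJ_sum eqJ_mult_right eqJ_sym[OF S_Tc])
    also have "\<dots> = (\<Sum>b<N. \<Sum>l\<le>m. S (Word [Tc b c (m - l)]) * S (Word [Tic a b l]))"
      by (rule sum.cong[OF refl], rule sum_rev)
    also have "\<dots> \<equiv>J (if a = c \<and> a < N \<and> m = 0 then 1 else 0)" by (rule S_inverse_J) simp
    finally show ?thesis unfolding Tic cu_Tic d by simp
  qed
  show "swee_gen N (\<lambda>x y. S x * basis y) g \<equiv>J scal (cu N (Word [g]))"
  proof (cases g)
    case (Tc a c m)
    have "(\<Sum>b<N. \<Sum>l\<le>m. S (Word [Tc a b l]) * basis (Word [Tc b c (m - l)])) \<equiv>J
        (\<Sum>b<N. \<Sum>l\<le>m. basis (Word [Tic a b l]) * basis (Word [Tc b c (m - l)]))"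
      by (intro eqJ_sum eqJ_mult_right S_Tc)
    also have "\<dots> \<equiv>J (if a = c \<and> a < N \<and> m = 0 then 1 else 0)" by (rule inverse_J) simp
    finally show ?thesis unfolding Tc cu_Tc d by simp
  next
    case (Tic a c m)
    have "(\<Sum>b<N. \<Sum>l\<le>m. S (Word [Tic b c l]) * basis (Word [Tic a b (m - l)])) \<equiv>J
        (\<Sum>b<N. \<Sum>l\<le>m. S (Word [Tic b c l]) * S (Word [Tc a b (m - l)]))"
      by (intro eqJ_sum eqJ_mult_left eqJ_sym[OF S_Tc])
    also have "\<dots> = (\<Sum>b<N. \<Sum>l\<le>m. S (Word [Tic b c (m - l)]) * S (Word [Tc a b l]))"
      by (rule sum.cong[OF refl], rule sum_rev)
    also have "\<dots> \<equiv>J (if a = c \<and> a < N \<and> m = 0 then 1 else 0)" by (rule S_inverse_J) simp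
    finally show ?thesis unfolding Tic cu_Tic d by simp
  qed
qed

lemma eqJ_swee: "(\<And>x y. \<Psi> x y \<equiv>J \<Psi>' x y) \<Longrightarrow> swee N \<Psi> w \<equiv>J swee N \<Psi>' w"
proof (induction w arbitrary: \<Psi> \<Psi>' rule: word_induct)
  case (Cons g w)
  show ?case unfolding swee_Cons by (intro eqJ_swee_gen Cons.IH Cons.prems)
qed simp

text \<open>For a word with head g one of the two contractions is always inside the other:
  antimultiplicativity of S puts the tail inside in the first identity and the head inside in the
  second.\<close>

lemma antipode_word:
  "swee N (\<lambda>x y. basis x * S y) w \<equiv>J scal (cu N w)" "swee N (\<lambda>x y. S x * basis y) w \<equiv>J scal (cu N w)"
proof (induction w rule: word_induct)
  case 0
  case 1 show ?case using S_0 by (simp add: basis_0 scal_1)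
  case 2 show ?case using S_0 by (simp add: basis_0 scal_1)
next
  case (Cons g w)
  have gen: "swee_gen N (\<lambda>x y. a x * swee N \<Psi> w * b y) g = swee_gen N (\<lambda>x y. swee N (\<lambda>u v. a x * \<Psi> u v * b y) w) g"
    for a b :: "gen0 word \<Rightarrow> (gen0 word, 'k) cmod" and \<Psi>
  proof -
    have "a x * swee N \<Psi> w * b y = swee N (\<lambda>u v. a x * \<Psi> u v * b y) w" for x y
      by (rule swee_additive[of "\<lambda>z. a x * z * b y"]) (simp_all add: distrib_left distrib_right)
    thus ?thesis by simp
  qed
  have sc: "a * scal c * b = scal c * (a * b)" for a b :: "(gen0 word, 'k) cmod" and c
    by (simp add: scal_mult_left scal_mult_right mult_hscale_left)
  have sg: "swee_gen N (\<lambda>x y. scal c * \<Psi> x y) g = scal c * swee_gen N \<Psi> g" for c and \<Psi> :: "_ \<Rightarrow> _ \<Rightarrow> (gen0 word, 'k) cmod"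
    by (cases g) (simp_all add: sum_distrib_left)
  case 1
  have "swee N (\<lambda>x y. basis x * S y) (Word [g] + w) \<equiv>J swee_gen N (\<lambda>x y. swee N (\<lambda>u v. basis x * (basis u * S v) * S y) w) g"
    unfolding swee_Cons basis_append mult.assoc by (intro eqJ_swee_gen eqJ_swee eqJ_mult_left S_append)
  also have "\<dots> \<equiv>J swee_gen N (\<lambda>x y. basis x * scal (cu N w) * S y) g"
    unfolding gen[symmetric] by (intro eqJ_swee_gen eqJ_mult_left eqJ_mult_right Cons)
  also have "\<dots> \<equiv>J scal (cu N w) * scal (cu N (Word [g]))" unfolding sc sg by (intro eqJ_mult_left antipode_gen)
  also have "\<dots> = scal (cu N (Word [g] + w))" by (simp add: mult.commute flip: scal_mult)
  finally show ?case .
  case 2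
  have r: "S (x + u) * (basis y * basis v) \<equiv>J S u * (S x * basis y) * basis v" for x u y v
    using eqJ_mult_right[OF S_append[of x u], of "basis y * basis v"] by (simp add: mult.assoc)
  have "swee N (\<lambda>x y. S x * basis y) (Word [g] + w) \<equiv>J swee_gen N (\<lambda>x y. swee N (\<lambda>u v. S u * (S x * basis y) * basis v) w) g"
    unfolding swee_Cons basis_append by (intro eqJ_swee_gen eqJ_swee r)
  also have "\<dots> = swee N (\<lambda>u v. S u * swee_gen N (\<lambda>x y. S x * basis y) g * basis v) w"
    unfolding swee_gen_swee_Fubini by (cases g) (simp_all add: sum_distrib_left sum_distrib_right)
  also have "\<dots> \<equiv>J swee N (\<lambda>u v. S u * scal (cu N (Word [g])) * basis v) w"
    by (intro eqJ_swee eqJ_mult_left eqJ_mult_right antipode_gen)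
  also have "\<dots> = scal (cu N (Word [g])) * swee N (\<lambda>u v. S u * basis v) w"
    unfolding sc by (rule swee_additive[symmetric]) (simp_all add: distrib_left)
  also have "\<dots> \<equiv>J scal (cu N (Word [g])) * scal (cu N w)" by (intro eqJ_mult_left Cons)
  also have "\<dots> = scal (cu N (Word [g] + w))" by (simp flip: scal_mult)
  finally show ?case .
qed

lemma lin_scal_fun:
  fixes f :: "gen0 word \<Rightarrow> 'k fps"
  shows "lin (\<lambda>w. scal (f w)) x = (scal (appl f x) :: (gen0 word, 'k) cmod)"
proof (rule cmod_eqI[of "lin (\<lambda>w. scal (f w))" "\<lambda>x. scal (appl f x)"])
  show "hadd (\<lambda>x. scal (appl f x) :: (gen0 word, 'k) cmod)" by (rule hadd_compose[OF hadd_scal hadd_appl])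
qed (simp_all add: hadd_lin lin_single appl_single scal_mult scal_mult_left del: fps_const_mult)

context
  fixes d t assumes co: "comodule N J d t"
begin

text \<open>The comodule axiom holds only modulo \<open>tens_ideal\<close>, so it can be pushed
  through a linear map L exactly when L sends that submodule into the ideal.\<close>

lemma comod_transfer:
  assumes L: "\<And>x y. x \<in> J \<or> y \<in> J \<Longrightarrow> lin L (tens x y) \<in> J" and w: "\<And>w. lin L (cop0 N w) \<equiv>J scal (cu N w)"
    and b: "b < d" "e < d"
  shows "(\<Sum>a<d. lin L (tens (t b a) (t a e))) \<equiv>J (if b = e then 1 else 0)"
proof -
  have "tens_ideal J \<subseteq> {x. lin L x \<in> J}"
    unfolding tens_ideal_def using L
    by (intro closed_span_least csub_preimage[OF csub_J hadd_lin]) (auto simp: lin_hscale)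
  moreover have "lin (cop0 N) (t b e) - (\<Sum>a<d. tens (t b a) (t a e)) \<in> tens_ideal J"
    using co b unfolding comodule_def by blast
  ultimately have "lin L (lin (cop0 N) (t b e)) \<equiv>J (\<Sum>a<d. lin L (tens (t b a) (t a e)))"
    by (auto simp: eqJ_def hadd_diff[OF hadd_lin] hadd_sum[OF hadd_lin])
  from eqJ_sym[OF this] have "(\<Sum>a<d. lin L (tens (t b a) (t a e))) \<equiv>J lin (\<lambda>w. lin L (cop0 N w)) (t b e)"
    by (simp add: lin_lin)
  also have "\<dots> \<equiv>J lin (\<lambda>w. scal (cu N w)) (t b e)" by (rule eqJ_lin[OF w])
  also have "\<dots> = (if b = e then 1 else 0)"
    using co b unfolding lin_scal_fun comodule_def eps0_cu[abs_def] by (auto simp: scal_1 hadd_0[OF hadd_scal])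
  finally show ?thesis .
qed

lemma lin_mult_pair:
  "lin (\<lambda>(x, y). f x * g y) (tens u v) = lin f u * (lin g v :: (gen0 word, 'k) cmod)"
proof -
  have "lin (\<lambda>t. f s * g t) v = f s * lin g v" for s
    by (rule cmod_eqI[of "lin (\<lambda>t. f s * g t)" "\<lambda>v. f s * lin g v"])
      (simp_all add: hadd_lin hadd_compose[OF hadd_mult_left hadd_lin] lin_single mult_hscale_right)
  moreover have "lin (\<lambda>s. f s * lin g v) u = lin f u * lin g v"
    by (rule cmod_eqI[of "lin (\<lambda>s. f s * lin g v)" "\<lambda>u. lin f u * lin g v"])
      (simp_all add: hadd_lin hadd_compose[OF hadd_mult_right hadd_lin] lin_single mult_hscale_left)
  ultimately show ?thesis by (simp add: lin_tens)
qed

lemma S_cancel: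
  assumes "lin S x \<equiv>J lin S y" shows "x \<equiv>J y"
  using S'_cong[OF assms] S'_S eqJ_sym eqJ_trans by meson

lemma S_delta: "lin S (if P then 1 else 0) \<equiv>J (if P then 1 else 0)"
  by (simp add: S_1 hadd_0[OF hadd_lin] eqJ_refl)

text \<open>The inverse antipode satisfies the axiom for the opposite product. Applying S turns each
  sum into the ordinary antipode identity, and S may be cancelled because \<open>S'\<close> inverts
  it modulo the ideal.\<close>

lemma antipode_comodule:
  assumes b: "b < d" "e < d"
  shows "(\<Sum>a<d. t a e * lin S' (t b a)) \<equiv>J (if b = e then 1 else 0)" "(\<Sum>a<d. lin S' (t a e) * t b a) \<equiv>J (if b = e then 1 else 0)"
proof -
  have "lin S (\<Sum>a<d. t a e * lin S' (t b a)) \<equiv>J (\<Sum>a<d. lin S (lin S' (t b a)) * lin S (t a e))"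
    unfolding hadd_sum[OF hadd_lin] by (intro eqJ_sum S_mult)
  also have "\<dots> \<equiv>J (\<Sum>a<d. t b a * lin S (t a e))" by (intro eqJ_sum eqJ_mult_right S_S')
  also have "\<dots> = (\<Sum>a<d. lin (\<lambda>(x, y). basis x * S y) (tens (t b a) (t a e)))" by (simp add: lin_mult_pair lin_id)
  also have "\<dots> \<equiv>J (if b = e then 1 else 0)"
    by (rule comod_transfer[OF _ _ b])
      (auto simp: lin_mult_pair lin_id S_J unit_ideal_mult_left[OF J_unit] unit_ideal_mult_right[OF J_unit] antipode_word hadd_cop0[OF hadd_lin])
  finally show "(\<Sum>a<d. t a e * lin S' (t b a)) \<equiv>J (if b = e then 1 else 0)"
    using S_cancel[OF eqJ_trans[OF _ eqJ_sym[OF S_delta]]] by blast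
  have "lin S (\<Sum>a<d. lin S' (t a e) * t b a) \<equiv>J (\<Sum>a<d. lin S (t b a) * lin S (lin S' (t a e)))"
    unfolding hadd_sum[OF hadd_lin] by (intro eqJ_sum S_mult)
  also have "\<dots> \<equiv>J (\<Sum>a<d. lin S (t b a) * t a e)" by (intro eqJ_sum eqJ_mult_left S_S')
  also have "\<dots> = (\<Sum>a<d. lin (\<lambda>(x, y). S x * basis y) (tens (t b a) (t a e)))" by (simp add: lin_mult_pair lin_id)
  also have "\<dots> \<equiv>J (if b = e then 1 else 0)"
    by (rule comod_transfer[OF _ _ b])
      (auto simp: lin_mult_pair lin_id S_J unit_ideal_mult_left[OF J_unit] unit_ideal_mult_right[OF J_unit] antipode_word hadd_cop0[OF hadd_lin])
  finally show "(\<Sum>a<d. lin S' (t a e) * t b a) \<equiv>J (if b = e then 1 else 0)"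
    using S_cancel[OF eqJ_trans[OF _ eqJ_sym[OF S_delta]]] by blast
qed

end

lemma S'_0: "S' 0 \<equiv>J 1"
proof -
  have "S' 0 = lin S' 1" by (simp flip: basis_0)
  also have "\<dots> \<equiv>J lin S' (lin S 1)" by (rule S'_cong[OF eqJ_sym[OF S_1]])
  also have "\<dots> \<equiv>J 1" by (rule S'_S)
  finally show ?thesis .
qed

end

text \<open>Convolution of functionals becomes matrix multiplication on the matrix coefficients of a
  comodule; both functionals must kill the ideal since the comodule axiom holds only in the
  quotient.\<close>

lemma kills_comodule:
  assumes co: "comodule N J d t" and f: "kills f" and h: "kills h" and "a < d" "b < d"
  shows "appl (conv N f h) (t a b) = (\<Sum>c<d. appl f (t a c) * appl h (t c b))"
proof -
  have "lin (cop0 N) (t a b) - (\<Sum>c<d. tens (t a c) (t c b)) \<in> tens_ideal J"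
    using co assms(4,5) unfolding comodule_def by blast
  hence "appl (\<lambda>(s, t). f s * h t) (lin (cop0 N) (t a b) - (\<Sum>c<d. tens (t a c) (t c b))) = 0"
    unfolding tens_ideal_def using f h
    by (rule_tac appl_closed_span[rotated]) (auto simp: appl_tens_prod kills_def)
  thus ?thesis unfolding appl_conv by (simp add: hadd_diff[OF hadd_appl] hadd_sum[OF hadd_appl] appl_tens_prod)
qed

end

section \<open>Invariant functionals\<close>

subsection \<open>Convolution of matrices of functionals\<close>

text \<open>
  A family \<open>m j a b\<close> of functionals is, for each j, a matrix acting on the j-th tensor factor; \<open>L\<close> runs over
  the multi-indices of a basis of the tensor product.
\<close>

type_synonym 'a fam = "nat \<Rightarrow> nat \<Rightarrow> nat \<Rightarrow> gen0 word \<Rightarrow> 'a"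

context
  fixes N :: nat and d :: "nat \<Rightarrow> nat"
begin

text \<open>A chain of matrices convolved from the left onto X, each contracting its own index of
  the multi-index.\<close>

primrec ch :: "'a::comm_ring_1 fam \<Rightarrow> nat list \<Rightarrow> ((nat \<Rightarrow> nat) \<Rightarrow> gen0 word \<Rightarrow> 'a) \<Rightarrow> (nat \<Rightarrow> nat) \<Rightarrow> gen0 word \<Rightarrow> 'a" where
  "ch m [] X L = X L"
| "ch m (j # js) X L = (\<lambda>g. \<Sum>a<d j. conv N (m j a (L j)) (ch m js X (L(j := a))) g)"

text \<open>The same contraction with the matrix convolved from the right. Factors before the
  distinguished slot i act from the left, those after it from the right.\<close>

definition rt :: "'a::comm_ring_1 fam \<Rightarrow> nat \<Rightarrow> ((nat \<Rightarrow> nat) \<Rightarrow> gen0 word \<Rightarrow> 'a) \<Rightarrow> (nat \<Rightarrow> nat) \<Rightarrow> gen0 word \<Rightarrow> 'a"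
  where "rt m j X L = (\<lambda>g. \<Sum>a<d j. conv N (X (L(j := a))) (m j a (L j)) g)"

lemma ch_append: "ch m (js @ ks) X L = ch m js (ch m ks X) L"
  by (induction js arbitrary: L) simp_all

lemma ch_upd: "j \<notin> set js \<Longrightarrow> ch m js X (L(j := a)) = ch m js (\<lambda>L. X (L(j := a))) L"
proof (induction js arbitrary: L)
  case (Cons k js)
  hence "j \<noteq> k" "j \<notin> set js" by simp_all
  moreover have "L(j := a, k := b) = L(k := b, j := a)" for b using \<open>j \<noteq> k\<close> by (rule fun_upd_twist)
  ultimately show ?case by (simp add: Cons.IH del: fun_upd_apply) (simp add: fun_upd_def)
qed simp

lemma ch_fixed: "j \<notin> set js \<Longrightarrow> ch m js (\<lambda>L. Y (L j) L) L = ch m js (\<lambda>L'. Y (L j) L') L"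
  using ch_upd[of j js m "\<lambda>L. Y (L j) L" L "L j"] ch_upd[of j js m "\<lambda>L'. Y (L j) L'" L "L j"] by simp

lemma ch_conv_right: "conv N (ch m js X L) h = ch m js (\<lambda>L. conv N (X L) h) L"
proof (induction js arbitrary: L)
  case (Cons j js)
  show ?case by (rule ext) (simp add: conv_sum_left conv_assoc Cons, simp add: fun_upd_def)
qed simp

lemma conv_cong_fun: "(\<And>g. h g = h' g) \<Longrightarrow> conv N f h g = conv N f h' g" for f h :: "gen0 word \<Rightarrow> 'a::comm_ring_1"
  by (simp add: conv_def)

lemma ch_sum: "ch m js (\<lambda>L g. \<Sum>i\<in>A. X i L g) L g = (\<Sum>i\<in>A. ch m js (X i) L g)"
proof (induction js arbitrary: L g)
  case (Cons j js)
  have "ch m js (\<lambda>L g. \<Sum>i\<in>A. X i L g) L = (\<lambda>g. \<Sum>i\<in>A. ch m js (X i) L g)" for L using Cons by (intro ext)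
  thus ?case by (simp add: conv_sum_right) (rule sum.swap)
qed simp

lemma ch_scale: "ch m js (\<lambda>L g. c * X L g) L g = c * ch m js X L g"
proof (induction js arbitrary: L g)
  case (Cons j js)
  have "ch m js (\<lambda>L g. c * X L g) L = (\<lambda>g. c * ch m js X L g)" for L using Cons by (intro ext)
  thus ?case by (simp add: conv_mult_right sum_distrib_left)
qed simp

lemma ch_swee: "ch m js (\<lambda>L g. swee M (\<lambda>u v. X u v L g) x) L g = swee M (\<lambda>u v. ch m js (X u v) L g) x"
proof (induction js arbitrary: L g)
  case (Cons j js)
  have "ch m js (\<lambda>L g. swee M (\<lambda>u v. X u v L g) x) L = (\<lambda>g. swee M (\<lambda>u v. ch m js (X u v) L g) x)" for L using Cons by (intro ext)
  thus ?case by (simp add: conv_swee_right swee_sum_fun)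
qed simp

lemma nullf_sum: "(\<And>i. i \<in> A \<Longrightarrow> nullf N (f i)) \<Longrightarrow> nullf N (\<lambda>g. \<Sum>i\<in>A. f i g :: 'a::comm_ring_1)"
  by (simp add: nullf_def)

lemma nullf_rt: "(\<And>L. nullf N (X L)) \<Longrightarrow> (\<And>j a b. nullf N (m j a b)) \<Longrightarrow> nullf N (rt m j X L)"
  unfolding rt_def by (intro nullf_sum nullf_conv)

text \<open>Coassociativity moves the head of the chain from the second Sweedler component to the
  right end of the first, converting one \<open>ch\<close> step into one \<open>rt\<close>
  step.\<close>

lemma swee_ch_Cons:
  assumes "j \<notin> set js"
  shows "swee N (\<lambda>x y. ch m (j # js) (\<lambda>L g. X L x * cu N g) L y) g = swee N (\<lambda>x y. ch m js (\<lambda>L g. rt m j X L x * cu N g) L y) g"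
proof -
  let ?c = "\<lambda>a x y. ch m js (\<lambda>L g. X (L(j := a)) x * cu N g) L y"
  have "swee N (\<lambda>x y. ch m (j # js) (\<lambda>L g. X L x * cu N g) L y) g =
      (\<Sum>a<d j. swee N (\<lambda>x y. swee N (\<lambda>p q. m j a (L j) p * ?c a x q) y) g)"
    by (simp add: ch_upd[OF assms] swee_sum_fun conv_def)
  also have "\<dots> = (\<Sum>a<d j. swee N (\<lambda>x y. swee N (\<lambda>p q. m j a (L j) q * ?c a p y) x) g)"
    by (rule sum.cong[OF refl]) (rule swee_coassoc)
  also have "\<dots> = swee N (\<lambda>x y. \<Sum>a<d j. swee N (\<lambda>p q. m j a (L j) q * ?c a p y) x) g"
    by (simp add: swee_sum_fun)
  also have "(\<lambda>x y. \<Sum>a<d j. swee N (\<lambda>p q. m j a (L j) q * ?c a p y) x) = (\<lambda>x y. ch m js (\<lambda>L g. rt m j X L x * cu N g) L y)"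
  proof (intro ext)
    fix x y
    have "ch m js (\<lambda>L' g. rt m j X L' x * cu N g) L y =
        ch m js (\<lambda>L' g. \<Sum>a<d j. swee N (\<lambda>p q. m j a (L j) q * (X (L'(j := a)) p * cu N g)) x) L y"
      unfolding rt_def conv_def sum_distrib_right swee_mult_right
      by (subst ch_fixed[OF assms, of m "\<lambda>b L' g. \<Sum>a<d j. swee N (\<lambda>p q. X (L'(j := a)) p * m j a b q * cu N g) x"])
        (simp add: mult_ac)
    also have "\<dots> = (\<Sum>a<d j. swee N (\<lambda>p q. m j a (L j) q * ?c a p y) x)"
      by (simp add: ch_sum ch_swee ch_scale)
    finally show "(\<Sum>a<d j. swee N (\<lambda>p q. m j a (L j) q * ?c a p y) x) = ch m js (\<lambda>L' g. rt m j X L' x * cu N g) L y" ..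
  qed
  finally show ?thesis .
qed

lemma swee_ch:
  assumes "distinct js" "\<And>L. nullf N (X L)" "\<And>j a b. nullf N (m j a b)"
  shows "swee N (\<lambda>x y. ch m js (\<lambda>L g. X L x * cu N g) L y) g = fold (rt m) js X L g"
  using assms(1,2)
proof (induction js arbitrary: X)
  case Nil
  thus ?case using conv_cu_right[of N "X L"] by (simp add: conv_def[abs_def] fun_eq_iff)
next
  case (Cons j js)
  have "swee N (\<lambda>x y. ch m js (\<lambda>L g. rt m j X L x * cu N g) L y) g = fold (rt m) js (rt m j X) L g"
    using Cons.prems by (intro Cons.IH nullf_rt assms(3)) auto
  moreover have "j \<notin> set js" using Cons.prems by simp
  ultimately show ?case using swee_ch_Cons[of j js m X L g] by simp
qed

definition inrange :: "nat \<Rightarrow> (nat \<Rightarrow> nat) \<Rightarrow> bool" where "inrange n L \<longleftrightarrow> (\<forall>k<n. L k < d k)"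

lemma inrange_upd: "inrange n L \<Longrightarrow> a < d j \<Longrightarrow> inrange n (L(j := a))" by (simp add: inrange_def)

lemma conv_delta_sum: "(\<Sum>a<D. conv N (\<lambda>g. if a = e then cu N g else 0) (X a) g) = (if e < D then conv N (cu N) (X e) g else 0)"
  "(\<Sum>a<D. conv N (X a) (\<lambda>g. if a = e then cu N g else 0) g) = (if e < D then conv N (X e) (cu N) g else 0)"
  for X :: "nat \<Rightarrow> gen0 word \<Rightarrow> 'a::comm_ring_1"
proof -
  have z: "conv N (\<lambda>g. 0) h g = 0" "conv N h (\<lambda>g. 0) g = 0" for h :: "gen0 word \<Rightarrow> 'a" by (simp_all add: conv_def swee_zero_fun)
  have "(\<Sum>a<D. conv N (\<lambda>g. if a = e then cu N g else 0) (X a) g) = (\<Sum>a<D. if a = e then conv N (cu N) (X a) g else 0)"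
    by (rule sum.cong) (simp_all add: z)
  thus "(\<Sum>a<D. conv N (\<lambda>g. if a = e then cu N g else 0) (X a) g) = (if e < D then conv N (cu N) (X e) g else 0)" by simp
  have "(\<Sum>a<D. conv N (X a) (\<lambda>g. if a = e then cu N g else 0) g) = (\<Sum>a<D. if a = e then conv N (X a) (cu N) g else 0)"
    by (rule sum.cong) (simp_all add: z)
  also have "\<dots> = (if e < D then conv N (X e) (cu N) g else 0)" by simp
  finally show "(\<Sum>a<D. conv N (X a) (\<lambda>g. if a = e then cu N g else 0) g) = (if e < D then conv N (X e) (cu N) g else 0)" .
qed

text \<open>The equation for slot j is solved by convolving from the left with a left inverse;
  associativity brings inverse and matrix together, and they contract to the counit.\<close>

lemma left_inverse:
  assumes inv: "\<And>a e g. a < d j \<Longrightarrow> e < d j \<Longrightarrow> (\<Sum>b<d j. conv N (\<mu> j b e) (\<sigma> j a b) g) = (if a = e then cu N g else 0)"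
    and X: "\<And>b g. b < d j \<Longrightarrow> X (L(j := b)) g = (\<Sum>a<d j. conv N (\<sigma> j a b) (X' (L(j := a))) g)"
    and null: "nullf N (X' L)" and L: "L j < d j"
  shows "X' L g = (\<Sum>b<d j. conv N (\<mu> j b (L j)) (X (L(j := b))) g)"
proof -
  have "(\<Sum>b<d j. conv N (\<mu> j b (L j)) (X (L(j := b))) g) = (\<Sum>b<d j. conv N (\<mu> j b (L j)) (\<lambda>g. \<Sum>a<d j. conv N (\<sigma> j a b) (X' (L(j := a))) g) g)"
    by (intro sum.cong refl conv_cong_fun) (simp add: X)
  also have "\<dots> = (\<Sum>a<d j. conv N (\<lambda>g. \<Sum>b<d j. conv N (\<mu> j b (L j)) (\<sigma> j a b) g) (X' (L(j := a))) g)"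
    unfolding conv_sum_right conv_sum_left conv_assoc by (rule sum.swap)
  also have "\<dots> = (\<Sum>a<d j. conv N (\<lambda>g. if a = L j then cu N g else 0) (X' (L(j := a))) g)"
    by (rule sum.cong[OF refl]) (simp add: inv L)
  finally show ?thesis unfolding conv_delta_sum using L by (simp add: conv_cu_left[OF null])
qed

lemma right_inverse:
  assumes inv: "\<And>a e g. a < d j \<Longrightarrow> e < d j \<Longrightarrow> (\<Sum>b<d j. conv N (\<sigma> j a b) (\<mu> j b e) g) = (if a = e then cu N g else 0)"
    and null: "nullf N (X L)" and L: "L j < d j"
  shows "rt \<mu> j (rt \<sigma> j X) L = X L"
proof
  fix g
  have "rt \<mu> j (rt \<sigma> j X) L g = (\<Sum>a<d j. conv N (X (L(j := a))) (\<lambda>g. \<Sum>b<d j. conv N (\<sigma> j a b) (\<mu> j b (L j)) g) g)"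
    unfolding rt_def conv_sum_right conv_sum_left by (simp add: conv_assoc) (rule sum.swap)
  also have "\<dots> = (\<Sum>a<d j. conv N (X (L(j := a))) (\<lambda>g. if a = L j then cu N g else 0) g)"
    by (rule sum.cong[OF refl]) (simp add: inv L)
  finally show "rt \<mu> j (rt \<sigma> j X) L g = X L g" unfolding conv_delta_sum using L by (simp add: conv_cu_right[OF null])
qed

text \<open>The operations are undone in the opposite order, whence \<open>foldr\<close> against
  \<open>fold\<close>. Everything is restricted to \<open>inrange\<close> multi-indices because the
  inverse matrices are inverse only for indices below \<open>d j\<close>.\<close>

lemma fold_rt_inverse:
  assumes inv: "\<And>j a e g. j \<in> set js \<Longrightarrow> a < d j \<Longrightarrow> e < d j \<Longrightarrow> (\<Sum>b<d j. conv N (\<sigma> j a b) (\<mu> j b e) g) = (if a = e then cu N g else 0)"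
    and null: "\<And>L. nullf N (X L)" "\<And>j a b. nullf N (\<sigma> j a b)" and js: "set js \<subseteq> {..<n}"
    and Y: "\<And>L. inrange n L \<Longrightarrow> fold (rt \<sigma>) js X L = Y L" and L: "inrange n L"
  shows "X L = foldr (rt \<mu>) js Y L"
  using inv null(1) js Y L
proof (induction js arbitrary: X L)
  case (Cons j js)
  have "rt \<sigma> j X L = foldr (rt \<mu>) js Y L" if "inrange n L" for L
    using Cons.prems that by (intro Cons.IH nullf_rt null(2)) auto
  hence "rt \<mu> j (rt \<sigma> j X) L = rt \<mu> j (foldr (rt \<mu>) js Y) L"
    unfolding rt_def[of \<mu>] using Cons.prems by (intro ext sum.cong refl) (simp add: inrange_upd)
  moreover have "rt \<mu> j (rt \<sigma> j X) L = X L"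
    using Cons.prems by (intro right_inverse) (auto simp: inrange_def)
  ultimately show ?case by simp
qed simp

text \<open>At the end of the chain stands a multiple of the counit, which is a unit on both sides.
  A right convolution can therefore be regarded as a further left convolution in last
  position.\<close>

lemma rt_ch:
  assumes "j \<notin> set js" "\<And>j a b. nullf N (m j a b)"
  shows "rt m j (ch m js (\<lambda>L g. \<phi> L * cu N g)) L = ch m (js @ [j]) (\<lambda>L g. \<phi> L * cu N g) L"
proof
  fix g
  have c: "conv N (\<lambda>g. \<phi>' * cu N g) (m j a b) = (\<lambda>g. \<phi>' * m j a b g)" "conv N (m j a b) (\<lambda>g. \<phi>' * cu N g) = (\<lambda>g. \<phi>' * m j a b g)" for \<phi>' a b
    by (intro ext, simp add: conv_mult_left conv_mult_right conv_cu_left conv_cu_right assms(2))+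
  have "rt m j (ch m js (\<lambda>L g. \<phi> L * cu N g)) L g = (\<Sum>a<d j. ch m js (\<lambda>L' g. \<phi> (L'(j := a)) * m j a (L j) g) L g)"
    unfolding rt_def by (simp add: ch_conv_right ch_upd[OF assms(1)] c)
  also have "\<dots> = ch m js (\<lambda>L' g. \<Sum>a<d j. \<phi> (L'(j := a)) * m j a (L j) g) L g"
    by (simp add: ch_sum)
  also have "\<dots> = ch m (js @ [j]) (\<lambda>L g. \<phi> L * cu N g) L g"
  proof -
    have "(\<lambda>L g. \<Sum>a<d j. \<phi> (L(j := a)) * m j a (L j) g) = ch m [j] (\<lambda>L g. \<phi> L * cu N g)" by (intro ext) (simp add: c)
    thus ?thesis
      unfolding ch_append ch_fixed[OF assms(1), of m "\<lambda>b L' g. \<Sum>a<d j. \<phi> (L'(j := a)) * m j a b g", symmetric] by simp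
  qed
  finally show "rt m j (ch m js (\<lambda>L g. \<phi> L * cu N g)) L g = ch m (js @ [j]) (\<lambda>L g. \<phi> L * cu N g) L g" .
qed

lemma foldr_rt_ch:
  assumes "distinct (A @ js)" and null: "\<And>j a b. nullf N (m j a b)"
  shows "foldr (rt m) js (ch m A (\<lambda>L g. \<phi> L * cu N g)) = ch m (A @ rev js) (\<lambda>L g. \<phi> L * cu N g)"
  using assms(1)
proof (induction js)
  case (Cons j js)
  hence "rt m j (ch m (A @ rev js) (\<lambda>L g. \<phi> L * cu N g)) = ch m ((A @ rev js) @ [j]) (\<lambda>L g. \<phi> L * cu N g)"
    by (intro ext[of "rt m j _"] rt_ch null) auto
  moreover have "foldr (rt m) js (ch m A (\<lambda>L g. \<phi> L * cu N g)) = ch m (A @ rev js) (\<lambda>L g. \<phi> L * cu N g)"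
    using Cons by simp
  ultimately show ?case by simp
qed simp

primrec kern :: "'a::comm_ring_1 fam \<Rightarrow> nat list \<Rightarrow> (nat \<Rightarrow> nat) \<Rightarrow> (nat \<Rightarrow> nat) \<Rightarrow> gen0 word \<Rightarrow> 'a" where
  "kern m [] I L = cu N"
| "kern m (j # js) I L = conv N (m j (I j) (L j)) (kern m js I L)"

lemma kern_cong: "(\<And>k. k \<in> set js \<Longrightarrow> I k = I' k \<and> L k = L' k) \<Longrightarrow> kern m js I L = kern m js I' L'"
  by (induction js) auto

text \<open>The multi-indices over which a chain along \<open>js\<close> sums: free within range on
  \<open>js\<close>, fixed elsewhere.\<close>

definition agree :: "nat list \<Rightarrow> (nat \<Rightarrow> nat) \<Rightarrow> (nat \<Rightarrow> nat) set"
  where "agree js L = {L'. (\<forall>k\<in>set js. L' k < d k) \<and> (\<forall>k. k \<notin> set js \<longrightarrow> L' k = L k)}"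

lemma agree_Nil [simp]: "agree [] L = {L}" by (auto simp: agree_def)

lemma agree_part: "j \<notin> set js \<Longrightarrow> a < d j \<Longrightarrow> {L' \<in> agree (j # js) L. L' j = a} = agree js (L(j := a))"
  unfolding agree_def by auto

lemma finite_agree: "distinct js \<Longrightarrow> finite (agree js L)"
proof (induction js arbitrary: L)
  case (Cons j js)
  have "agree (j # js) L = (\<Union>a<d j. {L' \<in> agree (j # js) L. L' j = a})" by (auto simp: agree_def)
  also have "\<dots> = (\<Union>a<d j. agree js (L(j := a)))" using Cons.prems by (intro SUP_cong refl agree_part) auto
  finally show ?case using Cons by simp
qed simp

lemma sum_agree_Cons:
  assumes "distinct (j # js)"
  shows "(\<Sum>L'\<in>agree (j # js) L. f L') = (\<Sum>a<d j. \<Sum>L'\<in>agree js (L(j := a)). f L')"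
proof -
  have "(\<Sum>L'\<in>agree (j # js) L. f L') = (\<Sum>a<d j. \<Sum>L'\<in>{L' \<in> agree (j # js) L. L' j = a}. f L')"
    by (rule sum.group[symmetric]) (use finite_agree[OF assms] in \<open>auto simp: agree_def\<close>)
  also have "\<dots> = (\<Sum>a<d j. \<Sum>L'\<in>agree js (L(j := a)). f L')"
    using assms by (intro sum.cong agree_part refl) auto
  finally show ?thesis .
qed

lemma sum_tidx:
  assumes "distinct js" "set js = {..<n}"
  shows "(\<Sum>I\<in>tidx n d. f I) = (\<Sum>L'\<in>agree js L. f (map L' [0..<n]))"
proof -
  have "map (\<lambda>k. if k < length I then I ! k else L k) [0..<length I] = I" for I by (rule nth_equalityI) simp_all
  thus ?thesis
  by (rule_tac sum.reindex_bij_witness[of _ "\<lambda>L'. map L' [0..<n]" "\<lambda>I k. if k < n then I ! k else L k"])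
    (use assms in \<open>auto simp: tidx_def agree_def fun_eq_iff\<close>)
qed

lemma ch_kern:
  assumes "distinct js"
  shows "ch m js (\<lambda>L g. \<phi> L * cu N g) L g = (\<Sum>L'\<in>agree js L. \<phi> L' * kern m js L' L g)"
  using assms
proof (induction js arbitrary: L g)
  case (Cons j js)
  have j: "j \<notin> set js" using Cons by simp
  have "ch m js (\<lambda>L g. \<phi> L * cu N g) L = (\<lambda>g. \<Sum>L'\<in>agree js L. \<phi> L' * kern m js L' L g)" for L
    using Cons by (intro ext) simp
  hence "ch m (j # js) (\<lambda>L g. \<phi> L * cu N g) L g =
      (\<Sum>a<d j. \<Sum>L'\<in>agree js (L(j := a)). \<phi> L' * conv N (m j a (L j)) (kern m js L' (L(j := a))) g)"
    by (simp add: conv_sum_right conv_mult_right)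
  also have "\<dots> = (\<Sum>a<d j. \<Sum>L'\<in>agree js (L(j := a)). \<phi> L' * kern m (j # js) L' L g)"
  proof (intro sum.cong refl)
    fix a L' assume L': "L' \<in> agree js (L(j := a))"
    have "kern m js L' (L(j := a)) = kern m js L' L" using j by (intro kern_cong) auto
    moreover have "L' j = a" using L' j by (simp add: agree_def)
    ultimately show "\<phi> L' * conv N (m j a (L j)) (kern m js L' (L(j := a))) g = \<phi> L' * kern m (j # js) L' L g" by simp
  qed
  finally show ?case unfolding sum_agree_Cons[OF Cons.prems] .
qed simp

text \<open>The factors for different j are convolved and not multiplied; splitting the concatenated
  word by its coproduct lets each j be multiplied separately. The order of the words is reversed
  because they stand in the second argument of B.\<close>

lemma kern_mult:
  assumes m: "\<And>j a b g g'. j \<in> set js \<Longrightarrow> a < d j \<Longrightarrow> b < d j \<Longrightarrow> m j a b (g + g') = (\<Sum>c<d j. m j a c g' * m j c b g)"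
    and IJ: "\<And>j. j \<in> set js \<Longrightarrow> I j < d j \<and> J j < d j" and "distinct js"
  shows "(\<Sum>L\<in>agree js L0. kern m js I L g' * kern m js L J g) = kern m js I J (g + g')"
  using assms
proof (induction js arbitrary: g g' L0)
  case (Cons j js)
  have j: "j \<notin> set js" using Cons by simp
  have IH: "(\<Sum>L\<in>agree js L0. kern m js I L g' * kern m js L J g) = kern m js I J (g + g')" for L0 g g'
    using Cons.prems by (intro Cons.IH) auto
  have "(\<Sum>L\<in>agree (j # js) L0. kern m (j # js) I L g' * kern m (j # js) L J g) =
    (\<Sum>a<d j. \<Sum>L\<in>agree js (L0(j := a)). swee N (\<lambda>y1 y2. swee N (\<lambda>x1 x2.
      (m j (I j) a y1 * m j a (J j) x1) * (kern m js I L y2 * kern m js L J x2)) g) g')"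
    unfolding sum_agree_Cons[OF Cons.prems(3)]
  proof (intro sum.cong refl)
    fix a L assume "L \<in> agree js (L0(j := a))"
    hence "L j = a" using j by (simp add: agree_def)
    thus "kern m (j # js) I L g' * kern m (j # js) L J g = swee N (\<lambda>y1 y2. swee N (\<lambda>x1 x2.
      (m j (I j) a y1 * m j a (J j) x1) * (kern m js I L y2 * kern m js L J x2)) g) g'"
      by (simp add: conv_def swee_mult_left swee_mult_right mult_ac)
  qed
  also have "\<dots> = swee N (\<lambda>y1 y2. swee N (\<lambda>x1 x2. \<Sum>a<d j. (m j (I j) a y1 * m j a (J j) x1) *
      (\<Sum>L\<in>agree js (L0(j := a)). kern m js I L y2 * kern m js L J x2)) g) g'"
    by (simp add: swee_sum_fun sum_distrib_left)
  also have "\<dots> = swee N (\<lambda>y1 y2. swee N (\<lambda>x1 x2. m j (I j) (J j) (x1 + y1) * kern m js I J (x2 + y2)) g) g'"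
    unfolding IH sum_distrib_right[symmetric] using Cons.prems by simp
  also have "\<dots> = kern m (j # js) I J (g + g')"
    by (simp add: conv_def swee_append) (rule swee_Fubini)
  finally show ?case .
qed simp

lemma kern_0:
  assumes "\<And>j. j \<in> set js \<Longrightarrow> m j (I j) (J j) 0 = (if I j = J j then 1 else 0)"
  shows "kern m js I J 0 = (if \<forall>j\<in>set js. I j = J j then 1 else 0)"
  using assms by (induction js) (auto simp: conv_def)

end

lemma (in qkz) kills_kern:
  assumes "kills (cu N)" "\<And>j. j \<in> set js \<Longrightarrow> kills (m j (I j) (L j))"
  shows "kills (kern N m js I L)"
  using assms(2) by (induction js) (simp_all add: assms(1) kills_conv)

subsection \<open>Coproduct with central elements acting by scalars\<close>

definition emb :: "nat \<Rightarrow> gen0 word \<Rightarrow> gen word" where "emb i g = Word (map (G i) (letters g))"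

lemma emb_simps [simp]: "emb i 0 = 0" "emb i (u + v) = emb i u + emb i v" "emb i (Word [g]) = Word [G i g]"
  by (simp_all add: emb_def zero_word_def plus_word_def)

text \<open>The central letter acts by k at any position of a word. Stated for a general monoid so
  that it also covers a letter in either component of a pair of words.\<close>

definition cscal :: "'s::monoid_add \<Rightarrow> 'k::comm_ring_1 fps \<Rightarrow> ('s \<Rightarrow> 'k fps) \<Rightarrow> bool"
  where "cscal c k \<Omega> \<longleftrightarrow> (\<forall>u v. \<Omega> (u + c + v) = k * \<Omega> (u + v))"

lemma cscal_power:
  assumes "cscal c k \<Omega>"
  shows "appl \<Omega> (x * (scal \<alpha> * basis c) ^ m * y) = (\<alpha> * k) ^ m * appl \<Omega> (x * y :: ('s::monoid_add, 'k::comm_ring_1) cmod)"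
proof (induction m arbitrary: x)
  case (Suc m)
  have "appl \<Omega> (x * basis c * y) = k * appl \<Omega> (x * y)" for x y :: "('s, 'k) cmod"
    using assms by (simp add: appl_mult appl_mult_fun cscal_def)
  hence 1: "appl \<Omega> (x * (scal \<alpha> * basis c) * y) = \<alpha> * k * appl \<Omega> (x * y)" for x y :: "('s, 'k) cmod"
    by (simp add: scal_mult_left mult_hscale_left mult_hscale_right appl_hscale)
  have "appl \<Omega> (x * (scal \<alpha> * basis c) ^ Suc m * y) = appl \<Omega> ((x * (scal \<alpha> * basis c)) * (scal \<alpha> * basis c) ^ m * y)"
    by (simp add: mult.assoc)
  also have "\<dots> = (\<alpha> * k) ^ m * appl \<Omega> (x * (scal \<alpha> * basis c) * y)" by (rule Suc)
  finally show ?case unfolding 1 by (simp only: power_Suc mult_ac)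
qed simp

lemma cscal_translate:
  assumes "cscal c k \<Omega>" and \<alpha>: "fps_nth \<alpha> 0 = (0::'k::comm_ring_1)"
  shows "appl \<Omega> (translate L (scal \<alpha> * basis c) m * y) = appl \<Omega> (translate L (scal (\<alpha> * k)) m * y)"
proof -
  have a: "fps_nth (scal \<alpha> * basis c) 0 = 0" "fps_nth (scal (\<alpha> * k)) 0 = 0" using \<alpha> by (simp_all add: scal_nth_0)
  have h: "hadd (\<lambda>x. appl \<Omega> (x * y))" by (rule hadd_compose[OF hadd_appl hadd_mult_right])
  have 2: "appl \<Omega> (x * scal (\<alpha> * k) ^ p * y) = (\<alpha> * k) ^ p * appl \<Omega> (x * y)" for x p
    by (simp add: scal_mult_right mult_hscale_left appl_hscale flip: scal_power)
  show ?thesis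
    unfolding translate_def hadd_hsum(1)[OF h hdiv_mult_power[OF a(1)]] hadd_hsum(1)[OF h hdiv_mult_power[OF a(2)]]
      cscal_power[OF assms(1)] 2 ..
qed

lemma cscal_appl: "cscal c k \<Omega> \<Longrightarrow> cscal c k (\<lambda>t. \<Omega> (s + t))"
  by (simp add: cscal_def add.assoc[symmetric])

lemma appl_translate_comp:
  fixes a :: "'k::field_char_0 fps"
  assumes "fps_nth a 0 = 0"
  shows "appl f (translate (\<lambda>k. basis (g (s k))) (scal a) m) = appl (\<lambda>w. f (g w)) (translate (\<lambda>k. basis (s k)) (scal a) m)"
  unfolding appl_translate[OF assms] ..

lemma emb_cop_pair:
  fixes \<Omega> :: "gen word \<times> gen word \<Rightarrow> 'k::field_char_0 fps"
  assumes l: "cscal (Word [Cc i], 0) k1 \<Omega>" and r: "cscal (0, Word [Cc i]) k2 \<Omega>"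
    and \<alpha>: "fps_nth \<alpha> 0 = 0" and \<beta>: "fps_nth \<beta> 0 = 0"
  shows "appl \<Omega> (translate (\<lambda>k. basis (emb i (x k), 0)) (scal \<alpha> * basis (0, Word [Cc i])) p *
      translate (\<lambda>k. basis (0, emb i (y k))) (scal \<beta> * basis (Word [Cc i], 0)) q) =
    appl (\<lambda>s. appl (\<lambda>t. \<Omega> (emb i s, emb i t)) (translate (\<lambda>k. basis (y k)) (scal (\<beta> * k1)) q)) (translate (\<lambda>k. basis (x k)) (scal (\<alpha> * k2)) p)"
  and "appl \<Omega> (translate (\<lambda>k. basis (0, emb i (y k))) (scal \<beta> * basis (Word [Cc i], 0)) q *
      translate (\<lambda>k. basis (emb i (x k), 0)) (scal \<alpha> * basis (0, Word [Cc i])) p) =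
    appl (\<lambda>s. appl (\<lambda>t. \<Omega> (emb i s, emb i t)) (translate (\<lambda>k. basis (y k)) (scal (\<beta> * k1)) q)) (translate (\<lambda>k. basis (x k)) (scal (\<alpha> * k2)) p)"
proof -
  have n: "fps_nth (\<beta> * k1) 0 = 0" "fps_nth (\<alpha> * k2) 0 = 0" using \<alpha> \<beta> by simp_all
  have 1: "appl (\<lambda>t. \<Omega> (s + t)) (translate L (scal \<beta> * basis (Word [Cc i], 0)) q) = appl (\<lambda>t. \<Omega> (s + t)) (translate L (scal (\<beta> * k1)) q)"
    "appl (\<lambda>t. \<Omega> (s + t)) (translate L' (scal \<alpha> * basis (0, Word [Cc i])) p) = appl (\<lambda>t. \<Omega> (s + t)) (translate L' (scal (\<alpha> * k2)) p)" for s L L'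
    using cscal_translate[OF cscal_appl[OF l] \<beta>, of s L q 1] cscal_translate[OF cscal_appl[OF r] \<alpha>, of s L' p 1] by simp_all
  show "appl \<Omega> (translate (\<lambda>k. basis (emb i (x k), 0)) (scal \<alpha> * basis (0, Word [Cc i])) p *
      translate (\<lambda>k. basis (0, emb i (y k))) (scal \<beta> * basis (Word [Cc i], 0)) q) =
    appl (\<lambda>s. appl (\<lambda>t. \<Omega> (emb i s, emb i t)) (translate (\<lambda>k. basis (y k)) (scal (\<beta> * k1)) q)) (translate (\<lambda>k. basis (x k)) (scal (\<alpha> * k2)) p)"
    unfolding cscal_translate[OF r \<alpha>] unfolding appl_mult 1 unfolding appl_translate_comp[OF n(1), of _ "\<lambda>w. (0, emb i w)"] appl_translate_comp[OF n(2), of _ "\<lambda>w. (emb i w, 0)"]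
    by simp
  show "appl \<Omega> (translate (\<lambda>k. basis (0, emb i (y k))) (scal \<beta> * basis (Word [Cc i], 0)) q *
      translate (\<lambda>k. basis (emb i (x k), 0)) (scal \<alpha> * basis (0, Word [Cc i])) p) =
    appl (\<lambda>s. appl (\<lambda>t. \<Omega> (emb i s, emb i t)) (translate (\<lambda>k. basis (y k)) (scal (\<beta> * k1)) q)) (translate (\<lambda>k. basis (x k)) (scal (\<alpha> * k2)) p)"
    unfolding cscal_translate[OF l \<beta>] unfolding appl_mult 1 unfolding appl_translate_comp[OF n(1), of _ "\<lambda>w. (0, emb i w)"] appl_translate_comp[OF n(2), of _ "\<lambda>w. (emb i w, 0)"]
    by (subst appl_Fubini) simp
qed

lemma appl_one: "appl f 1 = f 0" using appl_basis[of f 0] by (simp add: basis_0)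

lemma cop_append: "cop N (u + v) = cop N u * cop N v" and cop_0: "cop N 0 = 1" and cop_letter: "cop N (Word [g]) = cop_gen N g"
  by (simp_all add: cop_def zero_word_def plus_word_def)

definition half :: "'k::field_char_0 fps \<Rightarrow> 'k fps" where "half k = fps_const (1 / 2) * k * fps_X"

lemma half_0 [simp]: "fps_nth (half k) 0 = 0" "half 0 = 0" by (simp_all add: half_def)

lemma emb_cop_gen:
  fixes \<Omega> :: "gen word \<times> gen word \<Rightarrow> 'k::field_char_0 fps"
  assumes l: "cscal (Word [Cc i], 0) k1 \<Omega>" and r: "cscal (0, Word [Cc i]) k2 \<Omega>"
  shows "appl \<Omega> (cop_gen N (G i g)) =
    swee_gen N (\<lambda>x y. appl (\<lambda>s. appl (\<lambda>t. \<Omega> (emb i s, emb i t)) (tauw (- half k1) y)) (tauw (half k2) x)) g"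
proof -
  have n: "fps_nth (fps_const (- 1 / 2) * fps_X) 0 = (0::'k)" "fps_nth (fps_const (1 / 2) * fps_X) 0 = (0::'k)" by simp_all
  have e: "fps_const (- 1 / 2) * fps_X * k2 = - half k2" "fps_const (1 / 2) * fps_X * k1 = half k1"
    by (simp_all add: half_def mult_ac flip: fps_const_neg)
  note p = emb_cop_pair[OF l r n, unfolded e]
  show ?thesis
  proof (cases g)
    case (Tc a b m)
    show ?thesis unfolding Tc cop_gen.simps swee_gen.simps hadd_sum[OF hadd_appl]
      using p(1)[where x = "\<lambda>k. Word [Tc a q k]" and y = "\<lambda>k. Word [Tc q b k]" for q] by (simp add: tau0_gen_def)
  next
    case (Tic a b m)
    have "appl \<Omega> (cop_gen N (G i g)) = (\<Sum>q<N. \<Sum>l\<le>m. appl (\<lambda>s. appl (\<lambda>t. \<Omega> (emb i s, emb i t))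
        (tauw (- half k1) (Word [Tic a q l]))) (tauw (half k2) (Word [Tic q b (m - l)])))"
      unfolding Tic cop_gen.simps hadd_sum[OF hadd_appl]
      using p(2)[where x = "\<lambda>k. Word [Tic q b k]" and y = "\<lambda>k. Word [Tic a q k]" for q] by (simp add: tau0_gen_def)
    also have "\<dots> = (\<Sum>q<N. \<Sum>l\<le>m. appl (\<lambda>s. appl (\<lambda>t. \<Omega> (emb i s, emb i t))
        (tauw (- half k1) (Word [Tic a q (m - l)]))) (tauw (half k2) (Word [Tic q b l])))"
      by (rule sum.cong[OF refl], rule sum_rev)
    finally show ?thesis unfolding Tic swee_gen.simps .
  qed
qed

text \<open>In \<open>T_i(u - h c_i/2)\<close> and \<open>T_i(u + h c_i/2)\<close> each shift
  involves the central element of the other tensor factor. If it acts by \<open>k1\<close> on the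
  left and \<open>k2\<close> on the right, the coproduct is the plain one with translations
  \<open>half k2\<close> on the left and \<open>- half k1\<close> on the right.\<close>

lemma emb_cop:
  fixes \<Omega> :: "gen word \<times> gen word \<Rightarrow> 'k::field_char_0 fps"
  assumes "cscal (Word [Cc i], 0) k1 \<Omega>" "cscal (0, Word [Cc i]) k2 \<Omega>"
  shows "appl \<Omega> (cop N (emb i g)) =
    swee N (\<lambda>x y. appl (\<lambda>s. appl (\<lambda>t. \<Omega> (emb i s, emb i t)) (tauw (- half k1) y)) (tauw (half k2) x)) g"
  using assms
proof (induction g arbitrary: \<Omega> rule: word_induct)
  case 0
  show ?case by (simp add: cop_0 appl_one zero_prod_def)
next
  case (Cons g w)
  let ?T = "\<lambda>y. tauw (- half k1) y" and ?S = "\<lambda>x. tauw (half k2) x"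
  let ?\<Psi> = "\<lambda>u. swee N (\<lambda>x y. appl (\<lambda>s. appl (\<lambda>t. \<Omega> (u + (emb i s, emb i t))) (?T y)) (?S x)) w"
  have "appl \<Omega> (cop N (emb i (Word [g] + w))) = appl ?\<Psi> (cop_gen N (G i g))"
    by (simp add: cop_append cop_letter appl_mult Cons.IH[OF cscal_appl[OF Cons.prems(1)] cscal_appl[OF Cons.prems(2)]])
  also have "\<dots> = swee_gen N (\<lambda>x' y'. appl (\<lambda>s'. appl (\<lambda>t'. ?\<Psi> (emb i s', emb i t')) (?T y')) (?S x')) g"
  proof (rule emb_cop_gen)
    have a: "\<Omega> (u + c + v + x) = k * \<Omega> (u + v + x)" if "cscal c k \<Omega>" for u c v x k
      using that unfolding cscal_def by (metis add.assoc)
    show "cscal (Word [Cc i], 0) k1 ?\<Psi>" "cscal (0, Word [Cc i]) k2 ?\<Psi>"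
      unfolding cscal_def a[OF Cons.prems(1)] a[OF Cons.prems(2)] by (simp_all add: appl_mult_fun swee_mult_left)
  qed
  also have "\<dots> = swee N (\<lambda>x y. appl (\<lambda>s. appl (\<lambda>t. \<Omega> (emb i s, emb i t)) (?T y)) (?S x)) (Word [g] + w)"
    unfolding swee_Cons
  proof (rule swee_gen_cong)
    fix x' y'
    have "appl (\<lambda>s'. appl (\<lambda>t'. ?\<Psi> (emb i s', emb i t')) (?T y')) (?S x') =
      swee N (\<lambda>x y. appl (\<lambda>s'. appl (\<lambda>t'. appl (\<lambda>s. appl (\<lambda>t. \<Omega> (emb i (s' + s), emb i (t' + t))) (?T y)) (?S x)) (?T y')) (?S x')) w"
      by (simp add: swee_appl_fun)
    also have "\<dots> = swee N (\<lambda>x y. appl (\<lambda>s'. appl (\<lambda>s. appl (\<lambda>t'. appl (\<lambda>t. \<Omega> (emb i (s' + s), emb i (t' + t))) (?T y)) (?T y')) (?S x)) (?S x')) w"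
      by (subst appl_Fubini) (rule refl)
    finally show "appl (\<lambda>s'. appl (\<lambda>t'. ?\<Psi> (emb i s', emb i t')) (?T y')) (?S x') =
      swee N (\<lambda>x y. appl (\<lambda>s. appl (\<lambda>t. \<Omega> (emb i s, emb i t)) (?T (y' + y))) (?S (x' + x))) w"
      by (simp add: appl_mult)
  qed
  finally show ?case .
qed

lemma tauw_zero: "tauw 0 w = (basis w :: (gen0 word, 'k::field_char_0) cmod)"
proof (induction w rule: word_induct)
  case (Cons g w)
  have z: "translate L 0 m = L m" for L :: "nat \<Rightarrow> (gen0 word, 'k) cmod" and m
    unfolding translate_def by (subst hsum_0[OF hdiv_mult_power]) (simp_all add: power_0_left)
  have "tau0_gen 0 g = (basis (Word [g]) :: (gen0 word, 'k) cmod)"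
    by (cases g) (simp_all add: tau0_gen_def hadd_0[OF hadd_scal] z)
  thus ?case using Cons by (simp add: basis_append)
qed (simp add: basis_0)

lemma cu_tauw:
  assumes a: "fps_nth a 0 = (0::'k::field_char_0)"
  shows "appl (cu N) (tauw a w) = cu N w"
proof (induction w rule: word_induct)
  case 0
  show ?case by (simp add: appl_one)
next
  case (Cons g w)
  have na: "fps_nth (- a) 0 = 0" using a by simp
  have h: "hsum (\<lambda>k. of_nat ((m + k) choose k) * (if P \<and> m + k = 0 then 1 else 0) * (- a) ^ k) = (if P \<and> m = 0 then 1 else 0)" for P and m
    by (subst hsum_0[OF hdiv_mult_power[OF na]]) simp_all
  have "appl (cu N) (tau0_gen a g) = cu N (Word [g])"
  proof (cases g)
    case (Tc b c m)
    show ?thesis using h[of m "b = c \<and> b < N"] by (simp add: Tc tau0_gen_def appl_translate[OF na] cu_Tc)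
  next
    case (Tic b c m)
    show ?thesis using h[of m "b = c \<and> b < N"] by (simp add: Tic tau0_gen_def appl_translate[OF na] cu_Tic)
  qed
  thus ?case using Cons by (simp add: appl_mult appl_mult_fun mult.commute[of "cu N _" "cu N w"])
qed

lemma conv_tauw:
  assumes a: "fps_nth a 0 = 0"
  shows "appl (conv N f h) (tauw a w) = conv N (\<lambda>x. appl f (tauw a x)) (\<lambda>y. appl h (tauw a y)) w"
proof -
  have "appl (conv N f h) (tauw a w) = appl (swee N (\<lambda>s t. f s * h t)) (tauw a w)" by (simp add: conv_def[abs_def])
  also have "\<dots> = conv N (\<lambda>x. appl f (tauw a x)) (\<lambda>y. appl h (tauw a y)) w"
    unfolding swee_tauw[OF a] conv_def appl_mult_fun by (simp add: mult.commute[of _ "appl h _"] appl_mult_fun)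
  finally show ?thesis .
qed

lemma ch_tauw:
  assumes a: "fps_nth a 0 = 0"
  shows "appl (ch N d m js X L) (tauw a g) = ch N d (\<lambda>j b e g. appl (m j b e) (tauw a g)) js (\<lambda>L g. appl (X L) (tauw a g)) L g"
proof (induction js arbitrary: L g)
  case (Cons j js)
  have "(\<lambda>g. appl (ch N d m js X L) (tauw a g)) = ch N d (\<lambda>j b e g. appl (m j b e) (tauw a g)) js (\<lambda>L g. appl (X L) (tauw a g)) L" for L
    by (intro ext Cons)
  thus ?case by (simp add: appl_sum_fun conv_tauw[OF a])
qed simp

subsection \<open>Conformal blocks and the connection\<close>

context qkz
begin

lemma val_Bext: "fps_nth (snd x) 0 = 0 \<Longrightarrow> val (Bext B u v) x = appl (\<lambda>a. appl (pr x a) v) u"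
  by (simp add: val_ev Bext_def ev_appl_fls pr_ev[abs_def] bB_def)

lemma kills_pr: "good x \<Longrightarrow> kills (pr x w)" "good x \<Longrightarrow> kills (\<lambda>v. pr x v w)"
  by (simp_all add: kills_def pr_kill)

lemma nullf_appl: "(\<And>y. nullf N (f y)) \<Longrightarrow> nullf N (\<lambda>g. appl (\<lambda>y. f y g) x :: 'k fps)"
  by (simp add: nullf_def appl_zero_fun)

lemma kills_appl: assumes "\<And>y. kills (\<lambda>g. f y g)" shows "kills (\<lambda>g. appl (\<lambda>y. f y g) x)"
  unfolding kills_def
proof
  fix r assume "r \<in> J"
  have "appl (\<lambda>g. appl (\<lambda>y. f y g) x) r = appl (\<lambda>y. appl (f y) r) x" by (rule appl_Fubini)
  thus "appl (\<lambda>g. appl (\<lambda>y. f y g) x) r = 0" using assms \<open>r \<in> J\<close> by (simp add: kills_def appl_zero_fun)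
qed

context
  fixes n :: nat and d :: "nat \<Rightarrow> nat" and t :: "nat \<Rightarrow> nat \<Rightarrow> nat \<Rightarrow> (gen0 word, 'k) cmod" and K :: "'k fps"
    and z :: "nat \<Rightarrow> 'k hpt" and i :: nat
  assumes co: "\<And>j. j < n \<Longrightarrow> comodule N J (d j) (t j)" and zc: "z \<in> config_space \<Sigma> N R n" and i: "i < n"
begin

text \<open>Spectral parameters of slot k in three stages: \<open>xp\<close> in the invariance
  equation, \<open>yp\<close> after inversion, by crossing before i and by unitarity after i, and
  \<open>vp\<close> after the Sugawara translation by \<open>half K\<close>.\<close>

definition xp :: "nat \<Rightarrow> 'k hpt" where "xp k = hmove (hsub \<Sigma> (z i) (z k)) (if k < i then - half K else half K)"
definition yp :: "nat \<Rightarrow> 'k hpt" where "yp k = hmove (opp (xp k)) (if k < i then Nh else 0)"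
definition vp :: "nat \<Rightarrow> 'k hpt" where "vp k = hmove (hsub \<Sigma> (z k) (z i)) (if k < i then (K + of_nat N) * fps_X else 0)"

text \<open>The action of \<open>T_i\<close> on the k-th comodule in the induced module. The
  companions \<open>sg\<close>, \<open>mu\<close> and \<open>nu\<close> are its translated form, the
  convolution inverse of that, and the inverse after the Sugawara translation; all are set to 0
  outside the slots other than i.\<close>

definition rho :: "'k fps fam" where "rho k a e g = (if k < n \<and> k \<noteq> i then appl (pr (hsub \<Sigma> (z i) (z k)) g) (t k a e) else 0)"
definition sg :: "'k fps fam" where "sg k a e g = (if k < n \<and> k \<noteq> i then appl (pr (xp k) g) (t k a e) else 0)"
definition mu :: "'k fps fam" where "mu k a e g = (if k < n \<and> k \<noteq> i then appl (\<lambda>y. pr (yp k) y g) (t k a e) else 0)"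
definition nu :: "'k fps fam" where "nu k a e g = (if k < n \<and> k \<noteq> i then appl (\<lambda>y. pr (vp k) y g) (t k a e) else 0)"

lemma good_points:
  assumes "k < n" "k \<noteq> i"
  shows "good (hsub \<Sigma> (z i) (z k))" "good (xp k)" "good (yp k)" "good (vp k)"
proof -
  show 1: "good (hsub \<Sigma> (z i) (z k))" using good_hsub(1)[OF zc i] assms by blast
  show 2: "good (xp k)" unfolding xp_def by (rule good_hmove[OF 1]) simp
  show "good (yp k)" unfolding yp_def by (rule good_hmove[OF good_opp[OF 2]]) simp
  have "good (hsub \<Sigma> (z k) (z i))" using good_hsub(1)[OF zc _ i] assms by blast
  thus "good (vp k)" unfolding vp_def by (rule good_hmove) simp
qed

lemma nullf_fams: "nullf N (sg k a e)" "nullf N (mu k a e)" "nullf N (rho k a e)"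
proof -
  have "nullf N (\<lambda>g. appl (\<lambda>y. pr (xp k) g y) (t k a e))" "nullf N (\<lambda>g. appl (\<lambda>y. pr (yp k) y g) (t k a e))"
    "nullf N (\<lambda>g. appl (\<lambda>y. pr (hsub \<Sigma> (z i) (z k)) g y) (t k a e))"
    if "k < n" "k \<noteq> i"
    by (intro nullf_appl kills_nullf kills_pr good_points that)+
  thus "nullf N (sg k a e)" "nullf N (mu k a e)" "nullf N (rho k a e)"
    by (auto simp: nullf_def sg_def mu_def rho_def)
qed

lemma counit_t: "k < n \<Longrightarrow> a < d k \<Longrightarrow> b < d k \<Longrightarrow> appl (cu N) (t k a b) = (if a = b then 1 else 0)"
  using co[of k] unfolding comodule_def eps0_cu[abs_def] by blast

lemma swee_delta:
  assumes "k < n" "a < d k" "e < d k" "\<And>y. swee N (\<lambda>g1 g2. swee N (\<lambda>y1 y2. \<Omega> g1 g2 y1 y2) y) g = cu N g * cu N y"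
  shows "swee N (\<lambda>g1 g2. appl (swee N (\<Omega> g1 g2)) (t k a e)) g = (if a = e then cu N g else 0 :: 'k fps)"
  unfolding swee_appl_fun using counit_t[OF assms(1-3)] by (simp add: assms(4) appl_mult_fun)

text \<open>Matrix coefficients compose by the comodule axiom, and crossing contracts the form at
  \<open>xp\<close> with that at \<open>yp\<close>. The opposite coproduct in g yields a left
  inverse, as slots before i need.\<close>

lemma mu_sg:
  assumes k: "k < i" and ae: "a < d k" "e < d k"
  shows "(\<Sum>b<d k. conv N (mu k b e) (sg k a b) g) = (if a = e then cu N g else 0)"
proof -
  have kn: "k < n" "k \<noteq> i" using k i by auto
  note gp = good_points[OF kn]
  have "(\<Sum>b<d k. conv N (mu k b e) (sg k a b) g) =
      swee N (\<lambda>g1 g2. \<Sum>b<d k. appl (pr (xp k) g2) (t k a b) * appl (\<lambda>y. pr (yp k) y g1) (t k b e)) g"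
    using kn by (simp add: conv_def mu_def sg_def swee_sum_fun mult.commute)
  also have "\<dots> = swee N (\<lambda>g1 g2. appl (swee N (\<lambda>y1 y2. pr (xp k) g2 y1 * pr (yp k) y2 g1)) (t k a e)) g"
    using kills_comodule[OF co[OF kn(1)] kills_pr(1)[OF gp(2)] kills_pr(2)[OF gp(3)] ae] by (simp add: conv_def[abs_def])
  also have "\<dots> = (if a = e then cu N g else 0)"
    using pr_crossing[OF gp(2), of _ g] k by (intro swee_delta kn ae) (simp add: yp_def)
  finally show ?thesis .
qed

lemma hmove_0 [simp]: "hmove x 0 = x" by (simp add: hmove_def)

text \<open>Unitarity uses the coproduct in its own order, so here the inverse is a right one, as
  slots after i need.\<close>

lemma sg_mu:
  assumes k: "i < k" "k < n" and ae: "a < d k" "e < d k"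
  shows "(\<Sum>b<d k. conv N (sg k a b) (mu k b e) g) = (if a = e then cu N g else 0)"
proof -
  have kn: "k < n" "k \<noteq> i" using k i by auto
  note gp = good_points[OF kn]
  have "(\<Sum>b<d k. conv N (sg k a b) (mu k b e) g) =
      swee N (\<lambda>g1 g2. \<Sum>b<d k. appl (pr (xp k) g1) (t k a b) * appl (\<lambda>y. pr (yp k) y g2) (t k b e)) g"
    using kn by (simp add: conv_def mu_def sg_def swee_sum_fun)
  also have "\<dots> = swee N (\<lambda>g1 g2. appl (swee N (\<lambda>y1 y2. pr (xp k) g1 y1 * pr (yp k) y2 g2)) (t k a e)) g"
    using kills_comodule[OF co[OF kn(1)] kills_pr(1)[OF gp(2)] kills_pr(2)[OF gp(3)] ae] by (simp add: conv_def[abs_def])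
  also have "\<dots> = (if a = e then cu N g else 0)"
    using pr_unitary[OF gp(2), of _ g] k by (intro swee_delta kn ae) (simp add: yp_def)
  finally show ?thesis .
qed

lemma rho_tauw: "appl (rho k a e) (tauw (if k < i then half K else - half K) g) = sg k a e g"
proof (cases "k < n \<and> k \<noteq> i")
  case True
  let ?x = "hsub \<Sigma> (z i) (z k)" and ?c = "if k < i then half K else - half K"
  have "appl (rho k a e) (tauw ?c g) = appl (\<lambda>y. appl (\<lambda>w. pr ?x w y) (tauw ?c g)) (t k a e)"
    unfolding rho_def[abs_def] if_P[OF True] by (rule appl_Fubini)
  also have "\<dots> = appl (pr (hmove ?x (- ?c)) g) (t k a e)"
    using True by (subst pr_tau_left[OF good_points(1)]) auto
  finally show ?thesis using True by (auto simp: sg_def xp_def)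
qed (auto simp: rho_def[abs_def] sg_def appl_zero_fun)

lemma half_half: "half k + half k = k * fps_X" for k :: "'k fps"
proof -
  have "half k + half k = fps_const (1 / 2 + 1 / 2) * k * fps_X" unfolding half_def fps_const_add[symmetric] by (simp add: algebra_simps)
  thus ?thesis by simp
qed

lemma vp_yp: "k < n \<Longrightarrow> k \<noteq> i \<Longrightarrow> hmove (yp k) (half K) = vp k"
  using good_hsub(2)[OF zc i, of k] half_half[of K]
  by (auto simp: yp_def vp_def xp_def hmove_def opp_def algebra_simps prod_eq_iff)

lemma mu_tauw: "appl (mu k a e) (tauw (half K) g) = nu k a e g"
proof (cases "k < n \<and> k \<noteq> i")
  case True
  have "appl (mu k a e) (tauw (half K) g) = appl (\<lambda>y. appl (\<lambda>g. pr (yp k) y g) (tauw (half K) g)) (t k a e)"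
    unfolding mu_def[abs_def] if_P[OF True] by (rule appl_Fubini)
  also have "\<dots> = appl (\<lambda>y. pr (vp k) y g) (t k a e)"
    using True by (subst pr_tau_right[OF good_points(3)]) (auto simp: vp_yp)
  finally show ?thesis using True by (auto simp: nu_def)
qed (auto simp: mu_def[abs_def] nu_def appl_zero_fun)

section \<open>The invariance equation for a single functional\<close>

context
  fixes F :: "(gen word \<times> nat) list \<Rightarrow> 'k fps"
  assumes F: "F \<in> invariant_functionals \<Sigma> N R C f0 B K n d t z"
begin

lemma F_kernel: "x \<in> M_kernel \<Sigma> N R C f0 B K n d t z \<Longrightarrow> appl F x = 0"
  using F unfolding invariant_functionals_def by blast

lemma F_length: assumes "length s \<noteq> n" shows "F s = 0"
proof -
  have "basis s \<in> M_kernel \<Sigma> N R C f0 B K n d t z"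
    unfolding M_kernel_def by (rule subsetD[OF closed_span_superset]) (use assms in blast)
  from F_kernel[OF this] show ?thesis by simp
qed

lemma F_slot:
  assumes p: "length p < n" and y: "y \<in> ind_kernel \<Sigma> N R C f0 B K n z (length p) (d (length p)) (t (length p))"
  shows "appl (\<lambda>b. F (p @ b # q)) y = 0"
proof (cases "length p + Suc (length q) = n")
  case True
  let ?s = "p @ undefined # q" and ?j = "length p"
  have "length ?s = n" using True by simp
  hence "lin (\<lambda>b. basis (?s[?j := b])) y \<in> M_kernel \<Sigma> N R C f0 B K n d t z"
    unfolding M_kernel_def using p y by (intro subsetD[OF closed_span_superset]) blast
  from F_kernel[OF this] show ?thesis by (simp add: appl_lin)
next
  case False
  thus ?thesis by (simp add: F_length appl_zero_fun)
qed

lemma F_slot_ideal: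
  assumes "length p < n" "y \<in> multi_ideal \<Sigma> N R C f0 n z"
  shows "appl (\<lambda>w. F (p @ (w, e) # q)) y = 0"
proof -
  have "lin (\<lambda>w. basis (w, e)) y \<in> ind_kernel \<Sigma> N R C f0 B K n z (length p) (d (length p)) (t (length p))"
    unfolding ind_kernel_def using assms(2) by (intro subsetD[OF closed_span_superset]) blast
  from F_slot[OF assms(1) this, of q] show ?thesis by (simp add: appl_lin)
qed

lemma F_slot_gen:
  assumes p: "length p < n" "length p \<noteq> i" and e: "e < d (length p)"
  shows "F (p @ (w + Word [G i g], e) # q) = (\<Sum>a<d (length p). rho (length p) a e (Word [g]) * F (p @ (w, a) # q))"
proof -
  let ?j = "length p"
  have "basis (w + Word [G i g], e) -
        (\<Sum>a<d ?j. hscale (val (Bext B (basis (Word [g])) (t ?j a e)) (hsub \<Sigma> (z i) (z ?j))) (basis (w, a)))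
      \<in> ind_kernel \<Sigma> N R C f0 B K n z ?j (d ?j) (t ?j)"
    unfolding ind_kernel_def using assms i by (intro subsetD[OF closed_span_superset]) blast
  from F_slot[OF p(1) this, of q] have "F (p @ (w + Word [G i g], e) # q) =
      (\<Sum>a<d ?j. val (Bext B (basis (Word [g])) (t ?j a e)) (hsub \<Sigma> (z i) (z ?j)) * F (p @ (w, a) # q))"
    by (simp add: hadd_diff[OF hadd_appl] hadd_sum[OF hadd_appl] appl_hscale)
  moreover have "fps_nth (snd (hsub \<Sigma> (z i) (z ?j))) 0 = 0" using good_points(1)[OF p] by (rule goodD)
  ultimately show ?thesis using p by (simp add: val_Bext rho_def)
qed

text \<open>The induced module prescribes the action of \<open>c_k\<close> only next to the vector
  of V; the commutation relations carry the letter there, one step at a time.\<close>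

lemma F_central:
  assumes p: "length p < n"
  shows "F (p @ (u + Word [Cc k] + v, e) # q) = F (p @ (u + v + Word [Cc k], e) # q)"
proof (induction "letters v" arbitrary: u v)
  case Nil
  hence "v = 0" by (cases v) (simp add: zero_word_def)
  thus ?case by simp
next
  case (Cons g gs)
  define v' where "v' = Word gs"
  have v: "v = Word [g] + v'" using Cons(2) by (cases v) (simp add: v'_def plus_word_def)
  have "basis (Word [Cc k, g]) - basis (Word [g, Cc k]) \<in> multi_ideal \<Sigma> N R C f0 n z"
    unfolding multi_ideal_def by (rule closed_ideal_mem) blast
  from closed_ideal_mult[OF this[unfolded multi_ideal_def], folded multi_ideal_def, of "basis u" "basis v'"]
  have "basis (u + Word [Cc k, g] + v') - basis (u + Word [g, Cc k] + v') \<in> multi_ideal \<Sigma> N R C f0 n z"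
    by (simp add: basis_mult algebra_simps)
  from F_slot_ideal[OF p this, of e q]
  have "F (p @ (u + Word [Cc k, g] + v', e) # q) = F (p @ (u + Word [g, Cc k] + v', e) # q)"
    by (simp add: hadd_diff[OF hadd_appl])
  moreover have "F (p @ ((u + Word [g]) + Word [Cc k] + v', e) # q) = F (p @ ((u + Word [g]) + v' + Word [Cc k], e) # q)"
    by (rule Cons(1)) (simp add: v'_def)
  moreover have "Word [Cc k, g] = Word [Cc k] + Word [g]" "Word [g, Cc k] = Word [g] + Word [Cc k]" by (simp_all add: plus_word_def)
  ultimately show ?case unfolding v by (simp add: add.assoc)
qed

lemma F_slot_c:
  assumes p: "length p < n"
  shows "F (p @ (u + Word [Cc i] + v, e) # q) = (if length p = i then K else 0) * F (p @ (u + v, e) # q)"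
proof -
  have "basis ((u + v) + Word [Cc i], e) - hscale (if i = length p then K else 0) (basis (u + v, e))
      \<in> ind_kernel \<Sigma> N R C f0 B K n z (length p) (d (length p)) (t (length p))"
    unfolding ind_kernel_def using i by (intro subsetD[OF closed_span_superset]) blast
  from F_slot[OF p this, of q] show ?thesis
    unfolding F_central[OF p] by (simp add: hadd_diff[OF hadd_appl] appl_hscale eq_commute[of i])
qed

lemma rho_append:
  assumes "k < n" "k \<noteq> i" "a < d k" "e < d k"
  shows "rho k a e (u + v) = (\<Sum>c<d k. rho k a c u * rho k c e v)"
proof -
  note gp = good_points(1)[OF assms(1,2)]
  have "pr (hsub \<Sigma> (z i) (z k)) (u + v) = conv N (pr (hsub \<Sigma> (z i) (z k)) u) (pr (hsub \<Sigma> (z i) (z k)) v)"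
    by (rule ext) (simp add: conv_def pr_left[OF gp])
  thus ?thesis using assms by (simp add: rho_def kills_comodule[OF co kills_pr(1)[OF gp] kills_pr(1)[OF gp]])
qed

text \<open>In a slot other than i the series \<open>T_i\<close> belongs to the subalgebra from
  which the module is induced, so a word in it is absorbed by the vector. \<open>rho_append\<close>
  composes the matrices of successive letters.\<close>

lemma F_slot_emb:
  assumes p: "length p < n" "length p \<noteq> i" and e: "e < d (length p)"
  shows "F (p @ (w + emb i g, e) # q) = (\<Sum>a<d (length p). rho (length p) a e g * F (p @ (w, a) # q))"
  using e
proof (induction g arbitrary: w e rule: word_induct)
  case 0
  have "rho (length p) a e 0 = (if a = e then 1 else 0)" if "a < d (length p)" for a
    using p that 0 counit_t[OF p(1) that 0] pr_0(1)[OF good_points(1)[OF p]] by (simp add: rho_def fun_eq_iff cong: if_cong)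
      (metis (no_types) ext)
  hence "(\<Sum>a<d (length p). rho (length p) a e 0 * F (p @ (w, a) # q)) = (\<Sum>a<d (length p). if a = e then F (p @ (w, a) # q) else 0)"
    by (intro sum.cong) auto
  thus ?case using 0 by simp
next
  case (Cons g v)
  let ?j = "length p"
  have "F (p @ (w + emb i (Word [g] + v), e) # q) = (\<Sum>a<d ?j. rho ?j a e v * F (p @ (w + Word [G i g], a) # q))"
    using Cons.IH[OF Cons.prems, of "w + Word [G i g]"] by (simp add: add.assoc)
  also have "\<dots> = (\<Sum>a<d ?j. \<Sum>c<d ?j. rho ?j c a (Word [g]) * rho ?j a e v * F (p @ (w, c) # q))"
    by (intro sum.cong refl) (simp add: F_slot_gen[OF p] sum_distrib_left mult_ac)
  also have "\<dots> = (\<Sum>c<d ?j. rho ?j c e (Word [g] + v) * F (p @ (w, c) # q))"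
    by (subst sum.swap) (simp add: rho_append[OF p] Cons.prems sum_distrib_right)
  finally show ?case .
qed

text \<open>The invariance equation with the slots in \<open>p\<close> already filled and the word \<open>w\<close> still to be distributed over the others.\<close>

definition Tl :: "(gen word \<times> nat) list \<Rightarrow> (nat \<Rightarrow> nat) \<Rightarrow> gen word \<Rightarrow> 'k fps"
  where "Tl p L w = appl (\<lambda>l. F (p @ zip l (map L [length p..<n]))) (iter_cop N (n - length p) w)"

lemma Tl_full: "length p = n \<Longrightarrow> Tl p L w = eps N w * F p"
  by (simp add: Tl_def appl_hscale)

lemma Tl_step:
  assumes "length p < n"
  shows "Tl p L w = appl (\<lambda>(w1, w2). Tl (p @ [(w1, L (length p))]) L w2) (cop N w)"
proof -
  have 1: "n - length p = Suc (n - Suc (length p))" using assms by simp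
  have 2: "[length p..<n] = length p # [Suc (length p)..<n]" using assms by (rule upt_conv_Cons)
  show ?thesis unfolding Tl_def 1 iter_cop.simps appl_lin 2 by (simp add: split_def appl_lin)
qed

lemma eps_append: "eps N (u + v) = eps N u * eps N v" and eps_Cc: "eps N (Word [Cc k]) = 0" and eps_emb: "eps N (emb i g) = cu N g"
proof -
  show "eps N (u + v) = eps N u * eps N v" "eps N (Word [Cc k]) = 0" by (simp_all add: eps_def plus_word_def)
  show "eps N (emb i g) = cu N g" unfolding eps0_cu[symmetric] by (simp add: eps_def eps0_def emb_def o_def)
qed

lemma Tl_slot:
  "length p < n \<Longrightarrow> Tl (p @ [(u + Word [Cc i] + v, e)]) L w = (if length p = i then K else 0) * Tl (p @ [(u + v, e)]) L w"
  "length p < n \<Longrightarrow> length p \<noteq> i \<Longrightarrow> e < d (length p) \<Longrightarrow>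
    Tl (p @ [(emb i g, e)]) L w = (\<Sum>a<d (length p). rho (length p) a e g * Tl (p @ [(0, a)]) L w)"
  unfolding Tl_def using F_slot_emb[where w = 0]
  by (simp_all add: F_slot_c appl_mult_fun appl_sum_fun appl_zero_fun)

text \<open>\<open>c_i\<close> is primitive, so its values in the slots not yet filled add up; only
  slot i contributes, and only while it is still ahead.\<close>

lemma Tl_c: "length p \<le> n \<Longrightarrow> Tl p L (u + Word [Cc i] + v) = (if length p \<le> i then K else 0) * Tl p L (u + v)"
proof (induction "n - length p" arbitrary: p u v)
  case 0
  hence l: "length p = n" by simp
  show ?case unfolding Tl_full[OF l] eps_append eps_Cc using l i by simp
next
  case (Suc m)
  hence p: "length p < n" and m: "m = n - Suc (length p)" by simp_all
  let ?e = "L (length p)"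
  let ?\<Omega> = "\<lambda>(w1, w2). Tl (p @ [(w1, ?e)]) L w2"
  have 1: "?\<Omega> (x + (Word [Cc i], 0) + y) = (if length p = i then K else 0) * ?\<Omega> (x + y)" for x y
    by (cases x; cases y) (simp add: Tl_slot(1)[OF p])
  have 2: "?\<Omega> (x + (0, Word [Cc i]) + y) = (if Suc (length p) \<le> i then K else 0) * ?\<Omega> (x + y)" for x y
    using Suc(1)[of "p @ [(fst x + fst y, ?e)]" "snd x" "snd y"] p m by (cases x; cases y) simp
  have "Tl p L (u + Word [Cc i] + v) = appl (\<lambda>x. appl (\<lambda>y. ?\<Omega> (x + (Word [Cc i], 0) + y)) (cop N v)) (cop N u) +
      appl (\<lambda>x. appl (\<lambda>y. ?\<Omega> (x + (0, Word [Cc i]) + y)) (cop N v)) (cop N u)"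
    unfolding Tl_step[OF p] cop_append cop_letter
    by (simp add: distrib_left distrib_right hadd_add[OF hadd_appl] appl_mult)
  also have "\<dots> = ((if length p = i then K else 0) + (if Suc (length p) \<le> i then K else 0)) * Tl p L (u + v)"
    unfolding 1 2 by (simp add: appl_mult_fun Tl_step[OF p] cop_append appl_mult distrib_right)
  finally show ?case by (auto simp: Suc_le_eq)
qed

text \<open>Before slot i the central element sits in the remainder and translates the component
  entering the current slot; at slot i it sits in that slot and translates the remainder; after it
  nothing is translated.\<close>

lemma Tl_emb:
  assumes p: "length p < n"
  shows "Tl p L (emb i g) = swee N (\<lambda>x y. appl (\<lambda>s. appl (\<lambda>w. Tl (p @ [(emb i s, L (length p))]) L (emb i w))
      (tauw (- half (if length p = i then K else 0)) y)) (tauw (half (if length p < i then K else 0)) x)) g"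
proof -
  let ?\<Omega> = "\<lambda>(w1, w2). Tl (p @ [(w1, L (length p))]) L w2"
  have "cscal (Word [Cc i], 0) (if length p = i then K else 0) ?\<Omega>"
    unfolding cscal_def by (auto simp: Tl_slot(1)[OF p] split: prod.splits)
  moreover have "cscal (0, Word [Cc i]) (if length p < i then K else 0) ?\<Omega>"
    unfolding cscal_def using p by (auto simp: Tl_c Suc_le_eq split: prod.splits)
  ultimately show ?thesis unfolding Tl_step[OF p] by (simp add: emb_cop)
qed

lemma Tl_L_cong: "(\<And>k. length p \<le> k \<Longrightarrow> k < n \<Longrightarrow> L k = L' k) \<Longrightarrow> Tl p L w = Tl p L' w"
  unfolding Tl_def by (intro arg_cong2[of _ _ _ _ appl] ext arg_cong[of _ _ F] arg_cong2[of _ _ _ _ append] refl arg_cong2[of _ _ _ _ zip] map_cong) auto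

definition zeros :: "nat \<Rightarrow> (nat \<Rightarrow> nat) \<Rightarrow> (gen word \<times> nat) list" where "zeros k L = map (\<lambda>j. (0, L j)) [0..<k]"
definition slots :: "nat \<Rightarrow> (nat \<Rightarrow> nat) \<Rightarrow> gen0 word \<Rightarrow> (gen word \<times> nat) list"
  where "slots k L x = map (\<lambda>j. (if j = i then emb i x else 0, L j)) [0..<k]"

text \<open>Stages of the computation. In \<open>X k\<close> the first k slots hold vectors of the
  comodules and g is still to be distributed; in \<open>W k\<close> slot i already holds x and y is
  to be distributed; \<open>\<Phi>\<close> is the unknown, with the word in slot i only.\<close>

definition X where "X k L g = Tl (zeros k L) L (emb i g)"
definition W where "W k L x y = Tl (slots k L x) L (emb i y)"
definition \<Phi> where "\<Phi> L x = F (slots n L x)"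

lemma zeros_Suc: "zeros k L @ [(0, a)] = zeros (Suc k) (L(k := a))" and slots_Suc: "i < k \<Longrightarrow> slots k L x @ [(0, a)] = slots (Suc k) (L(k := a)) x"
  and zeros_emb: "zeros i L @ [(emb i x, L i)] = slots (Suc i) L x" and length_zeros: "length (zeros k L) = k" "length (slots k L x) = k"
  by (auto simp: zeros_def slots_def)

lemma Tl_upd: "length p = Suc k \<Longrightarrow> Tl p (L(k := a)) w = Tl p L w"
  by (rule Tl_L_cong) simp

lemma X_step:
  assumes k: "k < i" and L: "L k < d k"
  shows "X k L g = (\<Sum>a<d k. conv N (sg k a (L k)) (X (Suc k) (L(k := a))) g)"
proof -
  have kn: "k < n" "k \<noteq> i" using k i by auto
  have "X k L g = swee N (\<lambda>x y. appl (\<lambda>s. \<Sum>a<d k. rho k a (L k) s * X (Suc k) (L(k := a)) y) (tauw (half K) x)) g"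
    unfolding X_def using kn k L
    by (simp add: Tl_emb length_zeros tauw_zero Tl_slot(2) zeros_Suc Tl_upd)
  also have "\<dots> = (\<Sum>a<d k. conv N (sg k a (L k)) (X (Suc k) (L(k := a))) g)"
    using rho_tauw[of k] k by (simp add: appl_sum_fun swee_sum_fun conv_def mult.commute[of "rho _ _ _ _"] appl_mult_fun) (simp add: mult.commute)
  finally show ?thesis .
qed

text \<open>Here the untranslated \<open>rho\<close> appears: the translation caused by slot i was
  applied once, to the whole remainder, before this stage.\<close>

lemma W_step:
  assumes k: "i < k" "k < n" and L: "L k < d k"
  shows "W k L x y = (\<Sum>a<d k. conv N (rho k a (L k)) (W (Suc k) (L(k := a)) x) y)"
  unfolding W_def using k L
  by (simp add: Tl_emb length_zeros tauw_zero Tl_slot(2) slots_Suc Tl_upd swee_sum_fun conv_def)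

lemma W_full: "W n L x y = \<Phi> L x * cu N y"
  by (simp add: W_def Tl_full length_zeros eps_emb \<Phi>_def)

lemma W_ch: "i < k \<Longrightarrow> k \<le> n \<Longrightarrow> inrange d n L \<Longrightarrow> W k L x = ch N d rho [k..<n] (\<lambda>L g. \<Phi> L x * cu N g) L"
proof (induction "n - k" arbitrary: k L)
  case 0
  hence k: "k = n" by simp
  show ?case unfolding k by (rule ext) (simp add: W_full)
next
  case (Suc m)
  hence k: "i < k" "k < n" "[k..<n] = k # [Suc k..<n]" by (auto simp: upt_conv_Cons)
  have "W (Suc k) (L(k := a)) x = ch N d rho [Suc k..<n] (\<lambda>L g. \<Phi> L x * cu N g) (L(k := a))" if "a < d k" for a
    using Suc that k by (intro Suc(1) inrange_upd) auto
  moreover have "L k < d k" using Suc.prems k by (simp add: inrange_def)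
  ultimately show ?case unfolding k(3) by (auto simp: W_step[OF k(1,2)])
qed

lemma nullf_\<Phi>: "nullf N (\<Phi> L)"
  unfolding nullf_def
proof (intro allI impI)
  fix w assume "\<not> valid N w"
  then obtain us vs g where w: "letters w = us @ g # vs" and g: "\<not> valid_gen N g"
    unfolding valid_def using split_list by fast
  have "basis (Word [G i g]) \<in> multi_ideal \<Sigma> N R C f0 n z"
  proof -
    have "basis (Word [G i g]) \<in> range_rels N (TG i) \<union> range_rels N (TG' i)"
      using g by (cases g) (auto simp: range_rels_def TG_def TG'_def basis_letter, (metis leI)+)
    thus ?thesis unfolding multi_ideal_def using i by (intro closed_ideal_mem) blast
  qed
  from closed_ideal_mult[OF this[unfolded multi_ideal_def], folded multi_ideal_def, of "basis (emb i (Word us))" "basis (emb i (Word vs))"]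
  have "basis (emb i (Word us) + Word [G i g] + emb i (Word vs)) \<in> multi_ideal \<Sigma> N R C f0 n z" by (simp add: basis_mult)
  moreover have "emb i (Word us) + Word [G i g] + emb i (Word vs) = emb i w"
    by (simp add: emb_def plus_word_def w)
  ultimately have 1: "basis (emb i w) \<in> multi_ideal \<Sigma> N R C f0 n z" by simp
  have "slots n L w = zeros i L @ (emb i w, L i) # map (\<lambda>j. (0, L j)) [Suc i..<n]"
  proof -
    have "[0..<n] = [0..<i] @ i # [Suc i..<n]" using i by (metis upt_add_eq_append[of 0 i "n - i"] le_add_diff_inverse less_imp_le upt_conv_Cons zero_le)
    thus ?thesis by (auto simp: slots_def zeros_def)
  qed
  thus "\<Phi> L w = 0" using F_slot_ideal[OF _ 1, of "zeros i L"] i by (simp add: \<Phi>_def length_zeros)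
qed

text \<open>Slot i keeps the first component, and the second, translated by \<open>- half K\<close>,
  acts on the later slots. Translation is a coalgebra map, so it distributes over the chain and
  turns each \<open>rho\<close> into \<open>sg\<close>; \<open>swee_ch\<close> then attaches the
  chain to the right of \<open>\<Phi>\<close>.\<close>

lemma X_i:
  assumes L: "inrange d n L"
  shows "X i L = fold (rt N d sg) [Suc i..<n] \<Phi> L"
proof
  fix g
  have a: "fps_nth (- half K) 0 = 0" by simp
  have s: "ch N d (\<lambda>j b e g. appl (rho j b e) (tauw (- half K) g)) [Suc i..<n] Y L y = ch N d sg [Suc i..<n] Y L y" for Y y
  proof -
    have *: "ch N d (\<lambda>j b e g. appl (rho j b e) (tauw (- half K) g)) js Y L = ch N d sg js Y L" if "\<forall>k\<in>set js. k > i" for js L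
      using that
    proof (induction js arbitrary: L)
      case (Cons j js)
      have "(\<lambda>g. appl (rho j b e) (tauw (- half K) g)) = sg j b e" for b e
        using rho_tauw[of j b e] Cons.prems by auto
      thus ?case using Cons by simp
    qed simp
    show ?thesis by (subst *) auto
  qed
  have "X i L g = swee N (\<lambda>x y. appl (W (Suc i) L x) (tauw (- half K) y)) g"
    unfolding X_def W_def using i by (simp add: Tl_emb length_zeros tauw_zero zeros_emb)
  also have "\<dots> = swee N (\<lambda>x y. ch N d sg [Suc i..<n] (\<lambda>L g. \<Phi> L x * cu N g) L y) g"
    using i L by (simp add: W_ch ch_tauw[OF a] appl_mult_fun cu_tauw[OF a] s)
  also have "\<dots> = fold (rt N d sg) [Suc i..<n] \<Phi> L g"
    by (rule swee_ch) (simp_all add: nullf_\<Phi> nullf_fams)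
  finally show "X i L g = fold (rt N d sg) [Suc i..<n] \<Phi> L g" .
qed

lemma nullf_X: "k \<le> i \<Longrightarrow> inrange d n L \<Longrightarrow> nullf N (X k L)"
proof (induction "i - k" arbitrary: k L)
  case 0
  have "nullf N (fold (rt N d sg) js Y L)" if "\<And>L. nullf N (Y L)" for js Y L
    using that by (induction js arbitrary: Y) (simp_all add: nullf_rt nullf_fams)
  moreover have k: "k = i" using 0 by simp
  ultimately show ?case unfolding k X_i[OF 0(3)] using nullf_\<Phi> by blast
next
  case (Suc m)
  hence k: "k < i" by simp
  have "L k < d k" using Suc.prems k i by (simp add: inrange_def)
  hence "X k L = (\<lambda>g. \<Sum>a<d k. conv N (sg k a (L k)) (X (Suc k) (L(k := a))) g)"
    using k by (intro ext X_step)
  moreover have "nullf N (X (Suc k) (L(k := a)))" if "a < d k" for a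
    using Suc k that by (intro Suc(1) inrange_upd) auto
  ultimately show ?case by (auto intro!: nullf_sum nullf_conv nullf_fams)
qed

text \<open>\<open>X_step\<close> expresses each stage through the next. It is solved for the later
  stage by the left inverse \<open>mu\<close>, so the known stage 0 determines all stages up to
  i.\<close>

lemma X_ch: "k \<le> i \<Longrightarrow> inrange d n L \<Longrightarrow> X k L = ch N d mu (rev [0..<k]) (X 0) L"
proof (induction k arbitrary: L)
  case (Suc k)
  hence k: "k < i" "k < n" using i by auto
  have Lk: "L k < d k" using Suc.prems k by (simp add: inrange_def)
  have IH: "X k (L(k := b)) = ch N d mu (rev [0..<k]) (X 0) (L(k := b))" if "b < d k" for b
    using Suc k that by (intro Suc.IH inrange_upd) auto
  have e: "X (Suc k) L g = (\<Sum>b<d k. conv N (mu k b (L k)) (X k (L(k := b))) g)" for g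
  proof (rule left_inverse[where \<sigma> = sg])
    show "(\<Sum>b<d k. conv N (mu k b e) (sg k a b) g) = (if a = e then cu N g else 0)" if "a < d k" "e < d k" for a e g
      by (rule mu_sg[OF k(1) that])
    show "X k (L(k := b)) g = (\<Sum>a<d k. conv N (sg k a b) (X (Suc k) (L(k := a))) g)" if "b < d k" for b g
      using X_step[OF k(1), of "L(k := b)" g] that by simp
  qed (use Suc.prems Lk in \<open>simp_all add: nullf_X\<close>)
  have "X (Suc k) L = (\<lambda>g. \<Sum>b<d k. conv N (mu k b (L k)) (ch N d mu (rev [0..<k]) (X 0) (L(k := b))) g)"
    by (rule ext) (simp add: e IH)
  thus ?case by simp
qed simp

lemma X_0: "X 0 L g = F (zeros n L) * cu N g"
proof -
  have m: "map2 (\<lambda>u (v, e). (u + v, e)) l (zeros n L) = zip l (map L [0..<n])" for l :: "gen word list"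
    unfolding zeros_def by (rule nth_equalityI) (auto simp: split_def)
  have "set (letters (emb i g)) \<subseteq> {G j g |j g. j < n}" using i by (auto simp: emb_def)
  hence "appl F (M_action N (emb i g) (zeros n L)) = eps N (emb i g) * F (zeros n L)"
    using F by (simp add: invariant_functionals_def length_zeros)
  thus ?thesis unfolding M_action_def appl_lin m by (simp add: X_def Tl_def length_zeros eps_emb zeros_def mult.commute)
qed

text \<open>Slot i is reached from stage 0 by left inverses, and the later slots are removed by
  right inverses. Since stage 0 is a multiple of the counit, the right ones can be appended to the
  same chain.\<close>

lemma block_chain:
  assumes L: "inrange d n L"
  shows "\<Phi> L = ch N d mu (rev [0..<i] @ rev [Suc i..<n]) (\<lambda>L g. F (zeros n L) * cu N g) L"
proof -
  let ?Y = "ch N d mu (rev [0..<i]) (\<lambda>L g. F (zeros n L) * cu N g)"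
  have X0: "X 0 = (\<lambda>L g. F (zeros n L) * cu N g)" by (intro ext) (rule X_0)
  have "\<Phi> L = foldr (rt N d mu) [Suc i..<n] ?Y L"
  proof (rule fold_rt_inverse[where \<sigma> = sg, OF _ _ _ _ _ L])
    show "fold (rt N d sg) [Suc i..<n] \<Phi> L = ?Y L" if "inrange d n L" for L
      using X_i[OF that] X_ch[OF order_refl that] X0 by simp
  qed (auto simp: sg_mu nullf_\<Phi> nullf_fams)
  also have "\<dots> = ch N d mu (rev [0..<i] @ rev [Suc i..<n]) (\<lambda>L g. F (zeros n L) * cu N g) L"
    by (subst foldr_rt_ch) (auto simp: nullf_fams)
  finally show ?thesis .
qed

lemma block_kernel:
  assumes L: "inrange d n L"
  shows "appl (\<Phi> L) (tauw (half K) g) = (\<Sum>L'\<in>agree d (rev [0..<i] @ rev [Suc i..<n]) L.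
    F (zeros n L') * kern N nu (rev [0..<i] @ rev [Suc i..<n]) L' L g)"
proof -
  have a: "fps_nth (half K) 0 = 0" by simp
  have "nu = (\<lambda>j b e g. appl (mu j b e) (tauw (half K) g))" by (intro ext) (simp add: mu_tauw)
  thus ?thesis unfolding block_chain[OF L] ch_tauw[OF a] by (simp add: appl_mult_fun cu_tauw[OF a] ch_kern)
qed

end

text \<open>The form with 1 in one argument is the counit and vanishes on the ideal, so the counit
  does as well.\<close>

lemma cu_J: "kills (cu N)"
  unfolding kills_def
proof
  fix x assume x: "x \<in> J"
  have o: "origin \<Sigma> \<in> points \<Sigma>" by (cases \<Sigma>) auto
  have "appl_fls (cu N) x = hconst (appl (cu N) x)"
    by (rule cmod_eqI[of "appl_fls (cu N)" "\<lambda>x. hconst (appl (cu N) x)"])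
      (simp_all add: hadd_appl_fls hadd_compose[OF hadd_hconst hadd_appl] appl_fls_single appl_single hconst_mult hconst_fps_const cu_def del: fps_const_mult)
  moreover have "appl_fls (bB (origin \<Sigma>) 0) x = 0" by (rule pairing_kill(2)[OF pairing_bB[OF o] x])
  moreover have "bB (origin \<Sigma>) 0 = cu N" by (rule ext) (rule pairing_0(1)[OF pairing_bB[OF o]])
  ultimately have "hconst (appl (cu N) x) = 0" by simp
  thus "appl (cu N) x = 0" by (metis c0_hconst hconst_0)
qed

section \<open>Multiplicativity of the final kernel and the product of R-matrices in
  coordinates\<close>

lemma kills_nu:
  assumes "k < n" "k \<noteq> i" shows "kills (nu k a b)"
proof -
  have "kills (\<lambda>g. appl (\<lambda>y. pr (vp k) y g) (t k a b))"
    by (intro kills_appl kills_pr good_points assms)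
  thus ?thesis using assms by (simp add: nu_def[abs_def])
qed

lemma nu_append:
  assumes "k < n" "k \<noteq> i" "a < d k" "b < d k"
  shows "nu k a b (g + g') = (\<Sum>c<d k. nu k a c g' * nu k c b g)"
proof -
  note gp = good_points(4)[OF assms(1,2)]
  have "(\<lambda>y. pr (vp k) y (g + g')) = conv N (\<lambda>y. pr (vp k) y g') (\<lambda>y. pr (vp k) y g)"
    by (rule ext) (simp add: conv_def pr_right[OF gp])
  thus ?thesis using assms by (simp add: nu_def kills_comodule[OF co kills_pr(2)[OF gp] kills_pr(2)[OF gp]])
qed

lemma nu_0:
  assumes "k < n" "k \<noteq> i" "a < d k" "b < d k"
  shows "nu k a b 0 = (if a = b then 1 else 0)"
proof -
  have "(\<lambda>y. pr (vp k) y 0) = cu N" by (rule ext) (rule pr_0(2)[OF good_points(4)[OF assms(1,2)]])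
  thus ?thesis using assms counit_t by (simp add: nu_def)
qed

text \<open>The order in which the factors come out of \<open>block_chain\<close>, which is also the
  order of the product of R-matrices read from left to right.\<close>

definition js :: "nat list" where "js = rev [0..<i] @ rev [Suc i..<n]"

lemma js: "distinct (i # js)" "set (i # js) = {..<n}" "j \<in> set js \<Longrightarrow> j < n \<and> j \<noteq> i"
  using i by (auto simp: js_def)

lemma agree_cong: "set us = set vs \<Longrightarrow> agree d us L = agree d vs L" by (simp add: agree_def)

lemma agree_upd: "k \<in> set us \<Longrightarrow> agree d us (L(k := b)) = agree d us L" by (auto simp: agree_def)

lemma kills_kern_nu: "(\<And>j. j \<in> set us \<Longrightarrow> j < n \<and> j \<noteq> i) \<Longrightarrow> kills (kern N nu us I L)"
  by (intro kills_kern cu_J kills_nu) auto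

lemma val_R_comod:
  assumes "j < n" "j \<noteq> i"
  shows "val (R_comod B (t j) (t i) a c b e) (vp j) = appl (nu j a b) (t i c e)"
proof -
  have "fps_nth (snd (vp j)) 0 = 0" using good_points(4)[OF assms] by (rule goodD)
  thus ?thesis using assms unfolding R_comod_def by (simp add: val_Bext nu_def[abs_def]) (rule appl_Fubini)
qed

text \<open>Each R-matrix is \<open>nu j\<close> evaluated on the coaction of the i-th comodule.
  Composition multiplies these matrices in the i-th index, and the comodule axiom merges the
  functionals into one convolution, the kernel.\<close>

lemma foldr_R_op:
  assumes "I \<in> tidx n d" "distinct us" "\<And>j. j \<in> set us \<Longrightarrow> j < n \<and> j \<noteq> i"
  shows "foldr (\<lambda>j. R_op B n d t j i (vp j)) us v I =
    (\<Sum>L\<in>agree d (i # us) (nth I). appl (kern N nu us (nth I) L) (t i (I ! i) (L i)) * v (map L [0..<n]))"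
  using assms
proof (induction us arbitrary: I)
  case Nil
  hence I: "length I = n" "I ! i < d i" using i by (auto simp: tidx_def)
  have "(\<Sum>L\<in>agree d [i] (nth I). appl (kern N nu [] (nth I) L) (t i (I ! i) (L i)) * v (map L [0..<n])) =
      (\<Sum>b<d i. if b = I ! i then v (map (nth I) [0..<n]) else 0)"
  proof -
    have d: "distinct [i]" by simp
    show ?thesis unfolding sum_agree_Cons[OF d] agree_Nil by (rule sum.cong[OF refl]) (auto simp: counit_t[OF i I(2)])
  qed
  also have "\<dots> = v I" using I by (simp add: map_nth flip: I(1))
  finally show ?case by simp
next
  case (Cons j us)
  have I: "length I = n" "\<And>k. k < n \<Longrightarrow> I ! k < d k" using Cons.prems by (auto simp: tidx_def)
  have j: "j < n" "j \<noteq> i" "j \<notin> set us" "distinct us" using Cons.prems by auto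
  have us: "k \<in> set us \<Longrightarrow> k < n \<and> k \<noteq> i" for k using Cons.prems by auto
  let ?f = "nth I"
  have e: "foldr (\<lambda>j. R_op B n d t j i (vp j)) us v (I[j := a, i := b]) =
      (\<Sum>L\<in>agree d (i # us) (?f(j := a)). appl (kern N nu us ?f L) (t i b (L i)) * v (map L [0..<n]))"
    if ab: "a < d j" "b < d i" for a b
  proof -
    have m: "I[j := a, i := b] \<in> tidx n d" using I ab i j by (auto simp: tidx_def nth_list_update)
    have f: "nth (I[j := a, i := b]) = ?f(j := a, i := b)"
      using I i j by (auto simp: fun_eq_iff nth_list_update)
    have "kern N nu us (?f(j := a, i := b)) L = kern N nu us ?f L" for L using j us by (intro kern_cong) auto
    moreover have "I[j := a, i := b] ! i = b" using I i by simp
    moreover have "agree d (i # us) (?f(j := a, i := b)) = agree d (i # us) (?f(j := a))" by (rule agree_upd) simp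
    ultimately show ?thesis using Cons.IH[OF m j(4) us] by (simp only: f)
  qed
  have "foldr (\<lambda>j. R_op B n d t j i (vp j)) (j # us) v I =
    (\<Sum>a<d j. \<Sum>b<d i. appl (nu j (I ! j) a) (t i (I ! i) b) *
      (\<Sum>L\<in>agree d (i # us) (?f(j := a)). appl (kern N nu us ?f L) (t i b (L i)) * v (map L [0..<n])))"
    using Cons.prems(1) by (simp add: R_op_def[of B n d t j] val_R_comod[OF j(1,2)] e)
  also have "\<dots> = (\<Sum>a<d j. \<Sum>L\<in>agree d (i # us) (?f(j := a)). \<Sum>b<d i. appl (nu j (I ! j) a) (t i (I ! i) b) *
      appl (kern N nu us ?f L) (t i b (L i)) * v (map L [0..<n]))"
    unfolding sum_distrib_left mult.assoc by (rule sum.cong[OF refl], rule sum.swap)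
  also have "\<dots> = (\<Sum>a<d j. \<Sum>L\<in>agree d (i # us) (?f(j := a)).
      appl (kern N nu (j # us) ?f L) (t i (I ! i) (L i)) * v (map L [0..<n]))"
  proof (intro sum.cong refl)
    fix a L assume "L \<in> agree d (i # us) (?f(j := a))"
    hence L: "L j = a" "L i < d i" using j by (auto simp: agree_def)
    have kk: "kills (kern N nu us ?f L)" by (rule kills_kern_nu[OF us])
    have "appl (conv N (nu j (I ! j) a) (kern N nu us ?f L)) (t i (I ! i) (L i)) =
      (\<Sum>b<d i. appl (nu j (I ! j) a) (t i (I ! i) b) * appl (kern N nu us ?f L) (t i b (L i)))"
      by (rule kills_comodule[OF co[OF i] kills_nu[OF j(1,2)] kk I(2)[OF i] L(2)])
    thus "(\<Sum>b<d i. appl (nu j (I ! j) a) (t i (I ! i) b) * appl (kern N nu us ?f L) (t i b (L i)) * v (map L [0..<n])) =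
      appl (kern N nu (j # us) ?f L) (t i (I ! i) (L i)) * v (map L [0..<n])"
      by (simp add: sum_distrib_right L(1))
  qed
  also have "\<dots> = (\<Sum>L\<in>agree d (j # i # us) ?f. appl (kern N nu (j # us) ?f L) (t i (I ! i) (L i)) * v (map L [0..<n]))"
    by (subst sum_agree_Cons) (use j us in auto)
  also have "agree d (j # i # us) ?f = agree d (i # j # us) ?f" by (rule agree_cong) auto
  finally show ?case .
qed

text \<open>The kernel evaluated on a matrix Y over the algebra. Y will be the coaction of the i-th
  comodule, giving the product of R-matrices, or its inverse antipode, giving the operator induced
  by Sugawara.\<close>

definition mat :: "(nat \<Rightarrow> nat \<Rightarrow> (gen0 word, 'k) cmod) \<Rightarrow> nat list \<Rightarrow> nat list \<Rightarrow> 'k fps"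
  where "mat Y I L = appl (kern N nu js (nth I) (nth L)) (Y (I ! i) (L ! i))"

lemma kern_map: "kern N nu js (nth (map L [0..<n])) I = kern N nu js L I" "kern N nu js I (nth (map L [0..<n])) = kern N nu js I L"
  using js(3) by (auto intro!: kern_cong)

lemma R_product:
  assumes "I \<in> tidx n d"
  shows "foldr (\<lambda>j. R_op B n d t j i (vp j)) js v I = (\<Sum>L\<in>tidx n d. mat (t i) I L * v L)"
proof -
  have "foldr (\<lambda>j. R_op B n d t j i (vp j)) js v I =
      (\<Sum>L\<in>agree d (i # js) (nth I). appl (kern N nu js (nth I) L) (t i (I ! i) (L i)) * v (map L [0..<n]))"
    using js by (intro foldr_R_op assms) auto
  also have "\<dots> = (\<Sum>L\<in>tidx n d. mat (t i) I L * v L)"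
    unfolding sum_tidx[OF js(1,2), where d = d and L = "nth I"] mat_def kern_map using i by simp
  finally show ?thesis .
qed

text \<open>Multiplicativity of the kernel merges the two values into one, at a product of algebra
  elements; that product is a delta modulo the ideal, on which the kernel vanishes.\<close>

lemma mat_comp:
  assumes I: "I \<in> tidx n d" "I' \<in> tidx n d"
    and Y: "(\<Sum>c<d i. Z c (I' ! i) * Y (I ! i) c) \<equiv>J (if I ! i = I' ! i then 1 else 0)"
  shows "(\<Sum>L\<in>tidx n d. mat Y I L * mat Z L I') = (if I = I' then 1 else 0)"
proof -
  let ?E = "kern N nu js"
  have il: "i < length I" "i < length I'" "length I = n" "length I' = n" "\<And>k. k < n \<Longrightarrow> I ! k < d k \<and> I' ! k < d k"
    using I i by (auto simp: tidx_def)
  have p: "appl a x * appl b y = appl (\<lambda>g. appl (\<lambda>g'. a g' * b g) x) y" for a b :: "gen0 word \<Rightarrow> 'k fps" and x y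
    by (simp add: mult.commute[of "a _"] appl_mult_fun) (simp add: mult.commute[of _ "appl a x"] appl_mult_fun)
  have "(\<Sum>L\<in>tidx n d. mat Y I L * mat Z L I') = (\<Sum>L\<in>agree d (i # js) (nth I). appl (?E (nth I) L) (Y (I ! i) (L i)) * appl (?E L (nth I')) (Z (L i) (I' ! i)))"
    unfolding sum_tidx[OF js(1,2), where d = d and L = "nth I"] mat_def kern_map using i by simp
  also have "\<dots> = (\<Sum>c<d i. \<Sum>L\<in>agree d js ((nth I)(i := c)). appl (?E (nth I) L) (Y (I ! i) c) * appl (?E L (nth I')) (Z c (I' ! i)))"
    unfolding sum_agree_Cons[OF js(1)] using js(1) by (intro sum.cong refl) (simp add: agree_def)
  also have "\<dots> = (\<Sum>c<d i. appl (\<lambda>g. appl (\<lambda>g'. \<Sum>L\<in>agree d js ((nth I)(i := c)). ?E (nth I) L g' * ?E L (nth I') g) (Y (I ! i) c)) (Z c (I' ! i)))"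
    unfolding p by (simp add: appl_sum_fun)
  also have "\<dots> = (\<Sum>c<d i. appl (\<lambda>g. appl (\<lambda>g'. ?E (nth I) (nth I') (g + g')) (Y (I ! i) c)) (Z c (I' ! i)))"
    using js(1,3) il nu_append by (subst kern_mult) auto
  also have "\<dots> = appl (?E (nth I) (nth I')) (\<Sum>c<d i. Z c (I' ! i) * Y (I ! i) c)"
    by (simp add: hadd_sum[OF hadd_appl] appl_mult)
  also have "\<dots> = appl (?E (nth I) (nth I')) (if I ! i = I' ! i then 1 else 0)"
    using Y unfolding eqJ_def by (intro kills_cong kills_kern_nu js(3))
  also have "\<dots> = (if I ! i = I' ! i \<and> (\<forall>j\<in>set js. I ! j = I' ! j) then 1 else 0)"
    using kern_0[of js nu "nth I" "nth I'" N] nu_0 js(3) il(5) by (auto simp: appl_one hadd_0[OF hadd_appl])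
  also have "I ! i = I' ! i \<and> (\<forall>j\<in>set js. I ! j = I' ! j) \<longleftrightarrow> I = I'"
  proof -
    have "I ! i = I' ! i \<and> (\<forall>j\<in>set js. I ! j = I' ! j) \<longleftrightarrow> (\<forall>j\<in>set (i # js). I ! j = I' ! j)" by simp
    also have "\<dots> \<longleftrightarrow> I = I'" unfolding js(2) using il by (auto simp: list_eq_iff_nth_eq)
    finally show ?thesis .
  qed
  finally show ?thesis .
qed

context
  fixes S S' assumes SS: "antipode_pair J S S'"
    and bij: "bij_betw xi (conformal_blocks \<Sigma> N R C f0 B K n d t z) (tspace n d)"
begin

text \<open>On a vector of V itself the iterated coproduct is that of 1. What remains of
  \<open>S^-1(a_(1))\<close> is \<open>S' 0\<close>, a representative congruent to 1 but not equal
  to it.\<close>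

lemma sugawara_0:
  assumes "b < D"
  shows "sugawara N K S' D tt (0, b) = (\<Sum>a<D. lin (\<lambda>w. basis (w, a)) (lin (tauw (half K)) (lin S' (tt a b * S' 0))))"
proof -
  have e0: "eps N 0 = (1 :: 'k fps)" by (simp add: eps_def)
  have c0: "cop N 0 = (basis (0, 0) :: (gen word \<times> gen word, 'k) cmod)" by (simp add: cop_0 basis_0 flip: zero_prod_def)
  have "iter_cop N 3 0 = (basis [0, 0, 0] :: (gen word list, 'k) cmod)"
    by (simp add: numeral_3_eq_3 c0 e0 hscale_1)
  moreover have "proj c 0 = (1 :: (gen0 word, 'k) cmod)" for c by (simp add: proj_def)
  moreover have "lin S' 1 = S' 0" using lin_basis[of S' 0] by (simp add: basis_0)
  moreover have "lin (\<lambda>v. basis (v, a)) 1 = (basis (0, a) :: (gen0 word \<times> nat, 'k) cmod)" for a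
    using lin_basis[of "\<lambda>v. basis (v, a)" 0] by (simp add: basis_0)
  ultimately have "ind_coaction N K S' D tt (0, b) = (\<Sum>a<D. tens (tt a b * S' 0) (basis (0, a)))"
    using assms by (simp add: ind_coaction_def flip: zero_word_def)
  thus ?thesis
    by (simp add: sugawara_def hadd_sum[OF hadd_lin] lin_tens lin_lin tau0_lin half_def basis_0)
qed

text \<open>The restriction isomorphism lifts the coordinates to a block. The Sugawara operator puts
  the translated inverse antipode of the coaction into slot i, where \<open>block_kernel\<close>
  evaluates the block.\<close>

lemma A_triv_mat:
  assumes \<phi>: "\<phi> \<in> tspace n d" and I: "I \<in> tidx n d"
  shows "A_triv (conformal_blocks \<Sigma> N R C f0 B K n d t z) N K S' d t i \<phi> I =
    (\<Sum>L\<in>tidx n d. \<phi> L * mat (\<lambda>a b. lin S' (t i a b)) L I)"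
proof -
  let ?BK = "conformal_blocks \<Sigma> N R C f0 B K n d t z"
  define f where "f = inv_into ?BK xi \<phi>"
  have "\<phi> \<in> xi ` ?BK" using bij \<phi> by (simp add: bij_betw_def)
  hence f: "f \<in> ?BK" "xi f = \<phi>" unfolding f_def by (simp_all add: inv_into_into f_inv_into_f)
  then obtain F where F: "F \<in> invariant_functionals \<Sigma> N R C f0 B K n d t z" and fF: "f = F \<circ> identify"
    unfolding conformal_blocks_def by blast
  have il: "length I = n" "\<And>k. k < n \<Longrightarrow> I ! k < d k" using I by (auto simp: tidx_def)
  let ?s = "map (\<lambda>e. (0, e)) I :: (gen0 word \<times> nat) list" and ?Y = "\<lambda>a. lin S' (t i a (I ! i) * S' 0)"
  have slot: "f (?s[i := (w, a)]) = \<Phi> F ((nth I)(i := a)) w" for w a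
  proof -
    have "identify (?s[i := (w, a)]) = slots n ((nth I)(i := a)) w"
      by (rule nth_equalityI) (auto simp: identify_def slots_def[OF F] il nth_enumerate_eq nth_list_update emb_def zero_word_def)
    thus ?thesis by (simp add: fF \<Phi>_def[OF F])
  qed
  have zero: "F (zeros n L) = \<phi> (map L [0..<n])" for L
  proof -
    have "identify (map (\<lambda>e. (0, e)) (map L [0..<n])) = zeros n L"
      by (rule nth_equalityI) (auto simp: identify_def zeros_def[OF F] nth_enumerate_eq zero_word_def)
    thus ?thesis unfolding f(2)[symmetric] by (simp add: xi_def fF)
  qed
  have "A_triv ?BK N K S' d t i \<phi> I = (\<Sum>a<d i. appl (\<lambda>g. appl (\<Phi> F ((nth I)(i := a))) (tauw (half K) g)) (?Y a))"
    unfolding A_triv_def f_def[symmetric] xi_def A_tilde_def using i il sugawara_0[OF il(2)[OF i], of "t i"]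
    by (simp add: hadd_sum[OF hadd_lin] hadd_sum[OF hadd_appl] appl_lin slot)
  also have "\<dots> = (\<Sum>a<d i. \<Sum>L\<in>agree d js ((nth I)(i := a)). \<phi> (map L [0..<n]) * appl (kern N nu js L (nth I)) (lin S' (t i a (I ! i))))"
  proof (rule sum.cong[OF refl])
    fix a assume a: "a \<in> {..<d i}"
    hence r: "inrange d n ((nth I)(i := a))" using il by (simp add: inrange_def)
    have k: "kern N nu js L ((nth I)(i := a)) = kern N nu js L (nth I)" for L using js(3) by (intro kern_cong) auto
    have y: "appl (kern N nu js L (nth I)) (?Y a) = appl (kern N nu js L (nth I)) (lin S' (t i a (I ! i)))" for L
    proof (rule kills_cong[OF kills_kern_nu[OF js(3)]])
      have "t i a (I ! i) * S' 0 \<equiv>J t i a (I ! i) * 1" by (rule eqJ_mult_left[OF S'_0[OF SS]])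
      from S'_cong[OF SS this] show "?Y a - lin S' (t i a (I ! i)) \<in> J" by (simp add: eqJ_def)
    qed
    show "appl (\<lambda>g. appl (\<Phi> F ((nth I)(i := a))) (tauw (half K) g)) (?Y a) =
      (\<Sum>L\<in>agree d js ((nth I)(i := a)). \<phi> (map L [0..<n]) * appl (kern N nu js L (nth I)) (lin S' (t i a (I ! i))))"
      unfolding block_kernel[OF F r, folded js_def] by (simp add: appl_sum_fun appl_mult_fun zero k y)
  qed
  also have "\<dots> = (\<Sum>L\<in>agree d (i # js) (nth I). \<phi> (map L [0..<n]) * appl (kern N nu js L (nth I)) (lin S' (t i (L i) (I ! i))))"
    unfolding sum_agree_Cons[OF js(1)] using js(1) by (intro sum.cong refl) (simp add: agree_def)
  also have "\<dots> = (\<Sum>L\<in>tidx n d. \<phi> L * mat (\<lambda>a b. lin S' (t i a b)) L I)"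
    unfolding sum_tidx[OF js(1,2), where d = d and L = "nth I"] mat_def kern_map using i by simp
  finally show ?thesis .
qed

lemma finite_tidx: "finite (tidx n d)"
proof -
  have "tidx n d \<subseteq> {I. set I \<subseteq> (\<Union>k<n. {..<d k}) \<and> length I = n}"
    by (auto simp: tidx_def set_conv_nth)
  thus ?thesis by (rule finite_subset) (rule finite_lists_length_eq, simp)
qed

text \<open>Both antipode identities are needed: one gives \<open>A_dual\<close> after the product
  of R-matrices as the identity, the other injectivity of \<open>A_dual\<close>; together they
  determine \<open>inv_into\<close>.\<close>

lemma nabla_R:
  assumes v: "v \<in> tspace n d"
  shows "nabla (conformal_blocks \<Sigma> N R C f0 B K n d t z) N K S' n d t i v = foldr (\<lambda>j. R_op B n d t j i (vp j)) js v"
proof -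
  let ?A = "A_dual (conformal_blocks \<Sigma> N R C f0 B K n d t z) N K S' n d t i" and ?P = "foldr (\<lambda>j. R_op B n d t j i (vp j)) js"
  let ?M = "mat (\<lambda>a b. lin S' (t i a b))" and ?M' = "mat (t i)"
  have A: "?A x I = (\<Sum>L\<in>tidx n d. ?M I L * x L)" if I: "I \<in> tidx n d" for x I
  proof -
    have \<delta>: "(\<lambda>I'. if I' = I then 1 else 0) \<in> tspace n d" using I by (auto simp: tspace_def)
    have "A_triv (conformal_blocks \<Sigma> N R C f0 B K n d t z) N K S' d t i (\<lambda>I'. if I' = I then 1 else 0) L = ?M I L"
      if "L \<in> tidx n d" for L using A_triv_mat[OF \<delta> that] I by (simp add: if_zero_mult finite_tidx)
    thus ?thesis using I by (simp add: A_dual_def cong: sum.cong)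
  qed
  have A0: "?A x I = 0" if "I \<notin> tidx n d" for x I using that by (simp add: A_dual_def)
  have P0: "?P x I = 0" if "I \<notin> tidx n d" "x \<in> tspace n d" for x I
    using that by (cases js) (simp_all add: R_op_def tspace_def)
  have ti: "I ! i < d i" if "I \<in> tidx n d" for I using that i by (simp add: tidx_def)
  have MM': "(\<Sum>L\<in>tidx n d. ?M I L * ?M' L I') = (if I = I' then 1 else 0)" if "I \<in> tidx n d" "I' \<in> tidx n d" for I I'
    by (rule mat_comp[OF that, where Y = "\<lambda>a b. lin S' (t i a b)" and Z = "t i"])
      (rule antipode_comodule(1)[OF SS co[OF i] ti[OF that(1)] ti[OF that(2)]])
  have M'M: "(\<Sum>L\<in>tidx n d. ?M' I L * ?M L I') = (if I = I' then 1 else 0)" if "I \<in> tidx n d" "I' \<in> tidx n d" for I I'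
    by (rule mat_comp[OF that, where Y = "t i" and Z = "\<lambda>a b. lin S' (t i a b)"])
      (rule antipode_comodule(2)[OF SS co[OF i] ti[OF that(1)] ti[OF that(2)]])
  have AP: "(\<Sum>L\<in>tidx n d. U I L * (\<Sum>L'\<in>tidx n d. V L L' * x L')) = x I"
    if "\<And>I'. I' \<in> tidx n d \<Longrightarrow> (\<Sum>L\<in>tidx n d. U I L * V L I') = (if I = I' then 1 else 0)" "I \<in> tidx n d"
    for U V :: "nat list \<Rightarrow> nat list \<Rightarrow> 'k fps" and x I
  proof -
    have "(\<Sum>L\<in>tidx n d. U I L * (\<Sum>L'\<in>tidx n d. V L L' * x L')) = (\<Sum>L'\<in>tidx n d. (\<Sum>L\<in>tidx n d. U I L * V L L') * x L')"
      unfolding sum_distrib_left sum_distrib_right mult.assoc by (rule sum.swap)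
    also have "\<dots> = (\<Sum>L'\<in>tidx n d. if I = L' then x L' else 0)" by (rule sum.cong[OF refl]) (simp add: that(1))
    finally show ?thesis using that(2) by (simp add: finite_tidx)
  qed
  have "?A (?P v) = v"
  proof
    fix I
    show "?A (?P v) I = v I"
    proof (cases "I \<in> tidx n d")
      case True
      have "?A (?P v) I = (\<Sum>L\<in>tidx n d. ?M I L * (\<Sum>L'\<in>tidx n d. ?M' L L' * v L'))"
        unfolding A[OF True] by (intro sum.cong refl) (simp add: R_product)
      also have "\<dots> = v I" by (rule AP[where U = ?M and V = ?M', OF MM'[OF True] True])
      finally show ?thesis .
    qed (use v in \<open>simp add: A0 tspace_def\<close>)
  qed
  moreover have "?P v \<in> tspace n d" using P0[OF _ v] by (simp add: tspace_def)
  moreover have "inj_on ?A (tspace n d)"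
  proof (rule inj_onI)
    fix x y assume x: "x \<in> tspace n d" "y \<in> tspace n d" and eq: "?A x = ?A y"
    have w: "w I = (\<Sum>L\<in>tidx n d. ?M' I L * ?A w L)" if I: "I \<in> tidx n d" for w I
    proof -
      have "(\<Sum>L\<in>tidx n d. ?M' I L * ?A w L) = (\<Sum>L\<in>tidx n d. ?M' I L * (\<Sum>L'\<in>tidx n d. ?M L L' * w L'))"
        by (intro sum.cong refl) (simp add: A)
      also have "\<dots> = w I" by (rule AP[where U = ?M' and V = ?M, OF M'M[OF I] I])
      finally show ?thesis ..
    qed
    have "x I = y I" if "I \<in> tidx n d" for I
      unfolding w[OF that, of x] w[OF that, of y] eq ..
    moreover have "x I = y I" if "I \<notin> tidx n d" for I using x that by (simp add: tspace_def)
    ultimately show "x = y" by (intro ext) blast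
  qed
  ultimately show ?thesis unfolding nabla_def by (intro inv_into_f_eq)
qed

lemmas nabla_product = nabla_R[unfolded vp_def js_def]

end

end

end

theorem theorem5p7:
  fixes \<Sigma> :: "'k::{alg_closed_field, field_char_0} curve"
    and N n :: nat
    and R :: "'k hfun tmat"
    and C :: "nat list \<Rightarrow> 'k fps"
    and f0 :: "'k hfun"
    and B :: "gen0 word \<Rightarrow> gen0 word \<Rightarrow> 'k hfun"
    and S S' :: "gen0 word \<Rightarrow> (gen0 word, 'k) cmod"
    and d :: "nat \<Rightarrow> nat"
    and t :: "nat \<Rightarrow> nat \<Rightarrow> nat \<Rightarrow> (gen0 word, 'k) cmod"
    and K \<kappa> :: "'k fps"
    and z :: "nat \<Rightarrow> 'k hpt"
    and i :: nat
  assumes "N > 0"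
    and "smooth \<Sigma>"
    and "standard_R \<Sigma> N R"
    and "R_identities \<Sigma> N R"
    and "qdet_vector \<Sigma> N R C"
    and "normalizing \<Sigma> N R C f0"
    and "B_form \<Sigma> N R C f0 B"
    and "antipode_pair (F0_ideal \<Sigma> N R C) S S'"
    and "\<And>j. j < n \<Longrightarrow> comodule N (F0_ideal \<Sigma> N R C) (d j) (t j)"
    and "\<kappa> = K + of_nat N"
    and restriction_isomorphism: "\<And>y. y \<in> config_space \<Sigma> N R n \<Longrightarrow>
          bij_betw xi (conformal_blocks \<Sigma> N R C f0 B K n d t y) (tspace n d)"
    and "z \<in> config_space \<Sigma> N R n"
    and "i < n"
    and "v \<in> tspace n d"
  shows "nabla (conformal_blocks \<Sigma> N R C f0 B K n d t z) N K S' n d t i v =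
    foldr (\<lambda>j. R_op B n d t j i
             (hmove (hsub \<Sigma> (z j) (z i)) (if j < i then \<kappa> * fps_X else 0)))
      (rev [0..<i] @ rev [Suc i..<n]) v"
proof -
  interpret qkz \<Sigma> N R C f0 B by unfold_locales (use assms in auto)
  show ?thesis unfolding \<open>\<kappa> = K + of_nat N\<close>
    by (rule nabla_product) (use assms in auto)
qed

end
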